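(* Let $M$ be a simply-connected complex $n$-manifold endowed with a Bochner-Kähler structure $\Omega$. Let $\mathfrak g$ denote the Lie algebra of vector fields on $M$ whose (local) flows preserve the complex structure and $\Omega$. Then $\dim_{\mathbb R}\mathfrak g\ge n$.
   Context: Simply-connected manifolds are connected. $\mathbb C^n$ consists of columns; $z^*$ denotes conjugate transpose; $\mathfrak u(n)=\{a\in M_n(\mathbb C): a^*=-a\}$. Let $(M,g,\Omega)$ be a Kähler manifold of complex dimension $n\ge1$. Its unitary coframe bundle $\pi:P\to M$ has as fiber $P_x$ the set of complex-linear isometries $u:T_xM\to\mathbb C^n$. Let $\omega$ be the $\mathbb C^n$-valued $1$-form on $P$ with $\omega(v)=u(\pi'(v))$ for $v\in T_uP$ (so $\pi^*\Omega=-\frac i2\,\omega^*\wedge\omega$), and let $\phi$ be the unique $\mathfrak u(n)$-valued $1$-form on $P$ with $d\omega=-\phi\wedge\omega$. The structure is called Bochner-Kähler if there are functions $H:P\to i\mathfrak u(n)$ (Hermitian matrices), $T:P\to\mathbb C^n$, $V:P\to\mathbb R$ satisfying $$d\phi=-\phi\wedge\phi+H\,\omega^*\wedge\omega-H\,\omega\wedge\omega^*-\omega\wedge\omega^*H+(\omega^*\wedge H\omega)\,I_n+(\operatorname{tr}H)\bigl(\omega^*\wedge\omega\,I_n-\omega\wedge\omega^*\bigr),$$ $$dH=-\phi H+H\phi+T\omega^*+\omega T^*,\qquad dT=-\phi T+\bigl(H^2+(\operatorname{tr}H)H+V I_n\bigr)\omega,$$ $$dV=(\operatorname{tr}H)(T^*\omega+\omega^*T)+(T^*H\omega+\omega^*HT).$$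 For $n\ge2$ this is equivalent to the vanishing of the Bochner curvature (the component of the Kähler curvature tensor complementary to the scalar and traceless Ricci components); for $n=1$ it is the definition. Bochner-Kähler structures are assumed real-analytic. *)

theory Defs
  imports "HOL-Analysis.Analysis" "HOL-Library.Function_Algebras"
begin

section \<open>Smooth and real-analytic maps on open subsets of normed spaces\<close>

primrec Ck_on :: "nat \<Rightarrow> 'a::real_normed_vector set \<Rightarrow> ('a \<Rightarrow> 'b::real_normed_vector) \<Rightarrow> bool"
  where
    "Ck_on 0 S f \<longleftrightarrow> continuous_on S f"
  | "Ck_on (Suc k) S f \<longleftrightarrow>
       (\<forall>x\<in>S. f differentiable (at x)) \<and> (\<forall>v. Ck_on k S (\<lambda>x. frechet_derivative f (at x) v))"

definition smooth_on :: "'a::real_normed_vector set \<Rightarrow> ('a \<Rightarrow> 'b::real_normed_vector) \<Rightarrow> bool"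
  where "smooth_on S f \<longleftrightarrow> (\<forall>k. Ck_on k S f)"

text \<open>Local expansion in a power series in the coordinates with respect to \<^term>\<open>Basis\<close>;
  the summation index \<open>k\<close> runs over all multi-indices.\<close>

definition real_analytic_on ::
    "'a::euclidean_space set \<Rightarrow> ('a \<Rightarrow> 'b::real_normed_vector) \<Rightarrow> bool"
  where "real_analytic_on S f \<longleftrightarrow>
    (\<forall>x\<in>S. \<exists>r>0. \<exists>a :: ('a \<Rightarrow> nat) \<Rightarrow> 'b. \<forall>y\<in>ball x r.
       ((\<lambda>k. (\<Prod>b\<in>Basis. ((y - x) \<bullet> b) ^ k b) *\<^sub>R a k) has_sum f y) (Basis \<rightarrow>\<^sub>E UNIV))"

definition holomorphic_map_on :: "(complex^'n) set \<Rightarrow> (complex^'n \<Rightarrow> complex^'n) \<Rightarrow> bool"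
  where "holomorphic_map_on S f \<longleftrightarrow>
    (\<forall>z\<in>S. \<exists>D. (f has_derivative D) (at z) \<and> (\<forall>a v. D (a *s v) = a *s D v))"

section \<open>Charts and tangent vectors\<close>

text \<open>A chart is a pair of its domain and its coordinate map. A tangent vector at a point is
  the family of its coordinate vectors in the charts around that point, related by the
  derivatives of the coordinate changes, and extended by \<open>0\<close> to all other charts.\<close>

type_synonym ('p, 'e) chart = "'p set \<times> ('p \<Rightarrow> 'e)"
type_synonym ('p, 'e) tvec = "('p, 'e) chart \<Rightarrow> 'e"

definition carrier :: "('p, 'e) chart set \<Rightarrow> 'p set"
  where "carrier A = (\<Union>c\<in>A. fst c)"

definition charts_at :: "('p, 'e) chart set \<Rightarrow> 'p \<Rightarrow> ('p, 'e) chart set"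
  where "charts_at A p = {c \<in> A. p \<in> fst c}"

definition chart_image :: "('p, 'e) chart \<Rightarrow> 'e set"
  where "chart_image c = snd c ` fst c"

definition chart_inv :: "('p, 'e) chart \<Rightarrow> 'e \<Rightarrow> 'p"
  where "chart_inv c = inv_into (fst c) (snd c)"

definition coord_change_deriv ::
    "('p, 'e::real_normed_vector) chart \<Rightarrow> ('p, 'e) chart \<Rightarrow> 'p \<Rightarrow> 'e \<Rightarrow> 'e"
  where "coord_change_deriv c d p = frechet_derivative (snd d \<circ> chart_inv c) (at (snd c p))"

definition tangent_space ::
    "('p, 'e::real_normed_vector) chart set \<Rightarrow> 'p \<Rightarrow> ('p, 'e) tvec set"
  where "tangent_space A p =
    {v. (\<forall>c. c \<notin> charts_at A p \<longrightarrow> v c = 0) \<and>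
        (\<forall>c\<in>charts_at A p. \<forall>d\<in>charts_at A p. v d = coord_change_deriv c d p (v c))}"

definition tangent_of_coords ::
    "('p, 'e::real_normed_vector) chart set \<Rightarrow> ('p, 'e) chart \<Rightarrow> 'p \<Rightarrow> 'e \<Rightarrow> ('p, 'e) tvec"
  where "tangent_of_coords A c p w =
    (\<lambda>d. if d \<in> charts_at A p then coord_change_deriv c d p w else 0)"

definition smooth_map ::
    "('p, 'e::real_normed_vector) chart set \<Rightarrow> ('q, 'f::real_normed_vector) chart set \<Rightarrow>
     'p set \<Rightarrow> ('p \<Rightarrow> 'q) \<Rightarrow> bool"
  where "smooth_map A B W f \<longleftrightarrow>
    (\<forall>p\<in>W. f p \<in> carrier B \<and>
      (\<forall>c\<in>charts_at A p. \<forall>d\<in>charts_at B (f p). \<exists>N. open N \<and> snd c p \<in> N \<and>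
         N \<subseteq> chart_image c \<and> f ` chart_inv c ` N \<subseteq> fst d \<and>
         smooth_on N (snd d \<circ> f \<circ> chart_inv c)))"

definition differential ::
    "('p, 'e::real_normed_vector) chart set \<Rightarrow> ('q, 'f::real_normed_vector) chart set \<Rightarrow>
     ('p \<Rightarrow> 'q) \<Rightarrow> 'p \<Rightarrow> ('p, 'e) tvec \<Rightarrow> ('q, 'f) tvec"
  where "differential A B f p v =
    (\<lambda>d. if d \<in> charts_at B (f p)
         then let c = (SOME c. c \<in> charts_at A p)
              in frechet_derivative (snd d \<circ> f \<circ> chart_inv c) (at (snd c p)) (v c)
         else 0)"

section \<open>Functions and forms on a submanifold\<close>

text \<open>Here \<open>S\<close> is an embedded submanifold of the manifold with atlas \<open>B\<close>. Its tangent vectors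
  are the velocities of smooth curves in \<open>S\<close>. Smoothness, and the differentials of functions and
  \<open>1\<close>-forms on \<open>S\<close>, are expressed in every chart of the ambient manifold by means of local
  smooth extensions from \<open>S\<close>; the restriction to \<open>S\<close> of the (exterior) derivative of such
  an extension does not depend on the extension.\<close>

definition submanifold_tangent ::
    "('p, 'e::real_normed_vector) chart set \<Rightarrow> 'p set \<Rightarrow> 'p \<Rightarrow> ('p, 'e) tvec set"
  where "submanifold_tangent B S p =
    {v \<in> tangent_space B p. \<forall>c\<in>charts_at B p. \<exists>\<gamma> :: real \<Rightarrow> 'p. \<exists>\<epsilon>>0.
       \<gamma> 0 = p \<and> \<gamma> ` {-\<epsilon><..<\<epsilon>} \<subseteq> S \<inter> fst c \<and> smooth_on {-\<epsilon><..<\<epsilon>} (snd c \<circ> \<gamma>) \<and>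
       (snd c \<circ> \<gamma> has_vector_derivative v c) (at 0)}"

definition function_extension ::
    "'p set \<Rightarrow> ('p, 'e::real_normed_vector) chart \<Rightarrow> ('p \<Rightarrow> 'v::real_normed_vector) \<Rightarrow>
     'e set \<Rightarrow> ('e \<Rightarrow> 'v) \<Rightarrow> bool"
  where "function_extension S c f N F \<longleftrightarrow>
    open N \<and> N \<subseteq> chart_image c \<and> smooth_on N F \<and>
    (\<forall>q\<in>S \<inter> fst c. snd c q \<in> N \<longrightarrow> F (snd c q) = f q)"

definition has_differential_on ::
    "('p, 'e::real_normed_vector) chart set \<Rightarrow> 'p set \<Rightarrow> ('p \<Rightarrow> 'v::real_normed_vector) \<Rightarrow>
     ('p \<Rightarrow> ('p, 'e) tvec \<Rightarrow> 'v) \<Rightarrow> bool"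
  where "has_differential_on B S f \<alpha> \<longleftrightarrow>
    (\<forall>p\<in>S. \<forall>c\<in>charts_at B p. \<exists>N F. snd c p \<in> N \<and> function_extension S c f N F \<and>
       (\<forall>v\<in>submanifold_tangent B S p.
          \<alpha> p v = frechet_derivative F (at (snd c p)) (v c)))"

definition form_extension ::
    "('p, 'e::real_normed_vector) chart set \<Rightarrow> 'p set \<Rightarrow> ('p, 'e) chart \<Rightarrow>
     ('p \<Rightarrow> ('p, 'e) tvec \<Rightarrow> 'v::real_normed_vector) \<Rightarrow> 'e set \<Rightarrow> ('e \<Rightarrow> 'e \<Rightarrow> 'v) \<Rightarrow> bool"
  where "form_extension B S c \<alpha> N a \<longleftrightarrow>
    open N \<and> N \<subseteq> chart_image c \<and> (\<forall>z\<in>N. linear (a z)) \<and> (\<forall>w. smooth_on N (\<lambda>z. a z w)) \<and>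
    (\<forall>q\<in>S \<inter> fst c. snd c q \<in> N \<longrightarrow>
       (\<forall>v\<in>submanifold_tangent B S q. \<alpha> q v = a (snd c q) (v c)))"

definition smooth_form_on ::
    "('p, 'e::real_normed_vector) chart set \<Rightarrow> 'p set \<Rightarrow>
     ('p \<Rightarrow> ('p, 'e) tvec \<Rightarrow> 'v::real_normed_vector) \<Rightarrow> bool"
  where "smooth_form_on B S \<alpha> \<longleftrightarrow>
    (\<forall>p\<in>S. \<forall>c\<in>charts_at B p. \<exists>N a. snd c p \<in> N \<and> form_extension B S c \<alpha> N a)"

text \<open>Normalisation:
  \<open>d\<alpha>(v,w) = v \<alpha>(w) - w \<alpha>(v) - \<alpha>([v,w])\<close> and
  \<open>(\<alpha> \<and> \<beta>)(v,w) = \<alpha>(v) \<beta>(w) - \<alpha>(w) \<beta>(v)\<close>.\<close>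

definition has_exterior_derivative_on ::
    "('p, 'e::real_normed_vector) chart set \<Rightarrow> 'p set \<Rightarrow>
     ('p \<Rightarrow> ('p, 'e) tvec \<Rightarrow> 'v::real_normed_vector) \<Rightarrow>
     ('p \<Rightarrow> ('p, 'e) tvec \<Rightarrow> ('p, 'e) tvec \<Rightarrow> 'v) \<Rightarrow> bool"
  where "has_exterior_derivative_on B S \<alpha> \<beta> \<longleftrightarrow>
    (\<forall>p\<in>S. \<forall>c\<in>charts_at B p. \<exists>N a. snd c p \<in> N \<and> form_extension B S c \<alpha> N a \<and>
       (\<forall>v\<in>submanifold_tangent B S p. \<forall>w\<in>submanifold_tangent B S p.
          \<beta> p v w = frechet_derivative (\<lambda>z. a z (w c)) (at (snd c p)) (v c)
                  - frechet_derivative (\<lambda>z. a z (v c)) (at (snd c p)) (w c)))"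

section \<open>Complex manifolds and Kaehler forms\<close>

text \<open>The manifold is the open subset \<^term>\<open>carrier A\<close> of a Hausdorff, second countable space.\<close>

definition complex_manifold ::
    "('m::{t2_space, second_countable_topology}, complex^'n) chart set \<Rightarrow> bool"
  where "complex_manifold A \<longleftrightarrow>
    (\<forall>c\<in>A. open (fst c) \<and> open (chart_image c) \<and>
       homeomorphism (fst c) (chart_image c) (snd c) (chart_inv c)) \<and>
    (\<forall>c\<in>A. \<forall>d\<in>A. holomorphic_map_on (snd c ` (fst c \<inter> fst d)) (snd d \<circ> chart_inv c))"

definition Jmap :: "('m, complex^'n) tvec \<Rightarrow> ('m, complex^'n) tvec"
  where "Jmap v = (\<lambda>c. \<i> *s v c)"

definition coord_form ::
    "('m, complex^'n) chart set \<Rightarrow>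
     ('m \<Rightarrow> ('m, complex^'n) tvec \<Rightarrow> ('m, complex^'n) tvec \<Rightarrow> real) \<Rightarrow>
     ('m, complex^'n) chart \<Rightarrow> complex^'n \<Rightarrow> complex^'n \<Rightarrow> complex^'n \<Rightarrow> real"
  where "coord_form A \<Omega> c z v w =
    \<Omega> (chart_inv c z) (tangent_of_coords A c (chart_inv c z) v)
      (tangent_of_coords A c (chart_inv c z) w)"

text \<open>The metric determined by \<open>\<Omega>\<close> and the complex structure is \<open>g(v,w) = \<Omega>(v, J w)\<close>.
  This is the sign for which \<open>\<Omega>\<close> pulls back to \<open>-(\<i>/2) \<omega>\<^sup>* \<and> \<omega>\<close> on the unitary coframe bundle.\<close>

definition kaehler_metric ::
    "('m \<Rightarrow> ('m, complex^'n) tvec \<Rightarrow> ('m, complex^'n) tvec \<Rightarrow> real) \<Rightarrow>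
     'm \<Rightarrow> ('m, complex^'n) tvec \<Rightarrow> ('m, complex^'n) tvec \<Rightarrow> real"
  where "kaehler_metric \<Omega> x v w = \<Omega> x v (Jmap w)"

definition kaehler_form ::
    "('m, complex^'n) chart set \<Rightarrow>
     ('m \<Rightarrow> ('m, complex^'n) tvec \<Rightarrow> ('m, complex^'n) tvec \<Rightarrow> real) \<Rightarrow> bool"
  where "kaehler_form A \<Omega> \<longleftrightarrow>
    (\<forall>x\<in>carrier A. \<forall>u\<in>tangent_space A x. \<forall>v\<in>tangent_space A x. \<forall>w\<in>tangent_space A x.
       \<Omega> x (u + v) w = \<Omega> x u w + \<Omega> x v w) \<and>
    (\<forall>x\<in>carrier A. \<forall>v\<in>tangent_space A x. \<forall>w\<in>tangent_space A x.
       (\<forall>r. \<Omega> x (\<lambda>c. r *\<^sub>R v c) w = r * \<Omega> x v w) \<and>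
       \<Omega> x w v = - \<Omega> x v w \<and>
       \<Omega> x (Jmap v) (Jmap w) = \<Omega> x v w \<and>
       (v \<noteq> 0 \<longrightarrow> kaehler_metric \<Omega> x v v > 0)) \<and>
    (\<forall>c\<in>A. \<forall>v w. smooth_on (chart_image c) (\<lambda>z. coord_form A \<Omega> c z v w)) \<and>
    (\<forall>c\<in>A. \<forall>z\<in>chart_image c. \<forall>u v w.
       frechet_derivative (\<lambda>y. coord_form A \<Omega> c y v w) (at z) u
     + frechet_derivative (\<lambda>y. coord_form A \<Omega> c y w u) (at z) v
     + frechet_derivative (\<lambda>y. coord_form A \<Omega> c y u v) (at z) w = 0)"

section \<open>The unitary coframe bundle\<close>

type_synonym ('m, 'n) coframe_point = "'m \<times> (('m, complex^'n) tvec \<Rightarrow> complex^'n)"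
type_synonym ('m, 'n) coframe_tvec =
  "(('m, 'n) coframe_point, (complex^'n) \<times> (complex^'n^'n)) tvec"

text \<open>Complex-linear isomorphisms from the tangent space at \<open>x\<close> to \<open>\<complex>\<^sup>n\<close>, extended by \<open>0\<close>.\<close>

definition coframes ::
    "('m, complex^'n) chart set \<Rightarrow> 'm \<Rightarrow> (('m, complex^'n) tvec \<Rightarrow> complex^'n) set"
  where "coframes A x =
    {u. (\<forall>v\<in>tangent_space A x. \<forall>w\<in>tangent_space A x. u (v + w) = u v + u w) \<and>
        (\<forall>a. \<forall>v\<in>tangent_space A x. u (\<lambda>c. a *s v c) = a *s u v) \<and>
        bij_betw u (tangent_space A x) UNIV \<and>
        (\<forall>v. v \<notin> tangent_space A x \<longrightarrow> u v = 0)}"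

text \<open>The bundle of all complex-linear coframes is the manifold in which the unitary coframe
  bundle is embedded. In the chart lying over \<open>c\<close>, a coframe \<open>u\<close> at \<open>x\<close> has as coordinates the
  coordinates of \<open>x\<close> and the matrix of \<open>u\<close> with respect to the coordinate basis.\<close>

definition coframe_chart ::
    "('m, complex^'n) chart set \<Rightarrow> ('m, complex^'n) chart \<Rightarrow>
     (('m, 'n) coframe_point, (complex^'n) \<times> (complex^'n^'n)) chart"
  where "coframe_chart A c =
    ({(x, u). x \<in> fst c \<and> u \<in> coframes A x},
     \<lambda>(x, u). (snd c x, \<chi> i j. u (tangent_of_coords A c x (axis j 1)) $ i))"

definition coframe_atlas ::
    "('m, complex^'n) chart set \<Rightarrow>
     (('m, 'n) coframe_point, (complex^'n) \<times> (complex^'n^'n)) chart set"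
  where "coframe_atlas A = coframe_chart A ` A"

text \<open>On \<open>\<complex>\<^sup>n\<close> the operation \<open>\<bullet>\<close> is the real part of the standard Hermitian product.\<close>

definition unitary_coframes ::
    "('m, complex^'n) chart set \<Rightarrow>
     ('m \<Rightarrow> ('m, complex^'n) tvec \<Rightarrow> ('m, complex^'n) tvec \<Rightarrow> real) \<Rightarrow>
     ('m, 'n) coframe_point set"
  where "unitary_coframes A \<Omega> =
    {(x, u). x \<in> carrier A \<and> u \<in> coframes A x \<and>
       (\<forall>v\<in>tangent_space A x. \<forall>w\<in>tangent_space A x. u v \<bullet> u w = kaehler_metric \<Omega> x v w)}"

definition tautological_form ::
    "('m, complex^'n) chart set \<Rightarrow> ('m, 'n) coframe_point \<Rightarrow> ('m, 'n) coframe_tvec \<Rightarrow> complex^'n"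
  where "tautological_form A p v = snd p (differential (coframe_atlas A) A fst p v)"

section \<open>Bochner-Kaehler structures\<close>

definition conj_transpose :: "complex^'n^'m \<Rightarrow> complex^'m^'n"
  where "conj_transpose a = (\<chi> i j. cnj (a $ j $ i))"

definition herm :: "complex^'n \<Rightarrow> complex^'n \<Rightarrow> complex" \<comment> \<open>\<open>v\<^sup>* w\<close>\<close>
  where "herm v w = (\<Sum>i\<in>UNIV. cnj (v $ i) * w $ i)"

definition outer :: "complex^'n \<Rightarrow> complex^'n \<Rightarrow> complex^'n^'n" \<comment> \<open>\<open>v w\<^sup>*\<close>\<close>
  where "outer v w = (\<chi> i j. v $ i * cnj (w $ j))"

text \<open>By the fundamental lemma of Kaehler geometry there is exactly one such form, up to values
  on vectors that are not tangent to the unitary coframe bundle.\<close>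

definition is_connection_form ::
    "('m, complex^'n) chart set \<Rightarrow>
     ('m \<Rightarrow> ('m, complex^'n) tvec \<Rightarrow> ('m, complex^'n) tvec \<Rightarrow> real) \<Rightarrow>
     (('m, 'n) coframe_point \<Rightarrow> ('m, 'n) coframe_tvec \<Rightarrow> complex^'n^'n) \<Rightarrow> bool"
  where "is_connection_form A \<Omega> \<phi> \<longleftrightarrow>
    (let B = coframe_atlas A; P = unitary_coframes A \<Omega>; \<omega> = tautological_form A in
      smooth_form_on B P \<phi> \<and>
      (\<forall>p\<in>P. \<forall>v\<in>submanifold_tangent B P p. conj_transpose (\<phi> p v) = - \<phi> p v) \<and>
      has_exterior_derivative_on B P \<omega> (\<lambda>p v w. - (\<phi> p v *v \<omega> p w - \<phi> p w *v \<omega> p v)))"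

text \<open>A scalar \<open>a\<close> times the identity matrix is \<^term>\<open>mat a\<close>; accordingly scalar factors of
  matrices are written as multiplication by \<^term>\<open>mat a\<close>.\<close>

definition bochner_kaehler ::
    "('m, complex^'n) chart set \<Rightarrow>
     ('m \<Rightarrow> ('m, complex^'n) tvec \<Rightarrow> ('m, complex^'n) tvec \<Rightarrow> real) \<Rightarrow> bool"
  where "bochner_kaehler A \<Omega> \<longleftrightarrow>
    kaehler_form A \<Omega> \<and>
    (\<forall>c\<in>A. \<forall>v w. real_analytic_on (chart_image c) (\<lambda>z. coord_form A \<Omega> c z v w)) \<and>
    (let B = coframe_atlas A; P = unitary_coframes A \<Omega>; \<omega> = tautological_form A in
     \<exists>\<phi> (H :: ('m, 'n) coframe_point \<Rightarrow> complex^'n^'n)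
        (T :: ('m, 'n) coframe_point \<Rightarrow> complex^'n) (V :: ('m, 'n) coframe_point \<Rightarrow> real).
      is_connection_form A \<Omega> \<phi> \<and>
      (\<forall>p\<in>P. conj_transpose (H p) = H p) \<and>
      has_exterior_derivative_on B P \<phi> (\<lambda>p v w.
        let s = herm (\<omega> p v) (\<omega> p w) - herm (\<omega> p w) (\<omega> p v);
            Q = outer (\<omega> p v) (\<omega> p w) - outer (\<omega> p w) (\<omega> p v);
            h = herm (\<omega> p v) (H p *v \<omega> p w) - herm (\<omega> p w) (H p *v \<omega> p v)
        in - (\<phi> p v ** \<phi> p w - \<phi> p w ** \<phi> p v)
           + H p ** mat s - H p ** Q - Q ** H p + mat h
           + mat (trace (H p)) ** (mat s - Q)) \<and>
      has_differential_on B P H (\<lambda>p v.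
        - (\<phi> p v ** H p) + H p ** \<phi> p v + outer (T p) (\<omega> p v) + outer (\<omega> p v) (T p)) \<and>
      has_differential_on B P T (\<lambda>p v.
        - (\<phi> p v *v T p)
        + (H p ** H p + mat (trace (H p)) ** H p + mat (complex_of_real (V p))) *v \<omega> p v) \<and>
      has_differential_on B P (\<lambda>p. complex_of_real (V p)) (\<lambda>p v.
        trace (H p) * (herm (T p) (\<omega> p v) + herm (\<omega> p v) (T p))
        + (herm (T p) (H p *v \<omega> p v) + herm (\<omega> p v) (H p *v T p))))"

section \<open>Infinitesimal symmetries\<close>

definition smooth_vector_field ::
    "('m, complex^'n) chart set \<Rightarrow> ('m \<Rightarrow> ('m, complex^'n) tvec) \<Rightarrow> bool"
  where "smooth_vector_field A X \<longleftrightarrow>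
    (\<forall>x. X x \<in> tangent_space A x) \<and>
    (\<forall>c\<in>A. smooth_on (chart_image c) (\<lambda>z. X (chart_inv c z) c))"

text \<open>For \<open>x\<close> outside \<^term>\<open>carrier A\<close> the space \<^term>\<open>tangent_space A x\<close> is \<open>{0}\<close>, so that a
  vector field is determined by its values on the manifold.\<close>

definition local_flow ::
    "('m::topological_space, complex^'n) chart set \<Rightarrow> ('m \<Rightarrow> ('m, complex^'n) tvec) \<Rightarrow>
     'm set \<Rightarrow> real \<Rightarrow> (real \<Rightarrow> 'm \<Rightarrow> 'm) \<Rightarrow> bool"
  where "local_flow A X W \<epsilon> \<Phi> \<longleftrightarrow>
    open W \<and> W \<subseteq> carrier A \<and> \<epsilon> > 0 \<and>
    (\<forall>t\<in>{-\<epsilon><..<\<epsilon>}. smooth_map A A W (\<Phi> t)) \<and>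
    (\<forall>x\<in>W. \<Phi> 0 x = x \<and> continuous_on {-\<epsilon><..<\<epsilon>} (\<lambda>t. \<Phi> t x) \<and>
       (\<forall>t\<in>{-\<epsilon><..<\<epsilon>}. \<forall>c\<in>charts_at A (\<Phi> t x).
          ((\<lambda>s. snd c (\<Phi> s x)) has_vector_derivative X (\<Phi> t x) c) (at t)))"

definition symmetry_fields ::
    "('m::topological_space, complex^'n) chart set \<Rightarrow>
     ('m \<Rightarrow> ('m, complex^'n) tvec \<Rightarrow> ('m, complex^'n) tvec \<Rightarrow> real) \<Rightarrow>
     ('m \<Rightarrow> ('m, complex^'n) tvec) set"
  where "symmetry_fields A \<Omega> =
    {X. smooth_vector_field A X \<and>
       (\<forall>W \<epsilon> \<Phi>. local_flow A X W \<epsilon> \<Phi> \<longrightarrow>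
          (\<forall>t\<in>{-\<epsilon><..<\<epsilon>}. \<forall>x\<in>W. \<forall>v\<in>tangent_space A x.
             differential A A (\<Phi> t) x (Jmap v) = Jmap (differential A A (\<Phi> t) x v) \<and>
             (\<forall>w\<in>tangent_space A x.
                \<Omega> (\<Phi> t x) (differential A A (\<Phi> t) x v) (differential A A (\<Phi> t) x w)
                = \<Omega> x v w)))}"

definition field_scale ::
    "real \<Rightarrow> ('m \<Rightarrow> ('m, complex^'n) tvec) \<Rightarrow> 'm \<Rightarrow> ('m, complex^'n) tvec"
  where "field_scale r X = (\<lambda>x c. r *\<^sub>R X x c)"

interpretation vector_fields: vector_space field_scale
  by standard (auto simp: field_scale_def fun_eq_iff algebra_simps)

end

theory Submission
  imports Defs "HOL-Complex_Analysis.Cauchy_Integral_Formula"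
begin

text \<open>A vector field \<open>X\<close> that preserves the Kaehler structure infinitesimally lifts to a field on the
  unitary coframe bundle that preserves \<open>\<omega>\<close> and \<open>\<phi>\<close>. The pair of the values \<open>a\<close> of \<open>\<omega>\<close> and \<open>b\<close> of \<open>\<phi>\<close> on the lift
  satisfies \<open>da = b \<omega> - \<phi> a\<close>, \<open>db = [b, \<phi>] - \<rho>(a, \<omega>)\<close>, where \<open>\<rho>\<close> is the curvature of \<open>\<phi>\<close>. The
  derivatives of \<open>H\<close>, \<open>T\<close>, \<open>V\<close> along the lift, computed from the structure equations, are linear in
  \<open>(a, b)\<close> and have to vanish. Conversely, the pairs on which these three expressions vanish form a
  parallel family on which the linear system is flat, because its curvature at \<open>(a, b)\<close> is \<open>\<rho>\<close> formed
  with the derivative of \<open>H\<close>. So Killing fields near a point correspond to the solutions \<open>(a, b)\<close> at that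
  point, and in an eigenbasis of \<open>H\<close> adapted to \<open>T\<close> one sees that these have dimension at least \<open>n\<close>.
  Hence the sheaf of Killing fields is locally constant with stalks of dimension at least \<open>n\<close>, and on
  a simply connected manifold every germ extends to a global field. Its flows preserve the
  structure because their differentials satisfy the variational equation.\<close>

section \<open>Calculus of smooth maps\<close>

text \<open>The system for \<open>(a, b)\<close> is not flat on all pairs: its curvature is nonzero
  wherever \<open>kapH\<close> is. The integrability theorem therefore asks for zero curvature only
  along the solutions with the given initial value; these stay in the kernel, because
  \<open>(kapH, kapT, kapV)\<close> satisfies a homogeneous linear equation along them. The bound n
  counts free real parameters, one for each vector e of an adapted eigenbasis: the ratio of the
  e-component of \<open>a\<close> to that of \<open>T\<close>, divided by \<i>, if the latter is
  nonzero, and otherwise a diagonal entry of \<open>b\<close>. Calculations on the coframe bundle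
  are pulled back to a chart of M along a unitary frame obtained by Gram-Schmidt; the directions of
  the structure group survive as the unknown \<open>b\<close>. At the other end, a
  \<open>local_flow\<close> is smooth in the point for each fixed time and differentiable in time
  for each fixed point, with no joint regularity. So the variational equation comes from comparing
  nearby orbits with solutions of the linearised equation, not from interchanging
  derivatives.\<close>

lemma differentiable_has_frechet_derivative:
  "f differentiable (at x) \<Longrightarrow> (f has_derivative frechet_derivative f (at x)) (at x)"
  by (simp add: frechet_derivative_works)

lemma frechet_derivative_eqI:
  "(f has_derivative D) (at x) \<Longrightarrow> frechet_derivative f (at x) = D"
  by (rule frechet_derivative_at[symmetric])

lemma frechet_derivative_cong:
  assumes "open S" "x \<in> S" "\<And>y. y \<in> S \<Longrightarrow> f y = g y"
  shows "frechet_derivative f (at x) = frechet_derivative g (at x)"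
proof -
  have "(f has_derivative D) (at x) \<longleftrightarrow> (g has_derivative D) (at x)" for D
    using has_derivative_transform_within_open[of f D x UNIV S g]
      has_derivative_transform_within_open[of g D x UNIV S f] assms by auto
  then show ?thesis by (simp add: frechet_derivative_def)
qed

lemma differentiable_cong_open:
  assumes "open S" "x \<in> S" "\<And>y. y \<in> S \<Longrightarrow> f y = g y" "f differentiable (at x)"
  shows "g differentiable (at x)"
  using assms has_derivative_transform_within_open[of f _ x UNIV S g]
  unfolding differentiable_def by blast

lemma Ck_on_cong:
  assumes "open S" "\<And>x. x \<in> S \<Longrightarrow> f x = g x" "Ck_on k S f"
  shows "Ck_on k S g"
  using assms(2,3)
proof (induction k arbitrary: f g)
  case 0 then show ?case using continuous_on_cong[of S S f g] by auto
next
  case (Suc k)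
  have "g differentiable (at x)" if "x \<in> S" for x
    using differentiable_cong_open[OF assms(1) that] Suc.prems that by auto
  moreover have "Ck_on k S (\<lambda>x. frechet_derivative g (at x) v)" for v
    by (rule Suc.IH[of "\<lambda>x. frechet_derivative f (at x) v"])
       (use Suc.prems frechet_derivative_cong[OF assms(1), of _ f g] in auto)
  ultimately show ?case by simp
qed

lemma Ck_on_subset:
  assumes "Ck_on k S f" "T \<subseteq> S"
  shows "Ck_on k T f"
  using assms(1)
  by (induction k arbitrary: f) (use assms(2) in \<open>auto intro: continuous_on_subset\<close>)

lemma Ck_on_Suc_imp_Ck_on: "Ck_on (Suc k) S f \<Longrightarrow> Ck_on k S f"
proof (induction k arbitrary: f)
  case 0 then show ?case
    by (auto intro!: continuous_at_imp_continuous_on intro: differentiable_imp_continuous_within)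
next
  case (Suc k) then show ?case by (metis Ck_on.simps(2))
qed

lemma Ck_on_const [intro]: "Ck_on k S (\<lambda>x. c)"
  by (induction k arbitrary: c) auto

lemma Ck_on_bounded_linear:
  assumes "bounded_linear L" "open S" "Ck_on k S f"
  shows "Ck_on k S (\<lambda>x. L (f x))"
  using assms(3)
proof (induction k arbitrary: f)
  case 0 then show ?case using assms(1) by (auto intro: bounded_linear.continuous_on)
next
  case (Suc k)
  have D: "((\<lambda>x. L (f x)) has_derivative (\<lambda>v. L (frechet_derivative f (at x) v))) (at x)"
    if "x \<in> S" for x
    using Suc.prems that
    by (intro bounded_linear.has_derivative[OF assms(1)] differentiable_has_frechet_derivative) auto
  have "Ck_on k S (\<lambda>x. frechet_derivative (\<lambda>x. L (f x)) (at x) v)" for v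
    by (rule Ck_on_cong[OF assms(2), of "\<lambda>x. L (frechet_derivative f (at x) v)"])
       (use Suc frechet_derivative_eqI[OF D] in auto)
  then show ?case using D by (auto simp: differentiable_def)
qed

lemma Ck_on_add:
  assumes "open S" "Ck_on k S f" "Ck_on k S g"
  shows "Ck_on k S (\<lambda>x. f x + g x)"
  using assms(2,3)
proof (induction k arbitrary: f g)
  case 0 then show ?case by (auto intro: continuous_on_add)
next
  case (Suc k)
  have D: "((\<lambda>x. f x + g x) has_derivative
      (\<lambda>v. frechet_derivative f (at x) v + frechet_derivative g (at x) v)) (at x)"
    if "x \<in> S" for x
    using Suc.prems that by (intro has_derivative_add differentiable_has_frechet_derivative) auto
  have "Ck_on k S (\<lambda>x. frechet_derivative (\<lambda>x. f x + g x) (at x) v)" for v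
    by (rule Ck_on_cong[OF assms(1),
          of "\<lambda>x. frechet_derivative f (at x) v + frechet_derivative g (at x) v"])
       (use Suc frechet_derivative_eqI[OF D] in auto)
  then show ?case using D by (auto simp: differentiable_def)
qed

lemma Ck_on_sum:
  assumes "open S" "\<And>i. i \<in> I \<Longrightarrow> Ck_on k S (f i)"
  shows "Ck_on k S (\<lambda>x. \<Sum>i\<in>I. f i x)"
  using assms(2)
  by (induction I rule: infinite_finite_induct) (auto intro: Ck_on_add[OF assms(1)])

lemma Ck_on_bilinear:
  assumes "bounded_bilinear B" "open S" "Ck_on k S f" "Ck_on k S g"
  shows "Ck_on k S (\<lambda>x. B (f x) (g x))"
  using assms(3,4)
proof (induction k arbitrary: f g)
  case 0 then show ?case using assms(1) by (auto intro: bounded_bilinear.continuous_on)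
next
  case (Suc k)
  have D: "((\<lambda>x. B (f x) (g x)) has_derivative
      (\<lambda>v. B (f x) (frechet_derivative g (at x) v) + B (frechet_derivative f (at x) v) (g x))) (at x)"
    if "x \<in> S" for x
    using Suc.prems that
    by (intro bounded_bilinear.FDERIV[OF assms(1)] differentiable_has_frechet_derivative) auto
  have "Ck_on k S (\<lambda>x. frechet_derivative (\<lambda>x. B (f x) (g x)) (at x) v)" for v
    by (rule Ck_on_cong[OF assms(2), of "\<lambda>x. B (f x) (frechet_derivative g (at x) v)
                                            + B (frechet_derivative f (at x) v) (g x)"])
       (use Suc.prems frechet_derivative_eqI[OF D] Ck_on_Suc_imp_Ck_on[of k S f]
           Ck_on_Suc_imp_Ck_on[of k S g] in \<open>auto intro!: Ck_on_add assms(2) Suc.IH\<close>)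
  then show ?case using D by (auto simp: differentiable_def)
qed

text \<open>\<open>Ck_on\<close> only sees derivatives in a fixed direction, whereas the chain rule
  feeds the moving vector \<open>Dg(x) v\<close> into the derivative of \<open>f\<close>. Expanding
  that vector in \<open>Basis\<close> leaves fixed directions with scalar coefficients, to which the
  induction hypothesis and the product rule apply.\<close>

lemma Ck_on_compose:
  fixes g :: "'a::real_normed_vector \<Rightarrow> 'b::euclidean_space"
  assumes "open S" "open T" "g ` S \<subseteq> T" "Ck_on k T f" "Ck_on k S g"
  shows "Ck_on k S (\<lambda>x. f (g x))"
  using assms(4,5)
proof (induction k arbitrary: f)
  case 0 then show ?case
    using continuous_on_compose2[OF _ _ assms(3), of f] by auto
next
  case (Suc k)
  let ?Df = "\<lambda>x. frechet_derivative f (at x)" and ?Dg = "\<lambda>x. frechet_derivative g (at x)"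
  have D: "((\<lambda>x. f (g x)) has_derivative (\<lambda>v. \<Sum>b\<in>Basis. (?Dg x v \<bullet> b) *\<^sub>R ?Df (g x) b)) (at x)"
    if "x \<in> S" for x
  proof -
    have 1: "(f has_derivative ?Df (g x)) (at (g x))"
      using Suc.prems that assms(3) by (intro differentiable_has_frechet_derivative) auto
    have 2: "(g has_derivative ?Dg x) (at x)"
      using Suc.prems that assms(3) by (intro differentiable_has_frechet_derivative) auto
    have "((\<lambda>x. f (g x)) has_derivative (\<lambda>v. ?Df (g x) (?Dg x v))) (at x)"
      by (rule has_derivative_compose[OF 2 1])
    moreover have eq: "?Df (g x) w = (\<Sum>b\<in>Basis. (w \<bullet> b) *\<^sub>R ?Df (g x) b)" for w
    proof -
      have "?Df (g x) w = ?Df (g x) (\<Sum>b\<in>Basis. (w \<bullet> b) *\<^sub>R b)"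
        by (simp add: euclidean_representation)
      also have "\<dots> = (\<Sum>b\<in>Basis. (w \<bullet> b) *\<^sub>R ?Df (g x) b)"
        using has_derivative_linear[OF 1] by (simp add: linear_sum linear_cmul)
      finally show ?thesis .
    qed
    moreover have "(\<lambda>v. ?Df (g x) (?Dg x v)) = (\<lambda>v. \<Sum>b\<in>Basis. (?Dg x v \<bullet> b) *\<^sub>R ?Df (g x) b)"
      by (rule ext) (rule eq)
    ultimately show ?thesis by metis
  qed
  have g: "Ck_on k S g" using Suc.prems(2) by (rule Ck_on_Suc_imp_Ck_on)
  have "Ck_on k S (\<lambda>x. frechet_derivative (\<lambda>x. f (g x)) (at x) v)" for v
  proof (rule Ck_on_cong[OF assms(1), of "\<lambda>x. \<Sum>b\<in>Basis. (?Dg x v \<bullet> b) *\<^sub>R ?Df (g x) b"])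
    show "Ck_on k S (\<lambda>x. \<Sum>b\<in>Basis. (?Dg x v \<bullet> b) *\<^sub>R ?Df (g x) b)"
    proof (intro Ck_on_sum Ck_on_bilinear[OF bounded_bilinear_scaleR] assms(1))
      fix b :: 'b
      show "Ck_on k S (\<lambda>x. ?Dg x v \<bullet> b)"
        using Ck_on_bounded_linear[OF bounded_linear_inner_left assms(1), of k "\<lambda>x. ?Dg x v" b]
          Suc.prems(2) by auto
      show "Ck_on k S (\<lambda>x. ?Df (g x) b)"
        using Suc.IH[of "\<lambda>x. ?Df x b"] Suc.prems(1) g by auto
    qed
  qed (use frechet_derivative_eqI[OF D] in auto)
  then show ?case using D by (auto simp: differentiable_def)
qed

lemma smooth_on_cong: "\<lbrakk>open S; \<And>x. x \<in> S \<Longrightarrow> f x = g x; smooth_on S f\<rbrakk> \<Longrightarrow> smooth_on S g"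
  unfolding smooth_on_def using Ck_on_cong by blast

lemma smooth_on_subset: "smooth_on S f \<Longrightarrow> T \<subseteq> S \<Longrightarrow> smooth_on T f"
  unfolding smooth_on_def using Ck_on_subset by blast

lemma smooth_on_has_derivative:
  "smooth_on S f \<Longrightarrow> x \<in> S \<Longrightarrow> (f has_derivative frechet_derivative f (at x)) (at x)"
  unfolding smooth_on_def using Ck_on.simps(2)[of 0 S f] differentiable_has_frechet_derivative by blast

lemma smooth_on_frechet_derivative:
  "smooth_on S f \<Longrightarrow> smooth_on S (\<lambda>x. frechet_derivative f (at x) v)"
  unfolding smooth_on_def using Ck_on.simps(2)[of _ S f] by blast

lemma smooth_on_continuous_on: "smooth_on S f \<Longrightarrow> continuous_on S f"
  unfolding smooth_on_def using Ck_on.simps(1)[of S f] by blast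

lemma smooth_on_linear_frechet:
  "smooth_on S f \<Longrightarrow> x \<in> S \<Longrightarrow> linear (frechet_derivative f (at x))"
  using smooth_on_has_derivative has_derivative_linear by blast

lemma smooth_on_const [simp, intro]: "smooth_on S (\<lambda>x. c)"
  by (auto simp: smooth_on_def)

lemma smooth_on_bounded_linear:
  "\<lbrakk>bounded_linear L; open S; smooth_on S f\<rbrakk> \<Longrightarrow> smooth_on S (\<lambda>x. L (f x))"
  unfolding smooth_on_def using Ck_on_bounded_linear by blast

lemma smooth_on_add: "\<lbrakk>open S; smooth_on S f; smooth_on S g\<rbrakk> \<Longrightarrow> smooth_on S (\<lambda>x. f x + g x)"
  unfolding smooth_on_def using Ck_on_add by blast

lemma smooth_on_minus: "\<lbrakk>open S; smooth_on S f\<rbrakk> \<Longrightarrow> smooth_on S (\<lambda>x. - f x)"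
  using smooth_on_bounded_linear[OF bounded_linear_minus[OF bounded_linear_ident]] by auto

lemma smooth_on_diff: "\<lbrakk>open S; smooth_on S f; smooth_on S g\<rbrakk> \<Longrightarrow> smooth_on S (\<lambda>x. f x - g x)"
  using smooth_on_add[of S f "\<lambda>x. - g x"] smooth_on_minus by auto

lemma smooth_on_sum:
  "\<lbrakk>open S; \<And>i. i \<in> I \<Longrightarrow> smooth_on S (f i)\<rbrakk> \<Longrightarrow> smooth_on S (\<lambda>x. \<Sum>i\<in>I. f i x)"
  unfolding smooth_on_def by (auto intro: Ck_on_sum)

lemma smooth_on_bilinear:
  "\<lbrakk>bounded_bilinear B; open S; smooth_on S f; smooth_on S g\<rbrakk> \<Longrightarrow> smooth_on S (\<lambda>x. B (f x) (g x))"
  unfolding smooth_on_def by (auto intro: Ck_on_bilinear)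

lemmas smooth_on_scaleR = smooth_on_bilinear[OF bounded_bilinear_scaleR]

lemma smooth_on_compose:
  fixes g :: "'a::real_normed_vector \<Rightarrow> 'b::euclidean_space"
  shows "\<lbrakk>open S; open T; g ` S \<subseteq> T; smooth_on T f; smooth_on S g\<rbrakk> \<Longrightarrow> smooth_on S (\<lambda>x. f (g x))"
  unfolding smooth_on_def by (auto intro: Ck_on_compose)

lemma smooth_on_ident [simp, intro]: "smooth_on S (\<lambda>x. x)"
proof -
  have "Ck_on k S (\<lambda>x. x)" for k by (cases k) (auto simp: frechet_derivative_ident)
  then show ?thesis by (simp add: smooth_on_def)
qed

lemma smooth_on_locally:
  assumes "\<And>x. x \<in> S \<Longrightarrow> \<exists>N. open N \<and> x \<in> N \<and> smooth_on N f"
  shows "smooth_on S f"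
proof -
  have "Ck_on k S f" if "\<And>x. x \<in> S \<Longrightarrow> \<exists>N. open N \<and> x \<in> N \<and> Ck_on k N f" for k
    using that
  proof (induction k arbitrary: f)
    case 0
    then have "isCont f x" if "x \<in> S" for x using that by (fastforce simp: continuous_on_eq_continuous_at)
    then show ?case by (simp add: continuous_at_imp_continuous_on)
  next
    case (Suc k)
    have "f differentiable (at x)" if "x \<in> S" for x using Suc.prems[OF that] by auto
    moreover have "Ck_on k S (\<lambda>x. frechet_derivative f (at x) v)" for v
      using Suc.IH[of "\<lambda>x. frechet_derivative f (at x) v"] Suc.prems by (metis Ck_on.simps(2))
    ultimately show ?case by simp
  qed
  then show ?thesis using assms by (fastforce simp: smooth_on_def)
qed

lemma smooth_on_components:
  fixes f :: "'a::real_normed_vector \<Rightarrow> 'b::euclidean_space"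
  assumes "open S" "\<And>b. b \<in> Basis \<Longrightarrow> smooth_on S (\<lambda>x. f x \<bullet> b)"
  shows "smooth_on S f"
proof -
  have "smooth_on S (\<lambda>x. \<Sum>b\<in>Basis. (f x \<bullet> b) *\<^sub>R b)"
    using assms by (intro smooth_on_sum smooth_on_scaleR) auto
  then show ?thesis by (simp add: euclidean_representation)
qed

lemma smooth_on_vec_nth: "\<lbrakk>open S; smooth_on S f\<rbrakk> \<Longrightarrow> smooth_on S (\<lambda>x. f x $ i)"
  using smooth_on_bounded_linear[OF bounded_linear_vec_nth] by blast

lemma smooth_on_vec_lambda:
  fixes f :: "'n::finite \<Rightarrow> 'a::real_normed_vector \<Rightarrow> 'b::euclidean_space"
  assumes "open S" "\<And>i. smooth_on S (f i)"
  shows "smooth_on S (\<lambda>x. \<chi> i. f i x)"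
proof (rule smooth_on_components[OF assms(1)])
  fix b :: "'b^'n" assume "b \<in> Basis"
  then obtain i c where b: "b = axis i c" by (auto simp: Basis_vec_def)
  have "smooth_on S (\<lambda>x. f i x \<bullet> c)"
    using smooth_on_bounded_linear[OF bounded_linear_inner_left assms(1) assms(2)] .
  then show "smooth_on S (\<lambda>x. (\<chi> i. f i x) \<bullet> b)" by (simp add: b inner_axis)
qed

lemma smooth_on_Pair:
  fixes f :: "'a::real_normed_vector \<Rightarrow> 'b::real_normed_vector" and g :: "'a \<Rightarrow> 'c::real_normed_vector"
  assumes "open S" "smooth_on S f" "smooth_on S g"
  shows "smooth_on S (\<lambda>x. (f x, g x))"
proof -
  have "smooth_on S (\<lambda>x. (f x, 0) + (0, g x))"
    using smooth_on_bounded_linear[OF bounded_linear_Pair[OF bounded_linear_ident bounded_linear_zero] assms(1,2)]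
      smooth_on_bounded_linear[OF bounded_linear_Pair[OF bounded_linear_zero bounded_linear_ident] assms(1,3)]
    by (intro smooth_on_add assms)
  then show ?thesis by simp
qed

text \<open>The derivative is a polynomial in \<open>inverse\<close> itself, so order k for the
  function gives order k for its derivative, hence order k + 1. The square root below bootstraps in
  the same way through \<open>inverse (sqrt x)\<close>.\<close>

lemma smooth_on_inverse: "smooth_on (- {0}) (inverse :: 'a::real_normed_field \<Rightarrow> 'a)"
proof -
  let ?S = "- {0::'a}"
  have D: "(inverse has_derivative (\<lambda>v. - (inverse x * v * inverse x))) (at x)" if "x \<in> ?S" for x :: 'a
    using has_derivative_inverse'[of x UNIV] that by simp
  have "Ck_on k ?S inverse" for k
  proof (induction k)
    case 0 then show ?case by (auto intro: continuous_intros)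
  next
    case (Suc k)
    have "Ck_on k ?S (\<lambda>x. frechet_derivative inverse (at x) v)" for v
    proof (rule Ck_on_cong[of ?S "\<lambda>x. - (inverse x * v * inverse x)"])
      show "Ck_on k ?S (\<lambda>x. - (inverse x * v * inverse x))"
        by (rule Ck_on_bounded_linear[OF bounded_linear_minus[OF bounded_linear_ident]])
           (auto intro!: Ck_on_bilinear[OF bounded_bilinear_mult] Suc)
    qed (use frechet_derivative_eqI[OF D] in auto)
    then show ?case using D by (auto simp: differentiable_def)
  qed
  then show ?thesis by (simp add: smooth_on_def)
qed

lemma smooth_on_sqrt: "smooth_on {0<..} sqrt"
proof -
  have D: "(sqrt has_derivative (\<lambda>v. v * (inverse (sqrt x) / 2))) (at x)" if "x > 0" for x
    using DERIV_real_sqrt[OF that] unfolding has_field_derivative_def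
    by (rule has_derivative_eq_rhs) (auto simp: fun_eq_iff)
  have "Ck_on k {0<..} sqrt" for k
  proof (induction k)
    case 0 then show ?case by (auto intro: continuous_intros)
  next
    case (Suc k)
    have i: "Ck_on k {0<..} (\<lambda>x. inverse (sqrt x))"
      by (rule Ck_on_compose[of _ "- {0}"]) (use Suc smooth_on_inverse in \<open>auto simp: smooth_on_def\<close>)
    have "Ck_on k {0<..} (\<lambda>x. frechet_derivative sqrt (at x) v)" for v
    proof (rule Ck_on_cong[of "{0<..}" "\<lambda>x. v * (inverse (sqrt x) / 2)"])
      show "Ck_on k {0<..} (\<lambda>x. v * (inverse (sqrt x) / 2))"
        using Ck_on_bilinear[OF bounded_bilinear_mult _ Ck_on_const[of k "{0<..}" "v/2"] i] by simp
    qed (use frechet_derivative_eqI[OF D] in auto)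
    then show ?case using D by (auto simp: differentiable_def)
  qed
  then show ?thesis by (simp add: smooth_on_def)
qed

section \<open>Uniform bounds for linear families, Taylor estimates and symmetry of second
  derivatives\<close>

lemma linear_norm_le_Basis:
  fixes f :: "'a::euclidean_space \<Rightarrow> 'b::real_normed_vector"
  assumes "linear f"
  shows "norm (f v) \<le> (\<Sum>b\<in>Basis. norm (f b)) * norm v"
proof -
  have "f v = (\<Sum>b\<in>Basis. (v \<bullet> b) *\<^sub>R f b)"
    using linear_sum[OF assms] linear_cmul[OF assms] euclidean_representation[of v]
    by (metis (mono_tags, lifting) sum.cong)
  then have "norm (f v) \<le> (\<Sum>b\<in>Basis. \<bar>v \<bullet> b\<bar> * norm (f b))"
    by (metis (mono_tags, lifting) norm_scaleR sum_norm_le order.refl)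
  also have "\<dots> \<le> (\<Sum>b\<in>Basis. norm v * norm (f b))"
    by (intro sum_mono mult_right_mono) (auto simp: Basis_le_norm)
  finally show ?thesis by (simp add: sum_distrib_left mult.commute)
qed

text \<open>Families of linear maps occur here as functions \<open>M t e\<close> whose regularity is
  known for each fixed \<open>e\<close>. Finitely many basis vectors turn this into an estimate
  uniform in \<open>e\<close>; the Lipschitz and bilinear versions follow the same pattern.\<close>

lemma linear_family_bound:
  fixes M :: "'t::topological_space \<Rightarrow> 'e::euclidean_space \<Rightarrow> 'f::real_normed_vector"
  assumes "compact K" "\<And>t. t \<in> K \<Longrightarrow> linear (M t)" "\<And>e. continuous_on K (\<lambda>t. M t e)"
  obtains C where "C \<ge> 0" "\<And>t e. t \<in> K \<Longrightarrow> norm (M t e) \<le> C * norm e"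
proof -
  have "\<exists>B. \<forall>t\<in>K. norm (M t e) \<le> B" for e
    using compact_continuous_image[OF assms(3,1)] compact_imp_bounded bounded_iff by (metis imageI)
  then obtain B where B: "\<And>e t. t \<in> K \<Longrightarrow> norm (M t e) \<le> B e" by metis
  define C where "C = \<bar>\<Sum>b\<in>Basis. B b\<bar>"
  have "norm (M t e) \<le> C * norm e" if "t \<in> K" for t e
  proof -
    have "norm (M t e) \<le> (\<Sum>b\<in>Basis. norm (M t b)) * norm e"
      by (rule linear_norm_le_Basis[OF assms(2)[OF that]])
    also have "\<dots> \<le> C * norm e"
    proof (rule mult_right_mono)
      have "(\<Sum>b\<in>Basis. norm (M t b)) \<le> (\<Sum>b\<in>Basis. B b)" using B that by (intro sum_mono) auto
      then show "(\<Sum>b\<in>Basis. norm (M t b)) \<le> C" unfolding C_def by linarith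
    qed auto
    finally show ?thesis .
  qed
  then show ?thesis using that[of C] by (auto simp: C_def)
qed

lemma linear_family_Lipschitz:
  fixes M :: "'t::metric_space \<Rightarrow> 'e::euclidean_space \<Rightarrow> 'f::real_normed_vector"
  assumes "\<And>t. t \<in> K \<Longrightarrow> linear (M t)"
    and "\<And>e. \<exists>L. \<forall>x\<in>K. \<forall>y\<in>K. norm (M x e - M y e) \<le> L * dist x y"
  obtains L where "L \<ge> 0"
    "\<And>x y e. \<lbrakk>x \<in> K; y \<in> K\<rbrakk> \<Longrightarrow> norm (M x e - M y e) \<le> L * dist x y * norm e"
proof -
  obtain B where B: "\<And>e x y. \<lbrakk>x \<in> K; y \<in> K\<rbrakk> \<Longrightarrow> norm (M x e - M y e) \<le> B e * dist x y"
    using assms(2) by metis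
  define L where "L = (\<Sum>b\<in>Basis. \<bar>B b\<bar>)"
  have "norm (M x e - M y e) \<le> L * dist x y * norm e" if "x \<in> K" "y \<in> K" for x y e
  proof -
    have "norm (M x e - M y e) \<le> (\<Sum>b\<in>Basis. norm (M x b - M y b)) * norm e"
      by (rule linear_norm_le_Basis) (intro linear_compose_sub assms(1) that)
    also have "\<dots> \<le> L * dist x y * norm e"
    proof (rule mult_right_mono)
      show "(\<Sum>b\<in>Basis. norm (M x b - M y b)) \<le> L * dist x y"
        unfolding L_def sum_distrib_right
        by (rule sum_mono) (use B[OF that] in \<open>smt (verit) mult_right_mono zero_le_dist\<close>)
    qed auto
    finally show ?thesis .
  qed
  then show ?thesis using that[of L] by (auto simp: L_def sum_nonneg)
qed

lemma smooth_on_Lipschitz_cball: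
  fixes f :: "'a::euclidean_space \<Rightarrow> 'b::real_normed_vector"
  assumes "smooth_on U f" "cball z r \<subseteq> U"
  shows "\<exists>L. \<forall>x\<in>cball z r. \<forall>y\<in>cball z r. norm (f x - f y) \<le> L * dist x y"
proof -
  let ?D = "\<lambda>x. frechet_derivative f (at x)"
  have lin: "linear (?D t)" if "t \<in> cball z r" for t
    using smooth_on_linear_frechet[OF assms(1)] assms(2) that by blast
  have cont: "continuous_on (cball z r) (\<lambda>t. ?D t e)" for e
    using smooth_on_continuous_on[OF smooth_on_frechet_derivative[OF assms(1)]] assms(2)
    by (rule continuous_on_subset)
  obtain C where C: "C \<ge> 0" "\<And>t e. t \<in> cball z r \<Longrightarrow> norm (?D t e) \<le> C * norm e"
    using linear_family_bound[OF compact_cball lin cont] by blast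
  have der: "(f has_derivative ?D x) (at x within cball z r)" if "x \<in> cball z r" for x
    by (rule has_derivative_at_withinI[OF smooth_on_has_derivative[OF assms(1)]]) (use that assms(2) in blast)
  have "onorm (?D x) \<le> C" if "x \<in> cball z r" for x
    by (rule onorm_bound[OF C(1) C(2)[OF that]])
  then have "norm (f x - f y) \<le> C * norm (x - y)" if "x \<in> cball z r" "y \<in> cball z r" for x y
    using differentiable_bound[OF convex_cball der] that by blast
  then have "\<forall>x\<in>cball z r. \<forall>y\<in>cball z r. norm (f x - f y) \<le> C * dist x y"
    unfolding dist_norm[of x y for x y :: 'a] by blast
  then show ?thesis by blast
qed

text \<open>On the ball the derivative is Lipschitz. The mean value inequality on the segment from
  \<open>x\<close> to \<open>y\<close>, applied to \<open>f\<close> minus its linearisation at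
  \<open>x\<close>, then bounds the remainder by the Lipschitz constant times the squared
  distance.\<close>

lemma smooth_on_Taylor_cball:
  fixes f :: "'a::euclidean_space \<Rightarrow> 'b::real_normed_vector"
  assumes "smooth_on U f" "cball z r \<subseteq> U"
  obtains C where "C \<ge> 0" "\<And>x y. \<lbrakk>x \<in> cball z r; y \<in> cball z r\<rbrakk> \<Longrightarrow>
      norm (f y - f x - frechet_derivative f (at x) (y - x)) \<le> C * (norm (y - x))\<^sup>2"
proof -
  let ?D = "\<lambda>x. frechet_derivative f (at x)"
  have lin: "linear (?D t)" if "t \<in> cball z r" for t
    using smooth_on_linear_frechet[OF assms(1)] assms(2) that by blast
  obtain L where L: "L \<ge> 0" "\<And>x y e. \<lbrakk>x \<in> cball z r; y \<in> cball z r\<rbrakk> \<Longrightarrow>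
      norm (?D x e - ?D y e) \<le> L * dist x y * norm e"
    using linear_family_Lipschitz[OF lin
        smooth_on_Lipschitz_cball[OF smooth_on_frechet_derivative[OF assms(1)] assms(2)]] by blast
  have "norm (f y - f x - ?D x (y - x)) \<le> L * (norm (y - x))\<^sup>2"
    if xy: "x \<in> cball z r" "y \<in> cball z r" for x y
  proof -
    have seg: "closed_segment x y \<subseteq> cball z r" using xy by (intro closed_segment_subset) auto
    have der: "(f has_derivative ?D u) (at u within closed_segment x y)" if "u \<in> closed_segment x y" for u
      by (rule has_derivative_at_withinI[OF smooth_on_has_derivative[OF assms(1)]])
         (use that seg assms(2) in blast)
    have "norm (f y - f x - ?D x (y - x)) \<le> norm (y - x) * (L * norm (y - x))"
    proof (rule differentiable_bound_linearization[where S = "closed_segment x y", OF _ der])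
      show "x + t *\<^sub>R (y - x) \<in> closed_segment x y" if "t \<in> {0..1}" for t
        using that by (auto simp: closed_segment_def algebra_simps intro!: exI[of _ t])
      show "onorm (?D u - ?D x) \<le> L * norm (y - x)" if u: "u \<in> closed_segment x y" for u
      proof (rule onorm_bound)
        fix e
        have "norm (?D u e - ?D x e) \<le> L * dist u x * norm e" using L(2) u seg xy by blast
        also have "\<dots> \<le> L * norm (y - x) * norm e"
          using L(1) segment_bound(1)[OF u]
          by (intro mult_right_mono mult_left_mono) (auto simp: dist_norm)
        finally show "norm ((?D u - ?D x) e) \<le> L * norm (y - x) * norm e" by simp
      qed (use L(1) in auto)
    qed auto
    then show ?thesis by (simp add: power2_eq_square mult.commute mult.left_commute)
  qed
  then show ?thesis using that L(1) by blast
qed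

lemma has_derivative_quadratic:
  fixes f :: "'a::euclidean_space \<Rightarrow> 'b::real_normed_vector"
  assumes "linear D" "d > 0" "\<And>w. norm w < d \<Longrightarrow> norm (f (x + w) - f x - D w) \<le> K * (norm w)\<^sup>2"
  shows "(f has_derivative D) (at x)"
  unfolding has_derivative_at
proof
  show "bounded_linear D" using assms(1) by (simp add: linear_conv_bounded_linear)
  have "\<forall>\<^sub>F w in at 0. norm (norm (f (x + w) - f x - D w) / norm w) \<le> norm w * \<bar>K\<bar>"
    unfolding eventually_at
  proof (intro exI[of _ d] conjI ballI impI assms(2))
    fix w :: 'a assume w: "w \<noteq> 0 \<and> dist w 0 < d"
    then have "norm (f (x + w) - f x - D w) \<le> K * (norm w)\<^sup>2" by (intro assms) auto
    also have "\<dots> \<le> norm w * \<bar>K\<bar> * norm w"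
      by (simp add: power2_eq_square mult_right_mono mult.left_commute mult.commute)
    finally show "norm (norm (f (x + w) - f x - D w) / norm w) \<le> norm w * \<bar>K\<bar>"
      using w by (simp add: pos_divide_le_eq)
  qed
  moreover have "((\<lambda>w::'a. norm w * \<bar>K\<bar>) \<longlongrightarrow> 0) (at 0)"
    by (auto intro!: tendsto_eq_intros)
  ultimately show "(\<lambda>w. norm (f (x + w) - f x - D w) / norm w) \<midarrow>0\<rightarrow> 0"
    by (rule Lim_null_comparison)
qed

lemma vector_derivative_norm_bound:
  fixes f :: "real \<Rightarrow> 'b::real_normed_vector"
  assumes "convex S" "\<And>x. x \<in> S \<Longrightarrow> (f has_vector_derivative f' x) (at x within S)"
    and "\<And>x. x \<in> S \<Longrightarrow> norm (f' x) \<le> B" "x \<in> S" "y \<in> S"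
  shows "norm (f x - f y) \<le> B * norm (x - y)"
  using assms unfolding has_vector_derivative_def
  by (intro differentiable_bound[of S f "\<lambda>x h. h *\<^sub>R f' x"])
     (auto intro!: onorm_bound mult_left_mono simp: mult.commute[of B] intro: order_trans[OF norm_ge_zero])

text \<open>The second difference over a parallelogram with sides \<open>h v\<close> and
  \<open>h w\<close>, divided by the square of \<open>h\<close>, approximates an iterated derivative
  up to a multiple of \<open>h\<close>. The difference treats \<open>v\<close> and \<open>w\<close>
  alike, which is the source of the symmetry of second derivatives.\<close>

lemma smooth_on_second_difference:
  fixes f :: "'a::euclidean_space \<Rightarrow> 'b::real_normed_vector"
  assumes f: "smooth_on U f" and U: "open U" "x \<in> U"
  obtains K d where "d > 0" "\<And>h. \<lbrakk>0 < h; h < d\<rbrakk> \<Longrightarrow>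
     norm (f (x + h *\<^sub>R v + h *\<^sub>R w) - f (x + h *\<^sub>R v) - f (x + h *\<^sub>R w) + f x
       - (h * h) *\<^sub>R frechet_derivative (\<lambda>y. frechet_derivative f (at y) v) (at x) w) \<le> K * h ^ 3"
proof -
  define p where "p y = frechet_derivative f (at y) v" for y
  have p: "smooth_on U p" unfolding p_def by (rule smooth_on_frechet_derivative[OF f])
  obtain r where r: "r > 0" "cball x r \<subseteq> U" using U open_contains_cball by blast
  obtain C where C: "C \<ge> 0" "\<And>y. y \<in> cball x r \<Longrightarrow>
      norm (p y - p x - frechet_derivative p (at x) (y - x)) \<le> C * (norm (y - x))\<^sup>2"
    using smooth_on_Taylor_cball[OF p r(2)] r(1) by (metis centre_in_cball less_imp_le)
  let ?Dp = "frechet_derivative p (at x)"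
  have lin: "linear ?Dp" using smooth_on_linear_frechet[OF p U(2)] .
  define k where "k = norm v + norm w + 1"
  have k: "k > 0" by (simp add: k_def add_nonneg_pos)
  have bound: "norm (f (x + h *\<^sub>R v + h *\<^sub>R w) - f (x + h *\<^sub>R v) - f (x + h *\<^sub>R w) + f x
       - (h * h) *\<^sub>R ?Dp w) \<le> (2 * C * k\<^sup>2) * h ^ 3" if h: "0 < h" "h < r / k" for h
  proof -
    have hk: "h * k \<le> r" using h k by (simp add: field_simps)
    have inb: "norm (s *\<^sub>R v + t *\<^sub>R w) \<le> h * k" if "\<bar>s\<bar> \<le> h" "\<bar>t\<bar> \<le> h" for s t
    proof -
      have "norm (s *\<^sub>R v + t *\<^sub>R w) \<le> \<bar>s\<bar> * norm v + \<bar>t\<bar> * norm w"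
        by (metis norm_scaleR norm_triangle_ineq)
      also have "\<dots> \<le> h * norm v + h * norm w"
        using that by (intro add_mono mult_right_mono) auto
      also have "\<dots> \<le> h * k" using h(1) by (simp add: k_def algebra_simps)
      finally show ?thesis .
    qed
    have T: "norm (p (x + s *\<^sub>R v + t *\<^sub>R w) - p x - ?Dp (s *\<^sub>R v + t *\<^sub>R w)) \<le> C * (h * k)\<^sup>2"
      and mem: "x + s *\<^sub>R v + t *\<^sub>R w \<in> U" if "\<bar>s\<bar> \<le> h" "\<bar>t\<bar> \<le> h" for s t
    proof -
      have m: "x + s *\<^sub>R v + t *\<^sub>R w \<in> cball x r"
      proof -
        have "dist (x + (s *\<^sub>R v + t *\<^sub>R w)) x = norm (s *\<^sub>R v + t *\<^sub>R w)"
          by (simp only: dist_norm add_diff_cancel_left')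
        then show ?thesis using inb[OF that] hk by (simp only: mem_cball add.assoc dist_commute[of x])
      qed
      then show "x + s *\<^sub>R v + t *\<^sub>R w \<in> U" using r by blast
      have "C * (norm (s *\<^sub>R v + t *\<^sub>R w))\<^sup>2 \<le> C * (h * k)\<^sup>2"
        using inb[OF that] C(1) by (intro mult_left_mono power_mono) auto
      then show "norm (p (x + s *\<^sub>R v + t *\<^sub>R w) - p x - ?Dp (s *\<^sub>R v + t *\<^sub>R w)) \<le> C * (h * k)\<^sup>2"
        using C(2)[OF m] by (simp add: add.assoc)
    qed
    \<comment> \<open>The mean value inequality is applied along the side \<open>s v\<close> to the
      difference of \<open>f\<close> on two opposite edges minus the expected bilinear term. The
      summand \<open>0 *\<^sub>R w\<close> is kept so that both edges are instances of the same
      facts.\<close>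
    define g where "g s = f (x + s *\<^sub>R v + h *\<^sub>R w) - f (x + s *\<^sub>R v + 0 *\<^sub>R w) - (s * h) *\<^sub>R ?Dp w" for s
    have g: "(g has_vector_derivative
        (p (x + s *\<^sub>R v + h *\<^sub>R w) - p (x + s *\<^sub>R v + 0 *\<^sub>R w) - h *\<^sub>R ?Dp w)) (at s within {0..h})"
      if s: "s \<in> {0..h}" for s
    proof -
      have 1: "((\<lambda>s. f (x + s *\<^sub>R v + t *\<^sub>R w)) has_vector_derivative p (x + s *\<^sub>R v + t *\<^sub>R w))
          (at s within {0..h})" if t: "\<bar>t\<bar> \<le> h" for t
      proof -
        have m: "x + s *\<^sub>R v + t *\<^sub>R w \<in> U" using mem[of s t] s t by auto
        have i: "((\<lambda>s. x + s *\<^sub>R v + t *\<^sub>R w) has_vector_derivative v) (at s within {0..h})"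
          by (auto intro!: derivative_eq_intros)
        have "((f \<circ> (\<lambda>s. x + s *\<^sub>R v + t *\<^sub>R w)) has_vector_derivative
            frechet_derivative f (at (x + s *\<^sub>R v + t *\<^sub>R w)) v) (at s within {0..h})"
          using vector_derivative_diff_chain_within[OF i
              has_derivative_at_withinI[OF smooth_on_has_derivative[OF f m]]] .
        then show ?thesis by (simp add: o_def p_def)
      qed
      have 3: "((\<lambda>s. (s * h) *\<^sub>R ?Dp w) has_vector_derivative (h *\<^sub>R ?Dp w)) (at s within {0..h})"
        by (auto intro!: derivative_eq_intros)
      show ?thesis unfolding g_def[abs_def]
        by (intro has_vector_derivative_diff 1 3) (use h in auto)
    qed
    have "norm (g h - g 0) \<le> (2 * (C * (h * k)\<^sup>2)) * norm (h - 0)"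
    proof (rule vector_derivative_norm_bound[of "{0..h}", OF _ g]) 
      fix s assume s: "s \<in> {0..h}"
      let ?a = "x + s *\<^sub>R v + h *\<^sub>R w" and ?b = "x + s *\<^sub>R v + 0 *\<^sub>R w"
      have e: "?Dp (s *\<^sub>R v + h *\<^sub>R w) - ?Dp (s *\<^sub>R v + 0 *\<^sub>R w) = h *\<^sub>R ?Dp w"
        by (simp add: linear_add[OF lin] linear_cmul[OF lin])
      have "p ?a - p ?b - h *\<^sub>R ?Dp w = (p ?a - p x - ?Dp (s *\<^sub>R v + h *\<^sub>R w))
          - (p ?b - p x - ?Dp (s *\<^sub>R v + 0 *\<^sub>R w))"
        unfolding e[symmetric] by simp
      also have "norm \<dots> \<le> C * (h * k)\<^sup>2 + C * (h * k)\<^sup>2"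
        by (rule order_trans[OF norm_triangle_ineq4 add_mono[OF T T]]) (use s h in auto)
      finally show "norm (p ?a - p ?b - h *\<^sub>R ?Dp w) \<le> 2 * (C * (h * k)\<^sup>2)" by simp
    qed (use h in auto)
    moreover have "g h - g 0 = f (x + h *\<^sub>R v + h *\<^sub>R w) - f (x + h *\<^sub>R v) - f (x + h *\<^sub>R w) + f x
       - (h * h) *\<^sub>R ?Dp w" by (simp add: g_def)
    moreover have "(2 * (C * (h * k)\<^sup>2)) * norm (h - 0) = (2 * C * k\<^sup>2) * h ^ 3"
      using h by (simp add: power2_eq_square power3_eq_cube)
    ultimately show ?thesis by metis
  qed
  show ?thesis
  proof (rule that[of "r / k" "2 * C * k\<^sup>2"])
    show "r / k > 0" using r k by simp
    have Dp: "?Dp = frechet_derivative (\<lambda>y. frechet_derivative f (at y) v) (at x)"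
      by (simp only: p_def[abs_def])
    fix h assume h: "0 < h" "h < r / k"
    show "norm (f (x + h *\<^sub>R v + h *\<^sub>R w) - f (x + h *\<^sub>R v) - f (x + h *\<^sub>R w) + f x
       - (h * h) *\<^sub>R frechet_derivative (\<lambda>y. frechet_derivative f (at y) v) (at x) w)
        \<le> (2 * C * k\<^sup>2) * h ^ 3"
      using bound[OF h] unfolding Dp .
  qed
qed

text \<open>Both iterated derivatives differ by a multiple of \<open>h\<close> from the same second
  difference divided by the square of \<open>h\<close>. A positive gap \<open>e\<close> between them
  contradicts this for small \<open>h\<close>.\<close>

lemma smooth_on_symmetric_second_derivative:
  fixes f :: "'a::euclidean_space \<Rightarrow> 'b::real_normed_vector"
  assumes f: "smooth_on U f" and U: "open U" "x \<in> U"
  shows "frechet_derivative (\<lambda>y. frechet_derivative f (at y) v) (at x) w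
       = frechet_derivative (\<lambda>y. frechet_derivative f (at y) w) (at x) v" (is "?a = ?b")
proof (rule ccontr)
  assume ne: "?a \<noteq> ?b"
  obtain K d where K: "d > 0" "\<And>h. \<lbrakk>0 < h; h < d\<rbrakk> \<Longrightarrow>
     norm (f (x + h *\<^sub>R v + h *\<^sub>R w) - f (x + h *\<^sub>R v) - f (x + h *\<^sub>R w) + f x - (h * h) *\<^sub>R ?a) \<le> K * h ^ 3"
    using smooth_on_second_difference[OF assms] by metis
  obtain K' d' where K': "d' > 0" "\<And>h. \<lbrakk>0 < h; h < d'\<rbrakk> \<Longrightarrow>
     norm (f (x + h *\<^sub>R w + h *\<^sub>R v) - f (x + h *\<^sub>R w) - f (x + h *\<^sub>R v) + f x - (h * h) *\<^sub>R ?b) \<le> K' * h ^ 3"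
    using smooth_on_second_difference[OF assms] by metis
  define e where "e = norm (?a - ?b)"
  have e: "e > 0" using ne by (simp add: e_def)
  have le: "e \<le> (K + K') * h" if h: "0 < h" "h < d" "h < d'" for h
  proof -
    have eq: "x + h *\<^sub>R w + h *\<^sub>R v = x + h *\<^sub>R v + h *\<^sub>R w" by simp
    have "(h * h) * e = norm ((f (x + h *\<^sub>R v + h *\<^sub>R w) - f (x + h *\<^sub>R w) - f (x + h *\<^sub>R v) + f x - (h * h) *\<^sub>R ?b)
       - (f (x + h *\<^sub>R v + h *\<^sub>R w) - f (x + h *\<^sub>R v) - f (x + h *\<^sub>R w) + f x - (h * h) *\<^sub>R ?a))"
    proof -
      have "(f (x + h *\<^sub>R v + h *\<^sub>R w) - f (x + h *\<^sub>R w) - f (x + h *\<^sub>R v) + f x - (h * h) *\<^sub>R ?b)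
       - (f (x + h *\<^sub>R v + h *\<^sub>R w) - f (x + h *\<^sub>R v) - f (x + h *\<^sub>R w) + f x - (h * h) *\<^sub>R ?a)
        = (h * h) *\<^sub>R (?a - ?b)" by (simp add: algebra_simps)
      then show ?thesis by (simp add: e_def)
    qed
    also have "\<dots> \<le> K' * h ^ 3 + K * h ^ 3"
      using K(2)[OF h(1,2)] K'(2)[OF h(1,3)] unfolding eq
      by (rule order_trans[OF norm_triangle_ineq4 add_mono, rotated])
    finally have "(h * h) * e \<le> (h * h) * ((K + K') * h)"
      by (simp add: power3_eq_cube algebra_simps)
    then show ?thesis using h by (simp add: mult_le_cancel_left)
  qed
  \<comment> \<open>Small enough for both estimates, and such that
    \<open>(\<bar>K + K'\<bar> + 1) * h\<close> is at most half of the gap \<open>e\<close>.\<close>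
  define h where "h = min (min (d / 2) (d' / 2)) (e / (2 * (\<bar>K + K'\<bar> + 1)))"
  have "0 < 2 * (\<bar>K + K'\<bar> + 1)" by (simp add: add_nonneg_pos)
  with e have q: "0 < e / (2 * (\<bar>K + K'\<bar> + 1))" by (rule divide_pos_pos)
  have h: "0 < h" "h < d" "h < d'" "h \<le> e / (2 * (\<bar>K + K'\<bar> + 1))"
    unfolding h_def using K(1) K'(1) q by linarith+
  have "e \<le> (K + K') * h" by (rule le) (use h in auto)
  also have "\<dots> \<le> (\<bar>K + K'\<bar> + 1) * h" using h(1) by (intro mult_right_mono) auto
  also have "\<dots> \<le> e / 2"
  proof -
    have "(\<bar>K + K'\<bar> + 1) * h \<le> (\<bar>K + K'\<bar> + 1) * (e / (2 * (\<bar>K + K'\<bar> + 1)))"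
      using h(4) by (intro mult_left_mono) auto
    also have "\<dots> = e / 2"
    proof -
      have half: "q * (e / (2 * q)) = e / 2" if "q \<noteq> 0" for q :: real using that by simp
      have "0 < \<bar>K + K'\<bar> + 1" by (simp add: add_nonneg_pos)
      then show ?thesis by (intro half) (rule less_imp_neq[THEN not_sym])
    qed
    finally show ?thesis .
  qed
  finally show False using e by simp
qed

section \<open>Linear differential equations\<close>

text \<open>Picard iteration. With a coefficient bound \<open>c < 1\<close> the integral operator is
  a contraction over the whole unit interval at once; callers reach such a bound by shrinking a
  radius or rescaling time.\<close>

lemma linear_ode_exists:
  fixes M :: "real \<Rightarrow> 'e::euclidean_space \<Rightarrow> 'e"
  assumes lin: "\<And>t. t \<in> {0..1} \<Longrightarrow> linear (M t)"
    and cont: "\<And>e. continuous_on {0..1} (\<lambda>t. M t e)"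
    and bound: "\<And>t e. t \<in> {0..1} \<Longrightarrow> norm (M t e) \<le> c * norm e" and c: "0 \<le> c" "c < 1"
  obtains y where "y 0 = y0"
    "\<And>t. t \<in> {0..1} \<Longrightarrow> (y has_vector_derivative M t (y t)) (at t within {0..1})"
proof -
  \<comment> \<open>Freezing time outside \<open>{0..1}\<close> lets the integral operator act on
    the complete space of bounded continuous functions on the whole line.\<close>
  define cl where "cl t = max 0 (min 1 t)" for t :: real
  have cl: "cl t \<in> {0..1}" for t by (auto simp: cl_def)
  have cont': "continuous_on {0..1} (\<lambda>t. M t (u t))" if "continuous_on {0..1} u" for u
  proof -
    have "((\<lambda>s. M s (u s)) \<longlongrightarrow> M t (u t)) (at t within {0..1})" if t: "t \<in> {0..1}" for t
    proof -
      have "((\<lambda>s. M s (u s - u t)) \<longlongrightarrow> 0) (at t within {0..1})"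
      proof (rule Lim_null_comparison)
        show "\<forall>\<^sub>F s in at t within {0..1}. norm (M s (u s - u t)) \<le> c * norm (u s - u t)"
          using bound by (auto simp: eventually_at_filter intro!: always_eventually)
        have "(u \<longlongrightarrow> u t) (at t within {0..1})"
          using \<open>continuous_on {0..1} u\<close> t by (auto simp: continuous_on_def)
        then show "((\<lambda>s. c * norm (u s - u t)) \<longlongrightarrow> 0) (at t within {0..1})"
          by (auto intro!: tendsto_eq_intros)
      qed
      moreover have "((\<lambda>s. M s (u t)) \<longlongrightarrow> M t (u t)) (at t within {0..1})"
        using cont[of "u t"] t by (auto simp: continuous_on_def)
      ultimately have "((\<lambda>s. M s (u s - u t) + M s (u t)) \<longlongrightarrow> 0 + M t (u t)) (at t within {0..1})"
        by (rule tendsto_add)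
      moreover have "\<forall>\<^sub>F s in at t within {0..1}. M s (u s - u t) + M s (u t) = M s (u s)"
        by (auto simp: eventually_at_filter linear_diff[OF lin] intro!: always_eventually)
      ultimately show ?thesis using Lim_transform_eventually by fastforce
    qed
    then show ?thesis by (auto simp: continuous_on_def)
  qed
  define op where "op u t = y0 + integral {0..cl t} (\<lambda>s. M s (u s))" for u t
  define Op where "Op u = Bcontfun (op (apply_bcontfun u))" for u :: "real \<Rightarrow>\<^sub>C 'e"
  have contu: "continuous_on {0..1} (\<lambda>s. M s (apply_bcontfun u s))" for u :: "real \<Rightarrow>\<^sub>C 'e"
    by (rule cont') (rule continuous_on_apply_bcontfun)
  have deriv: "((\<lambda>t. y0 + integral {0..t} (\<lambda>s. M s (apply_bcontfun u s))) has_vector_derivative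
      M t (apply_bcontfun u t)) (at t within {0..1})" if "t \<in> {0..1}" for u t
    using has_vector_derivative_add[OF has_vector_derivative_const
        integral_has_vector_derivative[OF contu that]] by simp
  have Op: "apply_bcontfun (Op u) = op u" for u
    unfolding Op_def
  proof (rule Bcontfun_inverse)
    let ?g = "\<lambda>t. y0 + integral {0..t} (\<lambda>s. M s (apply_bcontfun u s))"
    have g: "continuous_on {0..1} ?g"
      by (rule continuous_on_vector_derivative[OF deriv])
    have "continuous_on UNIV (\<lambda>t. ?g (cl t))"
    proof (rule continuous_on_compose2[OF g, of UNIV cl])
      show "continuous_on UNIV cl" unfolding cl_def by (intro continuous_intros)
    qed (use cl in blast)
    moreover have "bounded (range (\<lambda>t. ?g (cl t)))"
      by (rule bounded_subset[OF compact_imp_bounded[OF compact_continuous_image[OF g]]])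
         (use cl in auto)
    ultimately show "op u \<in> bcontfun" by (auto simp: bcontfun_def op_def[abs_def])
  qed
  have "\<exists>!u. Op u = u"
  proof (rule banach_fix_type[OF c], intro allI)
    fix u v :: "real \<Rightarrow>\<^sub>C 'e"
    show "dist (Op u) (Op v) \<le> c * dist u v"
    proof (rule dist_bound)
      fix t
      have sub: "{0..cl t} \<subseteq> {0..1}" using cl[of t] by auto
      have i: "(\<lambda>s. M s (apply_bcontfun u s)) integrable_on {0..cl t}" for u
        by (rule integrable_continuous_real[OF continuous_on_subset[OF contu sub]])
      have "dist (Op u t) (Op v t)
          = norm (integral {0..cl t} (\<lambda>s. M s (apply_bcontfun u s) - M s (apply_bcontfun v s)))"
        unfolding Op op_def by (simp add: dist_norm integral_diff[OF i i])
      also have "\<dots> = norm (integral {0..cl t} (\<lambda>s. M s (apply_bcontfun u s - apply_bcontfun v s)))"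
        by (rule arg_cong[where f = norm], rule integral_cong)
           (use sub in \<open>auto simp: linear_diff[OF lin]\<close>)
      also have "\<dots> \<le> integral {0..cl t} (\<lambda>s. c * dist u v)"
      proof (rule integral_norm_bound_integral)
        show "(\<lambda>s. M s (apply_bcontfun u s - apply_bcontfun v s)) integrable_on {0..cl t}"
          by (rule integrable_eq[OF integrable_diff[OF i[of u] i[of v]]])
             (use sub in \<open>auto simp: linear_diff[OF lin]\<close>)
        fix s assume "s \<in> {0..cl t}"
        then have "norm (M s (apply_bcontfun u s - apply_bcontfun v s))
            \<le> c * norm (apply_bcontfun u s - apply_bcontfun v s)"
          using sub by (intro bound) auto
        also have "\<dots> \<le> c * dist u v"
          using dist_bounded[of u s v] c by (intro mult_left_mono) (auto simp: dist_norm)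
        finally show "norm (M s (apply_bcontfun u s - apply_bcontfun v s)) \<le> c * dist u v" .
      qed auto
      also have "\<dots> \<le> c * dist u v"
        using mult_right_mono[of "cl t" 1 "c * dist u v"] cl[of t] c by (simp add: mult_ac)
      finally show "dist (Op u t) (Op v t) \<le> c * dist u v" .
    qed
  qed
  then obtain u where u: "Op u = u" by blast
  have eq: "apply_bcontfun u t = y0 + integral {0..t} (\<lambda>s. M s (apply_bcontfun u s))"
    if "t \<in> {0..1}" for t
  proof -
    have "apply_bcontfun u t = op u t" using Op[of u] u by simp
    moreover have "cl t = t" using that by (auto simp: cl_def)
    ultimately show ?thesis by (simp add: op_def)
  qed
  show ?thesis
  proof (rule that[of "apply_bcontfun u"])
    show "apply_bcontfun u 0 = y0" using eq[of 0] by simp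
    show "(apply_bcontfun u has_vector_derivative M t (apply_bcontfun u t)) (at t within {0..1})"
      if "t \<in> {0..1}" for t
      by (rule has_vector_derivative_transform[OF that _ deriv[OF that]]) (use eq in auto)
  qed
qed

text \<open>At a time where \<open>norm (y t)\<close> is maximal, the mean value inequality bounds
  this maximum by the initial norm plus half of itself plus \<epsilon>, and the half is absorbed.
  This takes the place of a Gronwall estimate.\<close>

lemma ode_norm_bound:
  fixes y :: "real \<Rightarrow> 'e::real_normed_vector"
  assumes der: "\<And>t. t \<in> {0..1} \<Longrightarrow> (y has_vector_derivative y' t) (at t within {0..1})"
    and bound: "\<And>t. t \<in> {0..1} \<Longrightarrow> norm (y' t) \<le> norm (y t) / 2 + \<epsilon>"
    and t: "t \<in> {0..1}"
  shows "norm (y t) \<le> 2 * (norm (y 0) + \<epsilon>)"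
proof -
  have "continuous_on {0..1} (\<lambda>t. norm (y t))"
    using der by (intro continuous_intros) (meson continuous_on_vector_derivative)
  then obtain s where s: "s \<in> {0..1}" "\<And>t. t \<in> {0..1} \<Longrightarrow> norm (y t) \<le> norm (y s)"
    using continuous_attains_sup[of "{0..1::real}" "\<lambda>t. norm (y t)"] by auto
  have e: "0 \<le> norm (y s) / 2 + \<epsilon>" using bound[OF s(1)] norm_ge_zero order_trans by blast
  have "norm (y s - y 0) \<le> (norm (y s) / 2 + \<epsilon>) * norm (s - 0)"
    by (rule vector_derivative_norm_bound[of "{0..1}", OF _ der]) (use bound s in \<open>force+\<close>)
  also have "\<dots> \<le> norm (y s) / 2 + \<epsilon>" using s e by (auto intro!: mult_left_le)
  finally have "norm (y s) \<le> norm (y 0) + (norm (y s) / 2 + \<epsilon>)"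
    using norm_triangle_ineq2[of "y s" "y 0"] by linarith
  then show ?thesis using s(2)[OF t] by simp
qed

text \<open>The squared norm multiplied by \<open>exp (- (2 * C) * t)\<close> cannot increase, and
  it starts at 0.\<close>

lemma ode_zero:
  fixes y :: "real \<Rightarrow> 'e::real_inner"
  assumes der: "\<And>t. t \<in> {0..1} \<Longrightarrow> (y has_vector_derivative y' t) (at t within {0..1})"
    and bound: "\<And>t. t \<in> {0..1} \<Longrightarrow> norm (y' t) \<le> C * norm (y t)"
    and "y 0 = 0" and t: "t \<in> {0..1}"
  shows "y t = 0"
proof -
  define u where "u t = exp (- (2 * C) * t) * (y t \<bullet> y t)" for t
  have cont: "continuous_on {0..1} u"
    unfolding u_def using der by (intro continuous_intros) (meson continuous_on_vector_derivative)+
  have "u t \<le> u 0"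
  proof (rule DERIV_nonpos_imp_decreasing_open[of 0 t u])
    fix s assume s: "0 < s" "s < t"
    have "(y has_vector_derivative y' s) (at s within {0..1})" using s t by (intro der) auto
    then have "(y has_vector_derivative y' s) (at s)"
      using s t at_within_interior[of s "{0..1}"] by simp
    then have "((\<lambda>t. y t \<bullet> y t) has_real_derivative (2 * (y s \<bullet> y' s))) (at s)"
      unfolding has_vector_derivative_def has_field_derivative_def
      by (auto intro!: derivative_eq_intros simp: inner_commute algebra_simps)
    then have "(u has_real_derivative (exp (- (2 * C) * s) * (2 * (y s \<bullet> y' s) - 2 * C * (y s \<bullet> y s)))) (at s)"
      unfolding u_def by (auto intro!: derivative_eq_intros simp: algebra_simps)
    moreover have "y s \<bullet> y' s \<le> C * (y s \<bullet> y s)"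
    proof -
      have "y s \<bullet> y' s \<le> norm (y s) * norm (y' s)" by (rule norm_cauchy_schwarz)
      also have "\<dots> \<le> norm (y s) * (C * norm (y s))" using bound s t by (intro mult_left_mono) auto
      finally show ?thesis by (simp add: dot_square_norm power2_eq_square mult.left_commute)
    qed
    ultimately show "\<exists>d. (u has_real_derivative d) (at s) \<and> d \<le> 0"
      by (auto intro!: exI mult_nonneg_nonpos)
  qed (use t cont in \<open>auto intro: continuous_on_subset\<close>)
  then have "y t \<bullet> y t \<le> 0"
    using \<open>y 0 = 0\<close> by (simp add: u_def mult_le_0_iff not_le[symmetric])
  then show ?thesis by (metis antisym inner_ge_zero inner_eq_zero_iff)
qed

lemma linear_ode_zero:
  fixes y :: "real \<Rightarrow> 'e::euclidean_space"
  assumes "\<And>t. t \<in> {0..1} \<Longrightarrow> (y has_vector_derivative M t (y t)) (at t within {0..1})"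
    and "\<And>t. t \<in> {0..1} \<Longrightarrow> linear (M t)" "\<And>e. continuous_on {0..1} (\<lambda>t. M t e)"
    and "y 0 = 0" "t \<in> {0..1}"
  shows "y t = 0"
proof -
  obtain C where "C \<ge> 0" "\<And>t e. t \<in> {0..1} \<Longrightarrow> norm (M t e) \<le> C * norm e"
    using linear_family_bound[of "{0..1::real}" M] assms(2,3) by auto
  then show ?thesis using ode_zero[of y "\<lambda>t. M t (y t)" C t] assms(1,4,5) by auto
qed

section \<open>Parallel sections of linear connections\<close>

lemma linear_Basis_expansion:
  fixes f :: "'a::euclidean_space \<Rightarrow> 'b::real_vector"
  assumes "linear f"
  shows "f e = (\<Sum>b\<in>Basis. (e \<bullet> b) *\<^sub>R f b)"
proof -
  have "f e = f (\<Sum>b\<in>Basis. (e \<bullet> b) *\<^sub>R b)" by (simp add: euclidean_representation)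
  then show ?thesis by (simp add: linear_sum[OF assms] linear_cmul[OF assms])
qed

text \<open>The comparison family \<open>F\<close> covers three uses: \<open>A\<close> at the other
  point for a Lipschitz estimate, the first-order expansion of \<open>A\<close> there for a Taylor
  estimate, and zero for a plain bound on \<open>A\<close>.\<close>

lemma bilinear_family_bound:
  fixes A :: "'a::euclidean_space \<Rightarrow> 'v::euclidean_space \<Rightarrow> 'e::euclidean_space \<Rightarrow> 'f::real_normed_vector"
  assumes bil: "\<And>z. z \<in> K \<Longrightarrow> bilinear (A z)"
    and B: "\<And>v e. \<exists>C. \<forall>z\<in>K. \<forall>z'\<in>K. norm (A z v e - F z z' v e) \<le> C * q z z'"
    and F: "\<And>z z'. \<lbrakk>z \<in> K; z' \<in> K\<rbrakk> \<Longrightarrow> bilinear (F z z')" and q: "\<And>z z'. q z z' \<ge> 0"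
  obtains C where "C \<ge> 0" "\<And>z z' v e. \<lbrakk>z \<in> K; z' \<in> K\<rbrakk> \<Longrightarrow>
      norm (A z v e - F z z' v e) \<le> C * q z z' * norm v * norm e"
proof -
  obtain C0 where C0: "\<And>v e z z'. \<lbrakk>z \<in> K; z' \<in> K\<rbrakk> \<Longrightarrow> norm (A z v e - F z z' v e) \<le> C0 v e * q z z'"
    using B by metis
  define C where "C = (\<Sum>b\<in>Basis. \<Sum>b'\<in>Basis. \<bar>C0 b b'\<bar>)"
  have "norm (A z v e - F z z' v e) \<le> C * q z z' * norm v * norm e" if z: "z \<in> K" "z' \<in> K" for z z' v e
  proof -
    let ?G = "\<lambda>v e. A z v e - F z z' v e"
    have l1: "linear (\<lambda>v. ?G v e)" for e
      using bil[OF z(1)] F[OF z] unfolding bilinear_def by (intro linear_compose_sub) auto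
    have l2: "linear (\<lambda>e. ?G v e)" for v
      using bil[OF z(1)] F[OF z] unfolding bilinear_def by (intro linear_compose_sub) auto
    have "norm (?G v e) \<le> (\<Sum>b\<in>Basis. norm (?G b e)) * norm v"
      by (rule linear_norm_le_Basis[OF l1])
    also have "\<dots> \<le> (\<Sum>b\<in>Basis. (\<Sum>b'\<in>Basis. \<bar>C0 b b'\<bar> * q z z') * norm e) * norm v"
    proof (intro mult_right_mono sum_mono)
      fix b :: 'v
      have "norm (?G b e) \<le> (\<Sum>b'\<in>Basis. norm (?G b b')) * norm e"
        by (rule linear_norm_le_Basis[OF l2])
      also have "\<dots> \<le> (\<Sum>b'\<in>Basis. \<bar>C0 b b'\<bar> * q z z') * norm e"
      proof (intro mult_right_mono sum_mono)
        fix b' :: 'e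
        have "norm (?G b b') \<le> C0 b b' * q z z'" by (rule C0[OF z])
        also have "\<dots> \<le> \<bar>C0 b b'\<bar> * q z z'" using q by (intro mult_right_mono) auto
        finally show "norm (?G b b') \<le> \<bar>C0 b b'\<bar> * q z z'" .
      qed auto
      finally show "norm (?G b e) \<le> (\<Sum>b'\<in>Basis. \<bar>C0 b b'\<bar> * q z z') * norm e" .
    qed auto
    also have "\<dots> = C * q z z' * norm v * norm e"
      by (simp add: C_def sum_distrib_right sum_distrib_left mult_ac)
    finally show ?thesis .
  qed
  then show ?thesis using that[of C] by (auto simp: C_def sum_nonneg)
qed

lemma bilinear_zero: "bilinear (\<lambda>v e. 0)"
  by (simp add: bilinear_def module_hom_zero)

lemma frechet_derivative_family_linear:
  fixes A :: "'a::euclidean_space \<Rightarrow> 'e::real_vector \<Rightarrow> 'f::real_normed_vector"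
  assumes "open U" "z \<in> U" "\<And>e. smooth_on U (\<lambda>z. A z e)" "\<And>z. z \<in> U \<Longrightarrow> linear (A z)"
  shows "linear (\<lambda>e. frechet_derivative (\<lambda>z. A z e) (at z) w)"
proof (rule linearI)
  fix e e' :: 'e and r :: real
  have D: "((\<lambda>z. A z e) has_derivative frechet_derivative (\<lambda>z. A z e) (at z)) (at z)" for e
    by (rule smooth_on_has_derivative[OF assms(3,2)])
  have "((\<lambda>z. A z (e + e')) has_derivative (\<lambda>w. frechet_derivative (\<lambda>z. A z e) (at z) w
          + frechet_derivative (\<lambda>z. A z e') (at z) w)) (at z)"
    by (rule has_derivative_transform_within_open[OF has_derivative_add[OF D D] assms(1,2)])
       (use assms(4) linear_add in fastforce)
  then show "frechet_derivative (\<lambda>z. A z (e + e')) (at z) w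
      = frechet_derivative (\<lambda>z. A z e) (at z) w + frechet_derivative (\<lambda>z. A z e') (at z) w"
    by (simp add: frechet_derivative_eqI)
  have "((\<lambda>z. A z (r *\<^sub>R e)) has_derivative (\<lambda>w. r *\<^sub>R frechet_derivative (\<lambda>z. A z e) (at z) w)) (at z)"
    by (rule has_derivative_transform_within_open[OF has_derivative_scaleR_right[OF D] assms(1,2)])
       (use assms(4) linear_cmul in fastforce)
  then show "frechet_derivative (\<lambda>z. A z (r *\<^sub>R e)) (at z) w
      = r *\<^sub>R frechet_derivative (\<lambda>z. A z e) (at z) w"
    by (simp add: frechet_derivative_eqI)
qed

lemma linear_family_curve_derivative:
  fixes A :: "'a::euclidean_space \<Rightarrow> 'e::euclidean_space \<Rightarrow> 'f::real_normed_vector"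
  assumes U: "open U" "z t \<in> U" and sm: "\<And>e. smooth_on U (\<lambda>z. A z e)"
    and lin: "\<And>z. z \<in> U \<Longrightarrow> linear (A z)" and zU: "\<And>s. s \<in> S \<Longrightarrow> z s \<in> U" "t \<in> S"
    and z: "(z has_vector_derivative v) (at t within S)"
    and y: "(y has_vector_derivative y') (at t within S)"
  shows "((\<lambda>t. A (z t) (y t)) has_vector_derivative
      (frechet_derivative (\<lambda>z. A z (y t)) (at (z t)) v + A (z t) y')) (at t within S)"
proof -
  have rep: "A x e = (\<Sum>b\<in>Basis. (e \<bullet> b) *\<^sub>R A x b)" if "x \<in> U" for x e
    by (rule linear_Basis_expansion[OF lin[OF that]])
  let ?D = "\<lambda>e. frechet_derivative (\<lambda>z. A z e) (at (z t)) v"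
  have Dlin: "linear ?D" by (rule frechet_derivative_family_linear[OF U sm lin])
  have repD: "?D e = (\<Sum>b\<in>Basis. (e \<bullet> b) *\<^sub>R ?D b)" for e
    by (rule linear_Basis_expansion[OF Dlin])
  have "((\<lambda>t. A (z t) b) has_vector_derivative ?D b) (at t within S)" for b
    using vector_derivative_diff_chain_within[OF z
        has_derivative_at_withinI[OF smooth_on_has_derivative[OF sm U(2)]]] by (simp add: o_def)
  moreover have "((\<lambda>t. y t \<bullet> b) has_real_derivative (y' \<bullet> b)) (at t within S)" for b
    using bounded_linear.has_vector_derivative[OF bounded_linear_inner_left y]
    by (simp add: has_real_derivative_iff_has_vector_derivative)
  ultimately have "((\<lambda>t. \<Sum>b\<in>Basis. (y t \<bullet> b) *\<^sub>R A (z t) b) has_vector_derivative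
      (\<Sum>b\<in>Basis. (y t \<bullet> b) *\<^sub>R ?D b + (y' \<bullet> b) *\<^sub>R A (z t) b)) (at t within S)"
    by (intro has_vector_derivative_sum has_vector_derivative_scaleR)
  then have "((\<lambda>t. \<Sum>b\<in>Basis. (y t \<bullet> b) *\<^sub>R A (z t) b) has_vector_derivative (?D (y t) + A (z t) y'))
      (at t within S)"
    by (simp add: sum.distrib repD[of "y t"] rep[OF U(2), of y'])
  then show ?thesis
    by (rule has_vector_derivative_transform[OF zU(2), rotated]) (simp add: rep zU(1))
qed

text \<open>The equation is solved along every ray from \<open>z0\<close>, and the endpoint values
  define \<open>s\<close>. Its derivative at \<open>z0 + v\<close> in direction \<open>w\<close> is
  found by comparing the rays \<open>v\<close> and \<open>v + w\<close>: zero curvature says that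
  \<open>t *\<^sub>R A z w (y t)\<close>, with \<open>z\<close> moving on the ray, is the
  first-order variation of the solution. Curvature is required to vanish only along solutions
  starting at \<open>s0\<close>, since the connection to which this is applied is flat only on a
  kernel.\<close>

lemma flat_section_exists:
  fixes A :: "'a::euclidean_space \<Rightarrow> 'a \<Rightarrow> 'e::euclidean_space \<Rightarrow> 'e"
  assumes U: "open U" "cball z0 r \<subseteq> U" "r > 0"
    and sm: "\<And>v e. smooth_on U (\<lambda>z. A z v e)" and bil: "\<And>z. z \<in> U \<Longrightarrow> bilinear (A z)"
    and bound: "\<And>z v e. z \<in> cball z0 r \<Longrightarrow> norm (A z v e) \<le> C * norm v * norm e"
    and C: "C * r \<le> 1 / 2" "C \<ge> 0"
    and flat: "\<And>v y t w. \<lbrakk>norm v < r; y 0 = s0; t \<in> {0..1};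
        \<And>t. t \<in> {0..1} \<Longrightarrow> (y has_vector_derivative A (z0 + t *\<^sub>R v) v (y t)) (at t within {0..1})\<rbrakk>
      \<Longrightarrow> frechet_derivative (\<lambda>z. A z v (y t)) (at (z0 + t *\<^sub>R v)) w
        - frechet_derivative (\<lambda>z. A z w (y t)) (at (z0 + t *\<^sub>R v)) v
        + A (z0 + t *\<^sub>R v) v (A (z0 + t *\<^sub>R v) w (y t))
        - A (z0 + t *\<^sub>R v) w (A (z0 + t *\<^sub>R v) v (y t)) = 0"
  obtains s where "s z0 = s0"
    "\<And>z. z \<in> ball z0 r \<Longrightarrow> (s has_derivative (\<lambda>v. A z v (s z))) (at z)"
proof -
  have lin: "linear (A z v)" if "z \<in> U" for z v using bil[OF that] by (simp add: bilinear_def)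
  have lin': "linear (\<lambda>v. A z v e)" if "z \<in> U" for z e using bil[OF that] by (simp add: bilinear_def)
  have inb: "z0 + t *\<^sub>R v \<in> cball z0 r" if "norm v < r" "t \<in> {0..1}" for t v
  proof -
    have "norm (t *\<^sub>R v) \<le> 1 * norm v" unfolding norm_scaleR using that by (intro mult_right_mono) auto
    then have "norm (t *\<^sub>R v) \<le> r" using that(1) by linarith
    moreover have "dist (z0 + t *\<^sub>R v) z0 = norm (t *\<^sub>R v)" by (simp only: dist_norm add_diff_cancel_left')
    ultimately show ?thesis by (simp only: mem_cball dist_commute[of z0])
  qed
  have "\<exists>y. y 0 = s0 \<and> (\<forall>t\<in>{0..1}. (y has_vector_derivative A (z0 + t *\<^sub>R v) v (y t)) (at t within {0..1}))"
    if v: "norm v < r" for v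
  proof -
    have c1: "continuous_on {0..1} (\<lambda>t. A (z0 + t *\<^sub>R v) v e)" for e
    proof (rule continuous_on_compose2[OF smooth_on_continuous_on[OF sm], of "{0..1}" "\<lambda>t. z0 + t *\<^sub>R v"])
      show "(\<lambda>t. z0 + t *\<^sub>R v) ` {0..1} \<subseteq> U" using inb[OF v] U(2) by blast
    qed (intro continuous_intros)
    have c2: "norm (A (z0 + t *\<^sub>R v) v e) \<le> 1 / 2 * norm e" if "t \<in> {0..1}" for t e
    proof -
      have "norm (A (z0 + t *\<^sub>R v) v e) \<le> C * norm v * norm e" by (rule bound[OF inb[OF v that]])
      also have "\<dots> \<le> C * r * norm e" using v C(2) by (intro mult_right_mono mult_left_mono) auto
      also have "\<dots> \<le> 1 / 2 * norm e" using C(1) by (intro mult_right_mono) auto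
      finally show ?thesis .
    qed
    have c3: "linear (A (z0 + t *\<^sub>R v) v)" if "t \<in> {0..1}" for t
      using lin inb[OF v that] U(2) by blast
    show ?thesis
      by (rule linear_ode_exists[OF c3 c1 c2, of s0]) auto
  qed
  then obtain Y where Y0: "\<And>v. norm v < r \<Longrightarrow> Y v 0 = s0"
    and Y: "\<And>v t. \<lbrakk>norm v < r; t \<in> {0..1}\<rbrakk> \<Longrightarrow>
        (Y v has_vector_derivative A (z0 + t *\<^sub>R v) v (Y v t)) (at t within {0..1})"
    by metis
  define s where "s z = Y (z - z0) 1" for z
  obtain L where L: "L \<ge> 0" "\<And>z z' v e. \<lbrakk>z \<in> cball z0 r; z' \<in> cball z0 r\<rbrakk> \<Longrightarrow>
      norm (A z v e - A z' v e) \<le> L * dist z z' * norm v * norm e"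
  proof (rule bilinear_family_bound[of "cball z0 r" A "\<lambda>z z'. A z'" dist])
    show "\<exists>C. \<forall>z\<in>cball z0 r. \<forall>z'\<in>cball z0 r. norm (A z v e - A z' v e) \<le> C * dist z z'" for v e
      by (rule smooth_on_Lipschitz_cball[OF sm U(2)])
  qed (use bil U(2) in auto)
  let ?DA = "\<lambda>z v e. frechet_derivative (\<lambda>z. A z v e) (at z)"
  have DA_bil: "bilinear (\<lambda>v e. ?DA z v e w)" if "z \<in> U" for z w
    unfolding bilinear_def
    using frechet_derivative_family_linear[OF U(1) that sm lin]
      frechet_derivative_family_linear[OF U(1) that sm lin'] by auto
  obtain T where T: "T \<ge> 0" "\<And>z z' v e. \<lbrakk>z \<in> cball z0 r; z' \<in> cball z0 r\<rbrakk> \<Longrightarrow>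
      norm (A z v e - (A z' v e + ?DA z' v e (z - z'))) \<le> T * (dist z z')\<^sup>2 * norm v * norm e"
  proof (rule bilinear_family_bound[of "cball z0 r" A "\<lambda>z z' v e. A z' v e + ?DA z' v e (z - z')"
        "\<lambda>z z'. (dist z z')\<^sup>2"])
    fix v e
    obtain K where "\<And>x y. \<lbrakk>x \<in> cball z0 r; y \<in> cball z0 r\<rbrakk> \<Longrightarrow>
      norm (A y v e - A x v e - ?DA x v e (y - x)) \<le> K * (norm (y - x))\<^sup>2"
      using smooth_on_Taylor_cball[OF sm U(2)] by metis
    then show "\<exists>C. \<forall>z\<in>cball z0 r. \<forall>z'\<in>cball z0 r.
        norm (A z v e - (A z' v e + ?DA z' v e (z - z'))) \<le> C * (dist z z')\<^sup>2"
      unfolding dist_norm diff_diff_eq by blast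
  next
    fix z z' assume "z \<in> cball z0 r" "z' \<in> cball z0 r"
    then have "z' \<in> U" using U(2) by blast
    then show "bilinear (\<lambda>v e. A z' v e + ?DA z' v e (z - z'))"
      using bil DA_bil unfolding bilinear_def by (auto intro!: linear_compose_add)
  next
    fix z assume "z \<in> cball z0 r" then show "bilinear (A z)" using bil U(2) by blast
  qed auto
  have der: "(s has_derivative (\<lambda>w. A z w (s z))) (at z)" if z: "z \<in> ball z0 r" for z
  proof -
    define v where "v = z - z0"
    have v: "norm v < r" using z by (simp add: v_def dist_norm norm_minus_commute)
    have zv: "z = z0 + v" by (simp add: v_def)
    let ?z = "\<lambda>t. z0 + t *\<^sub>R v" and ?y = "Y v"
    obtain m where m: "\<And>t. t \<in> {0..1} \<Longrightarrow> norm (?y t) \<le> m" "m \<ge> 0"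
    proof -
      have "continuous_on {0..1} ?y" by (rule continuous_on_vector_derivative[OF Y[OF v]])
      then have "bounded (?y ` {0..1})" by (intro compact_imp_bounded compact_continuous_image) auto
      then obtain m where "\<forall>x\<in>?y ` {0..1}. norm x \<le> m" by (auto simp: bounded_iff)
      then show ?thesis using that[of "\<bar>m\<bar>"] by force
    qed
    \<comment> \<open>Sum of the constants in the bounds for the four remainders \<open>r1\<close>
      to \<open>r4\<close> below.\<close>
    define K where "K = T * norm v * m + L * m + L * norm v * C * m + C * C * m"
    have est: "norm (s (z + w) - s z - A z w (s z)) \<le> (2 * K) * (norm w)\<^sup>2"
      if w: "norm w < r - norm v" for w
    proof -
      have vw: "norm (v + w) < r" using norm_triangle_ineq[of v w] w by linarith
      let ?z' = "\<lambda>t. z0 + t *\<^sub>R (v + w)" and ?y' = "Y (v + w)"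
      \<comment> \<open>Deviation of the solution on the neighbouring ray from its expected
        first-order variation. It vanishes at time 0, and at time 1 it is the remainder in the
        claimed derivative of \<open>s\<close>.\<close>
      define \<delta> where "\<delta> t = ?y' t - ?y t - t *\<^sub>R A (?z t) w (?y t)" for t
      define \<delta>' where "\<delta>' t = A (?z' t) (v + w) (?y' t) - A (?z t) v (?y t)
          - (t *\<^sub>R (?DA (?z t) w (?y t) v + A (?z t) w (A (?z t) v (?y t))) + 1 *\<^sub>R A (?z t) w (?y t))" for t
      have d\<delta>: "(\<delta> has_vector_derivative \<delta>' t) (at t within {0..1})" if t: "t \<in> {0..1}" for t
        unfolding \<delta>_def[abs_def] \<delta>'_def
      proof (intro has_vector_derivative_diff Y v vw t has_vector_derivative_scaleR)
        show "((\<lambda>t. A (?z t) w (?y t)) has_vector_derivative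
            ?DA (?z t) w (?y t) v + A (?z t) w (A (?z t) v (?y t))) (at t within {0..1})"
        proof (rule linear_family_curve_derivative[OF U(1) _ sm lin _ t _ Y[OF v t]])
          show "?z s \<in> U" if "s \<in> {0..1}" for s using inb[OF v that] U(2) by blast
          then show "?z t \<in> U" using t by blast
          show "(?z has_vector_derivative v) (at t within {0..1})" by (auto intro!: derivative_eq_intros)
        qed auto
      qed (auto intro!: derivative_eq_intros)
      have "norm (\<delta> 1) \<le> 2 * (norm (\<delta> 0) + K * (norm w)\<^sup>2)"
      proof (rule ode_norm_bound[OF d\<delta>])
        fix t :: real assume t: "t \<in> {0..1}"
        let ?a = "?z t" and ?b = "?z' t" and ?e = "?y t"
        have ab: "?a \<in> cball z0 r" "?b \<in> cball z0 r" using inb v vw t by auto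
        then have abU: "?a \<in> U" "?b \<in> U" using U(2) by auto
        have dist: "dist ?b ?a = t * norm w" "?b - ?a = t *\<^sub>R w" using t by (auto simp: dist_norm algebra_simps)
        have tw: "t * norm w \<le> norm w" using t by (auto intro!: mult_left_le_one_le)
        note la = linear_add[OF lin[OF abU(2)]] linear_add[OF lin'[OF abU(2)]] linear_cmul[OF lin[OF abU(2)]]
        have y': "?y' t = \<delta> t + ?e + t *\<^sub>R A ?a w ?e" by (simp add: \<delta>_def)
        have flat': "?DA ?a v ?e w = ?DA ?a w ?e v - A ?a v (A ?a w ?e) + A ?a w (A ?a v ?e)"
          using flat[OF v Y0[OF v] t Y[OF v], of w] by (simp add: algebra_simps)
        have DAc: "?DA ?a v ?e (t *\<^sub>R w) = t *\<^sub>R ?DA ?a v ?e w"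
          by (rule linear_cmul[OF smooth_on_linear_frechet[OF sm abU(1)]])
        define r1 where "r1 = A ?b v ?e - (A ?a v ?e + ?DA ?a v ?e (?b - ?a))"
        define r2 where "r2 = A ?b w ?e - A ?a w ?e"
        define r3 where "r3 = t *\<^sub>R (A ?b v (A ?a w ?e) - A ?a v (A ?a w ?e))"
        define r4 where "r4 = t *\<^sub>R A ?b w (A ?a w ?e)"
        \<comment> \<open>Zero curvature cancels what is of first order in \<open>w\<close>. There
          remain the connection applied to \<open>\<delta> t\<close>, whose norm is at most half of
          that of \<open>\<delta> t\<close> as \<open>ode_norm_bound\<close> requires, and four
          terms of second order in \<open>w\<close>.\<close>
        have "\<delta>' t = A ?b (v + w) (\<delta> t) + (r1 + r2 + r3 + r4)"
          unfolding \<delta>'_def y' la r1_def r2_def r3_def r4_def dist(2) DAc flat'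
          by (simp add: algebra_simps)
        also have "norm \<dots> \<le> norm (A ?b (v + w) (\<delta> t)) + (norm r1 + norm r2 + norm r3 + norm r4)"
          by (intro norm_triangle_mono norm_triangle_ineq order_refl)
        also have "norm (A ?b (v + w) (\<delta> t)) \<le> norm (\<delta> t) / 2"
        proof -
          have "norm (A ?b (v + w) (\<delta> t)) \<le> C * norm (v + w) * norm (\<delta> t)" by (rule bound[OF ab(2)])
          also have "\<dots> \<le> C * r * norm (\<delta> t)" using vw C(2) by (intro mult_right_mono mult_left_mono) auto
          also have "\<dots> \<le> 1 / 2 * norm (\<delta> t)" using C(1) by (intro mult_right_mono) auto
          finally show ?thesis by simp
        qed
        also have "norm r1 + norm r2 + norm r3 + norm r4 \<le> K * (norm w)\<^sup>2"
        proof -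
          have Aw: "norm (A ?a w ?e) \<le> C * norm w * m"
            using bound[OF ab(1), of w ?e] m(1)[OF t] C(2)
            by (meson mult_left_mono mult_nonneg_nonneg norm_ge_zero order_trans)
          have "norm r1 \<le> T * (t * norm w)\<^sup>2 * norm v * norm ?e"
            unfolding r1_def using T(2)[OF ab(2,1)] dist by metis
          also have "\<dots> \<le> T * (norm w)\<^sup>2 * norm v * m"
            using T(1) tw m(1)[OF t] t by (intro mult_mono power_mono) auto
          finally have 1: "norm r1 \<le> T * norm v * m * (norm w)\<^sup>2" by (simp add: mult_ac)
          have "norm r2 \<le> L * (t * norm w) * norm w * norm ?e"
            unfolding r2_def using L(2)[OF ab(2,1)] dist by metis
          also have "\<dots> \<le> L * norm w * norm w * m"
            using L(1) tw m(1)[OF t] t by (intro mult_mono) auto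
          finally have 2: "norm r2 \<le> L * m * (norm w)\<^sup>2" by (simp add: mult_ac power2_eq_square)
          have "norm r3 \<le> norm (A ?b v (A ?a w ?e) - A ?a v (A ?a w ?e))"
            unfolding r3_def norm_scaleR using t by (intro mult_left_le_one_le) auto
          also have "\<dots> \<le> L * (t * norm w) * norm v * norm (A ?a w ?e)"
            using L(2)[OF ab(2,1)] dist by metis
          also have "\<dots> \<le> L * norm w * norm v * (C * norm w * m)"
            using L(1) tw Aw t by (intro mult_mono) auto
          finally have 3: "norm r3 \<le> L * norm v * C * m * (norm w)\<^sup>2"
            by (simp add: mult_ac power2_eq_square)
          have "norm r4 \<le> norm (A ?b w (A ?a w ?e))"
            unfolding r4_def norm_scaleR using t by (intro mult_left_le_one_le) auto
          also have "\<dots> \<le> C * norm w * norm (A ?a w ?e)" by (rule bound[OF ab(2)])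
          also have "\<dots> \<le> C * norm w * (C * norm w * m)" using Aw C(2) by (intro mult_left_mono) auto
          finally have 4: "norm r4 \<le> C * C * m * (norm w)\<^sup>2" by (simp add: mult_ac power2_eq_square)
          show ?thesis using 1 2 3 4 by (simp add: K_def distrib_right)
        qed
        finally show "norm (\<delta>' t) \<le> norm (\<delta> t) / 2 + K * (norm w)\<^sup>2" by simp
      qed auto
      moreover have "\<delta> 0 = 0" by (simp add: \<delta>_def Y0 v vw)
      moreover have "\<delta> 1 = s (z + w) - s z - A z w (s z)" by (simp add: \<delta>_def s_def zv add.assoc)
      ultimately show ?thesis by simp
    qed
    have "z \<in> U" using z U(2) ball_subset_cball by blast
    then show ?thesis
      by (intro has_derivative_quadratic[of _ "r - norm v", OF _ _ est] lin') (use v in auto)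
  qed
  \<comment> \<open>The ray of direction 0 stays at \<open>z0\<close>, so its solution is constant;
    this yields the value of \<open>s\<close> at \<open>z0\<close>.\<close>
  have "(Y 0 has_vector_derivative 0) (at t within {0..1})" if "t \<in> {0..1}" for t
  proof -
    have "z0 \<in> cball z0 r" using U(3) by simp
    then have "z0 \<in> U" using U(2) by blast
    then have "A z0 0 (Y 0 t) = 0" by (rule linear_0[OF lin'])
    then show ?thesis using Y[of 0 t, OF _ that] U(3) by (simp only: scaleR_zero_right add_0_right norm_zero)
  qed
  then have "norm (Y 0 1 - Y 0 0) \<le> 0 * norm (1 - 0 :: real)"
    by (intro vector_derivative_norm_bound[of "{0..1}" "Y 0" "\<lambda>_. 0"]) auto
  then have "s z0 = s0" using Y0[of 0] U(3) by (simp add: s_def)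
  then show ?thesis using that der by blast
qed

text \<open>Along the segment from \<open>z0\<close> to \<open>z\<close> the difference of the two
  sections solves a homogeneous linear equation with initial value 0.\<close>

lemma flat_section_unique:
  fixes s :: "'a::euclidean_space \<Rightarrow> 'e::euclidean_space"
  assumes "convex W" "W \<subseteq> U" "z0 \<in> W" and U: "open U"
    and sm: "\<And>v e. smooth_on U (\<lambda>z. A z v e)" and bil: "\<And>z. z \<in> U \<Longrightarrow> bilinear (A z)"
    and s: "\<And>z. z \<in> W \<Longrightarrow> (s has_derivative (\<lambda>v. A z v (s z))) (at z)"
    and s': "\<And>z. z \<in> W \<Longrightarrow> (s' has_derivative (\<lambda>v. A z v (s' z))) (at z)"
    and "s z0 = s' z0" "z \<in> W"
  shows "s z = s' z"
proof -
  define v where "v = z - z0"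
  have inW: "z0 + t *\<^sub>R v \<in> W" if "t \<in> {0..1}" for t
    using convexD_alt[OF assms(1,3,10), of t] that by (simp add: v_def algebra_simps)
  have der: "((\<lambda>t. u (z0 + t *\<^sub>R v)) has_vector_derivative A (z0 + t *\<^sub>R v) v (u (z0 + t *\<^sub>R v)))
      (at t within {0..1})"
    if "\<And>z. z \<in> W \<Longrightarrow> (u has_derivative (\<lambda>v. A z v (u z))) (at z)" "t \<in> {0..1}" for u t
  proof -
    have "((\<lambda>t. z0 + t *\<^sub>R v) has_vector_derivative v) (at t within {0..1})"
      by (auto intro!: derivative_eq_intros)
    moreover have "(u has_derivative (\<lambda>w. A (z0 + t *\<^sub>R v) w (u (z0 + t *\<^sub>R v)))) (at (z0 + t *\<^sub>R v) within
        (\<lambda>t. z0 + t *\<^sub>R v) ` {0..1})"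
      by (rule has_derivative_at_withinI[OF that(1)[OF inW[OF that(2)]]])
    ultimately show ?thesis
      using vector_derivative_diff_chain_within by (force simp: o_def)
  qed
  have "s (z0 + 1 *\<^sub>R v) - s' (z0 + 1 *\<^sub>R v) = 0"
  proof (rule linear_ode_zero[where M = "\<lambda>t. A (z0 + t *\<^sub>R v) v"])
    fix t :: real assume t: "t \<in> {0..1}"
    show l: "linear (A (z0 + t *\<^sub>R v) v)"
      using bil inW[OF t] assms(2) by (auto simp: bilinear_def)
    show "((\<lambda>t. s (z0 + t *\<^sub>R v) - s' (z0 + t *\<^sub>R v)) has_vector_derivative
        A (z0 + t *\<^sub>R v) v (s (z0 + t *\<^sub>R v) - s' (z0 + t *\<^sub>R v))) (at t within {0..1})"
      unfolding linear_diff[OF l] by (intro has_vector_derivative_diff der s s' t)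
  next
    show "continuous_on {0..1} (\<lambda>t. A (z0 + t *\<^sub>R v) v e)" for e
    proof (rule continuous_on_compose2[OF smooth_on_continuous_on[OF sm], of "{0..1}" "\<lambda>t. z0 + t *\<^sub>R v"])
      show "(\<lambda>t. z0 + t *\<^sub>R v) ` {0..1} \<subseteq> U" using inW assms(2) by blast
    qed (intro continuous_intros)
  qed (use assms in auto)
  then show ?thesis by (simp add: v_def)
qed

text \<open>Bootstrap: the derivative of \<open>s\<close> is linear in \<open>s\<close> with smooth
  coefficients, so it has whatever regularity is already known for \<open>s\<close>.\<close>

lemma flat_section_smooth:
  fixes s :: "'a::euclidean_space \<Rightarrow> 'e::euclidean_space"
  assumes U: "open W" "W \<subseteq> U" "open U"
    and sm: "\<And>v e. smooth_on U (\<lambda>z. A z v e)" and bil: "\<And>z. z \<in> U \<Longrightarrow> bilinear (A z)"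
    and s: "\<And>z. z \<in> W \<Longrightarrow> (s has_derivative (\<lambda>v. A z v (s z))) (at z)"
  shows "smooth_on W s"
proof -
  have rep: "A x v e = (\<Sum>b\<in>Basis. (e \<bullet> b) *\<^sub>R A x v b)" if "x \<in> U" for x v e
    by (rule linear_Basis_expansion) (use bil[OF that] in \<open>simp add: bilinear_def\<close>)
  have smW: "smooth_on W (\<lambda>z. A z v e)" for v e by (rule smooth_on_subset[OF sm U(2)])
  have "Ck_on k W s" for k
  proof (induction k)
    case 0
    then show ?case using s by (auto intro!: continuous_at_imp_continuous_on has_derivative_continuous)
  next
    case (Suc k)
    have "Ck_on k W (\<lambda>x. frechet_derivative s (at x) v)" for v
    proof (rule Ck_on_cong[OF U(1), of "\<lambda>x. \<Sum>b\<in>Basis. (s x \<bullet> b) *\<^sub>R A x v b"])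
      show "Ck_on k W (\<lambda>x. \<Sum>b\<in>Basis. (s x \<bullet> b) *\<^sub>R A x v b)"
      proof (intro Ck_on_sum Ck_on_bilinear[OF bounded_bilinear_scaleR] U(1))
        fix b
        show "Ck_on k W (\<lambda>x. s x \<bullet> b)"
          using Ck_on_bounded_linear[OF bounded_linear_inner_left U(1) Suc] .
        show "Ck_on k W (\<lambda>x. A x v b)" using smW by (simp add: smooth_on_def)
      qed
      show "(\<Sum>b\<in>Basis. (s x \<bullet> b) *\<^sub>R A x v b) = frechet_derivative s (at x) v" if "x \<in> W" for x
        unfolding frechet_derivative_eqI[OF s[OF that]] using rep[of x v "s x"] U(2) that by auto
    qed
    then show ?case using s by (auto simp: differentiable_def)
  qed
  then show ?thesis by (simp add: smooth_on_def)
qed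

section \<open>Holomorphic maps of several variables are smooth\<close>

text \<open>The scalar notion behind \<open>holomorphic_map_on\<close>. The definition of a complex
  manifold grants the coordinate changes a single complex-linear derivative, and their smoothness
  has to be derived from it.\<close>

definition cdiff_on :: "(complex^'n) set \<Rightarrow> (complex^'n \<Rightarrow> complex) \<Rightarrow> bool"
  where "cdiff_on S g \<longleftrightarrow> (\<forall>z\<in>S. \<exists>D. (g has_derivative D) (at z) \<and> (\<forall>a v. D (a *s v) = a * D v))"

lemma norm_vector_smult: "norm (a *s (v::complex^'n)) = norm a * norm v"
  by (simp add: norm_vec_def L2_set_def norm_mult power_mult_distrib real_sqrt_mult
      flip: sum_distrib_left)

lemma smult_conv_scaleR: "complex_of_real r *s (v::complex^'n) = r *\<^sub>R v"
  by (simp add: vec_eq_iff scaleR_conv_of_real[where 'a = complex])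

lemma bounded_linear_smult_left: "bounded_linear (\<lambda>a. a *s (v::complex^'n))"
  by (rule bounded_linear_intro[of _ "norm v"])
     (auto simp: vec_eq_iff algebra_simps norm_vector_smult scaleR_conv_of_real[where 'a = complex])

lemma bounded_linear_smult_right: "bounded_linear (\<lambda>v. a *s (v::complex^'n))"
  by (rule bounded_linear_intro[of _ "norm a"])
     (auto simp: vec_eq_iff algebra_simps norm_vector_smult scaleR_conv_of_real[where 'a = complex])

text \<open>Cauchy's formula for the derivative at 0 of
  \<open>\<lambda>\<zeta>. g (z + \<zeta> *s v)\<close>; on the parametrised circle the factors 2 pi
  i cancel. The circle is the same for all \<open>z\<close> near \<open>z0\<close>, so the formula
  can be differentiated in \<open>z\<close> under the integral.\<close>

lemma cdiff_on_Cauchy: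
  fixes g :: "complex^'n \<Rightarrow> complex"
  assumes g: "cdiff_on S g" and cb: "cball z0 (2 * r) \<subseteq> S" and r: "r > 0"
  obtains \<delta> where "\<delta> > 0" "\<And>t. norm (circlepath 0 \<delta> t *s v) \<le> r"
    "\<And>z. z \<in> ball z0 r \<Longrightarrow>
      frechet_derivative g (at z) v = integral {0..1} (\<lambda>t. g (z + circlepath 0 \<delta> t *s v) / circlepath 0 \<delta> t)"
proof -
  \<comment> \<open>The radius is such that translation by \<open>\<zeta> *s v\<close> moves points
    by at most \<open>r\<close>; the added 1 covers \<open>v = 0\<close>.\<close>
  define \<delta> where "\<delta> = r / (norm v + 1)"
  have \<delta>: "\<delta> > 0" using r by (simp add: \<delta>_def add_nonneg_pos)
  have \<delta>v: "norm (\<zeta> *s v) \<le> r" if "norm \<zeta> \<le> \<delta>" for \<zeta>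
  proof -
    have "norm (\<zeta> *s v) \<le> \<delta> * norm v" using that by (simp add: norm_vector_smult mult_right_mono)
    also have "\<dots> \<le> \<delta> * (norm v + 1)" using \<delta> by simp
    also have "\<dots> = r" by (simp add: \<delta>_def add_nonneg_eq_0_iff)
    finally show ?thesis .
  qed
  have nc: "norm (circlepath 0 \<delta> t) = \<delta>" for t
    using \<delta> by (simp add: circlepath_def part_circlepath_def norm_mult exp_eq_polar)
  have nz: "circlepath 0 \<delta> t \<noteq> 0" for t using nc[of t] \<delta> by auto
  show ?thesis
  proof (rule that[OF \<delta>])
    show "norm (circlepath 0 \<delta> t *s v) \<le> r" for t by (rule \<delta>v) (simp add: nc)
    fix z assume z: "z \<in> ball z0 r"
    define f where "f \<zeta> = g (z + \<zeta> *s v)" for \<zeta>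
    have inS: "z + \<zeta> *s v \<in> S" if "norm \<zeta> \<le> \<delta>" for \<zeta>
    proof -
      have "dist z0 (z + \<zeta> *s v) \<le> dist z0 z + dist z (z + \<zeta> *s v)" by (rule dist_triangle)
      also have "dist z (z + \<zeta> *s v) = norm (\<zeta> *s v)"
        by (simp only: dist_commute[of z] dist_norm[of "z + _"] add_diff_cancel_left')
      finally have "dist z0 (z + \<zeta> *s v) \<le> 2 * r" using z \<delta>v[OF that] by simp
      then show ?thesis using cb by auto
    qed
    have f': "(f has_field_derivative frechet_derivative g (at (z + \<zeta> *s v)) v) (at \<zeta>)"
      if "norm \<zeta> \<le> \<delta>" for \<zeta>
    proof -
      have zS: "z + \<zeta> *s v \<in> S" by (rule inS[OF that])
      obtain D where D: "(g has_derivative D) (at (z + \<zeta> *s v))" "\<And>a v. D (a *s v) = a * D v"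
        using g zS unfolding cdiff_on_def by blast
      have "((\<lambda>\<zeta>. z + \<zeta> *s v) has_derivative (\<lambda>h. h *s v)) (at \<zeta>)"
        using has_derivative_add[OF has_derivative_const
          bounded_linear_imp_has_derivative[OF bounded_linear_smult_left]] by simp
      then have "(f has_derivative (\<lambda>h. D (h *s v))) (at \<zeta>)"
        unfolding f_def using has_derivative_compose D(1) by blast
      then show ?thesis
        unfolding has_field_derivative_def D(2) frechet_derivative_eqI[OF D(1)]
        by (rule has_derivative_eq_rhs) (simp add: fun_eq_iff)
    qed
    have "continuous_on (cball 0 \<delta>) f"
      using f' by (auto intro!: continuous_at_imp_continuous_on DERIV_isCont)
    moreover have "f holomorphic_on ball 0 \<delta>"
      unfolding holomorphic_on_def
    proof
      fix \<zeta> :: complex assume "\<zeta> \<in> ball 0 \<delta>"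
      then show "f field_differentiable at \<zeta> within ball 0 \<delta>"
        using has_field_derivative_at_within[OF f'[of \<zeta>]] by (auto simp: field_differentiable_def)
    qed
    moreover have "0 \<in> ball (0::complex) \<delta>" using \<delta> by simp
    ultimately have "(f has_field_derivative (1 / (2 * of_real pi * \<i>) *
        contour_integral (circlepath 0 \<delta>) (\<lambda>u. f u / (u - 0)\<^sup>2))) (at 0)"
      by (rule Cauchy_derivative_integral_circlepath)
    moreover have "(f has_field_derivative frechet_derivative g (at z) v) (at 0)"
      using f'[of 0] \<delta> by simp
    ultimately have "frechet_derivative g (at z) v
        = 1 / (2 * of_real pi * \<i>) * contour_integral (circlepath 0 \<delta>) (\<lambda>u. f u / (u - 0)\<^sup>2)"
      by (rule DERIV_unique[rotated])
    also have "\<dots> = integral {0..1} (\<lambda>t. 1 / (2 * of_real pi * \<i>) *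
        (f (circlepath 0 \<delta> t) / (circlepath 0 \<delta> t)\<^sup>2 * vector_derivative (circlepath 0 \<delta>) (at t)))"
      by (simp only: contour_integral_integral integral_mult_right diff_zero)
    also have "\<dots> = integral {0..1} (\<lambda>t. f (circlepath 0 \<delta> t) / circlepath 0 \<delta> t)"
    proof (rule integral_cong)
      fix t :: real
      have vd: "vector_derivative (circlepath 0 \<delta>) (at t) = 2 * of_real pi * \<i> * circlepath 0 \<delta> t"
        unfolding vector_derivative_circlepath by (simp add: circlepath mult_ac)
      show "1 / (2 * of_real pi * \<i>) * (f (circlepath 0 \<delta> t) / (circlepath 0 \<delta> t)\<^sup>2
          * vector_derivative (circlepath 0 \<delta>) (at t)) = f (circlepath 0 \<delta> t) / circlepath 0 \<delta> t"
        unfolding vd using nz[of t] by (simp add: power2_eq_square)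
    qed
    finally show "frechet_derivative g (at z) v
        = integral {0..1} (\<lambda>t. g (z + circlepath 0 \<delta> t *s v) / circlepath 0 \<delta> t)"
      by (simp add: f_def)
  qed
qed

lemma cdiff_on_continuous_on: "cdiff_on S g \<Longrightarrow> continuous_on S g"
  unfolding cdiff_on_def by (meson continuous_at_imp_continuous_on has_derivative_continuous)

lemma continuous_on_circlepath: "continuous_on T (circlepath z r)"
  unfolding circlepath_def part_circlepath_def by (intro continuous_intros)

lemma circlepath_translate_in_cball:
  assumes "z \<in> ball z0 r" "norm (circlepath 0 \<delta> t *s v) \<le> r"
  shows "z + circlepath 0 \<delta> t *s (v::complex^'n) \<in> cball z0 (2 * r)"
proof -
  let ?a = "circlepath 0 \<delta> t *s v"
  have "dist z0 (z + ?a) \<le> dist z0 z + dist z (z + ?a)" by (rule dist_triangle)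
  also have "dist z (z + ?a) = norm ?a"
    by (simp only: dist_commute[of z] dist_norm[of "z + _"] add_diff_cancel_left')
  finally show ?thesis using assms by simp
qed

text \<open>Continuity of the derivative has to precede its differentiability: the rule for
  differentiating the integral asks for a jointly continuous derivative of the integrand.\<close>

lemma cdiff_on_continuous_frechet:
  fixes g :: "complex^'n \<Rightarrow> complex"
  assumes g: "cdiff_on S g" and S: "open S"
  shows "continuous_on S (\<lambda>z. frechet_derivative g (at z) v)"
proof (rule continuous_at_imp_continuous_on, rule ballI)
  fix z0 assume "z0 \<in> S"
  then obtain \<rho> where \<rho>: "\<rho> > 0" "cball z0 \<rho> \<subseteq> S" using S open_contains_cball by blast
  define r where "r = \<rho> / 2"
  have r: "r > 0" "cball z0 (2 * r) \<subseteq> S" using \<rho> by (auto simp: r_def)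
  obtain \<delta> where \<delta>: "\<delta> > 0" "\<And>t. norm (circlepath 0 \<delta> t *s v) \<le> r"
    "\<And>z. z \<in> ball z0 r \<Longrightarrow>
      frechet_derivative g (at z) v = integral {0..1} (\<lambda>t. g (z + circlepath 0 \<delta> t *s v) / circlepath 0 \<delta> t)"
    using cdiff_on_Cauchy[OF g r(2,1), of v] by blast
  have nz: "circlepath 0 \<delta> t \<noteq> 0" for t using \<delta>(1) by (simp add: circlepath_def part_circlepath_def)
  have "continuous_on (ball z0 r) (\<lambda>z. integral (cbox 0 1) (\<lambda>t. g (z + circlepath 0 \<delta> t *s v) / circlepath 0 \<delta> t))"
  proof (rule integral_continuous_on_param)
    have "continuous_on (ball z0 r \<times> cbox 0 1) (\<lambda>p. circlepath 0 \<delta> (snd p))"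
      by (rule continuous_on_compose2[OF continuous_on_circlepath, of _ snd UNIV]) (auto intro: continuous_intros)
    moreover have "continuous_on (ball z0 r \<times> cbox 0 1) (\<lambda>p. g (fst p + circlepath 0 \<delta> (snd p) *s v))"
    proof (rule continuous_on_compose2[OF cdiff_on_continuous_on[OF g]])
      show "continuous_on (ball z0 r \<times> cbox 0 1) (\<lambda>p. fst p + circlepath 0 \<delta> (snd p) *s v)"
        using bounded_linear.continuous_on[OF bounded_linear_smult_left calculation]
        by (intro continuous_on_add) (auto intro: continuous_intros)
      show "(\<lambda>p. fst p + circlepath 0 \<delta> (snd p) *s v) ` (ball z0 r \<times> cbox 0 1) \<subseteq> S"
        using circlepath_translate_in_cball \<delta>(2) r(2) by fastforce
    qed
    ultimately show "continuous_on (ball z0 r \<times> cbox 0 1)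
        (\<lambda>(z, t). g (z + circlepath 0 \<delta> t *s v) / circlepath 0 \<delta> t)"
      unfolding split_beta using nz by (intro continuous_on_divide) auto
  qed
  then have "continuous_on (ball z0 r) (\<lambda>z. frechet_derivative g (at z) v)"
    by (rule continuous_on_eq) (simp add: \<delta>(3))
  then show "isCont (\<lambda>z. frechet_derivative g (at z) v) z0"
    using r(1) by (simp add: continuous_on_eq_continuous_at)
qed

text \<open>Differentiation under the integral in Cauchy's formula; the result is complex-linear
  because the derivative of the integrand is. Directional derivatives thus inherit
  \<open>cdiff_on\<close>, and smoothness follows by induction.\<close>

lemma cdiff_on_frechet_derivative:
  fixes g :: "complex^'n \<Rightarrow> complex"
  assumes g: "cdiff_on S g" and S: "open S"
  shows "cdiff_on S (\<lambda>z. frechet_derivative g (at z) v)"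
  unfolding cdiff_on_def
proof
  fix z0 assume z0: "z0 \<in> S"
  then obtain \<rho> where \<rho>: "\<rho> > 0" "cball z0 \<rho> \<subseteq> S" using S open_contains_cball by blast
  define r where "r = \<rho> / 2"
  have r: "r > 0" "cball z0 (2 * r) \<subseteq> S" using \<rho> by (auto simp: r_def)
  let ?D = "\<lambda>z. frechet_derivative g (at z)"
  have gD: "(g has_derivative ?D z) (at z)" "?D z (a *s w) = a * ?D z w" if z: "z \<in> S" for z a w
  proof -
    obtain D where D: "(g has_derivative D) (at z)" "\<And>a v. D (a *s v) = a * D v"
      using g z unfolding cdiff_on_def by blast
    then show "(g has_derivative ?D z) (at z)" "?D z (a *s w) = a * ?D z w"
      using frechet_derivative_eqI[OF D(1)] by auto
  qed
  obtain \<delta> where \<delta>: "\<delta> > 0" "\<And>t. norm (circlepath 0 \<delta> t *s v) \<le> r"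
    "\<And>z. z \<in> ball z0 r \<Longrightarrow> ?D z v = integral {0..1} (\<lambda>t. g (z + circlepath 0 \<delta> t *s v) / circlepath 0 \<delta> t)"
    using cdiff_on_Cauchy[OF g r(2,1), of v] by blast
  let ?p = "\<lambda>z t. z + circlepath 0 \<delta> t *s v"
  have nz: "circlepath 0 \<delta> t \<noteq> 0" for t using \<delta>(1) by (simp add: circlepath_def part_circlepath_def)
  have inS: "?p z t \<in> S" if "z \<in> ball z0 r" for z t
    using circlepath_translate_in_cball[OF that \<delta>(2)] r(2) by blast
  have contc: "continuous_on (ball z0 r \<times> cbox 0 1) (\<lambda>p. circlepath 0 \<delta> (snd p))"
    by (rule continuous_on_compose2[OF continuous_on_circlepath, of _ snd UNIV]) (auto intro: continuous_intros)
  have contp: "continuous_on (ball z0 r \<times> cbox 0 1) (\<lambda>p. ?p (fst p) (snd p))"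
    using bounded_linear.continuous_on[OF bounded_linear_smult_left contc]
    by (intro continuous_on_add) (auto intro: continuous_intros)
  have cont: "continuous_on (ball z0 r \<times> cbox 0 1) (\<lambda>p. h (?p (fst p) (snd p)) / circlepath 0 \<delta> (snd p))"
    if "continuous_on S h" for h :: "complex^'n \<Rightarrow> complex"
  proof (intro continuous_on_divide contc)
    show "continuous_on (ball z0 r \<times> cbox 0 1) (\<lambda>p. h (?p (fst p) (snd p)))"
      by (rule continuous_on_compose2[OF that contp]) (use inS in auto)
  qed (use nz in blast)
  define fx where "fx z t = Blinfun (\<lambda>w. ?D (?p z t) w / circlepath 0 \<delta> t)" for z t
  have bl: "bounded_linear (\<lambda>w. ?D (?p z t) w / circlepath 0 \<delta> t)" if "z \<in> ball z0 r" for z t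
    by (intro bounded_linear_compose[OF bounded_linear_divide] has_derivative_bounded_linear[OF gD(1)] inS that)
  have fx: "blinfun_apply (fx z t) w = ?D (?p z t) w / circlepath 0 \<delta> t" if "z \<in> ball z0 r" for z t w
    unfolding fx_def by (simp add: bounded_linear_Blinfun_apply[OF bl[OF that]])
  have contfx: "continuous_on (ball z0 r \<times> cbox 0 1) (\<lambda>(z, t). fx z t)"
  proof (rule continuous_on_blinfun_componentwise)
    fix i :: "complex^'n"
    have "continuous_on (ball z0 r \<times> cbox 0 1) (\<lambda>p. ?D (?p (fst p) (snd p)) i / circlepath 0 \<delta> (snd p))"
      by (rule cont) (rule cdiff_on_continuous_frechet[OF g S])
    then show "continuous_on (ball z0 r \<times> cbox 0 1) (\<lambda>x. (case x of (z, t) \<Rightarrow> fx z t) i)"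
      by (rule continuous_on_eq) (auto simp: fx)
  qed
  have "((\<lambda>z. integral (cbox 0 1) (\<lambda>t. g (?p z t) / circlepath 0 \<delta> t)) has_derivative
      integral (cbox 0 1) (fx z0)) (at z0 within ball z0 r)"
  proof (rule leibniz_rule[OF _ _ contfx])
    fix z assume z: "z \<in> ball z0 r"
    show "((\<lambda>z. g (?p z t) / circlepath 0 \<delta> t) has_derivative blinfun_apply (fx z t)) (at z within ball z0 r)" for t
    proof -
      have "((\<lambda>z. ?p z t) has_derivative (\<lambda>w. w)) (at z within ball z0 r)"
        by (auto intro!: derivative_eq_intros)
      then have "((\<lambda>z. g (?p z t)) has_derivative ?D (?p z t)) (at z within ball z0 r)"
        using has_derivative_compose[of "\<lambda>z. ?p z t" "\<lambda>w. w" z "ball z0 r" g, OF _ gD(1)[OF inS[OF z]]] by simp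
      then show ?thesis
        using fx[OF z] by (auto intro!: has_derivative_eq_rhs[OF bounded_linear.has_derivative[OF bounded_linear_divide]])
    qed
    have "continuous_on (cbox 0 1) (\<lambda>t. g (?p (fst (z, t)) (snd (z, t))) / circlepath 0 \<delta> (snd (z, t)))"
      by (rule continuous_on_compose2[OF cont[OF cdiff_on_continuous_on[OF g]]])
         (use z in \<open>auto intro!: continuous_on_Pair continuous_on_const continuous_on_id\<close>)
    then have "continuous_on (cbox 0 1) (\<lambda>t. g (?p z t) / circlepath 0 \<delta> t)"
      by (simp only: fst_conv snd_conv)
    then show "(\<lambda>t. g (?p z t) / circlepath 0 \<delta> t) integrable_on cbox 0 1" by (rule integrable_continuous)
  qed (use r in auto)
  then have "((\<lambda>z. ?D z v) has_derivative blinfun_apply (integral (cbox 0 1) (fx z0))) (at z0 within ball z0 r)"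
    by (rule has_derivative_transform[rotated 2]) (use \<delta>(3) r(1) in auto)
  then have der: "((\<lambda>z. ?D z v) has_derivative blinfun_apply (integral (cbox 0 1) (fx z0))) (at z0)"
    using r(1) at_within_open[of z0 "ball z0 r"] by simp
  have z0r: "z0 \<in> ball z0 r" using r(1) by simp
  have int: "fx z0 integrable_on cbox 0 1"
  proof (rule integrable_continuous)
    have "continuous_on (cbox 0 1) (\<lambda>t. case (z0, t) of (z, t) \<Rightarrow> fx z t)"
      by (rule continuous_on_compose2[OF contfx])
         (use z0r in \<open>auto intro!: continuous_on_Pair continuous_on_const continuous_on_id\<close>)
    then show "continuous_on (cbox 0 1) (fx z0)" by simp
  qed
  have "blinfun_apply (integral (cbox 0 1) (fx z0)) (a *s w) = a * blinfun_apply (integral (cbox 0 1) (fx z0)) w" for a w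
  proof -
    have ap: "blinfun_apply (integral (cbox 0 1) (fx z0)) w = integral (cbox 0 1) (\<lambda>t. blinfun_apply (fx z0 t) w)" for w
      using integral_linear[OF int blinfun.bounded_linear_left[of w]] by (simp add: o_def)
    show ?thesis unfolding ap by (simp add: fx[OF z0r] gD(2)[OF inS[OF z0r]] flip: integral_mult_right)
  qed
  with der show "\<exists>D. ((\<lambda>z. ?D z v) has_derivative D) (at z0) \<and> (\<forall>a v. D (a *s v) = a * D v)" by blast
qed

lemma cdiff_on_smooth:
  assumes "open S" "cdiff_on S g"
  shows "smooth_on S g"
proof -
  have "Ck_on k S g" for k
    using assms(2)
  proof (induction k arbitrary: g)
    case 0 then show ?case by (simp add: cdiff_on_continuous_on)
  next
    case (Suc k)
    then show ?case
      using cdiff_on_frechet_derivative[OF Suc.prems assms(1)]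
      by (auto simp: differentiable_def cdiff_on_def)
  qed
  then show ?thesis by (simp add: smooth_on_def)
qed

lemma holomorphic_map_on_smooth:
  fixes f :: "complex^'n \<Rightarrow> complex^'n"
  assumes S: "open S" and f: "holomorphic_map_on S f"
  shows "smooth_on S f"
proof -
  have "cdiff_on S (\<lambda>z. f z $ i)" for i
    unfolding cdiff_on_def
  proof
    fix z assume "z \<in> S"
    then obtain D where D: "(f has_derivative D) (at z)" "\<And>a v. D (a *s v) = a *s D v"
      using f unfolding holomorphic_map_on_def by blast
    have "((\<lambda>z. f z $ i) has_derivative (\<lambda>v. D v $ i)) (at z)"
      by (rule bounded_linear.has_derivative[OF bounded_linear_vec_nth D(1)])
    then show "\<exists>D. ((\<lambda>z. f z $ i) has_derivative D) (at z) \<and> (\<forall>a v. D (a *s v) = a * D v)"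
      using D(2) by (intro exI[of _ "\<lambda>v. D v $ i"]) auto
  qed
  then have "smooth_on S (\<lambda>z. \<chi> i. f z $ i)"
    by (intro smooth_on_vec_lambda cdiff_on_smooth S)
  then show ?thesis by (simp add: vec_nth_inverse)
qed

section \<open>Algebra of the structure equations\<close>

text \<open>The curvature of \<phi>: the part of \<open>d\<phi>\<close> other than
  \<open>- \<phi> \<and> \<phi>\<close>, evaluated on two vectors whose \<omega>-values are
  \<open>v\<close> and \<open>w\<close>.\<close>

definition rho :: "complex^'n^'n \<Rightarrow> complex^'n \<Rightarrow> complex^'n \<Rightarrow> complex^'n^'n" where
  "rho H v w = (let s = herm v w - herm w v; Q = outer v w - outer w v;
      h = herm v (H *v w) - herm w (H *v v)
    in H ** mat s - H ** Q - Q ** H + mat h + mat (trace H) ** (mat s - Q))"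

text \<open>The structure equations for \<open>H\<close>, \<open>T\<close>, \<open>V\<close> say that \<open>dH\<close>, \<open>dT\<close>, \<open>dV\<close> are the following
  expressions at \<open>(\<omega>, \<phi>)\<close>; at \<open>(a, b)\<close> they are the Lie derivatives along the field with \<open>\<omega> = a\<close>, \<open>\<phi> = b\<close>.\<close>

definition kapH :: "complex^'n^'n \<Rightarrow> complex^'n \<Rightarrow> complex^'n \<Rightarrow> complex^'n^'n \<Rightarrow> complex^'n^'n" where
  "kapH H T a b = - (b ** H) + H ** b + outer T a + outer a T"

definition kapT :: "complex^'n^'n \<Rightarrow> complex^'n \<Rightarrow> real \<Rightarrow> complex^'n \<Rightarrow> complex^'n^'n \<Rightarrow> complex^'n" where
  "kapT H T V a b = - (b *v T) + (H ** H + mat (trace H) ** H + mat (complex_of_real V)) *v a"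

definition kapV :: "complex^'n^'n \<Rightarrow> complex^'n \<Rightarrow> complex^'n \<Rightarrow> complex" where
  "kapV H T a = trace H * (herm T a + herm a T) + (herm T (H *v a) + herm a (H *v T))"

lemma herm_add_left: "herm (u + v) w = herm u w + herm v w"
  and herm_add_right: "herm w (u + v) = herm w u + herm w v"
  and herm_diff_left: "herm (u - v) w = herm u w - herm v w"
  and herm_diff_right: "herm w (u - v) = herm w u - herm w v"
  and herm_minus_left: "herm (- u) w = - herm u w"
  and herm_minus_right: "herm w (- u) = - herm w u"
  and herm_smult_left: "herm (c *s u) w = cnj c * herm u w"
  and herm_smult_right: "herm w (c *s u) = c * herm w u"
  and herm_zero_left: "herm 0 w = 0"
  and herm_zero_right: "herm w 0 = 0"
  by (auto simp: herm_def algebra_simps sum.distrib sum_subtractf sum_negf sum_distrib_left)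

lemma cnj_herm: "cnj (herm u v) = herm v u"
  by (simp add: herm_def mult.commute)

lemma outer_mult_vec: "outer a b *v u = herm b u *s a"
  by (simp add: outer_def herm_def matrix_vector_mult_def vec_eq_iff sum_distrib_left
      sum_distrib_right mult_ac)

lemma mat_mult_vec: "mat c *v u = c *s (u :: complex^'n)"
  by (simp add: mat_def matrix_vector_mult_def vec_eq_iff if_distrib[of "\<lambda>x. x * _"] cong: if_cong)

lemma uminus_matrix_mult_vec: "(- A) *v u = - (A *v (u :: complex^'n))" for A :: "complex^'n^'n"
  by (simp add: matrix_vector_mult_def vec_eq_iff sum_negf)

lemma matrix_vec_uminus: "A *v (- u) = - (A *v (u :: complex^'n))" for A :: "complex^'n^'n"
  by (simp add: matrix_vector_mult_def vec_eq_iff sum_negf)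

lemma trace_outer: "trace (outer a b) = herm b a"
  by (simp add: trace_def outer_def herm_def mult.commute)

lemma trace_uminus: "trace (- A) = - trace (A :: complex^'n^'n)"
  by (simp add: trace_def sum_negf)

lemma herm_matrix_left: "herm (A *v u) v = herm u (conj_transpose A *v v)"
proof -
  have "herm (A *v u) v = (\<Sum>i\<in>UNIV. \<Sum>j\<in>UNIV. cnj (A $ i $ j) * cnj (u $ j) * v $ i)"
    by (simp add: herm_def matrix_vector_mult_def sum_distrib_right)
  also have "\<dots> = (\<Sum>j\<in>UNIV. \<Sum>i\<in>UNIV. cnj (A $ i $ j) * cnj (u $ j) * v $ i)"
    by (rule sum.swap)
  also have "\<dots> = herm u (conj_transpose A *v v)"
    by (simp add: herm_def matrix_vector_mult_def conj_transpose_def sum_distrib_left mult_ac)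
  finally show ?thesis .
qed

lemma herm_hermitian: "conj_transpose A = A \<Longrightarrow> herm (A *v u) v = herm u (A *v v)"
  by (simp add: herm_matrix_left)

lemma herm_skew: "conj_transpose A = - A \<Longrightarrow> herm (A *v u) v = - herm u (A *v v)"
  by (simp add: herm_matrix_left uminus_matrix_mult_vec herm_minus_right)

lemma cnj_trace: "conj_transpose H = H \<Longrightarrow> cnj (trace H) = trace H"
proof -
  assume "conj_transpose H = H"
  then have "cnj (H $ i $ i) = H $ i $ i" for i by (metis (no_types) conj_transpose_def vec_lambda_beta)
  then show ?thesis by (simp add: trace_def)
qed

lemma herm_eq_0_imp: "(\<And>u. herm u x = 0) \<Longrightarrow> x = 0"
proof -
  assume *: "\<And>u. herm u x = 0"
  have "herm (axis i 1) x = x $ i" for i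
    by (simp add: herm_def axis_def if_distrib[of cnj] if_distrib[of "\<lambda>c. c * _"] cong: if_cong)
  then show ?thesis using * by (simp add: vec_eq_iff)
qed

lemma matrix_eq_complex: "(\<And>u. A *v u = B *v u) \<Longrightarrow> A = (B :: complex^'n^'n)"
  by (simp add: matrix_eq)


lemma conj_transpose_eqI:
  fixes A B :: "complex^'n^'n"
  assumes "\<And>u v. herm (A *v u) v = herm u (B *v v)"
  shows "conj_transpose A = B"
proof (rule matrix_eq_complex)
  fix v
  have "herm u (conj_transpose A *v v - B *v v) = 0" for u
    using assms[of u v] by (simp add: herm_diff_right herm_matrix_left)
  then have "conj_transpose A *v v - B *v v = 0" by (rule herm_eq_0_imp)
  then show "conj_transpose A *v v = B *v v" by simp
qed

lemmas vec_expand = matrix_vector_mult_add_rdistrib matrix_vector_mult_diff_rdistrib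
  matrix_vector_mul_assoc[symmetric] uminus_matrix_mult_vec matrix_vec_uminus
  matrix_vector_right_distrib matrix_vector_mult_diff_distrib vector_scalar_commute
  outer_mult_vec mat_mult_vec

lemmas herm_expand = herm_add_left herm_add_right herm_diff_left herm_diff_right herm_minus_left
  herm_minus_right herm_smult_left herm_smult_right herm_zero_left herm_zero_right

lemmas trace_expand = trace_add trace_sub trace_uminus trace_outer

text \<open>Matrix identities are proved by applying both sides to a vector. The
  \<open>outer\<close> products then turn into scalars times vectors, and what is left is
  commutative algebra in the components.\<close>

lemma rho_mult_vec: "rho H v w *v u =
   (herm v w - herm w v) *s (H *v u) - (herm w u *s (H *v v) - herm v u *s (H *v w))
   - (herm w (H *v u) *s v - herm v (H *v u) *s w) + (herm v (H *v w) - herm w (H *v v)) *s u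
   + trace H *s ((herm v w - herm w v) *s u - (herm w u *s v - herm v u *s w))"
  by (simp add: rho_def Let_def vec_expand vec_eq_iff; simp add: algebra_simps)

lemma rho_skew:
  assumes "conj_transpose H = H"
  shows "conj_transpose (rho H v w) = - rho H v w"
  by (rule conj_transpose_eqI)
     (simp add: rho_mult_vec uminus_matrix_mult_vec herm_expand herm_hermitian[OF assms] cnj_trace[OF assms]
      cnj_herm; simp add: algebra_simps)

lemma rho_Bianchi: "conj_transpose H = H \<Longrightarrow> rho H x y *v a + rho H y a *v x + rho H a x *v y = 0"
  by (simp add: rho_mult_vec herm_hermitian vec_eq_iff; simp add: algebra_simps)

lemma rho_add: "rho (H + H') v w = rho H v w + rho H' v w"
  by (rule matrix_eq_complex) (simp add: rho_mult_vec vec_expand herm_expand trace_expand vec_eq_iff; simp add: algebra_simps)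

text \<open>The curvature determines \<open>H\<close> in every dimension. Testing on
  \<open>v\<close> and \<open>\<i> *s v\<close>, a holomorphic sectional curvature, gives
  \<open>2 * herm v (H *v v) + trace H * herm v v = 0\<close> for nonzero \<open>v\<close>. Summing
  over the standard basis yields (2 + n) times the trace equal to 0, and then polarisation makes
  \<open>H\<close> vanish.\<close>

lemma rho_zero_imp:
  assumes H: "conj_transpose H = H" and 0: "\<And>x y. rho H x y = 0"
  shows "H = (0 :: complex^'n^'n)"
proof -
  have vHv: "herm v v * (2 * herm v (H *v v) + trace H * herm v v) = 0" for v
  proof -
    have "herm v (rho H v (\<i> *s v) *v v)
        = 4 * \<i> * (herm v v * (2 * herm v (H *v v) + trace H * herm v v))"
      unfolding rho_mult_vec by (simp add: herm_expand vector_scalar_commute; simp add: algebra_simps)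
    then show ?thesis by (simp add: 0 herm_zero_right)
  qed
  have ax: "herm (axis i 1) x = x $ i" for i :: 'n and x :: "complex^'n"
    by (simp add: herm_def axis_def if_distrib[of cnj] if_distrib[of "\<lambda>c. c * _"] cong: if_cong)
  have diag: "2 * H $ i $ i + trace H = 0" for i
  proof -
    have "(H *v axis i 1) $ i = H $ i $ i"
      by (simp add: matrix_vector_mult_def axis_def if_distrib[of "\<lambda>c. _ * c"] cong: if_cong)
    then show ?thesis using vHv[of "axis i 1"] by (simp add: ax)
  qed
  have "2 * trace H + of_nat CARD('n) * trace H = (\<Sum>i\<in>UNIV. 2 * H $ i $ i + trace H)"
    by (simp add: trace_def sum.distrib sum_distrib_left)
  also have "\<dots> = 0" by (simp add: diag)
  finally have "of_nat (2 + CARD('n)) * trace H = 0" by (simp add: algebra_simps)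
  then have tr: "trace H = 0" unfolding mult_eq_0_iff of_nat_eq_0_iff by simp
  have vHv0: "herm v (H *v v) = 0" for v
  proof (cases "v = 0")
    case False
    have "herm v v \<noteq> 0"
    proof
      assume "herm v v = 0"
      moreover have "cnj z * z = complex_of_real ((cmod z)\<^sup>2)" for z
        by (metis complex_norm_square mult.commute)
      then have "herm v v = complex_of_real (\<Sum>i\<in>UNIV. (cmod (v $ i))\<^sup>2)"
        unfolding herm_def of_real_sum by (rule sum.cong[OF refl])
      ultimately have "(\<Sum>i\<in>UNIV. (cmod (v $ i))\<^sup>2) = 0" by (metis of_real_eq_0_iff)
      then have "v = 0" by (simp add: sum_nonneg_eq_0_iff vec_eq_iff)
      then show False using False by simp
    qed
    then show ?thesis using vHv[of v] tr by simp
  qed (simp add: herm_zero_left)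
  have "herm u (H *v v) = 0" for u v
  proof -
    have 1: "herm u (H *v v) + herm v (H *v u) = 0"
      using vHv0[of "u + v"] by (simp add: vHv0 vec_expand herm_expand add.commute)
    have "\<i> * herm u (H *v v) - \<i> * herm v (H *v u) = 0"
      using vHv0[of "u + \<i> *s v"] by (simp add: vHv0 vec_expand herm_expand vector_scalar_commute)
    then have "herm u (H *v v) - herm v (H *v u) = 0" by (simp flip: right_diff_distrib)
    then show ?thesis using 1 by simp
  qed
  then show ?thesis by (intro matrix_eq_complex) (simp add: herm_eq_0_imp)
qed

text \<open>For \<open>w = k\<close> the diagonal entries are twice the squared moduli of the
  components of \<open>k\<close>.\<close>

lemma outer_sym_zero_imp:
  assumes "\<And>w. outer k w + outer w k = 0"
  shows "k = 0"
proof -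
  have "outer k k $ i $ i + outer k k $ i $ i = 0" for i
    using assms[of k] by (metis vector_add_component zero_index)
  then show ?thesis by (simp add: outer_def vec_eq_iff flip: mult_2)
qed

text \<open>The first prolongation of u(n) is zero. When \<open>x\<close> is replaced by
  \<open>\<i> *s x\<close>, the pairing \<open>herm (c x *v y) z\<close> is multiplied by
  \<open>cnj \<i>\<close> because of the symmetry, and by \<i> because of the skewness. This will
  force the derivative of \<open>b\<close>.\<close>

lemma skew_symmetric_zero:
  assumes skew: "\<And>x. conj_transpose (c x) = - c x"
    and sym: "\<And>x y. c x *v y = c y *v (x :: complex^'n)"
  shows "c x = 0"
proof -
  have "herm (c x *v y) z = 0" for x y z
  proof -
    have A: "herm (c x *v y) z = - herm y (c z *v x)" for x
      using herm_skew[OF skew, of x y z] sym[of x z] by simp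
    have "herm (c (\<i> *s x) *v y) z = cnj \<i> * herm (c x *v y) z"
      by (simp add: sym[of "\<i> *s x" y] sym[of x y] vector_scalar_commute herm_expand)
    moreover have "herm (c (\<i> *s x) *v y) z = \<i> * herm (c x *v y) z"
      by (simp add: A vector_scalar_commute herm_expand)
    ultimately show ?thesis by simp
  qed
  then have "herm z (c x *v y) = 0" for y z by (metis cnj_herm complex_cnj_zero)
  then show ?thesis by (intro matrix_eq_complex) (simp add: herm_eq_0_imp)
qed

context
  fixes H p b :: "complex^'n^'n" and T x a :: "complex^'n" and V :: real
  assumes H: "conj_transpose H = H" and p: "conj_transpose p = - p" and b: "conj_transpose b = - b"
begin

private lemmas rules = rho_mult_vec vec_expand herm_expand trace_expand herm_hermitian[OF H]
  herm_skew[OF p] herm_skew[OF b] cnj_herm cnj_trace[OF H] kapH_def kapT_def kapV_def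

text \<open>Here \<open>x\<close> and \<open>p\<close> are the values of \<omega> and \<phi> on a
  direction, and primes denote the derivatives prescribed by the linear system and the structure
  equations. In this and the next two lemmas the result is homogeneous linear in
  \<open>kapH\<close>, \<open>kapT\<close>, \<open>kapV\<close>, and this makes their common kernel
  parallel.\<close>

lemma kapH_derivative:
  fixes a' b' H' T'
  defines "a' \<equiv> b *v x - p *v a" and "b' \<equiv> b ** p - p ** b - rho H a x"
    and "H' \<equiv> kapH H T x p" and "T' \<equiv> kapT H T V x p"
  shows "- (b' ** H) - b ** H' + H' ** b + H ** b' + outer T' a + outer T a' + outer a' T + outer a T'
     = - (p ** kapH H T a b) + kapH H T a b ** p + outer (kapT H T V a b) x + outer x (kapT H T V a b)"
  unfolding a'_def b'_def H'_def T'_def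
  by (rule matrix_eq_complex) (simp add: rules vec_eq_iff; simp add: algebra_simps)

lemma kapT_derivative:
  fixes a' b' H' T'
  defines "a' \<equiv> b *v x - p *v a" and "b' \<equiv> b ** p - p ** b - rho H a x"
    and "H' \<equiv> kapH H T x p" and "T' \<equiv> kapT H T V x p" and "V' \<equiv> kapV H T x"
  shows "- (b' *v T) - b *v T' + (H' ** H + H ** H' + mat (trace H') ** H + mat (trace H) ** H' + mat V') *v a
      + (H ** H + mat (trace H) ** H + mat (complex_of_real V)) *v a'
     = - (p *v kapT H T V a b) + (kapH H T a b ** H + H ** kapH H T a b + mat (trace (kapH H T a b)) ** H
      + mat (trace H) ** kapH H T a b + mat (kapV H T a)) *v x"
proof -
  have "trace (b ** H) = trace (H ** b)" "trace (p ** H) = trace (H ** p)" by (rule trace_mul_sym)+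
  then show ?thesis
    unfolding a'_def b'_def H'_def T'_def V'_def
    by (simp add: rules vec_eq_iff; simp add: algebra_simps)
qed

lemma kapV_derivative:
  fixes a' b' H' T'
  defines "a' \<equiv> b *v x - p *v a"
    and "H' \<equiv> kapH H T x p" and "T' \<equiv> kapT H T V x p"
  shows "trace H' * (herm T a + herm a T) + trace H * (herm T' a + herm T a' + herm a' T + herm a T')
     + (herm T' (H *v a) + herm T (H' *v a) + herm T (H *v a')
      + herm a' (H *v T) + herm a (H' *v T) + herm a (H *v T'))
    = trace (kapH H T a b) * (herm T x + herm x T)
     + trace H * (herm (kapT H T V a b) x + herm x (kapT H T V a b))
     + (herm (kapT H T V a b) (H *v x) + herm T (kapH H T a b *v x)
      + herm x (kapH H T a b *v T) + herm x (H *v kapT H T V a b))"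
proof -
  have "trace (b ** H) = trace (H ** b)" "trace (p ** H) = trace (H ** p)" by (rule trace_mul_sym)+
  then show ?thesis
    unfolding a'_def H'_def T'_def
    by (simp add: rules; simp add: algebra_simps)
qed

end

text \<open>The curvature of the linear system
  \<open>da = b \<omega> - \<phi> a\<close>, \<open>db = b \<phi> - \<phi> b - \<rho>(a, \<omega>)\<close> in the directions with \<open>(\<omega>, \<phi>) = (x, p), (y, q)\<close>.\<close>

lemma curvature_first:
  fixes a x y :: "complex^'n"
  assumes H: "conj_transpose H = H"
  defines "A \<equiv> \<lambda>(x, p) (a, b). (b *v x - p *v a, b ** p - p ** b - rho H a x)"
  shows "b *v (- (q *v x - p *v y)) - (- (q ** p - p ** q) + rho H y x) *v a
     + fst (A (x, p) (A (y, q) (a, b))) - fst (A (y, q) (A (x, p) (a, b))) = 0"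
proof -
  have "rho H x y *v a = - rho H y x *v a" by (simp add: rho_mult_vec vec_expand vec_eq_iff algebra_simps)
  then show ?thesis
    using rho_Bianchi[OF H, of x y a]
    unfolding A_def by (simp add: vec_expand rho_mult_vec vec_eq_iff; simp add: algebra_simps)
qed

text \<open>The curvature is \<open>rho\<close> formed with the Lie derivative \<open>kapH\<close>
  of \<open>H\<close>, so by \<open>rho_zero_imp\<close> it vanishes in all directions exactly at
  the pairs with \<open>kapH = 0\<close>.\<close>

lemma curvature_second:
  fixes a x y :: "complex^'n"
  assumes H: "conj_transpose H = H" and p: "conj_transpose p = - p" and q: "conj_transpose q = - q"
    and b: "conj_transpose b = - b"
  defines "A \<equiv> \<lambda>(x, p) (a, b). (b *v x - p *v a, b ** p - p ** b - rho H a x)"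
  defines "P \<equiv> - (q ** p - p ** q) + rho H y x"
  shows "b ** P - P ** b - rho (kapH H T y q) a x + rho (kapH H T x p) a y - rho H a (- (q *v x - p *v y))
     + snd (A (x, p) (A (y, q) (a, b))) - snd (A (y, q) (A (x, p) (a, b))) = - rho (kapH H T a b) y x"
proof (rule matrix_eq_complex)
  have "trace (b ** H) = trace (H ** b)" "trace (p ** H) = trace (H ** p)" "trace (q ** H) = trace (H ** q)"
    by (rule trace_mul_sym)+
  then show "(b ** P - P ** b - rho (kapH H T y q) a x + rho (kapH H T x p) a y - rho H a (- (q *v x - p *v y))
     + snd (A (x, p) (A (y, q) (a, b))) - snd (A (y, q) (A (x, p) (a, b)))) *v u = (- rho (kapH H T a b) y x) *v u" for u
    unfolding A_def P_def
    by (simp add: rho_mult_vec vec_expand herm_expand trace_expand herm_hermitian[OF H] herm_skew[OF p]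
        herm_skew[OF q] herm_skew[OF b] cnj_herm cnj_trace[OF H] kapH_def vec_eq_iff; simp add: algebra_simps)
qed

section \<open>The kernel of the structure map\<close>

lemma inner_eq_Re_herm: "v \<bullet> w = Re (herm v (w :: complex^'n))"
  by (simp add: inner_vec_def herm_def inner_complex_def)

lemma linear_matrix_vec: "linear (\<lambda>x. H *v x)" for H :: "complex^'n^'n"
  by (rule linearI)
     (simp_all add: matrix_vector_right_distrib vector_scalar_commute flip: smult_conv_scaleR)

lemma sum_matrix_mult_vec: "(\<Sum>i\<in>I. F i) *v u = (\<Sum>i\<in>I. F i *v u)"
  for F :: "'i \<Rightarrow> complex^'n^'n"
  by (induction I rule: infinite_finite_induct) (auto simp: matrix_vector_mult_add_rdistrib)

lemma scaleR_matrix_mult_vec: "(r *\<^sub>R A) *v u = complex_of_real r *s (A *v u)" for A :: "complex^'n^'n"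
  by (simp add: matrix_vector_mult_def vec_eq_iff sum_distrib_left scaleR_conv_of_real[where 'a = complex] mult.assoc)

lemma herm_self: "herm v v = complex_of_real ((norm v)\<^sup>2)"
proof -
  have "Im (herm v v) = 0" using cnj_herm[of v v] by (metis complex_cnj_cancel_iff complex_In_mult_cnj_zero cnj.simps(2) equal_neg_zero)
  moreover have "Re (herm v v) = (norm v)\<^sup>2" using inner_eq_Re_herm[of v v] by (simp add: dot_square_norm)
  ultimately show ?thesis by (simp add: complex_eq_iff)
qed

text \<open>First-variation principle: for small \<open>t\<close> of the same sign as
  \<open>a\<close> the linear term would exceed the quadratic one.\<close>

lemma quadratic_nonneg_imp_zero:
  fixes a c :: real
  assumes "\<And>t. 2 * t * a \<le> t\<^sup>2 * c"
  shows "a = 0"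
proof (rule ccontr)
  assume a: "a \<noteq> 0"
  define k where "k = \<bar>c\<bar> + 1"
  have k: "k > 0" "c < k" by (auto simp: k_def add_nonneg_pos intro: le_less_trans[OF abs_ge_self])
  have "2 * (a / k) * a \<le> (a / k)\<^sup>2 * c" by (rule assms)
  also have "\<dots> \<le> (a / k)\<^sup>2 * k" using k by (intro mult_left_mono) auto
  also have "\<dots> = a\<^sup>2 / k" using k by (simp add: power2_eq_square)
  finally have "2 * (a\<^sup>2 / k) \<le> a\<^sup>2 / k" by (simp add: power2_eq_square)
  moreover have "a\<^sup>2 / k > 0" using a k by simp
  ultimately show False by linarith
qed

text \<open>Maximise the Rayleigh quotient over the unit sphere of the invariant subspace
  \<open>W\<close>. The residual \<open>H *v v - l *\<^sub>R v\<close> lies in \<open>W\<close>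
  again, and the first variation in its direction shows that it is 0.\<close>

lemma hermitian_eigenvector_on:
  fixes H :: "complex^'n^'n"
  assumes H: "conj_transpose H = H"
    and W: "closed W" "\<And>x y. \<lbrakk>x \<in> W; y \<in> W\<rbrakk> \<Longrightarrow> x + y \<in> W" "\<And>c x. x \<in> W \<Longrightarrow> c *s x \<in> W"
      "\<And>x. x \<in> W \<Longrightarrow> H *v x \<in> W" "x0 \<in> W" "x0 \<noteq> 0"
  obtains v l where "v \<in> W" "norm v = 1" "H *v v = complex_of_real l *s v"
proof -
  let ?f = "\<lambda>x. x \<bullet> (H *v x)"
  note lin = linear_matrix_vec
  have scale: "r *\<^sub>R x \<in> W" if "x \<in> W" for r x using W(3)[OF that, of "of_real r"] by (simp add: smult_conv_scaleR)
  have "compact (W \<inter> sphere 0 1)" using W(1) by (simp add: closed_Int_compact)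
  moreover have "(1 / norm x0) *\<^sub>R x0 \<in> W \<inter> sphere 0 1" using W(5,6) scale by auto
  moreover have "continuous_on (W \<inter> sphere 0 1) ?f"
    by (intro continuous_intros linear_continuous_on) (simp add: lin flip: linear_conv_bounded_linear)
  ultimately obtain v where v: "v \<in> W" "norm v = 1"
    and max: "\<And>x. \<lbrakk>x \<in> W; norm x = 1\<rbrakk> \<Longrightarrow> ?f x \<le> ?f v"
    using continuous_attains_sup[of "W \<inter> sphere 0 1" ?f] by force
  define l where "l = ?f v"
  have sym: "(H *v x) \<bullet> y = x \<bullet> (H *v y)" for x y
    by (simp add: inner_eq_Re_herm herm_hermitian[OF H])
  have le: "?f x \<le> l * (x \<bullet> x)" if "x \<in> W" for x
  proof (cases "x = 0")
    case False
    have "?f ((1 / norm x) *\<^sub>R x) \<le> l"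
      unfolding l_def using False that by (intro max scale) auto
    then have "?f x / (norm x)\<^sup>2 \<le> l"
      by (simp add: linear_cmul[OF lin] power2_eq_square divide_divide_eq_left)
    then show ?thesis using False by (simp add: pos_divide_le_eq dot_square_norm)
  qed (simp add: linear_0[OF lin])
  define w where "w = H *v v - l *\<^sub>R v"
  have wW: "w \<in> W" using W(2)[OF W(4)[OF v(1)] scale[OF v(1), of "- l"]] by (simp add: w_def)
  have "w \<bullet> w = 0"
  proof (rule quadratic_nonneg_imp_zero)
    fix t :: real
    have "?f (v + t *\<^sub>R w) \<le> l * ((v + t *\<^sub>R w) \<bullet> (v + t *\<^sub>R w))"
      by (rule le) (intro W(2) v(1) scale wW)
    moreover have "?f (v + t *\<^sub>R w) = l + 2 * t * (w \<bullet> (H *v v)) + t\<^sup>2 * ?f w"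
      using sym[of v w] by (simp add: l_def linear_add[OF lin] linear_cmul[OF lin] inner_add_left inner_add_right
          power2_eq_square inner_commute[of "H *v v"] distrib_left)
    moreover have "l * ((v + t *\<^sub>R w) \<bullet> (v + t *\<^sub>R w)) = l + 2 * t * (w \<bullet> (l *\<^sub>R v)) + t\<^sup>2 * (l * (w \<bullet> w))"
      using v(2) by (simp add: inner_add_left inner_add_right power2_eq_square inner_commute[of v w]
          norm_eq_1 algebra_simps)
    ultimately have "2 * t * (w \<bullet> (H *v v)) - 2 * t * (w \<bullet> (l *\<^sub>R v)) \<le> t\<^sup>2 * (l * (w \<bullet> w)) - t\<^sup>2 * ?f w"
      by linarith
    then show "2 * t * (w \<bullet> w) \<le> t\<^sup>2 * (l * (w \<bullet> w) - ?f w)"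
      by (simp add: w_def inner_diff_right right_diff_distrib)
  qed
  then have "H *v v = of_real l *s v" by (simp add: w_def smult_conv_scaleR)
  then show ?thesis using that v by blast
qed

text \<open>Relative to a set \<open>I\<close> of indices, so that a basis can be built one vector
  at a time; for \<open>I = UNIV\<close> it is a unitary eigenbasis.\<close>

definition eigenbasis :: "complex^'n^'n \<Rightarrow> 'n set \<Rightarrow> ('n \<Rightarrow> complex^'n) \<Rightarrow> ('n \<Rightarrow> real) \<Rightarrow> bool"
  where "eigenbasis H I e l \<longleftrightarrow> (\<forall>i\<in>I. \<forall>j\<in>I. herm (e i) (e j) = (if i = j then 1 else 0)) \<and>
     (\<forall>i\<in>I. H *v e i = complex_of_real (l i) *s e i)"

lemma herm_sum_right: "herm u (\<Sum>i\<in>I. f i) = (\<Sum>i\<in>I. herm u (f i))"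
  by (induction I rule: infinite_finite_induct) (auto simp: herm_expand)

text \<open>The spectral theorem by induction on \<open>I\<close>. The orthogonal complement of the
  vectors found so far is invariant under \<open>H\<close>, and it is nonzero because fewer than n
  vectors cannot span.\<close>

lemma eigenbasis_exists:
  fixes H :: "complex^'n^'n"
  assumes H: "conj_transpose H = H"
  shows "\<exists>e l. eigenbasis H UNIV e l"
proof -
  have "\<exists>e l. eigenbasis H I e l" for I
    using finite[of I]
  proof (induction I)
    case empty then show ?case by (simp add: eigenbasis_def)
  next
    case (insert k I)
    then obtain e l where e: "eigenbasis H I e l" by blast
    have e1: "herm (e i) (e j) = (if i = j then 1 else 0)" if "i \<in> I" "j \<in> I" for i j
      using e that by (simp add: eigenbasis_def)
    have e2: "H *v e i = complex_of_real (l i) *s e i" if "i \<in> I" for i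
      using e that by (simp add: eigenbasis_def)
    define W where "W = {x. \<forall>i\<in>I. herm (e i) x = 0}"
    have "\<exists>x0\<in>W. x0 \<noteq> 0"
    proof (rule ccontr)
      assume no: "\<not> (\<exists>x0\<in>W. x0 \<noteq> 0)"
      have "x \<in> vec.span (e ` I)" for x
      proof -
        let ?p = "\<Sum>i\<in>I. herm (e i) x *s e i"
        have "herm (e j) ?p = herm (e j) x" if "j \<in> I" for j
        proof -
          have "herm (e j) ?p = (\<Sum>i\<in>I. if j = i then herm (e i) x else 0)"
            unfolding herm_sum_right using e1[OF that] by (intro sum.cong) (auto simp: herm_expand)
          then show ?thesis using that insert.hyps(1) by simp
        qed
        then have "x - ?p \<in> W" by (simp add: W_def herm_expand)
        then have "x = ?p" using no by auto
        moreover have "?p \<in> vec.span (e ` I)"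
          by (intro vec.span_sum vec.span_scale vec.span_base) auto
        ultimately show ?thesis by metis
      qed
      then have "vec.dim (UNIV :: (complex^'n) set) \<le> card (e ` I)"
        by (intro vec.dim_le_card) (use insert.hyps in auto)
      then have "CARD('n) \<le> card I"
        using card_image_le[OF insert.hyps(1), of e] by (simp add: vec_dim_card card_cart_basis)
      moreover have "card I < CARD('n)" using insert.hyps(2) by (intro psubset_card_mono) auto
      ultimately show False by simp
    qed
    then obtain x0 where x0: "x0 \<in> W" "x0 \<noteq> 0" by blast
    have lin: "bounded_linear (herm u)" for u :: "complex^'n"
      unfolding linear_conv_bounded_linear[symmetric]
      by (rule linearI) (auto simp: herm_expand herm_smult_right simp flip: smult_conv_scaleR scaleR_conv_of_real)
    have "W = (\<Inter>i\<in>I. herm (e i) -` {0})" by (auto simp: W_def)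
    moreover have "closed (herm (e i) -` {0})" for i
      by (rule closed_vimage[OF closed_singleton linear_continuous_on[OF lin]])
    ultimately have cl: "closed W" by (auto intro!: closed_INT)
    obtain v m where v: "v \<in> W" "norm v = 1" "H *v v = complex_of_real m *s v"
    proof (rule hermitian_eigenvector_on[OF H cl _ _ _ x0])
      fix x assume "x \<in> W"
      then show "H *v x \<in> W"
        unfolding W_def by (auto simp: herm_hermitian[OF H, symmetric] e2 herm_expand)
    qed (auto simp: W_def herm_expand)
    have v0: "herm (e i) v = 0" "herm v (e i) = 0" if "i \<in> I" for i
      using v(1) that cnj_herm[of "e i" v] by (auto simp: W_def)
    have vv: "herm v v = 1" using v(2) by (simp add: herm_self)
    have "eigenbasis H (insert k I) (e(k := v)) (l(k := m))"
      using e1 e2 v(3) v0 insert.hyps(2) vv unfolding eigenbasis_def by auto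
    then show ?case by blast
  qed
  then show ?thesis by blast
qed

lemma eigenbasis_expand:
  fixes H :: "complex^'n^'n"
  assumes "eigenbasis H UNIV e l"
  shows "x = (\<Sum>j\<in>UNIV. herm (e j) x *s e j)"
proof -
  define P :: "complex^'n^'n" where "P = (\<chi> i j. e j $ i)"
  have "conj_transpose P ** P = mat 1"
    using assms unfolding eigenbasis_def
    by (simp add: P_def conj_transpose_def matrix_matrix_mult_def mat_def vec_eq_iff herm_def)
  then have "P ** conj_transpose P = mat 1" using matrix_left_right_inverse by blast
  then have "x = P *v (conj_transpose P *v x)" by (simp add: matrix_vector_mul_assoc)
  also have "\<dots> = (\<Sum>j\<in>UNIV. herm (e j) x *s e j)"
    by (simp add: P_def conj_transpose_def matrix_vector_mult_def vec_eq_iff herm_def mult.commute)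
  finally show ?thesis .
qed

lemma eigenbasis_matrix_eqI:
  fixes H A B :: "complex^'n^'n"
  assumes "eigenbasis H UNIV e l" "\<And>j k. herm (e j) (A *v e k) = herm (e j) (B *v e k)"
  shows "A = B"
proof (rule matrix_eq_complex)
  have e: "A *v e k = B *v e k" for k
    using eigenbasis_expand[OF assms(1), of "A *v e k"] eigenbasis_expand[OF assms(1), of "B *v e k"] assms(2)
    by simp
  fix u
  have "A *v (\<Sum>j\<in>UNIV. herm (e j) u *s e j) = B *v (\<Sum>j\<in>UNIV. herm (e j) u *s e j)"
    by (simp add: vec.linear_sum[OF matrix_vector_mul_linear_gen] vector_scalar_commute e)
  then show "A *v u = B *v u" using eigenbasis_expand[OF assms(1), of u] by simp
qed

text \<open>Rotating inside the eigenspaces of \<open>H\<close>, one may assume that \<open>T\<close> has at most one nonzero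
  component in each of them.\<close>

lemma adapted_eigenbasis_exists:
  fixes H :: "complex^'n^'n" and T :: "complex^'n"
  assumes H: "conj_transpose H = H"
  obtains e l where "eigenbasis H UNIV e l"
    "\<And>j k. \<lbrakk>j \<noteq> k; l j = l k\<rbrakk> \<Longrightarrow> herm (e j) T = 0 \<or> herm (e k) T = 0"
proof -
  \<comment> \<open>Among all eigenbases, one is taken in which \<open>T\<close> has the fewest
    nonzero components.\<close>
  define N where "N e = card {j. herm (e j) T \<noteq> 0}" for e :: "'n \<Rightarrow> complex^'n"
  obtain p where p: "eigenbasis H UNIV (fst p) (snd p)"
    and min: "\<And>q. eigenbasis H UNIV (fst q) (snd q) \<Longrightarrow> N (fst p) \<le> N (fst q)"
    using ex_has_least_nat[of "\<lambda>p. eigenbasis H UNIV (fst p) (snd p)" _ "\<lambda>p. N (fst p)"]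
      eigenbasis_exists[OF H] by (metis fst_conv snd_conv)
  define e l where "e = fst p" and "l = snd p"
  have e1: "herm (e i) (e j) = (if i = j then 1 else 0)" and e2: "H *v e i = complex_of_real (l i) *s e i" for i j
    using p by (auto simp: eigenbasis_def e_def l_def)
  show ?thesis
  proof (rule that[of e l])
    show "eigenbasis H UNIV e l" using p by (simp add: e_def l_def)
    fix j k assume jk: "j \<noteq> k" "l j = l k"
    show "herm (e j) T = 0 \<or> herm (e k) T = 0"
    proof (rule ccontr)
      assume nz: "\<not> (herm (e j) T = 0 \<or> herm (e k) T = 0)"
      define \<alpha> \<beta> where "\<alpha> = herm (e j) T" and "\<beta> = herm (e k) T"
      define r where "r = sqrt ((norm \<alpha>)\<^sup>2 + (norm \<beta>)\<^sup>2)"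
      have r: "r > 0" using nz by (simp add: r_def \<alpha>_def sum_power2_gt_zero_iff)
      have r2: "complex_of_real r * complex_of_real r = \<alpha> * cnj \<alpha> + \<beta> * cnj \<beta>"
      proof -
        have "r * r = (norm \<alpha>)\<^sup>2 + (norm \<beta>)\<^sup>2" by (simp add: r_def)
        then show ?thesis by (metis complex_norm_square of_real_add of_real_mult)
      qed
      define c where "c = inverse (complex_of_real r)"
      have c: "cnj c = c" "c * c * (\<alpha> * cnj \<alpha> + \<beta> * cnj \<beta>) = 1" "c \<noteq> 0"
      proof -
        have "c * complex_of_real r = 1" using r by (simp add: c_def)
        then have "c * c * (complex_of_real r * complex_of_real r) = 1" by (metis mult.assoc mult.left_commute mult_1)
        then show "c * c * (\<alpha> * cnj \<alpha> + \<beta> * cnj \<beta>) = 1" by (simp only: r2)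
      qed (use r in \<open>auto simp: c_def\<close>)
      \<comment> \<open>A unitary rotation of the plane of \<open>e j\<close> and
        \<open>e k\<close>, on which \<open>H\<close> is scalar: \<open>u\<close> points along the
        component of \<open>T\<close> in this plane and \<open>v\<close> is orthogonal to it. One
        nonzero component disappears, contrary to minimality.\<close>
      define u v where "u = c *s (\<alpha> *s e j + \<beta> *s e k)" and "v = c *s ((- cnj \<beta>) *s e j + cnj \<alpha> *s e k)"
      define e' where "e' = e(j := u, k := v)"
      have Hu: "H *v u = complex_of_real (l j) *s u" "H *v v = complex_of_real (l k) *s v"
        by (simp_all add: u_def v_def matrix_vector_right_distrib vector_scalar_commute e2 jk(2) vec_eq_iff algebra_simps)
      have n: "herm u u = c * c * (\<alpha> * cnj \<alpha> + \<beta> * cnj \<beta>)" "herm v v = c * c * (\<alpha> * cnj \<alpha> + \<beta> * cnj \<beta>)"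
        "herm u v = 0" "herm v u = 0"
        using jk(1) by (simp_all add: u_def v_def herm_expand e1 c(1) algebra_simps)
      have o: "herm u (e i) = 0" "herm (e i) u = 0" "herm v (e i) = 0" "herm (e i) v = 0" if "i \<noteq> j" "i \<noteq> k" for i
        using that by (auto simp: u_def v_def herm_expand e1)
      have "eigenbasis H UNIV e' l"
        unfolding eigenbasis_def e'_def using jk(1) n o c(2) e1 e2 Hu by auto
      then have "N e \<le> N e'" using min[of "(e', l)"] by (simp add: e_def)
      moreover have "N e' < N e"
        unfolding N_def
      proof (intro psubset_card_mono psubsetI)
        have vT: "herm v T = 0" by (simp add: v_def herm_expand \<alpha>_def[symmetric] \<beta>_def[symmetric])
        show "{i. herm (e' i) T \<noteq> 0} \<subseteq> {j. herm (e j) T \<noteq> 0}"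
          using nz vT by (auto simp: e'_def split: if_splits)
        have "k \<notin> {i. herm (e' i) T \<noteq> 0}" "k \<in> {j. herm (e j) T \<noteq> 0}"
          using nz vT by (auto simp: e'_def)
        then show "{i. herm (e' i) T \<noteq> 0} \<noteq> {j. herm (e j) T \<noteq> 0}" by blast
      qed auto
      ultimately show False by simp
    qed
  qed
qed

text \<open>In an adapted eigenbasis \<open>e\<close> put \<open>\<tau> j = herm (e j) T\<close> and look for \<open>a\<close> with components
  \<open>\<i> r j \<tau> j\<close>, \<open>r\<close> real. Then \<open>kapH = 0\<close> determines the off-diagonal entries of \<open>b\<close> and \<open>kapT = 0\<close> the
  diagonal entries \<open>\<i> s j\<close> with \<open>\<tau> j \<noteq> 0\<close>; the other \<open>s j\<close> are free. The divisions by zero that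
  occur below for equal eigenvalues yield the desired value \<open>0\<close>.\<close>

lemma kernel_element:
  fixes H :: "complex^'n^'n" and T :: "complex^'n" and V :: real and r s :: "'n \<Rightarrow> real"
  assumes H: "conj_transpose H = H" and eig: "eigenbasis H UNIV e l"
    and ad: "\<And>j k. \<lbrakk>j \<noteq> k; l j = l k\<rbrakk> \<Longrightarrow> herm (e j) T = 0 \<or> herm (e k) T = 0"
    and s: "\<And>j. herm (e j) T \<noteq> 0 \<Longrightarrow> s j = ((l j)\<^sup>2 + Re (trace H) * l j + V) * r j
        + (\<Sum>k\<in>UNIV. (norm (herm (e k) T))\<^sup>2 * ((r j - r k) / (l j - l k)))"
  obtains a b where "conj_transpose b = - b" "kapH H T a b = 0" "kapT H T V a b = 0" "kapV H T a = 0"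
    "\<And>j. herm (e j) a = \<i> * r j * herm (e j) T" "\<And>j. herm (e j) (b *v e j) = \<i> * s j"
proof -
  have e1: "herm (e i) (e j) = (if i = j then 1 else 0)" and e2: "H *v e i = complex_of_real (l i) *s e i" for i j
    using eig by (auto simp: eigenbasis_def)
  define \<tau> where "\<tau> j = herm (e j) T" for j
  \<comment> \<open>Divided differences of \<open>r\<close> with respect to the eigenvalues; they
    occur in the off-diagonal entries of \<open>b\<close> and in the condition on
    \<open>s\<close>.\<close>
  define x where "x j k = (r j - r k) / (l j - l k)" for j k
  have xs: "x j k = x k j" for j k
    unfolding x_def by (metis minus_diff_eq minus_divide_divide)
  \<comment> \<open>The matrix of \<open>b\<close> in the eigenbasis. Its off-diagonal entries solve
    \<open>(l j - l k) * c j k + \<i> * \<tau> j * cnj (\<tau> k) * (r j - r k) = 0\<close>, which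
    is \<open>kapH = 0\<close> in components.\<close>
  define c where "c j k = (if j = k then \<i> * s j else - (\<i> * \<tau> j * cnj (\<tau> k) * x j k))" for j k
  define a where "a = (\<Sum>j\<in>UNIV. (\<i> * r j * \<tau> j) *s e j)"
  define b where "b = (\<Sum>j\<in>UNIV. \<Sum>k\<in>UNIV. outer (c j k *s e j) (e k))"
  have ea: "herm (e j) a = \<i> * r j * \<tau> j" for j
    by (simp add: a_def herm_sum_right herm_expand e1 if_distrib[of "\<lambda>c. _ * c"] cong: if_cong)
  have bu: "herm (e j) (b *v u) = (\<Sum>k\<in>UNIV. c j k * herm (e k) u)" for j u
  proof -
    have "herm (e j) (b *v u) = (\<Sum>i\<in>UNIV. \<Sum>k\<in>UNIV. herm (e j) (outer (c i k *s e i) (e k) *v u))"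
      by (simp add: b_def sum_matrix_mult_vec herm_sum_right)
    also have "\<dots> = (\<Sum>i\<in>UNIV. if j = i then \<Sum>k\<in>UNIV. c j k * herm (e k) u else 0)"
      by (rule sum.cong) (auto simp: outer_mult_vec herm_expand e1 mult_ac)
    finally show ?thesis by simp
  qed
  have eb: "herm (e j) (b *v e k) = c j k" for j k
    by (simp add: bu e1 if_distrib[of "\<lambda>c. _ * c"] cong: if_cong)
  have eH: "herm (e j) (H *v u) = l j * herm (e j) u" for j u
    using herm_hermitian[OF H, of "e j" u] by (simp add: e2 herm_expand)
  have Te: "herm T (e k) = cnj (\<tau> k)" for k by (simp add: \<tau>_def cnj_herm)
  have ae: "herm a (e k) = - (\<i> * r k * cnj (\<tau> k))" for k
    using cnj_herm[of "e k" a] by (simp add: ea)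
  have cc: "cnj (c j k) = - c k j" for j k by (simp add: c_def xs[of j k])
  have skew: "conj_transpose b = - b"
  proof (rule eigenbasis_matrix_eqI[OF eig])
    fix j k
    have "herm (e j) (conj_transpose b *v e k) = cnj (herm (e k) (b *v e j))"
      by (simp add: herm_matrix_left[symmetric] cnj_herm)
    then show "herm (e j) (conj_transpose b *v e k) = herm (e j) (- b *v e k)"
      by (simp add: eb cc uminus_matrix_mult_vec herm_expand)
  qed
  have kH: "kapH H T a b = 0"
  proof (rule eigenbasis_matrix_eqI[OF eig])
    fix j k
    have "herm (e j) (kapH H T a b *v e k) = (l j - l k) * c j k + \<i> * \<tau> j * cnj (\<tau> k) * (r j - r k)"
      by (simp add: kapH_def vec_expand herm_expand e2 eb eH Te ae ea \<tau>_def[symmetric]; simp add: algebra_simps)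
    also have "\<dots> = 0"
    proof (cases "j = k")
      case False
      show ?thesis
      proof (cases "l j = l k")
        case True then show ?thesis using ad[OF False True] by (auto simp: \<tau>_def)
      next
        case l: False
        then have "complex_of_real (l j) - complex_of_real (l k) \<noteq> 0" by (metis of_real_eq_iff right_minus_eq)
        then show ?thesis using False by (simp add: c_def x_def)
      qed
    qed simp
    finally show "herm (e j) (kapH H T a b *v e k) = herm (e j) (0 *v e k)"
      by (simp add: herm_expand)
  qed
  have ext0: "y = 0" if "\<And>j. herm (e j) y = 0" for y
    using eigenbasis_expand[OF eig, of y] that by simp
  have trH: "trace H = complex_of_real (Re (trace H))"
    using cnj_trace[OF H] by (metis complex_is_Real_iff Reals_cnj_iff of_real_Re)
  have kT: "kapT H T V a b = 0"
  proof (rule ext0)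
    fix j
    have off: "(\<Sum>k\<in>UNIV. c j k * \<tau> k)
        = \<i> * \<tau> j * (s j - (\<Sum>k\<in>UNIV. (norm (\<tau> k))\<^sup>2 * x j k))"
    proof -
      have "c j k * \<tau> k = (if k = j then \<i> * s j * \<tau> j else 0) - \<i> * \<tau> j * ((norm (\<tau> k))\<^sup>2 * x j k)" for k
        by (auto simp: c_def x_def complex_norm_square simp flip: of_real_power)
      then have "(\<Sum>k\<in>UNIV. c j k * \<tau> k)
          = (\<Sum>k\<in>UNIV. if k = j then \<i> * s j * \<tau> j else 0) - (\<Sum>k\<in>UNIV. \<i> * \<tau> j * ((norm (\<tau> k))\<^sup>2 * x j k))"
        by (simp add: sum_subtractf)
      also have "\<dots> = \<i> * s j * \<tau> j - \<i> * \<tau> j * (\<Sum>k\<in>UNIV. (norm (\<tau> k))\<^sup>2 * x j k)"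
        by (simp add: sum_distrib_left)
      finally show ?thesis by (simp add: algebra_simps)
    qed
    have "herm (e j) (kapT H T V a b)
      = - (\<Sum>k\<in>UNIV. c j k * \<tau> k) + (l j * l j + trace H * l j + V) * (\<i> * r j * \<tau> j)"
      by (simp add: kapT_def vec_expand herm_expand eH ea bu \<tau>_def[symmetric]; simp add: algebra_simps)
    also have "\<dots> = \<i> * \<tau> j * (((l j)\<^sup>2 + Re (trace H) * l j + V) * r j
        + (\<Sum>k\<in>UNIV. (norm (\<tau> k))\<^sup>2 * x j k) - s j)"
      unfolding off by (subst trH) (simp add: power2_eq_square algebra_simps)
    also have "\<dots> = 0"
      using s[of j] by (cases "\<tau> j = 0") (auto simp: \<tau>_def x_def)
    finally show "herm (e j) (kapT H T V a b) = 0" .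
  qed
  have sq: "\<tau> j * cnj (\<tau> j) = (norm (\<tau> j))\<^sup>2" for j by (metis complex_norm_square)
  have Ta: "herm T a = \<i> * (\<Sum>j\<in>UNIV. r j * (norm (\<tau> j))\<^sup>2)"
    by (simp add: a_def herm_sum_right herm_expand Te sum_distrib_left mult.assoc sq)
  have THa: "herm T (H *v a) = \<i> * (\<Sum>j\<in>UNIV. l j * r j * (norm (\<tau> j))\<^sup>2)"
  proof -
    have "herm T (H *v a) = (\<Sum>j\<in>UNIV. (\<i> * r j * \<tau> j) * herm T (H *v e j))"
      by (simp add: a_def vec.linear_sum[OF matrix_vector_mul_linear_gen] vector_scalar_commute herm_sum_right herm_expand)
    also have "\<dots> = \<i> * (\<Sum>j\<in>UNIV. l j * r j * (norm (\<tau> j))\<^sup>2)"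
    proof -
      have "(\<i> * r j * \<tau> j) * (l j * cnj (\<tau> j)) = \<i> * complex_of_real (l j * r j * (norm (\<tau> j))\<^sup>2)" for j
        by (simp only: of_real_mult sq[symmetric] mult_ac)
      then show ?thesis by (simp only: e2 herm_smult_right Te of_real_sum sum_distrib_left)
    qed
    finally show ?thesis .
  qed
  \<comment> \<open>Both \<open>herm T a\<close> and \<open>herm T (H *v a)\<close> are purely
    imaginary, so each cancels against its conjugate in \<open>kapV\<close>: the third equation puts
    no condition on \<open>r\<close> and \<open>s\<close>.\<close>
  have "herm a T = - herm T a" using cnj_herm[of T a] by (simp add: Ta)
  moreover have "herm a (H *v T) = - herm T (H *v a)"
    using cnj_herm[of T "H *v a"] by (simp add: THa herm_hermitian[OF H])
  ultimately have kV: "kapV H T a = 0" by (simp add: kapV_def)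
  show ?thesis
    by (rule that[OF skew kH kT kV]) (simp_all add: ea eb c_def \<tau>_def)
qed

text \<open>One real parameter per index m: the coefficient \<open>r\<close> at m if
  \<open>herm (e m) T \<noteq> 0\<close>, and otherwise the diagonal entry \<open>s\<close> at m.
  Independence is read off from the components of \<open>a\<close> at indices of the first kind and
  from the diagonal of \<open>b\<close> at the others.\<close>

lemma kernel_family_exists:
  fixes H :: "complex^'n^'n" and T :: "complex^'n" and V :: real
  assumes H: "conj_transpose H = H"
  obtains a :: "'n \<Rightarrow> complex^'n" and b :: "'n \<Rightarrow> complex^'n^'n" where
    "\<And>m. conj_transpose (b m) = - b m" "\<And>m. kapH H T (a m) (b m) = 0"
    "\<And>m. kapT H T V (a m) (b m) = 0" "\<And>m. kapV H T (a m) = 0"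
    "\<And>x :: 'n \<Rightarrow> real. \<lbrakk>(\<Sum>m\<in>UNIV. x m *\<^sub>R a m) = 0; (\<Sum>m\<in>UNIV. x m *\<^sub>R b m) = 0\<rbrakk> \<Longrightarrow> (\<forall>m. x m = 0)"
proof -
  obtain e l where eig: "eigenbasis H UNIV e l"
    and ad: "\<And>j k. \<lbrakk>j \<noteq> k; l j = l k\<rbrakk> \<Longrightarrow> herm (e j) T = 0 \<or> herm (e k) T = 0"
    using adapted_eigenbasis_exists[OF H] by metis
  define nz where "nz j \<longleftrightarrow> herm (e j) T \<noteq> 0" for j
  define r where "r m j = (if nz m \<and> j = m then 1 else 0 :: real)" for m j
  define s where "s m j = (if nz j then ((l j)\<^sup>2 + Re (trace H) * l j + V) * r m j
        + (\<Sum>k\<in>UNIV. (norm (herm (e k) T))\<^sup>2 * ((r m j - r m k) / (l j - l k)))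
      else if j = m then 1 else 0)" for m j
  have "\<exists>a b. conj_transpose b = - b \<and> kapH H T a b = 0 \<and> kapT H T V a b = 0 \<and> kapV H T a = 0 \<and>
    (\<forall>j. herm (e j) a = \<i> * r m j * herm (e j) T) \<and> (\<forall>j. herm (e j) (b *v e j) = \<i> * s m j)" for m
  proof -
    have sm: "s m j = ((l j)\<^sup>2 + Re (trace H) * l j + V) * r m j
        + (\<Sum>k\<in>UNIV. (norm (herm (e k) T))\<^sup>2 * ((r m j - r m k) / (l j - l k)))"
      if "herm (e j) T \<noteq> 0" for j using that by (simp add: s_def nz_def)
    show ?thesis by (rule kernel_element[OF H eig ad sm]) blast+
  qed
  then obtain a b where ab: "\<And>m. conj_transpose (b m) = - b m" "\<And>m. kapH H T (a m) (b m) = 0"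
    "\<And>m. kapT H T V (a m) (b m) = 0" "\<And>m. kapV H T (a m) = 0"
    "\<And>m j. herm (e j) (a m) = \<i> * r m j * herm (e j) T"
    "\<And>m j. herm (e j) (b m *v e j) = \<i> * s m j"
    by metis
  show ?thesis
  proof (rule that[OF ab(1-4)])
    fix x :: "'n \<Rightarrow> real" assume x: "(\<Sum>m\<in>UNIV. x m *\<^sub>R a m) = 0" "(\<Sum>m\<in>UNIV. x m *\<^sub>R b m) = 0"
    have x1: "x j = 0" if "nz j" for j
    proof -
      have "herm (e j) (\<Sum>m\<in>UNIV. x m *\<^sub>R a m) = (\<Sum>m\<in>UNIV. if j = m then \<i> * x m * herm (e j) T else 0)"
        unfolding herm_sum_right
        by (rule sum.cong) (auto simp: smult_conv_scaleR[symmetric] herm_expand ab(5) r_def that)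
      then have "\<i> * x j * herm (e j) T = 0" using x(1) by (simp add: herm_expand)
      then show ?thesis using that by (simp add: nz_def)
    qed
    have x2: "x j = 0" if "\<not> nz j" for j
    proof -
      have mv: "(\<Sum>m\<in>UNIV. x m *\<^sub>R b m) *v u = (\<Sum>m\<in>UNIV. complex_of_real (x m) *s (b m *v u))" for u
        by (simp add: sum_matrix_mult_vec scaleR_matrix_mult_vec)
      have "herm (e j) ((\<Sum>m\<in>UNIV. x m *\<^sub>R b m) *v e j) = (\<Sum>m\<in>UNIV. if j = m then \<i> * x m else 0)"
        unfolding mv herm_sum_right
        by (rule sum.cong) (auto simp: herm_expand ab(6) s_def that x1)
      then have "\<i> * x j = 0" using x(2) by (simp add: herm_expand)
      then show ?thesis by simp
    qed
    show "\<forall>m. x m = 0" using x1 x2 by blast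
  qed
qed

section \<open>Smoothness of matrix expressions\<close>

lemma bounded_bilinear_matrix_vec: "bounded_bilinear (\<lambda>(A :: complex^'n^'n) v. A *v v)"
  unfolding bilinear_conv_bounded_bilinear[symmetric] bilinear_def
  by (auto intro!: linearI simp: matrix_vector_right_distrib matrix_vector_mult_add_rdistrib
      vector_scalar_commute scaleR_matrix_mult_vec simp flip: smult_conv_scaleR)

lemma bounded_bilinear_matrix_mult: "bounded_bilinear (\<lambda>(A :: complex^'n^'n) B. A ** (B :: complex^'n^'n))"
  unfolding bilinear_conv_bounded_bilinear[symmetric] bilinear_def
  by (auto intro!: linearI matrix_eq_complex simp: vec_expand scaleR_matrix_mult_vec)

lemma bounded_bilinear_herm: "bounded_bilinear (herm :: complex^'n \<Rightarrow> _)"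
  unfolding bilinear_conv_bounded_bilinear[symmetric] bilinear_def
  by (auto intro!: linearI simp: herm_expand scaleR_conv_of_real[where 'a = complex] simp flip: smult_conv_scaleR)

lemma bounded_bilinear_outer: "bounded_bilinear (outer :: complex^'n \<Rightarrow> complex^'n \<Rightarrow> _)"
  unfolding bilinear_conv_bounded_bilinear[symmetric] bilinear_def
  by (auto intro!: linearI matrix_eq_complex simp: vec_expand herm_expand scaleR_matrix_mult_vec
      vector_sadd_rdistrib vector_add_ldistrib mult.commute simp flip: smult_conv_scaleR)

lemma bounded_linear_mat: "bounded_linear (mat :: complex \<Rightarrow> complex^'n^'n)"
  unfolding linear_conv_bounded_linear[symmetric]
  by (auto intro!: linearI simp: mat_def vec_eq_iff)

lemma bounded_linear_trace: "bounded_linear (trace :: complex^'n^'n \<Rightarrow> complex)"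
  unfolding linear_conv_bounded_linear[symmetric]
  by (auto intro!: linearI simp: trace_def sum.distrib scaleR_sum_right)

lemma bounded_linear_conj_transpose: "bounded_linear (conj_transpose :: complex^'n^'n \<Rightarrow> complex^'n^'n)"
  unfolding linear_conv_bounded_linear[symmetric]
  by (auto intro!: linearI simp: conj_transpose_def vec_eq_iff)

lemmas smooth_on_matrix_vec = smooth_on_bilinear[OF bounded_bilinear_matrix_vec]
  and smooth_on_matrix_mult = smooth_on_bilinear[OF bounded_bilinear_matrix_mult]
  and smooth_on_herm = smooth_on_bilinear[OF bounded_bilinear_herm]
  and smooth_on_outer = smooth_on_bilinear[OF bounded_bilinear_outer]
  and smooth_on_mat = smooth_on_bounded_linear[OF bounded_linear_mat]
  and smooth_on_trace = smooth_on_bounded_linear[OF bounded_linear_trace]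

lemmas smooth_intros = smooth_on_matrix_vec smooth_on_matrix_mult smooth_on_herm smooth_on_outer
  smooth_on_mat smooth_on_trace smooth_on_add smooth_on_diff smooth_on_minus smooth_on_const

lemma smooth_on_rho:
  "\<lbrakk>open S; smooth_on S H; smooth_on S a; smooth_on S x\<rbrakk> \<Longrightarrow> smooth_on S (\<lambda>z. rho (H z) (a z) (x z))"
  unfolding rho_def Let_def by (intro smooth_intros)

lemma linear_rho1: "linear (\<lambda>H. rho H a x)"
proof (rule linearI)
  show "rho (H + H') a x = rho H a x + rho H' a x" for H H' by (rule rho_add)
  have tr: "trace (r *\<^sub>R H) = complex_of_real r * trace H" for r and H :: "complex^'n^'n"
    using linear_cmul[OF bounded_linear.linear[OF bounded_linear_trace]] by (simp add: scaleR_conv_of_real)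
  show "rho (r *\<^sub>R H) a x = r *\<^sub>R rho H a x" for r H
    by (rule matrix_eq_complex)
       (simp add: rho_mult_vec scaleR_matrix_mult_vec herm_expand tr vec_eq_iff; simp add: algebra_simps)
qed

lemma linear_rho2: "linear (\<lambda>a. rho H a x)"
proof (rule linearI)
  show "rho H (a + b) x = rho H a x + rho H b x" for a b
    by (rule matrix_eq_complex)
       (simp add: rho_mult_vec vec_expand herm_expand vec_eq_iff; simp add: algebra_simps)
  show "rho H (r *\<^sub>R a) x = r *\<^sub>R rho H a x" for r a
    by (rule matrix_eq_complex, unfold smult_conv_scaleR[symmetric])
       (simp add: rho_mult_vec scaleR_matrix_mult_vec vec_expand herm_expand vec_eq_iff; simp add: algebra_simps)
qed

lemma rho_swap: "rho H v w = - rho H w v"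
  by (rule matrix_eq_complex) (simp add: rho_mult_vec vec_expand vec_eq_iff; simp add: algebra_simps)

lemma linear_rho3: "linear (\<lambda>x. rho H a x)"
proof -
  have "linear (\<lambda>x. - rho H x a)" by (rule linear_compose_neg[OF linear_rho2])
  then show ?thesis by (simp flip: rho_swap)
qed

lemma linear_components_vec: "linear D \<Longrightarrow> (\<And>a v. D (a *s v) = a *s D v) \<Longrightarrow>
    D v = (\<chi> i j. D (axis j 1) $ i) *v (v :: complex^'n)" for D :: "complex^'n \<Rightarrow> complex^'n"
proof -
  assume D: "linear D" "\<And>a v. D (a *s v) = a *s D v"
  have "v = (\<Sum>j\<in>UNIV. v $ j *s axis j 1)"
    by (simp add: vec_eq_iff axis_def if_distrib[of "\<lambda>c. _ * c"] cong: if_cong)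
  then have "D v = (\<Sum>j\<in>UNIV. v $ j *s D (axis j 1))"
    using linear_sum[OF D(1)] D(2) by (metis (mono_tags, lifting) sum.cong)
  then show ?thesis by (simp add: matrix_vector_mult_def vec_eq_iff mult.commute)
qed

section \<open>Killing fields in a local unitary frame\<close>

text \<open>The last expression is the Lie derivative of the form \<open>B\<close> along \<xi> in
  coordinates. Complex-linearity of the derivative of \<xi> is the infinitesimal form of preserving
  the complex structure.\<close>

definition killing_on ::
    "(complex^'n \<Rightarrow> complex^'n \<Rightarrow> complex^'n \<Rightarrow> real) \<Rightarrow> (complex^'n) set \<Rightarrow> (complex^'n \<Rightarrow> complex^'n) \<Rightarrow> bool"
  where "killing_on B N \<xi> \<longleftrightarrow> open N \<and> smooth_on N \<xi> \<and>
    (\<forall>z\<in>N. \<forall>a v. frechet_derivative \<xi> (at z) (a *s v) = a *s frechet_derivative \<xi> (at z) v) \<and>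
    (\<forall>z\<in>N. \<forall>v w. frechet_derivative (\<lambda>z. B z v w) (at z) (\<xi> z)
       + B z (frechet_derivative \<xi> (at z) v) w + B z v (frechet_derivative \<xi> (at z) w) = 0)"

lemma killing_on_subset: "\<lbrakk>killing_on B N \<xi>; open N'; N' \<subseteq> N\<rbrakk> \<Longrightarrow> killing_on B N' \<xi>"
  unfolding killing_on_def using smooth_on_subset by blast

lemma killing_on_cong:
  assumes "killing_on B N \<xi>" "\<And>z. z \<in> N \<Longrightarrow> \<xi> z = \<xi>' z"
  shows "killing_on B N \<xi>'"
proof -
  have N: "open N" using assms(1) by (simp add: killing_on_def)
  have "frechet_derivative \<xi> (at z) = frechet_derivative \<xi>' (at z)" if "z \<in> N" for z
    by (rule frechet_derivative_cong[OF N that assms(2)])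
  then show ?thesis
    using assms smooth_on_cong[OF N assms(2)] unfolding killing_on_def by simp
qed

text \<open>\<open>E\<close> is the matrix of a unitary coframe in the coordinates, \<open>F\<close> its inverse, and \<open>ph\<close>, \<open>H\<close>, \<open>T\<close>, \<open>V\<close>
  are the pull-backs of \<open>\<phi>\<close>, \<open>H\<close>, \<open>T\<close>, \<open>V\<close> along this local section of the coframe bundle;
  \<open>B\<close> is the Kaehler form.\<close>

locale frame_data =
  fixes U :: "(complex^'n) set" and E F :: "complex^'n \<Rightarrow> complex^'n^'n"
    and ph :: "complex^'n \<Rightarrow> complex^'n \<Rightarrow> complex^'n^'n" and H :: "complex^'n \<Rightarrow> complex^'n^'n"
    and T :: "complex^'n \<Rightarrow> complex^'n" and V :: "complex^'n \<Rightarrow> real"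
    and B :: "complex^'n \<Rightarrow> complex^'n \<Rightarrow> complex^'n \<Rightarrow> real"
  assumes U: "open U"
    and E: "smooth_on U E" and F: "smooth_on U F"
    and EF: "z \<in> U \<Longrightarrow> E z ** F z = mat 1" and FE: "z \<in> U \<Longrightarrow> F z ** E z = mat 1"
    and B: "z \<in> U \<Longrightarrow> B z v (\<i> *s w) = (E z *v v) \<bullet> (E z *v w)"
    and ph_linear: "z \<in> U \<Longrightarrow> linear (ph z)" and ph: "smooth_on U (\<lambda>z. ph z v)"
    and ph_skew: "z \<in> U \<Longrightarrow> conj_transpose (ph z v) = - ph z v"
    and H_herm: "z \<in> U \<Longrightarrow> conj_transpose (H z) = H z" and H: "smooth_on U H"
    and torsion: "z \<in> U \<Longrightarrow> frechet_derivative E (at z) v *v w - frechet_derivative E (at z) w *v v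
        = - (ph z v *v (E z *v w) - ph z w *v (E z *v v))"
    and curv: "z \<in> U \<Longrightarrow> frechet_derivative (\<lambda>z. ph z w) (at z) v - frechet_derivative (\<lambda>z. ph z v) (at z) w
        = - (ph z v ** ph z w - ph z w ** ph z v) + rho (H z) (E z *v v) (E z *v w)"
    and dH: "z \<in> U \<Longrightarrow> (H has_derivative (\<lambda>v. kapH (H z) (T z) (E z *v v) (ph z v))) (at z)"
    and dT: "z \<in> U \<Longrightarrow> (T has_derivative (\<lambda>v. kapT (H z) (T z) (V z) (E z *v v) (ph z v))) (at z)"
    and dV: "z \<in> U \<Longrightarrow> ((\<lambda>z. complex_of_real (V z)) has_derivative (\<lambda>v. kapV (H z) (T z) (E z *v v))) (at z)"
begin

definition conn :: "complex^'n \<Rightarrow> complex^'n \<Rightarrow> (complex^'n) \<times> (complex^'n^'n) \<Rightarrow> (complex^'n) \<times> (complex^'n^'n)"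
  where "conn z v s = (snd s *v (E z *v v) - ph z v *v fst s,
     snd s ** ph z v - ph z v ** snd s - rho (H z) (fst s) (E z *v v))"

definition ker :: "complex^'n \<Rightarrow> (complex^'n) \<times> (complex^'n^'n) \<Rightarrow> bool"
  where "ker z s \<longleftrightarrow> conj_transpose (snd s) = - snd s \<and> kapH (H z) (T z) (fst s) (snd s) = 0 \<and>
     kapT (H z) (T z) (V z) (fst s) (snd s) = 0 \<and> kapV (H z) (T z) (fst s) = 0"

lemma conn_smooth: "smooth_on U (\<lambda>z. conn z v s)"
  unfolding conn_def by (intro smooth_on_Pair smooth_intros smooth_on_rho U E ph H)

lemma conn_bilinear: "z \<in> U \<Longrightarrow> bilinear (conn z)"
proof -
  assume z: "z \<in> U"
  note l = linear_add[OF ph_linear[OF z]] linear_cmul[OF ph_linear[OF z]]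
    bounded_bilinear.add_left[OF bounded_bilinear_matrix_vec] bounded_bilinear.add_right[OF bounded_bilinear_matrix_vec]
    bounded_bilinear.scaleR_left[OF bounded_bilinear_matrix_vec] bounded_bilinear.scaleR_right[OF bounded_bilinear_matrix_vec]
    bounded_bilinear.add_left[OF bounded_bilinear_matrix_mult] bounded_bilinear.add_right[OF bounded_bilinear_matrix_mult]
    bounded_bilinear.scaleR_left[OF bounded_bilinear_matrix_mult] bounded_bilinear.scaleR_right[OF bounded_bilinear_matrix_mult]
    linear_add[OF linear_rho2] linear_cmul[OF linear_rho2] linear_add[OF linear_rho3] linear_cmul[OF linear_rho3]
  show ?thesis unfolding bilinear_def
    by (auto intro!: linearI simp: conn_def l scaleR_add_right scaleR_diff_right)
qed

lemma E_derivative: "z \<in> U \<Longrightarrow> (E has_derivative frechet_derivative E (at z)) (at z)"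
  by (rule smooth_on_has_derivative[OF E])

lemma ph_derivative: "z \<in> U \<Longrightarrow> ((\<lambda>z. ph z v) has_derivative frechet_derivative (\<lambda>z. ph z v) (at z)) (at z)"
  by (rule smooth_on_has_derivative[OF ph])

lemma conn_derivative:
  assumes z: "z \<in> U"
  shows "frechet_derivative (\<lambda>z. conn z v s) (at z) w =
    (snd s *v (frechet_derivative E (at z) w *v v) - frechet_derivative (\<lambda>z. ph z v) (at z) w *v fst s,
     snd s ** frechet_derivative (\<lambda>z. ph z v) (at z) w - frechet_derivative (\<lambda>z. ph z v) (at z) w ** snd s
     - (rho (kapH (H z) (T z) (E z *v w) (ph z w)) (fst s) (E z *v v)
        + rho (H z) (fst s) (frechet_derivative E (at z) w *v v)))"
proof -
  let ?DE = "frechet_derivative E (at z)" and ?Dp = "frechet_derivative (\<lambda>z. ph z v) (at z)"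
  note bl = bounded_linear.has_derivative
  have dE: "((\<lambda>z. E z *v v) has_derivative (\<lambda>w. ?DE w *v v)) (at z)"
    by (rule bl[OF bounded_bilinear.bounded_linear_left[OF bounded_bilinear_matrix_vec] E_derivative[OF z]])
  have 1: "((\<lambda>z. snd s *v (E z *v v)) has_derivative (\<lambda>w. snd s *v (?DE w *v v))) (at z)"
    by (rule bl[OF bounded_bilinear.bounded_linear_right[OF bounded_bilinear_matrix_vec] dE])
  have 2: "((\<lambda>z. ph z v *v fst s) has_derivative (\<lambda>w. ?Dp w *v fst s)) (at z)"
    by (rule bl[OF bounded_bilinear.bounded_linear_left[OF bounded_bilinear_matrix_vec] ph_derivative[OF z]])
  have 3: "((\<lambda>z. snd s ** ph z v) has_derivative (\<lambda>w. snd s ** ?Dp w)) (at z)"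
    by (rule bl[OF bounded_bilinear.bounded_linear_right[OF bounded_bilinear_matrix_mult] ph_derivative[OF z]])
  have 4: "((\<lambda>z. ph z v ** snd s) has_derivative (\<lambda>w. ?Dp w ** snd s)) (at z)"
    by (rule bl[OF bounded_bilinear.bounded_linear_left[OF bounded_bilinear_matrix_mult] ph_derivative[OF z]])
  have bb: "bounded_bilinear (\<lambda>H x. rho H (fst s) x)"
    unfolding bilinear_conv_bounded_bilinear[symmetric] bilinear_def
    using linear_rho1 linear_rho3 by blast
  have 5: "((\<lambda>z. rho (H z) (fst s) (E z *v v)) has_derivative
     (\<lambda>w. rho (H z) (fst s) (?DE w *v v) + rho (kapH (H z) (T z) (E z *v w) (ph z w)) (fst s) (E z *v v))) (at z)"
    by (rule bounded_bilinear.FDERIV[OF bb dH[OF z] dE])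
  have "((\<lambda>z. conn z v s) has_derivative (\<lambda>w. (snd s *v (?DE w *v v) - ?Dp w *v fst s,
     snd s ** ?Dp w - ?Dp w ** snd s
     - (rho (H z) (fst s) (?DE w *v v) + rho (kapH (H z) (T z) (E z *v w) (ph z w)) (fst s) (E z *v v))))) (at z)"
    unfolding conn_def by (intro has_derivative_Pair has_derivative_diff 1 2 3 4 5)
  then show ?thesis by (simp add: frechet_derivative_eqI add.commute)
qed

text \<open>Only antisymmetrised derivatives of \<open>E\<close> and \<open>ph\<close> survive. They
  are known from \<open>torsion\<close> and \<open>curv\<close>, which reduces the claim to the two
  algebraic curvature identities.\<close>

lemma conn_curvature:
  assumes z: "z \<in> U" and s: "conj_transpose (snd s) = - snd s"
  shows "frechet_derivative (\<lambda>z. conn z v s) (at z) w - frechet_derivative (\<lambda>z. conn z w s) (at z) v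
     + conn z v (conn z w s) - conn z w (conn z v s)
    = (0, - rho (kapH (H z) (T z) (fst s) (snd s)) (E z *v w) (E z *v v))"
proof -
  let ?x = "E z *v v" and ?y = "E z *v w" and ?p = "ph z v" and ?q = "ph z w" and ?H = "H z"
  obtain a b where ab: "s = (a, b)" by (cases s)
  have b: "conj_transpose b = - b" using s ab by simp
  define P where "P = frechet_derivative (\<lambda>z. ph z v) (at z) w - frechet_derivative (\<lambda>z. ph z w) (at z) v"
  have P: "P = - (?q ** ?p - ?p ** ?q) + rho ?H ?y ?x" unfolding P_def by (rule curv[OF z])
  define e where "e = frechet_derivative E (at z) w *v v - frechet_derivative E (at z) v *v w"
  have e: "e = - (?q *v ?x - ?p *v ?y)" unfolding e_def by (rule torsion[OF z])
  note 1 = curvature_first[OF H_herm[OF z], of b ?q ?x ?p ?y a, folded e P]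
  note 2 = curvature_second[OF H_herm[OF z] ph_skew[OF z, of v] ph_skew[OF z, of w] b, of ?y ?x "T z" a, folded e P]
  note bl = bounded_bilinear.diff_left[OF bounded_bilinear_matrix_vec] bounded_bilinear.diff_right[OF bounded_bilinear_matrix_vec]
    bounded_bilinear.diff_left[OF bounded_bilinear_matrix_mult] bounded_bilinear.diff_right[OF bounded_bilinear_matrix_mult]
  show ?thesis
  proof (rule prod_eqI)
    show "fst (frechet_derivative (\<lambda>z. conn z v s) (at z) w - frechet_derivative (\<lambda>z. conn z w s) (at z) v
     + conn z v (conn z w s) - conn z w (conn z v s)) = fst (0, - rho (kapH (H z) (T z) (fst s) (snd s)) ?y ?x)"
      using 1 unfolding conn_derivative[OF z] ab by (simp add: e_def P_def bl conn_def algebra_simps)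
    have e3: "rho (H z) a e = rho (H z) a (frechet_derivative E (at z) w *v v) - rho (H z) a (frechet_derivative E (at z) v *v w)"
      unfolding e_def by (rule linear_diff[OF linear_rho3])
    show "snd (frechet_derivative (\<lambda>z. conn z v s) (at z) w - frechet_derivative (\<lambda>z. conn z w s) (at z) v
     + conn z v (conn z w s) - conn z w (conn z v s)) = snd (0, - rho (kapH (H z) (T z) (fst s) (snd s)) ?y ?x)"
      using 2 unfolding conn_derivative[OF z] ab e3 by (simp add: P_def bl conn_def algebra_simps)
  qed
qed

end

section \<open>Parallel transport of the kernel\<close>

context frame_data
begin

text \<open>The three algebraic derivative identities, read along a curve over which
  \<open>s\<close> is parallel.\<close>

lemma kappa_curve:
  assumes zt: "zc t \<in> U" and zd: "(zc has_vector_derivative v) (at t within S)"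
    and sd: "(s has_vector_derivative conn (zc t) v (s t)) (at t within S)"
    and skew: "conj_transpose (snd (s t)) = - snd (s t)"
  defines "kH \<equiv> \<lambda>t. kapH (H (zc t)) (T (zc t)) (fst (s t)) (snd (s t))"
    and "kT \<equiv> \<lambda>t. kapT (H (zc t)) (T (zc t)) (V (zc t)) (fst (s t)) (snd (s t))"
    and "kV \<equiv> \<lambda>t. kapV (H (zc t)) (T (zc t)) (fst (s t))"
    and "p \<equiv> ph (zc t) v" and "x \<equiv> E (zc t) *v v" and "h \<equiv> H (zc t)"
  shows "(kH has_vector_derivative (- (p ** kH t) + kH t ** p + outer (kT t) x + outer x (kT t))) (at t within S)"
    and "(kT has_vector_derivative (- (p *v kT t) + (kH t ** h + h ** kH t + mat (trace (kH t)) ** h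
       + mat (trace h) ** kH t + mat (kV t)) *v x)) (at t within S)"
    and "(kV has_vector_derivative (trace (kH t) * (herm (T (zc t)) x + herm x (T (zc t)))
       + trace h * (herm (kT t) x + herm x (kT t)) + (herm (kT t) (h *v x) + herm (T (zc t)) (kH t *v x)
       + herm x (kH t *v T (zc t)) + herm x (h *v kT t)))) (at t within S)"
proof -
  note ch = vector_derivative_diff_chain_within[OF zd has_derivative_at_withinI, unfolded o_def]
  note d = ch[OF dH[OF zt]] ch[OF dT[OF zt]] ch[OF dV[OF zt]]
  have da: "((\<lambda>t. fst (s t)) has_vector_derivative (snd (s t) *v x - p *v fst (s t))) (at t within S)"
    using bounded_linear.has_vector_derivative[OF bounded_linear_fst sd] by (simp add: conn_def x_def p_def)
  have db: "((\<lambda>t. snd (s t)) has_vector_derivative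
      (snd (s t) ** p - p ** snd (s t) - rho h (fst (s t)) x)) (at t within S)"
    using bounded_linear.has_vector_derivative[OF bounded_linear_snd sd] by (simp add: conn_def x_def p_def h_def)
  note bb = bounded_bilinear.has_vector_derivative[OF bounded_bilinear_matrix_vec]
    bounded_bilinear.has_vector_derivative[OF bounded_bilinear_matrix_mult]
    bounded_bilinear.has_vector_derivative[OF bounded_bilinear_herm]
    bounded_bilinear.has_vector_derivative[OF bounded_bilinear_outer]
    bounded_bilinear.has_vector_derivative[OF bounded_bilinear_mult]
    bounded_linear.has_vector_derivative[OF bounded_linear_trace]
    bounded_linear.has_vector_derivative[OF bounded_linear_mat]
    has_vector_derivative_add has_vector_derivative_minus
  note algs = H_herm[OF zt] ph_skew[OF zt, of v] skew
  show "(kH has_vector_derivative (- (p ** kH t) + kH t ** p + outer (kT t) x + outer x (kT t))) (at t within S)"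
    unfolding kH_def kapH_def
    by (rule has_vector_derivative_eq_rhs, (rule bb d da db)+)
       (use kapH_derivative[OF algs, where T = "T (zc t)" and x = x and a = "fst (s t)" and V = "V (zc t)"] in
         \<open>simp add: kH_def kT_def x_def p_def h_def kapH_def[of _ _ "fst (s t)"] algebra_simps\<close>)
  show "(kT has_vector_derivative (- (p *v kT t) + (kH t ** h + h ** kH t + mat (trace (kH t)) ** h
       + mat (trace h) ** kH t + mat (kV t)) *v x)) (at t within S)"
    unfolding kT_def kapT_def
    by (rule has_vector_derivative_eq_rhs, (rule bb d da db)+)
       (use kapT_derivative[OF algs, where T = "T (zc t)" and x = x and a = "fst (s t)" and V = "V (zc t)"] in
         \<open>simp add: kH_def kT_def kV_def x_def p_def h_def kapT_def[of _ _ _ "fst (s t)"] algebra_simps\<close>)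
  show "(kV has_vector_derivative (trace (kH t) * (herm (T (zc t)) x + herm x (T (zc t)))
       + trace h * (herm (kT t) x + herm x (kT t)) + (herm (kT t) (h *v x) + herm (T (zc t)) (kH t *v x)
       + herm x (kH t *v T (zc t)) + herm x (h *v kT t)))) (at t within S)"
    unfolding kV_def kapV_def
    by (rule has_vector_derivative_eq_rhs, (rule bb d da db)+)
       (use kapV_derivative[OF algs, where T = "T (zc t)" and x = x and a = "fst (s t)" and V = "V (zc t)"] in
         \<open>simp add: kH_def kT_def kV_def x_def p_def h_def herm_add_right herm_diff_right algebra_simps\<close>)
qed

text \<open>Uniqueness for linear equations is used twice: first for \<open>b\<close> plus its
  conjugate transpose, from which the term with \<open>rho\<close> drops out since
  \<open>rho\<close> is skew, and then for the triple of \<open>kapH\<close>, \<open>kapT\<close>,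
  \<open>kapV\<close>, whose equation relies on the skewness just obtained.\<close>

lemma ker_line:
  assumes zU: "\<And>t. t \<in> {0..1} \<Longrightarrow> z0 + t *\<^sub>R v \<in> U"
    and sd: "\<And>t. t \<in> {0..1} \<Longrightarrow>
      (s has_vector_derivative conn (z0 + t *\<^sub>R v) v (s t)) (at t within {0..1})"
    and s0: "ker z0 (s 0)" and t: "t \<in> {0..1}"
  shows "ker (z0 + t *\<^sub>R v) (s t)"
proof -
  let ?z = "\<lambda>t. z0 + t *\<^sub>R v"
  have zd: "(?z has_vector_derivative v) (at t within {0..1})" for t
    by (auto intro!: derivative_eq_intros)
  have cz: "continuous_on {0..1} ?z" by (intro continuous_intros)
  have line: "continuous_on {0..1} (\<lambda>t. f (?z t))" if "continuous_on U f" for f :: "_ \<Rightarrow> 'b::topological_space"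
    by (rule continuous_on_compose2[OF that cz]) (use zU in auto)
  have cp: "continuous_on {0..1} (\<lambda>t. ph (?z t) v)" by (rule line[OF smooth_on_continuous_on[OF ph]])
  have cE: "continuous_on {0..1} (\<lambda>t. E (?z t))" by (rule line[OF smooth_on_continuous_on[OF E]])
  have cH: "continuous_on {0..1} (\<lambda>t. H (?z t))" by (rule line[OF smooth_on_continuous_on[OF H]])
  have cT: "continuous_on {0..1} (\<lambda>t. T (?z t))"
    by (rule line) (auto intro!: continuous_at_imp_continuous_on has_derivative_continuous dT)
  note bl = bounded_bilinear.add_left[OF bounded_bilinear_matrix_mult] bounded_bilinear.add_right[OF bounded_bilinear_matrix_mult]
    bounded_bilinear.scaleR_left[OF bounded_bilinear_matrix_mult] bounded_bilinear.scaleR_right[OF bounded_bilinear_matrix_mult]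
    bounded_bilinear.add_left[OF bounded_bilinear_matrix_vec] bounded_bilinear.add_right[OF bounded_bilinear_matrix_vec]
    bounded_bilinear.scaleR_left[OF bounded_bilinear_matrix_vec] bounded_bilinear.scaleR_right[OF bounded_bilinear_matrix_vec]
    bounded_bilinear.add_left[OF bounded_bilinear_outer] bounded_bilinear.add_right[OF bounded_bilinear_outer]
    bounded_bilinear.scaleR_left[OF bounded_bilinear_outer] bounded_bilinear.scaleR_right[OF bounded_bilinear_outer]
    bounded_bilinear.add_left[OF bounded_bilinear_herm] bounded_bilinear.add_right[OF bounded_bilinear_herm]
    bounded_bilinear.scaleR_left[OF bounded_bilinear_herm] bounded_bilinear.scaleR_right[OF bounded_bilinear_herm]
    linear_add[OF bounded_linear.linear[OF bounded_linear_mat]] linear_cmul[OF bounded_linear.linear[OF bounded_linear_mat]]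
    linear_add[OF bounded_linear.linear[OF bounded_linear_trace]] linear_cmul[OF bounded_linear.linear[OF bounded_linear_trace]]
  note bc = bounded_bilinear.continuous_on[OF bounded_bilinear_matrix_mult]
    bounded_bilinear.continuous_on[OF bounded_bilinear_matrix_vec]
    bounded_bilinear.continuous_on[OF bounded_bilinear_outer]
    bounded_bilinear.continuous_on[OF bounded_bilinear_herm]
    bounded_linear.continuous_on[OF bounded_linear_mat] bounded_linear.continuous_on[OF bounded_linear_trace]
  let ?M1 = "\<lambda>t q. q ** ph (?z t) v - ph (?z t) v ** q"
  have skew: "conj_transpose (snd (s t)) = - snd (s t)" if t: "t \<in> {0..1}" for t
  proof -
    have "snd (s t) + conj_transpose (snd (s t)) = 0"
    proof (rule linear_ode_zero[where M = ?M1, OF _ _ _ _ t])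
      fix t :: real assume t: "t \<in> {0..1}"
      let ?p = "ph (?z t) v" and ?x = "E (?z t) *v v" and ?b = "snd (s t)" and ?a = "fst (s t)"
      have db: "((\<lambda>t. snd (s t)) has_vector_derivative (?b ** ?p - ?p ** ?b - rho (H (?z t)) ?a ?x)) (at t within {0..1})"
        using bounded_linear.has_vector_derivative[OF bounded_linear_snd sd[OF t]] by (simp add: conn_def)
      have ct: "conj_transpose (A ** B) = conj_transpose B ** conj_transpose A" for A B :: "complex^'n^'n"
        by (simp add: conj_transpose_def matrix_matrix_mult_def vec_eq_iff mult.commute)
      have cd: "conj_transpose (A - B) = conj_transpose A - conj_transpose B" for A B :: "complex^'n^'n"
        by (simp add: conj_transpose_def vec_eq_iff)
      have mm: "(- A) ** B = - (A ** B)" "A ** (- B) = - (A ** B)" for A B :: "complex^'n^'n"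
        by (simp_all add: matrix_matrix_mult_def vec_eq_iff sum_negf)
      have "conj_transpose (?b ** ?p - ?p ** ?b - rho (H (?z t)) ?a ?x)
          = - (?p ** conj_transpose ?b) + conj_transpose ?b ** ?p + rho (H (?z t)) ?a ?x"
        by (simp add: cd ct ph_skew[OF zU[OF t]] rho_skew[OF H_herm[OF zU[OF t]]] mm)
      then have db': "((\<lambda>t. conj_transpose (snd (s t))) has_vector_derivative
          (- (?p ** conj_transpose ?b) + conj_transpose ?b ** ?p + rho (H (?z t)) ?a ?x)) (at t within {0..1})"
        using bounded_linear.has_vector_derivative[OF bounded_linear_conj_transpose db] by simp
      show "((\<lambda>t. snd (s t) + conj_transpose (snd (s t))) has_vector_derivative
          ?M1 t (?b + conj_transpose ?b)) (at t within {0..1})"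
        by (rule has_vector_derivative_eq_rhs[OF has_vector_derivative_add[OF db db']]) (simp add: bl algebra_simps)
      show "linear (?M1 t)" by (rule linearI) (simp_all add: bl algebra_simps)
    next
      show "continuous_on {0..1} (\<lambda>t. ?M1 t q)" for q by (intro continuous_on_diff bc cp continuous_on_const)
      show "snd (s 0) + conj_transpose (snd (s 0)) = 0" using s0 by (simp add: ker_def)
    qed
    then show ?thesis by (metis add.commute eq_neg_iff_add_eq_0)
  qed
  let ?M2 = "\<lambda>t (kH, kT, kV). (- (ph (?z t) v ** kH) + kH ** ph (?z t) v + outer kT (E (?z t) *v v) + outer (E (?z t) *v v) kT,
     - (ph (?z t) v *v kT) + (kH ** H (?z t) + H (?z t) ** kH + mat (trace kH) ** H (?z t)
       + mat (trace (H (?z t))) ** kH + mat kV) *v (E (?z t) *v v),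
     trace kH * (herm (T (?z t)) (E (?z t) *v v) + herm (E (?z t) *v v) (T (?z t)))
       + trace (H (?z t)) * (herm kT (E (?z t) *v v) + herm (E (?z t) *v v) kT)
       + (herm kT (H (?z t) *v (E (?z t) *v v)) + herm (T (?z t)) (kH *v (E (?z t) *v v))
       + herm (E (?z t) *v v) (kH *v T (?z t)) + herm (E (?z t) *v v) (H (?z t) *v kT)))"
  let ?k = "\<lambda>t. (kapH (H (?z t)) (T (?z t)) (fst (s t)) (snd (s t)),
     kapT (H (?z t)) (T (?z t)) (V (?z t)) (fst (s t)) (snd (s t)), kapV (H (?z t)) (T (?z t)) (fst (s t)))"
  have "?k t = 0"
  proof (rule linear_ode_zero[where M = ?M2, OF _ _ _ _ t])
    fix t :: real assume t: "t \<in> {0..1}"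
    show "(?k has_vector_derivative ?M2 t (?k t)) (at t within {0..1})"
      unfolding prod.case
      by (intro has_vector_derivative_Pair kappa_curve[OF zU[OF t] zd sd[OF t] skew[OF t]])
    show "linear (?M2 t)"
      by (rule linearI) (auto simp: bl algebra_simps)
  next
    show "continuous_on {0..1} (\<lambda>t. ?M2 t q)" for q
      by (cases q; simp only: prod.case)
         (intro continuous_on_Pair continuous_on_add continuous_on_minus continuous_on_mult bc cp cE cH cT continuous_on_const)
    show "?k 0 = 0" using s0 by (simp add: ker_def zero_prod_def)
  qed
  then show ?thesis using skew[OF t] by (simp add: ker_def zero_prod_def)
qed

lemma conn_bound:
  assumes "cball z0 r \<subseteq> U"
  obtains C where "C \<ge> 0" "\<And>z v s. z \<in> cball z0 r \<Longrightarrow> norm (conn z v s) \<le> C * norm v * norm s"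
proof -
  have ex: "\<exists>C. \<forall>z\<in>cball z0 r. \<forall>z'\<in>cball z0 r. norm (conn z v s - 0) \<le> C * (1::real)" for v s
  proof -
    have "compact ((\<lambda>z. conn z v s) ` cball z0 r)"
      by (intro compact_continuous_image continuous_on_subset[OF smooth_on_continuous_on[OF conn_smooth] assms]) simp
    then obtain C where "\<And>y. y \<in> (\<lambda>z. conn z v s) ` cball z0 r \<Longrightarrow> norm y \<le> C"
      using compact_imp_bounded bounded_iff by metis
    then show ?thesis by (intro exI[of _ C]) auto
  qed
  have bil: "bilinear (conn z)" if "z \<in> cball z0 r" for z using conn_bilinear that assms by blast
  obtain C where "C \<ge> 0" "\<And>z z' v s. \<lbrakk>z \<in> cball z0 r; z' \<in> cball z0 r\<rbrakk> \<Longrightarrow> norm (conn z v s - 0) \<le> C * 1 * norm v * norm s"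
    by (rule bilinear_family_bound[of "cball z0 r" conn "\<lambda>z z' v e. 0" "\<lambda>_ _. 1", OF bil ex bilinear_zero]) auto
  then show ?thesis using that[of C] by simp
qed

text \<open>Solutions along rays started at \<open>s0\<close> stay in the kernel, where
  \<open>kapH = 0\<close>, so the curvature there is \<open>rho\<close> formed with the zero matrix.
  This is the flatness that \<open>flat_section_exists\<close> asks for.\<close>

lemma ker_section_exists:
  assumes "cball z0 r \<subseteq> U" "r > 0"
    and C: "\<And>z v s. z \<in> cball z0 r \<Longrightarrow> norm (conn z v s) \<le> C * norm v * norm s" "C * r \<le> 1 / 2" "C \<ge> 0"
    and s0: "ker z0 s0"
  obtains s where "s z0 = s0" "\<And>z. z \<in> ball z0 r \<Longrightarrow> (s has_derivative (\<lambda>v. conn z v (s z))) (at z)"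
    "\<And>z. z \<in> ball z0 r \<Longrightarrow> ker z (s z)"
proof -
  have inU: "z0 + t *\<^sub>R v \<in> U" if "norm v < r" "t \<in> {0..1}" for t v
  proof -
    have "norm (t *\<^sub>R v) \<le> 1 * norm v" unfolding norm_scaleR using that by (intro mult_right_mono) auto
    then have "norm (t *\<^sub>R v) \<le> r" using that(1) by linarith
    moreover have "dist (z0 + t *\<^sub>R v) z0 = norm (t *\<^sub>R v)" by (simp only: dist_norm add_diff_cancel_left')
    ultimately have "z0 + t *\<^sub>R v \<in> cball z0 r" by (simp only: mem_cball dist_commute[of z0])
    then show ?thesis using assms(1) by blast
  qed
  obtain s where s: "s z0 = s0" "\<And>z. z \<in> ball z0 r \<Longrightarrow> (s has_derivative (\<lambda>v. conn z v (s z))) (at z)"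
  proof (rule flat_section_exists[OF U assms(1,2) conn_smooth conn_bilinear C])
    fix v y t w
    assume v: "norm v < r" and y0: "y 0 = s0" and t: "t \<in> {0..1 :: real}"
      and y: "\<And>t. t \<in> {0..1} \<Longrightarrow> (y has_vector_derivative conn (z0 + t *\<^sub>R v) v (y t)) (at t within {0..1})"
    have k: "ker (z0 + t *\<^sub>R v) (y t)"
      by (rule ker_line[OF inU[OF v] y _ t]) (use y0 s0 in auto)
    have "rho 0 a x = 0" for a x by (rule linear_0[OF linear_rho1])
    then show "frechet_derivative (\<lambda>z. conn z v (y t)) (at (z0 + t *\<^sub>R v)) w
        - frechet_derivative (\<lambda>z. conn z w (y t)) (at (z0 + t *\<^sub>R v)) v
        + conn (z0 + t *\<^sub>R v) v (conn (z0 + t *\<^sub>R v) w (y t))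
        - conn (z0 + t *\<^sub>R v) w (conn (z0 + t *\<^sub>R v) v (y t)) = 0"
      using conn_curvature[OF inU[OF v t], of "y t"] k by (simp add: ker_def zero_prod_def)
  qed auto
  moreover have "ker z (s z)" if z: "z \<in> ball z0 r" for z
  proof -
    define v where "v = z - z0"
    have v: "norm v < r" using z by (simp add: v_def dist_norm norm_minus_commute)
    have inb: "z0 + t *\<^sub>R v \<in> ball z0 r" if "t \<in> {0..1}" for t
    proof -
      have "norm (t *\<^sub>R v) \<le> 1 * norm v" unfolding norm_scaleR using that by (intro mult_right_mono) auto
      then have "norm (t *\<^sub>R v) < r" using v by linarith
      moreover have "dist (z0 + t *\<^sub>R v) z0 = norm (t *\<^sub>R v)" by (simp only: dist_norm add_diff_cancel_left')
      ultimately show ?thesis by (simp only: mem_ball dist_commute[of z0])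
    qed
    have "ker (z0 + 1 *\<^sub>R v) (s (z0 + 1 *\<^sub>R v))"
    proof (rule ker_line[where s = "\<lambda>t. s (z0 + t *\<^sub>R v)", OF inU[OF v]])
      fix t :: real assume t: "t \<in> {0..1}"
      have "((\<lambda>t. z0 + t *\<^sub>R v) has_vector_derivative v) (at t within {0..1})"
        by (auto intro!: derivative_eq_intros)
      from vector_derivative_diff_chain_within[OF this has_derivative_at_withinI[OF s(2)[OF inb[OF t]]]]
      show "((\<lambda>t. s (z0 + t *\<^sub>R v)) has_vector_derivative conn (z0 + t *\<^sub>R v) v (s (z0 + t *\<^sub>R v))) (at t within {0..1})"
        by (simp add: o_def)
    qed (use s(1) s0 in auto)
    then show ?thesis by (simp add: v_def)
  qed
  ultimately show ?thesis using that by blast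
qed

end

lemma smooth_on_linear_family_apply:
  fixes A :: "'a::real_normed_vector \<Rightarrow> 'e::euclidean_space \<Rightarrow> 'f::real_normed_vector"
  assumes "open S" "\<And>e. smooth_on S (\<lambda>z. A z e)" "\<And>z. z \<in> S \<Longrightarrow> linear (A z)" "smooth_on S \<xi>"
  shows "smooth_on S (\<lambda>z. A z (\<xi> z))"
proof (rule smooth_on_cong[OF assms(1)])
  show "(\<Sum>b\<in>Basis. (\<xi> z \<bullet> b) *\<^sub>R A z b) = A z (\<xi> z)" if "z \<in> S" for z
    using linear_Basis_expansion[OF assms(3)[OF that]] by metis
  show "smooth_on S (\<lambda>z. \<Sum>b\<in>Basis. (\<xi> z \<bullet> b) *\<^sub>R A z b)"
    by (intro smooth_on_sum smooth_on_scaleR assms(1,2)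
        smooth_on_bounded_linear[OF bounded_linear_inner_left assms(1,4)])
qed

lemma smooth_on_frechet_apply:
  fixes f :: "'a::euclidean_space \<Rightarrow> 'f::real_normed_vector"
  assumes "open S" "smooth_on S f" "smooth_on S \<xi>"
  shows "smooth_on S (\<lambda>z. frechet_derivative f (at z) (\<xi> z))"
  by (rule smooth_on_linear_family_apply[OF assms(1) smooth_on_frechet_derivative[OF assms(2)] _ assms(3)])
     (rule smooth_on_linear_frechet[OF assms(2)])

lemma kapH_hermitian:
  assumes H: "conj_transpose H = H" and b: "conj_transpose b = - b"
  shows "conj_transpose (kapH H T a b) = kapH H T a b"
  by (rule conj_transpose_eqI)
     (simp add: kapH_def vec_expand herm_expand herm_hermitian[OF H] herm_skew[OF b] cnj_herm; simp add: algebra_simps)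

lemma skew_inner: "conj_transpose b = - b \<Longrightarrow> (b *v x) \<bullet> y + x \<bullet> (b *v y) = 0"
  by (simp add: inner_eq_Re_herm herm_skew)

lemma has_vector_derivative_line:
  fixes z w :: "'a::real_normed_vector"
  assumes "(f has_derivative D) (at z)"
  shows "((\<lambda>t. f (z + t *\<^sub>R w)) has_vector_derivative D w) (at (0::real))"
proof -
  have "((\<lambda>t. z + t *\<^sub>R w) has_vector_derivative w) (at (0::real))"
    by (auto intro!: derivative_eq_intros)
  moreover have "(f has_derivative D) (at (z + 0 *\<^sub>R w) within range (\<lambda>t. z + t *\<^sub>R w))"
    using has_derivative_at_withinI[OF assms] by simp
  ultimately show ?thesis using vector_derivative_diff_chain_within by (force simp: o_def)
qed

section \<open>Killing fields as parallel sections of the kernel\<close>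

context frame_data
begin

definition jac :: "(complex^'n \<Rightarrow> complex^'n) \<Rightarrow> complex^'n \<Rightarrow> complex^'n^'n"
  where "jac \<xi> z = (\<chi> i j. frechet_derivative \<xi> (at z) (axis j 1) $ i)"

text \<open>The values of \<omega> and \<phi> on the lift of \<xi> to the coframe bundle. In the
  second component, \<open>ph z (\<xi> z)\<close> comes from the part of the lift tangent to the
  frame section; the other summand is its vertical part, the matrix by which the Lie derivative
  along \<xi> acts on the coframe \<open>E dz\<close>.\<close>

definition sec :: "(complex^'n \<Rightarrow> complex^'n) \<Rightarrow> complex^'n \<Rightarrow> (complex^'n) \<times> (complex^'n^'n)"
  where "sec \<xi> z = (E z *v \<xi> z, (frechet_derivative E (at z) (\<xi> z) + E z ** jac \<xi> z) ** F z + ph z (\<xi> z))"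

lemma E_F_vec: "z \<in> U \<Longrightarrow> E z *v (F z *v x) = x" "z \<in> U \<Longrightarrow> F z *v (E z *v x) = x"
  by (simp_all add: matrix_vector_mul_assoc EF FE)

lemma B_derivative:
  assumes z: "z \<in> U" and L: "\<And>a v. L (a *s v) = a *s L v"
  shows "frechet_derivative (\<lambda>z. B z v w) (at z) u + B z (L v) w + B z v (L w)
     = (frechet_derivative E (at z) u *v v + E z *v L v) \<bullet> (E z *v (- \<i> *s w))
     + (E z *v v) \<bullet> (frechet_derivative E (at z) u *v (- \<i> *s w) + E z *v L (- \<i> *s w))"
proof -
  have Beq: "B z v w = (E z *v v) \<bullet> (E z *v (- \<i> *s w))" if "z \<in> U" for z v w
    using B[OF that, of v "- \<i> *s w"] by simp
  have dE: "((\<lambda>z. E z *v v) has_derivative (\<lambda>u. frechet_derivative E (at z) u *v v)) (at z)" for v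
    by (rule bounded_linear.has_derivative[OF bounded_bilinear.bounded_linear_left[OF bounded_bilinear_matrix_vec]
          E_derivative[OF z]])
  have "frechet_derivative (\<lambda>z. B z v w) (at z)
      = frechet_derivative (\<lambda>z. (E z *v v) \<bullet> (E z *v (- \<i> *s w))) (at z)"
    by (rule frechet_derivative_cong[OF U z Beq])
  also have "\<dots> = (\<lambda>u. (E z *v v) \<bullet> (frechet_derivative E (at z) u *v (- \<i> *s w))
      + (frechet_derivative E (at z) u *v v) \<bullet> (E z *v (- \<i> *s w)))"
    by (rule frechet_derivative_eqI[OF has_derivative_inner[OF dE dE]])
  finally show ?thesis
    by (simp only: Beq[OF z] L inner_add_left inner_add_right)
qed

text \<open>By the torsion equation, the first half of parallelism says that the Lie derivative of
  the coframe along \<xi> is the coframe multiplied by \<open>snd (s z) - ph z (\<xi> z)\<close>.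
  This matrix is skew, so the metric, and with it \<open>B\<close>, has Lie derivative 0.\<close>

lemma killing_of_section:
  assumes N: "open N" "N \<subseteq> U" and s: "\<And>z. z \<in> N \<Longrightarrow> (s has_derivative (\<lambda>v. conn z v (s z))) (at z)"
    and skew: "\<And>z. z \<in> N \<Longrightarrow> conj_transpose (snd (s z)) = - snd (s z)"
  defines "\<xi> \<equiv> \<lambda>z. F z *v fst (s z)"
  shows "killing_on B N \<xi>" "\<And>z. z \<in> N \<Longrightarrow> sec \<xi> z = s z"
proof -
  have sN: "smooth_on N s" by (rule flat_section_smooth[OF N U conn_smooth conn_bilinear s])
  have xN: "smooth_on N \<xi>"
    unfolding \<xi>_def by (intro smooth_intros N smooth_on_bounded_linear[OF bounded_linear_fst] smooth_on_subset[OF F] sN)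
  let ?D = "\<lambda>z. frechet_derivative \<xi> (at z)" and ?DE = "\<lambda>z. frechet_derivative E (at z)"
  have Ex: "E z *v \<xi> z = fst (s z)" if "z \<in> N" for z using that N by (auto simp: \<xi>_def E_F_vec)
  \<comment> \<open>The product rule for \<open>E z *v \<xi> z\<close> is compared with the parallel
    equation; torsion exchanges \<open>v\<close> and \<open>\<xi> z\<close> in the derivative of
    \<open>E\<close>.\<close>
  have key: "E z *v ?D z v = ((snd (s z) - ph z (\<xi> z)) ** E z - ?DE z (\<xi> z)) *v v" if z: "z \<in> N" for z v
  proof -
    have zU: "z \<in> U" using z N by blast
    have d1: "((\<lambda>z. E z *v \<xi> z) has_derivative (\<lambda>v. E z *v ?D z v + ?DE z v *v \<xi> z)) (at z)"
      by (rule bounded_bilinear.FDERIV[OF bounded_bilinear_matrix_vec E_derivative[OF zU] smooth_on_has_derivative[OF xN z]])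
    have d2: "((\<lambda>z. E z *v \<xi> z) has_derivative (\<lambda>v. fst (conn z v (s z)))) (at z)"
      by (rule has_derivative_transform_within_open[OF has_derivative_fst[OF s[OF z]] N(1) z]) (simp add: Ex)
    have "E z *v ?D z v + ?DE z v *v \<xi> z = fst (conn z v (s z))"
      by (rule fun_cong[OF has_derivative_unique[OF d1 d2]])
    moreover have "?DE z v *v \<xi> z - ?DE z (\<xi> z) *v v = - (ph z v *v (E z *v \<xi> z) - ph z (\<xi> z) *v (E z *v v))"
      by (rule torsion[OF zU])
    ultimately have "E z *v ?D z v = snd (s z) *v (E z *v v) - ph z v *v fst (s z)
        + (ph z v *v (E z *v \<xi> z) - ph z (\<xi> z) *v (E z *v v)) - ?DE z (\<xi> z) *v v"
    proof -
      have "x + y = k \<Longrightarrow> y - d = - t \<Longrightarrow> x = k + t - d" for x y k d t :: "complex^'n"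
        by (auto simp: algebra_simps)
      then show "\<lbrakk>E z *v ?D z v + ?DE z v *v \<xi> z = fst (conn z v (s z));
          ?DE z v *v \<xi> z - ?DE z (\<xi> z) *v v = - (ph z v *v (E z *v \<xi> z) - ph z (\<xi> z) *v (E z *v v))\<rbrakk>
        \<Longrightarrow> ?thesis" unfolding conn_def fst_conv .
    qed
    then show ?thesis by (simp add: Ex[OF z] vec_expand)
  qed
  have D: "?D z v = (F z ** ((snd (s z) - ph z (\<xi> z)) ** E z - ?DE z (\<xi> z))) *v v" if z: "z \<in> N" for z v
  proof -
    have "z \<in> U" using z N by blast
    then show ?thesis using arg_cong[OF key[OF z, of v], of "\<lambda>y. F z *v y"]
      by (simp only: E_F_vec(2) matrix_vector_mul_assoc[symmetric])
  qed
  have Dc: "?D z (a *s v) = a *s ?D z v" if "z \<in> N" for z a v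
    by (simp add: D[OF that] vector_scalar_commute)
  show "killing_on B N \<xi>"
    unfolding killing_on_def
  proof (intro conjI ballI allI N(1) xN Dc)
    fix z v w assume z: "z \<in> N"
    have zU: "z \<in> U" using z N by blast
    have S: "conj_transpose (snd (s z) - ph z (\<xi> z)) = - (snd (s z) - ph z (\<xi> z))"
      using skew[OF z] ph_skew[OF zU, of "\<xi> z"] by (simp add: conj_transpose_def vec_eq_iff)
    have e: "?DE z (\<xi> z) *v v + E z *v ?D z v = (snd (s z) - ph z (\<xi> z)) *v (E z *v v)" for v
      by (simp add: key[OF z] vec_expand)
    show "frechet_derivative (\<lambda>z. B z v w) (at z) (\<xi> z) + B z (?D z v) w + B z v (?D z w) = 0"
      unfolding B_derivative[OF zU Dc[OF z], where u = "\<xi> z"] e by (rule skew_inner[OF S])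
  qed
  show "sec \<xi> z = s z" if z: "z \<in> N" for z
  proof -
    have zU: "z \<in> U" using z N by blast
    have "jac \<xi> z *v v = ?D z v" for v
      unfolding jac_def by (rule linear_components_vec[symmetric])
        (use smooth_on_linear_frechet[OF xN z] Dc[OF z] in auto)
    then have "E z ** jac \<xi> z = (snd (s z) - ph z (\<xi> z)) ** E z - ?DE z (\<xi> z)"
      by (intro matrix_eq_complex) (simp add: key[OF z] flip: matrix_vector_mul_assoc)
    then have "(?DE z (\<xi> z) + E z ** jac \<xi> z) ** F z = (snd (s z) - ph z (\<xi> z)) ** (E z ** F z)"
      by (simp add: matrix_mul_assoc)
    then show ?thesis by (simp add: sec_def Ex[OF z] EF[OF zU])
  qed
qed

text \<open>Prolongation: equality of mixed derivatives of \<open>a\<close> gives the equation for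
  \<open>b\<close>, that of \<open>(a, b)\<close> gives \<open>kapH = 0\<close>, and differentiating
  this relation successively yields \<open>kapT = 0\<close> and \<open>kapV = 0\<close>.\<close>

lemma section_of_killing:
  assumes kill: "killing_on B N \<xi>" and NU: "N \<subseteq> U"
  shows "\<And>z. z \<in> N \<Longrightarrow> (sec \<xi> has_derivative (\<lambda>v. conn z v (sec \<xi> z))) (at z)"
    and "\<And>z. z \<in> N \<Longrightarrow> ker z (sec \<xi> z)"
proof -
  let ?D = "\<lambda>z. frechet_derivative \<xi> (at z)" and ?DE = "\<lambda>z. frechet_derivative E (at z)"
  have N: "open N" and xN: "smooth_on N \<xi>" and Dc: "\<And>z a v. z \<in> N \<Longrightarrow> ?D z (a *s v) = a *s ?D z v"
    and L: "\<And>z v w. z \<in> N \<Longrightarrow> frechet_derivative (\<lambda>z. B z v w) (at z) (\<xi> z) + B z (?D z v) w + B z v (?D z w) = 0"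
    using kill by (auto simp: killing_on_def)
  have EN: "smooth_on N E" and FN: "smooth_on N F" and phN: "smooth_on N (\<lambda>z. ph z v)" for v
    by (rule smooth_on_subset[OF _ NU], rule E F ph)+
  define a b where "a z = fst (sec \<xi> z)" and "b z = snd (sec \<xi> z)" for z
  have a: "a z = E z *v \<xi> z" for z by (simp add: a_def sec_def)
  have jac: "jac \<xi> z *v v = ?D z v" if "z \<in> N" for z v
    unfolding jac_def by (rule linear_components_vec[symmetric])
      (use smooth_on_linear_frechet[OF xN that] Dc[OF that] in auto)
  have bE: "b z *v (E z *v v) = ?DE z (\<xi> z) *v v + E z *v ?D z v + ph z (\<xi> z) *v (E z *v v)" if "z \<in> N" for z v
    using that NU by (simp add: b_def sec_def vec_expand E_F_vec jac subset_iff)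
  have aN: "smooth_on N a" unfolding a by (intro smooth_intros N EN xN)
  have bN: "smooth_on N b"
    unfolding b_def sec_def snd_conv jac_def
    by (intro smooth_intros N FN EN smooth_on_frechet_apply xN smooth_on_vec_lambda smooth_on_vec_nth
        smooth_on_frechet_derivative smooth_on_linear_family_apply[OF N phN]) (use ph_linear NU in auto)
  have Da: "(a has_derivative (\<lambda>v. b z *v (E z *v v) - ph z v *v a z)) (at z)" if z: "z \<in> N" for z
  proof (rule has_derivative_eq_rhs)
    have zU: "z \<in> U" using z NU by blast
    show "(a has_derivative (\<lambda>v. E z *v ?D z v + ?DE z v *v \<xi> z)) (at z)"
      unfolding a
      by (rule bounded_bilinear.FDERIV[OF bounded_bilinear_matrix_vec E_derivative[OF zU] smooth_on_has_derivative[OF xN z]])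
    show "(\<lambda>v. E z *v ?D z v + ?DE z v *v \<xi> z) = (\<lambda>v. b z *v (E z *v v) - ph z v *v a z)"
    proof
      fix v
      have "?DE z v *v \<xi> z - ?DE z (\<xi> z) *v v = - (ph z v *v (E z *v \<xi> z) - ph z (\<xi> z) *v (E z *v v))"
        by (rule torsion[OF zU])
      then show "E z *v ?D z v + ?DE z v *v \<xi> z = b z *v (E z *v v) - ph z v *v a z"
        unfolding bE[OF z] a by (simp add: algebra_simps)
    qed
  qed
  have skew: "conj_transpose (b z) = - b z" if z: "z \<in> N" for z
  proof -
    have zU: "z \<in> U" using z NU by blast
    \<comment> \<open>The infinitesimal rotation of the coframe along \<xi>. The Killing equation
      first gives the real part of its skewness; replacing \<open>y\<close> by
      \<open>\<i> *s y\<close> adds the imaginary part.\<close>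
    define \<beta> where "\<beta> = b z - ph z (\<xi> z)"
    have re: "(\<beta> *v x) \<bullet> y + x \<bullet> (\<beta> *v y) = 0" for x y
    proof -
      have \<beta>E: "\<beta> *v (E z *v v) = ?DE z (\<xi> z) *v v + E z *v ?D z v" for v
        by (simp add: \<beta>_def vec_expand bE[OF z])
      have "0 = (\<beta> *v (E z *v (F z *v x))) \<bullet> (E z *v (F z *v y)) + (E z *v (F z *v x)) \<bullet> (\<beta> *v (E z *v (F z *v y)))"
        using L[OF z, of "F z *v x" "\<i> *s (F z *v y)"] unfolding B_derivative[OF zU Dc[OF z], where u = "\<xi> z"] \<beta>E by simp
      then show ?thesis by (simp add: E_F_vec[OF zU])
    qed
    have "conj_transpose \<beta> = - \<beta>"
    proof (rule conj_transpose_eqI)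
      fix x y
      have "Re (herm (\<beta> *v x) y + herm x (\<beta> *v y)) = 0" for x y using re[of x y] by (simp add: inner_eq_Re_herm)
      from this[of x y] this[of x "\<i> *s y"] have "herm (\<beta> *v x) y + herm x (\<beta> *v y) = 0"
        by (simp add: vector_scalar_commute herm_expand complex_eq_iff)
      then show "herm (\<beta> *v x) y = herm x (- \<beta> *v y)"
        by (simp add: uminus_matrix_mult_vec herm_expand add_eq_0_iff2)
    qed
    then show ?thesis
      using ph_skew[OF zU, of "\<xi> z"] unfolding \<beta>_def by (simp add: conj_transpose_def vec_eq_iff)
  qed
  let ?Db = "\<lambda>z. frechet_derivative b (at z)"
  have Db: "?Db z w = b z ** ph z w - ph z w ** b z - rho (H z) (a z) (E z *v w)" if z: "z \<in> N" for z w
  proof -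
    have zU: "z \<in> U" using z NU by blast
    \<comment> \<open>The defect in the equation for \<open>b\<close>. Its values are skew, since
      \<open>b\<close> and the right-hand side are, and it is symmetric by the equality of mixed
      derivatives of \<open>a\<close>. So it lies in the first prolongation of u(n), which is
      zero.\<close>
    define c where "c w = ?Db z w - (b z ** ph z w - ph z w ** b z - rho (H z) (a z) (E z *v w))" for w
    have sym: "c w *v (E z *v v) = c v *v (E z *v w)" for v w
    proof -
      have 2: "frechet_derivative (\<lambda>y. frechet_derivative a (at y) v) (at z) w
         = ?Db z w *v (E z *v v) + b z *v (?DE z w *v v)
           - (frechet_derivative (\<lambda>z. ph z v) (at z) w *v a z + ph z v *v (b z *v (E z *v w) - ph z w *v a z))" for v w
      proof -
        have "frechet_derivative (\<lambda>y. frechet_derivative a (at y) v) (at z)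
            = frechet_derivative (\<lambda>z. b z *v (E z *v v) - ph z v *v a z) (at z)"
          by (rule frechet_derivative_cong[OF N z]) (simp add: frechet_derivative_eqI[OF Da])
        also have "\<dots> = (\<lambda>w. (b z *v (?DE z w *v v) + ?Db z w *v (E z *v v))
            - (ph z v *v (b z *v (E z *v w) - ph z w *v a z) + frechet_derivative (\<lambda>z. ph z v) (at z) w *v a z))"
          by (rule frechet_derivative_eqI)
             (intro has_derivative_diff bounded_bilinear.FDERIV[OF bounded_bilinear_matrix_vec]
               smooth_on_has_derivative[OF bN z] ph_derivative[OF zU] Da[OF z]
               bounded_linear.has_derivative[OF bounded_bilinear.bounded_linear_left[OF bounded_bilinear_matrix_vec] E_derivative[OF zU]])
        finally show ?thesis by (simp add: algebra_simps)
      qed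
      note bl = bounded_bilinear.diff_left[OF bounded_bilinear_matrix_vec] bounded_bilinear.diff_right[OF bounded_bilinear_matrix_vec]
      define e where "e = ?DE z w *v v - ?DE z v *v w"
      define P where "P = frechet_derivative (\<lambda>z. ph z v) (at z) w - frechet_derivative (\<lambda>z. ph z w) (at z) v"
      have 0: "?Db z w *v (E z *v v) - ?Db z v *v (E z *v w) + b z *v e - P *v a z
          - ph z v *v (b z *v (E z *v w) - ph z w *v a z) + ph z w *v (b z *v (E z *v v) - ph z v *v a z) = 0"
        using smooth_on_symmetric_second_derivative[OF aN N z, of v w] unfolding 2 e_def P_def
        by (simp add: bl algebra_simps)
      have e: "e = - (ph z w *v (E z *v v) - ph z v *v (E z *v w))" unfolding e_def by (rule torsion[OF zU])
      have P: "P = - (ph z w ** ph z v - ph z v ** ph z w) + rho (H z) (E z *v w) (E z *v v)"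
        unfolding P_def by (rule curv[OF zU])
      have bi: "rho (H z) (a z) (E z *v w) *v (E z *v v)
          = rho (H z) (a z) (E z *v v) *v (E z *v w) - rho (H z) (E z *v w) (E z *v v) *v a z"
        using rho_Bianchi[OF H_herm[OF zU], of "E z *v w" "E z *v v" "a z"] rho_swap[of "H z" "E z *v v" "a z"]
        by (simp add: uminus_matrix_mult_vec algebra_simps)
      have "c w *v (E z *v v) - c v *v (E z *v w) = ?Db z w *v (E z *v v) - ?Db z v *v (E z *v w) + b z *v e - P *v a z
          - ph z v *v (b z *v (E z *v w) - ph z w *v a z) + ph z w *v (b z *v (E z *v v) - ph z v *v a z)"
        unfolding c_def e P by (simp add: vec_expand bi)
      then show ?thesis unfolding 0 by simp
    qed
    have skc: "conj_transpose (c w) = - c w" for w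
    proof -
      have "((\<lambda>z. - b z) has_derivative (\<lambda>w. conj_transpose (?Db z w))) (at z)"
        by (rule has_derivative_transform_within_open[OF bounded_linear.has_derivative[OF
                bounded_linear_conj_transpose smooth_on_has_derivative[OF bN z]] N z]) (rule skew)
      from fun_cong[OF has_derivative_unique[OF this has_derivative_minus[OF smooth_on_has_derivative[OF bN z]]]]
      have 1: "conj_transpose (?Db z w) = - ?Db z w" .
      have ct: "conj_transpose (A ** B) = conj_transpose B ** conj_transpose A" for A B :: "complex^'n^'n"
        by (simp add: conj_transpose_def matrix_matrix_mult_def vec_eq_iff mult.commute)
      have cd: "conj_transpose (A - B) = conj_transpose A - conj_transpose B" for A B :: "complex^'n^'n"
        by (simp add: conj_transpose_def vec_eq_iff)
      have mm: "(- A) ** B = - (A ** B)" "A ** (- B) = - (A ** B)" for A B :: "complex^'n^'n"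
        by (simp_all add: matrix_matrix_mult_def vec_eq_iff sum_negf)
      show ?thesis
        unfolding c_def by (simp add: cd ct 1 mm skew[OF z] ph_skew[OF zU] rho_skew[OF H_herm[OF zU]])
    qed
    have "c (F z *v x) = 0" for x
    proof (rule skew_symmetric_zero[of "\<lambda>x. c (F z *v x)"])
      show "c (F z *v x) *v y = c (F z *v y) *v x" for x y
        using sym[of "F z *v x" "F z *v y"] by (simp add: E_F_vec[OF zU])
    qed (rule skc)
    from this[of "E z *v w"] have "c w = 0" by (simp add: E_F_vec[OF zU])
    then show ?thesis by (simp add: c_def)
  qed
  have ab: "sec \<xi> z = (a z, b z)" for z by (simp add: a_def b_def)
  show ds: "(sec \<xi> has_derivative (\<lambda>v. conn z v (sec \<xi> z))) (at z)" if z: "z \<in> N" for z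
  proof -
    have "((\<lambda>z. (a z, b z)) has_derivative (\<lambda>v. (b z *v (E z *v v) - ph z v *v a z, ?Db z v))) (at z)"
      by (intro has_derivative_Pair Da[OF z] smooth_on_has_derivative[OF bN z])
    then show ?thesis unfolding ab[abs_def] conn_def by (simp add: Db[OF z])
  qed
  have sN: "smooth_on N (sec \<xi>)" unfolding ab[abs_def] by (intro smooth_on_Pair N aN bN)
  have line: "((\<lambda>t. z + t *\<^sub>R w) has_vector_derivative w) (at (0::real))" for z w
    by (auto intro!: derivative_eq_intros)
  have lineN: "\<exists>S. open S \<and> (0::real) \<in> S \<and> (\<forall>t\<in>S. z + t *\<^sub>R w \<in> N)" if "z \<in> N" for z w
  proof -
    have "open ((\<lambda>t::real. z + t *\<^sub>R w) -` N)"
      by (rule open_vimage[OF N]) (intro continuous_intros)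
    then show ?thesis using that by (intro exI[of _ "(\<lambda>t. z + t *\<^sub>R w) -` N"]) auto
  qed
  \<comment> \<open>Mixed derivatives of \<open>sec \<xi>\<close> agree, so the curvature of
    \<open>conn\<close> vanishes on its value in all directions. As \<open>E z\<close> is
    invertible, \<open>rho\<close> formed with \<open>kapH\<close> vanishes on all
    arguments.\<close>
  have kH: "kapH (H z) (T z) (a z) (b z) = 0" if z: "z \<in> N" for z
  proof (rule rho_zero_imp)
    have zU: "z \<in> U" using z NU by blast
    show "conj_transpose (kapH (H z) (T z) (a z) (b z)) = kapH (H z) (T z) (a z) (b z)"
      by (rule kapH_hermitian[OF H_herm[OF zU] skew[OF z]])
    fix x y
    have D2: "frechet_derivative (\<lambda>y. frechet_derivative (sec \<xi>) (at y) v) (at z) w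
        = frechet_derivative (\<lambda>z'. conn z' v (sec \<xi> z)) (at z) w + conn z v (conn z w (sec \<xi> z))" for v w
    proof -
      from lineN[OF z, of w] obtain S where S: "open S" "(0::real) \<in> S" "\<forall>t\<in>S. z + t *\<^sub>R w \<in> N"
        by (elim exE conjE)
      have at0: "at 0 within S = at 0" by (rule at_within_open[OF S(2,1)])
      have lin: "linear (conn y v)" if "y \<in> U" for y using conn_bilinear[OF that] by (simp add: bilinear_def)
      have "((\<lambda>t. conn (z + t *\<^sub>R w) v (sec \<xi> (z + t *\<^sub>R w))) has_vector_derivative
          frechet_derivative (\<lambda>z'. conn z' v (sec \<xi> (z + 0 *\<^sub>R w))) (at (z + 0 *\<^sub>R w)) w
            + conn (z + 0 *\<^sub>R w) v (conn z w (sec \<xi> z))) (at 0 within S)"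
      proof (rule linear_family_curve_derivative[OF U _ conn_smooth lin])
        show "((\<lambda>t. z + t *\<^sub>R w) has_vector_derivative w) (at 0 within S)" unfolding at0 by (rule line)
        show "((\<lambda>t. sec \<xi> (z + t *\<^sub>R w)) has_vector_derivative conn z w (sec \<xi> z)) (at 0 within S)"
          unfolding at0 by (rule has_vector_derivative_line[OF ds[OF z]])
        show "z + s *\<^sub>R w \<in> U" if "s \<in> S" for s using bspec[OF S(3) that] NU by (rule subsetD[rotated])
      qed (use zU S(2) in simp_all)
      then have "((\<lambda>t. conn (z + t *\<^sub>R w) v (sec \<xi> (z + t *\<^sub>R w))) has_vector_derivative
          frechet_derivative (\<lambda>z'. conn z' v (sec \<xi> z)) (at z) w + conn z v (conn z w (sec \<xi> z))) (at 0)"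
        unfolding at0 by simp
      then have "((\<lambda>t. frechet_derivative (sec \<xi>) (at (z + t *\<^sub>R w)) v) has_vector_derivative
          frechet_derivative (\<lambda>z'. conn z' v (sec \<xi> z)) (at z) w + conn z v (conn z w (sec \<xi> z))) (at 0)"
        by (rule has_vector_derivative_transform_within_open[OF _ S(1,2)])
           (use S(3) in \<open>simp add: frechet_derivative_eqI[OF ds]\<close>)
      then show ?thesis
        by (rule vector_derivative_unique_at[rotated])
           (rule has_vector_derivative_line[OF smooth_on_has_derivative[OF smooth_on_frechet_derivative[OF sN] z]])
    qed
    have "(0 :: complex^'n, - rho (kapH (H z) (T z) (fst (sec \<xi> z)) (snd (sec \<xi> z))) (E z *v w) (E z *v v)) = 0" for v w
    proof -
      have "A + C = B + D \<Longrightarrow> A - B + C - D = R \<Longrightarrow> R = 0" for A B C D R :: "(complex^'n) \<times> (complex^'n^'n)"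
        by (auto simp: algebra_simps)
      from this[OF smooth_on_symmetric_second_derivative[OF sN N z, of v w, unfolded D2]
          conn_curvature[OF zU, of "sec \<xi> z" v w]]
      show ?thesis using skew[OF z] by (simp add: ab)
    qed
    from this[of "F z *v x" "F z *v y"] show "rho (kapH (H z) (T z) (a z) (b z)) x y = 0"
      by (simp add: ab E_F_vec[OF zU] zero_prod_def)
  qed
  have curve: "((\<lambda>t. f (z + t *\<^sub>R w)) has_vector_derivative f') (at 0) \<Longrightarrow> f' = 0"
    if "z \<in> N" "\<And>z. z \<in> N \<Longrightarrow> f z = 0" for f :: "complex^'n \<Rightarrow> 'e::real_normed_vector" and z w f'
  proof -
    assume 1: "((\<lambda>t. f (z + t *\<^sub>R w)) has_vector_derivative f') (at 0)"
    from lineN[OF that(1), of w] obtain S where S: "open S" "(0::real) \<in> S" "\<forall>t\<in>S. z + t *\<^sub>R w \<in> N"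
      by (elim exE conjE)
    have "((\<lambda>t. f (z + t *\<^sub>R w)) has_vector_derivative 0) (at 0)"
      by (rule has_vector_derivative_transform_within_open[OF has_vector_derivative_const S(1,2)])
         (use that(2) S(3) in simp)
    with 1 show "f' = 0" by (rule vector_derivative_unique_at)
  qed
  have sline: "((\<lambda>t. sec \<xi> (z + t *\<^sub>R w)) has_vector_derivative conn (z + 0 *\<^sub>R w) w (sec \<xi> (z + 0 *\<^sub>R w))) (at 0)"
    if "z \<in> N" for z w
    using has_vector_derivative_line[OF ds[OF that], of w] by simp
  have zU: "z + 0 *\<^sub>R w \<in> U" if "z \<in> N" for z w :: "complex^'n" using that NU by auto
  have sk: "conj_transpose (snd (sec \<xi> (z + 0 *\<^sub>R w))) = - snd (sec \<xi> (z + 0 *\<^sub>R w))" if "z \<in> N" for z w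
    using skew[OF that] by (simp add: ab)
  \<comment> \<open>Near \<open>z\<close> the expression \<open>kapH\<close> is identically 0, hence
    so is its derivative, which \<open>kappa_curve\<close> reduces to the symmetrised
    \<open>outer\<close> product of \<open>kapT\<close> with an arbitrary vector.\<close>
  have kT: "kapT (H z) (T z) (V z) (a z) (b z) = 0" if z: "z \<in> N" for z
  proof (rule outer_sym_zero_imp)
    fix x
    have *: "E z *v (F z *v x) = x" using z NU by (auto simp: E_F_vec)
    note k = kappa_curve(1)[where t = 0 and S = UNIV, OF zU[OF z] line sline[OF z] sk[OF z], of "F z *v x"]
    from curve[OF z, of "\<lambda>z. kapH (H z) (T z) (fst (sec \<xi> z)) (snd (sec \<xi> z))", OF _ k]
    show "outer (kapT (H z) (T z) (V z) (a z) (b z)) x + outer x (kapT (H z) (T z) (V z) (a z) (b z)) = 0"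
      using kH[OF z] kH by (simp add: ab *)
  qed
  \<comment> \<open>Likewise the derivative of \<open>kapT\<close> is \<open>kapV\<close> times a
    vector once \<open>kapH\<close> and \<open>kapT\<close> vanish. A single nonzero vector
    suffices, whence \<open>axis undefined 1\<close>.\<close>
  have kV: "kapV (H z) (T z) (a z) = 0" if z: "z \<in> N" for z
  proof -
    have *: "E z *v (F z *v x) = x" for x using z NU by (auto simp: E_F_vec)
    note k = kappa_curve(2)[where t = 0 and S = UNIV, OF zU[OF z] line sline[OF z] sk[OF z], of "F z *v axis undefined 1"]
    have "trace (0 :: complex^'n^'n) = 0" "mat 0 = (0 :: complex^'n^'n)" by (simp_all add: trace_def mat_def vec_eq_iff)
    with curve[OF z, of "\<lambda>z. kapT (H z) (T z) (V z) (fst (sec \<xi> z)) (snd (sec \<xi> z))", OF _ k]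
    have "mat (kapV (H z) (T z) (a z)) *v axis undefined 1 = (0 :: complex^'n)"
      using kH[OF z] kT[OF z] kT by (simp add: ab *)
    from arg_cong[OF this, of "\<lambda>v. v $ undefined"] show ?thesis by (simp add: mat_mult_vec)
  qed
  show "ker z (sec \<xi> z)" if "z \<in> N" for z
    using kH[OF that] kT[OF that] kV[OF that] skew[OF that] by (simp add: ker_def ab)
qed

end

section \<open>Extension and uniqueness of local Killing fields\<close>

context frame_data
begin

lemma sec_cong:
  assumes "open N" "z \<in> N" "\<And>z. z \<in> N \<Longrightarrow> \<xi> z = \<xi>' z"
  shows "sec \<xi> z = sec \<xi>' z"
  using frechet_derivative_cong[OF assms] assms(2,3) by (simp add: sec_def jac_def)

lemma killing_unique:
  assumes W: "convex W" "W \<subseteq> U" "y \<in> W" "z \<in> W"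
    and k: "killing_on B W \<xi>" "killing_on B W \<xi>'" and eq: "sec \<xi> y = sec \<xi>' y"
  shows "\<xi> z = \<xi>' z"
proof -
  have "sec \<xi> z = sec \<xi>' z"
    by (rule flat_section_unique[OF W(1,2,3) U conn_smooth conn_bilinear section_of_killing(1)[OF k(1) W(2)]
          section_of_killing(1)[OF k(2) W(2)] eq W(4)])
  then have "E z *v \<xi> z = E z *v \<xi>' z" by (simp add: sec_def)
  then show ?thesis using E_F_vec(2) W(2,4) by (metis subsetD)
qed

text \<open>One ball has to serve all its points \<open>y\<close> as starting points. Parallel
  sections around \<open>y\<close> exist on a ball whose radius \<open>R\<close> does not depend on
  \<open>y\<close>, and the ball of radius \<open>R / 2\<close> around \<open>z0\<close> is
  contained in each of these.\<close>

lemma killing_extension: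
  assumes "z0 \<in> U"
  obtains r where "r > 0" "ball z0 r \<subseteq> U"
    "\<And>y s0. \<lbrakk>y \<in> ball z0 r; ker y s0\<rbrakk> \<Longrightarrow> \<exists>\<xi>. killing_on B (ball z0 r) \<xi> \<and> sec \<xi> y = s0"
proof -
  obtain \<rho> where \<rho>: "\<rho> > 0" "cball z0 \<rho> \<subseteq> U" using U assms open_contains_cball by blast
  obtain C where C: "C \<ge> 0" "\<And>z v s. z \<in> cball z0 \<rho> \<Longrightarrow> norm (conn z v s) \<le> C * norm v * norm s"
    using conn_bound[OF \<rho>(2)] by blast
  \<comment> \<open>The bound \<open>\<rho> / 2\<close> keeps the balls around \<open>y\<close>
    inside \<open>cball z0 \<rho>\<close>. The other bound ensures \<open>C * R \<le> 1 / 2\<close>,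
    with \<open>C + 1\<close> in place of \<open>C\<close> in case \<open>C = 0\<close>.\<close>
  define R where "R = min (\<rho> / 2) (1 / (2 * (C + 1)))"
  have R: "R > 0" "R \<le> \<rho> / 2" using \<rho>(1) C(1) by (auto simp: R_def)
  have "C * R \<le> (C + 1) * (1 / (2 * (C + 1)))" using C(1) R(1) by (intro mult_mono) (auto simp: R_def)
  also have "\<dots> = 1 / 2" using C(1) by simp
  finally have CR: "C * R \<le> 1 / 2" .
  define r where "r = R / 2"
  have r: "r > 0" "r + r \<le> R" using R by (auto simp: r_def)
  show ?thesis
  proof (rule that[OF r(1)])
    show "ball z0 r \<subseteq> U"
      using \<rho>(2) R r by (intro subset_trans[OF _ \<rho>(2)]) (auto simp: mem_ball)
    fix y s0 assume y: "y \<in> ball z0 r" and s0: "ker y s0"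
    have sub: "cball y R \<subseteq> cball z0 \<rho>"
    proof
      fix x assume "x \<in> cball y R"
      then have "dist z0 x \<le> r + R" using y dist_triangle[of z0 x y] by simp
      then show "x \<in> cball z0 \<rho>" using R r by simp
    qed
    have sub': "ball z0 r \<subseteq> ball y R"
    proof
      fix x assume "x \<in> ball z0 r"
      then have "dist y x < r + r" using y dist_triangle3[of y x z0] by simp
      then show "x \<in> ball y R" using r by simp
    qed
    obtain s where s: "s y = s0" "\<And>z. z \<in> ball y R \<Longrightarrow> (s has_derivative (\<lambda>v. conn z v (s z))) (at z)"
      "\<And>z. z \<in> ball y R \<Longrightarrow> ker z (s z)"
      by (rule ker_section_exists[OF _ R(1) _ CR C(1) s0]) (use sub \<rho>(2) C(2) in blast)+
    have bU: "ball y R \<subseteq> U" using sub \<rho>(2) ball_subset_cball by blast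
    have sk: "conj_transpose (snd (s z)) = - snd (s z)" if "z \<in> ball y R" for z
      using s(3)[OF that] by (simp add: ker_def)
    note k = killing_of_section[OF open_ball bU s(2) sk]
    have "y \<in> ball y R" using R by simp
    then show "\<exists>\<xi>. killing_on B (ball z0 r) \<xi> \<and> sec \<xi> y = s0"
      using killing_on_subset[OF k(1) open_ball sub'] k(2)[of y] s(1) by blast
  qed
qed

text \<open>At a fixed point \<open>sec\<close> is a real-linear function of the value and the
  Jacobian of the field there.\<close>

lemma sec_scaled_sum:
  assumes N: "open N" "z \<in> N" "z \<in> U" and x: "\<And>m. m \<in> I \<Longrightarrow> smooth_on N (\<xi> m)" and I: "finite I"
  shows "sec (\<lambda>z. \<Sum>m\<in>I. x m *\<^sub>R \<xi> m z) z = (\<Sum>m\<in>I. x m *\<^sub>R sec (\<xi> m) z)"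
proof -
  have "((\<lambda>z. \<Sum>m\<in>I. x m *\<^sub>R \<xi> m z) has_derivative
     (\<lambda>v. \<Sum>m\<in>I. x m *\<^sub>R frechet_derivative (\<xi> m) (at z) v)) (at z)"
    by (intro has_derivative_sum has_derivative_scaleR_right smooth_on_has_derivative[OF x N(2)])
  then have D: "frechet_derivative (\<lambda>z. \<Sum>m\<in>I. x m *\<^sub>R \<xi> m z) (at z)
     = (\<lambda>v. \<Sum>m\<in>I. x m *\<^sub>R frechet_derivative (\<xi> m) (at z) v)" by (rule frechet_derivative_eqI)
  have J: "jac (\<lambda>z. \<Sum>m\<in>I. x m *\<^sub>R \<xi> m z) z = (\<Sum>m\<in>I. x m *\<^sub>R jac (\<xi> m) z)"
    by (simp add: jac_def D vec_eq_iff)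
  let ?L = "\<lambda>(u, j). (E z *v u, (frechet_derivative E (at z) u + E z ** j) ** F z + ph z u)"
  have L: "linear ?L"
  proof -
    have lE: "linear (frechet_derivative E (at z))" by (rule smooth_on_linear_frechet[OF E N(3)])
    note bl = bounded_bilinear.add_left[OF bounded_bilinear_matrix_mult] bounded_bilinear.add_right[OF bounded_bilinear_matrix_mult]
      bounded_bilinear.scaleR_left[OF bounded_bilinear_matrix_mult] bounded_bilinear.scaleR_right[OF bounded_bilinear_matrix_mult]
      bounded_bilinear.add_right[OF bounded_bilinear_matrix_vec] bounded_bilinear.scaleR_right[OF bounded_bilinear_matrix_vec]
      linear_add[OF lE] linear_cmul[OF lE] linear_add[OF ph_linear[OF N(3)]] linear_cmul[OF ph_linear[OF N(3)]]
    show ?thesis by (rule linearI) (auto simp: bl algebra_simps)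
  qed
  have s: "sec \<eta> z = ?L (\<eta> z, jac \<eta> z)" for \<eta> by (simp add: sec_def)
  have "(\<Sum>m\<in>I. x m *\<^sub>R \<xi> m z, \<Sum>m\<in>I. x m *\<^sub>R jac (\<xi> m) z) = (\<Sum>m\<in>I. x m *\<^sub>R (\<xi> m z, jac (\<xi> m) z))"
    by (rule prod_eqI) (simp_all add: fst_sum snd_sum)
  then show ?thesis unfolding s J by (simp only: linear_sum[OF L] linear_cmul[OF L])
qed

lemma sec_zero: "z \<in> U \<Longrightarrow> sec (\<lambda>z. 0) z = 0"
  using sec_scaled_sum[of UNIV z "{}" "\<lambda>_ _. 0"] by simp

text \<open>Independence is obtained for germs at \<open>z0\<close>: a combination that vanishes
  near \<open>z0\<close> has \<open>sec\<close> equal to 0 there, and the prescribed values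
  \<open>(a m, b m)\<close> are independent.\<close>

lemma killing_family:
  assumes z0: "z0 \<in> U"
  obtains r and \<xi> :: "'n \<Rightarrow> complex^'n \<Rightarrow> complex^'n" where "r > 0" "ball z0 r \<subseteq> U" "\<And>m. killing_on B (ball z0 r) (\<xi> m)"
    "\<And>x N. \<lbrakk>open N; z0 \<in> N; \<And>z. z \<in> N \<Longrightarrow> (\<Sum>m\<in>UNIV. x m *\<^sub>R \<xi> m z) = 0\<rbrakk> \<Longrightarrow> (\<forall>m. x m = 0)"
proof -
  obtain r where r: "r > 0" "ball z0 r \<subseteq> U"
    "\<And>y s0. \<lbrakk>y \<in> ball z0 r; ker y s0\<rbrakk> \<Longrightarrow> \<exists>\<xi>. killing_on B (ball z0 r) \<xi> \<and> sec \<xi> y = s0"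
    using killing_extension[OF z0] by blast
  obtain a :: "'n \<Rightarrow> complex^'n" and b :: "'n \<Rightarrow> complex^'n^'n" where
    ab: "\<And>m. conj_transpose (b m) = - b m" "\<And>m. kapH (H z0) (T z0) (a m) (b m) = 0"
    "\<And>m. kapT (H z0) (T z0) (V z0) (a m) (b m) = 0" "\<And>m. kapV (H z0) (T z0) (a m) = 0"
    "\<And>x :: 'n \<Rightarrow> real. \<lbrakk>(\<Sum>m\<in>UNIV. x m *\<^sub>R a m) = 0; (\<Sum>m\<in>UNIV. x m *\<^sub>R b m) = 0\<rbrakk> \<Longrightarrow> (\<forall>m. x m = 0)"
    by (rule kernel_family_exists[OF H_herm[OF z0], of "T z0" "V z0"]) (rule that)
  have "ker z0 (a m, b m)" for m using ab(1-4) by (simp add: ker_def)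
  then have "\<forall>m. \<exists>\<xi>. killing_on B (ball z0 r) \<xi> \<and> sec \<xi> z0 = (a m, b m)"
    using r(1,3) by (metis centre_in_ball)
  then obtain \<xi> where \<xi>: "\<And>m. killing_on B (ball z0 r) (\<xi> m)" "\<And>m. sec (\<xi> m) z0 = (a m, b m)" by metis
  show ?thesis
  proof (rule that[OF r(1,2) \<xi>(1)])
    fix x :: "'n \<Rightarrow> real" and N
    assume N: "open N" "z0 \<in> N" "\<And>z. z \<in> N \<Longrightarrow> (\<Sum>m\<in>UNIV. x m *\<^sub>R \<xi> m z) = 0"
    have "sec (\<lambda>z. \<Sum>m\<in>UNIV. x m *\<^sub>R \<xi> m z) z0 = sec (\<lambda>z. 0) z0" by (rule sec_cong[OF N])
    moreover have "sec (\<lambda>z. \<Sum>m\<in>UNIV. x m *\<^sub>R \<xi> m z) z0 = (\<Sum>m\<in>UNIV. x m *\<^sub>R sec (\<xi> m) z0)"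
      by (rule sec_scaled_sum[OF open_ball]) (use r(1) z0 \<xi>(1) in \<open>auto simp: killing_on_def\<close>)
    ultimately have "(\<Sum>m\<in>UNIV. x m *\<^sub>R (a m, b m)) = 0" by (simp add: sec_zero[OF z0] \<xi>(2))
    then have "(\<Sum>m\<in>UNIV. x m *\<^sub>R a m) = 0" "(\<Sum>m\<in>UNIV. x m *\<^sub>R b m) = 0"
      by (simp_all add: prod_eq_iff fst_sum snd_sum)
    then show "\<forall>m. x m = 0" by (rule ab(5))
  qed
qed

text \<open>A Killing field on the ball is determined by \<open>sec\<close> at any one point, and
  each kernel value at that point is attained by a field on the whole ball. So the sheaf of Killing
  fields is constant over the ball.\<close>

lemma killing_locally_constant:
  assumes z0: "z0 \<in> U"
  obtains r where "r > 0" "ball z0 r \<subseteq> U"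
    "\<And>y N \<xi>. \<lbrakk>y \<in> ball z0 r; killing_on B N \<xi>; y \<in> N\<rbrakk> \<Longrightarrow>
       \<exists>\<xi>'. killing_on B (ball z0 r) \<xi>' \<and> (\<exists>N'. open N' \<and> y \<in> N' \<and> (\<forall>z\<in>N'. \<xi>' z = \<xi> z))"
    "\<And>y N' \<xi> \<xi>' z. \<lbrakk>killing_on B (ball z0 r) \<xi>; killing_on B (ball z0 r) \<xi>'; y \<in> ball z0 r; open N'; y \<in> N';
       \<And>z. z \<in> N' \<Longrightarrow> \<xi> z = \<xi>' z; z \<in> ball z0 r\<rbrakk> \<Longrightarrow> \<xi> z = \<xi>' z"
proof -
  obtain r where r: "r > 0" "ball z0 r \<subseteq> U"
    "\<And>y s0. \<lbrakk>y \<in> ball z0 r; ker y s0\<rbrakk> \<Longrightarrow> \<exists>\<xi>. killing_on B (ball z0 r) \<xi> \<and> sec \<xi> y = s0"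
    using killing_extension[OF z0] by blast
  show ?thesis
  proof (rule that[OF r(1,2)])
    fix y N \<xi> assume y: "y \<in> ball z0 r" "y \<in> N" and k: "killing_on B N \<xi>"
    have N: "open N" using k by (simp add: killing_on_def)
    have "open (N \<inter> ball z0 r)" "y \<in> N \<inter> ball z0 r" using N y by auto
    then obtain e where e: "e > 0" "ball y e \<subseteq> N \<inter> ball z0 r" using open_contains_ball by metis
    have k1: "killing_on B (ball y e) \<xi>" by (rule killing_on_subset[OF k open_ball]) (use e in blast)
    have bU: "ball y e \<subseteq> U" using e(2) r(2) by blast
    have ye: "y \<in> ball y e" using e(1) by simp
    obtain \<xi>' where \<xi>': "killing_on B (ball z0 r) \<xi>'" "sec \<xi>' y = sec \<xi> y"
      using r(3)[OF y(1) section_of_killing(2)[OF k1 bU ye]] by blast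
    have k2: "killing_on B (ball y e) \<xi>'" by (rule killing_on_subset[OF \<xi>'(1) open_ball]) (use e in blast)
    have "\<xi>' z = \<xi> z" if "z \<in> ball y e" for z
      by (rule killing_unique[OF convex_ball bU ye that k2 k1 \<xi>'(2)])
    then show "\<exists>\<xi>'. killing_on B (ball z0 r) \<xi>' \<and> (\<exists>N'. open N' \<and> y \<in> N' \<and> (\<forall>z\<in>N'. \<xi>' z = \<xi> z))"
      using \<xi>'(1) ye open_ball by blast
  next
    fix y N' \<xi> \<xi>' z
    assume k: "killing_on B (ball z0 r) \<xi>" "killing_on B (ball z0 r) \<xi>'" and y: "y \<in> ball z0 r" "open N'" "y \<in> N'"
      and eq: "\<And>z. z \<in> N' \<Longrightarrow> \<xi> z = \<xi>' z" and z: "z \<in> ball z0 r"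
    show "\<xi> z = \<xi>' z"
      by (rule killing_unique[OF convex_ball r(2) y(1) z k sec_cong[OF y(2,3) eq]])
  qed
qed

end

section \<open>Sections of locally constant sheaves over simply connected spaces\<close>

text \<open>\<open>F W s\<close> reads: \<open>s\<close> is a section over \<open>W\<close>, with
  arbitrary values outside \<open>W\<close>; \<open>agree y\<close> is equality of germs at
  \<open>y\<close>. The axiom \<open>F_local\<close> comprises restriction and gluing, and
  \<open>good\<close> provides open sets over which every germ extends uniquely.\<close>

locale locally_constant_sheaf =
  fixes M :: "'m::topological_space set" and F :: "'m set \<Rightarrow> ('m \<Rightarrow> 's) \<Rightarrow> bool" and agree
  defines "agree \<equiv> \<lambda>y s t. \<exists>N. open N \<and> y \<in> N \<and> (\<forall>z\<in>N. s z = t z)"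
  assumes F_open: "F W s \<Longrightarrow> open W"
    and F_local: "\<lbrakk>open W; \<And>x. x \<in> W \<Longrightarrow> \<exists>V t. F V t \<and> x \<in> V \<and> agree x s t\<rbrakk> \<Longrightarrow> F W s"
    and good: "x \<in> M \<Longrightarrow> \<exists>W. open W \<and> x \<in> W \<and> W \<subseteq> M \<and> path_connected W \<and>
       (\<forall>y V t. y \<in> W \<and> F V t \<and> y \<in> V \<longrightarrow> (\<exists>s. F W s \<and> agree y s t)) \<and>
       (\<forall>y s s'. y \<in> W \<and> F W s \<and> F W s' \<and> agree y s s' \<longrightarrow> (\<forall>z\<in>W. s z = s' z))"
begin

lemma goodE:
  assumes "x \<in> M"
  obtains W where "open W" "x \<in> W" "W \<subseteq> M" "path_connected W"
    "\<And>y V t. \<lbrakk>y \<in> W; F V t; y \<in> V\<rbrakk> \<Longrightarrow> \<exists>s. F W s \<and> agree y s t"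
    "\<And>y s s' z. \<lbrakk>y \<in> W; F W s; F W s'; agree y s s'; z \<in> W\<rbrakk> \<Longrightarrow> s z = s' z"
proof -
  from good[OF assms] obtain W where W: "open W" "x \<in> W" "W \<subseteq> M" "path_connected W"
    and e: "\<forall>y V t. y \<in> W \<and> F V t \<and> y \<in> V \<longrightarrow> (\<exists>s. F W s \<and> agree y s t)"
    and u: "\<forall>y s s'. y \<in> W \<and> F W s \<and> F W s' \<and> agree y s s' \<longrightarrow> (\<forall>z\<in>W. s z = s' z)"
    by (elim exE conjE)
  show ?thesis
  proof (rule that[OF W])
    show "\<exists>s. F W s \<and> agree y s t" if "y \<in> W" "F V t" "y \<in> V" for y V t
      using e[rule_format, of y V t] that by blast
    show "s z = s' z" if "y \<in> W" "F W s" "F W s'" "agree y s s'" "z \<in> W" for y s s' z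
      using u[rule_format, of y s s' z] that by blast
  qed
qed

lemma agree_refl [simp]: "agree y s s"
  unfolding agree_def by (intro exI[of _ UNIV]) auto

lemma agree_sym: "agree y s t \<Longrightarrow> agree y t s"
  unfolding agree_def by metis

lemma agree_trans: "agree y s t \<Longrightarrow> agree y t u \<Longrightarrow> agree y s u"
proof -
  assume "agree y s t" "agree y t u"
  then obtain N N' where "open N" "y \<in> N" "\<forall>z\<in>N. s z = t z" "open N'" "y \<in> N'" "\<forall>z\<in>N'. t z = u z"
    unfolding agree_def by blast
  then show ?thesis unfolding agree_def by (intro exI[of _ "N \<inter> N'"]) auto
qed

lemma agree_eq: "agree y s t \<Longrightarrow> s y = t y"
  unfolding agree_def by blast

lemma agree_neighbourhood:
  assumes "agree y s t"
  obtains N where "open N" "y \<in> N" "\<And>x. x \<in> N \<Longrightarrow> agree x s t"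
  using assms unfolding agree_def by blast

text \<open>A continuous lift of \<open>h\<close> to the space of germs: \<open>S q\<close> is a
  section near \<open>h q\<close> standing for its germ there, and continuity means that the germs
  at nearby parameters come from the same section.\<close>

definition lift :: "'q::topological_space set \<Rightarrow> ('q \<Rightarrow> 'm) \<Rightarrow> ('q \<Rightarrow> 'm \<Rightarrow> 's) \<Rightarrow> bool"
  where "lift Q h S \<longleftrightarrow> (\<forall>q\<in>Q. \<exists>V N. F V (S q) \<and> h q \<in> V \<and> open N \<and> q \<in> N \<and>
     (\<forall>q'\<in>N \<inter> Q. h q' \<in> V \<and> agree (h q') (S q') (S q)))"

lemma liftE:
  assumes "lift Q h S" "q \<in> Q"
  obtains V N where "F V (S q)" "h q \<in> V" "open N" "q \<in> N"
    "\<forall>q'\<in>N \<inter> Q. h q' \<in> V \<and> agree (h q') (S q') (S q)"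
proof -
  from bspec[OF assms(1)[unfolded lift_def] assms(2)]
  show ?thesis by (elim exE conjE) (rule that)
qed

lemma lift_compose:
  assumes "lift Q h S" "continuous_on Q' j" "j ` Q' \<subseteq> Q"
  shows "lift Q' (h \<circ> j) (S \<circ> j)"
  unfolding lift_def
proof
  fix q assume q: "q \<in> Q'"
  then have "j q \<in> Q" using assms(3) by blast
  then obtain V N where VN: "F V (S (j q))" "h (j q) \<in> V" "open N" "j q \<in> N"
    "\<forall>q'\<in>N \<inter> Q. h q' \<in> V \<and> agree (h q') (S q') (S (j q))"
    by (rule liftE[OF assms(1)])
  obtain N' where N': "open N'" "N' \<inter> Q' = j -` N \<inter> Q'"
    using assms(2)[unfolded continuous_on_open_invariant, rule_format, OF VN(3)] by blast
  show "\<exists>V N. F V ((S \<circ> j) q) \<and> (h \<circ> j) q \<in> V \<and> open N \<and> q \<in> N \<and>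
     (\<forall>q'\<in>N \<inter> Q'. (h \<circ> j) q' \<in> V \<and> agree ((h \<circ> j) q') ((S \<circ> j) q') ((S \<circ> j) q))"
  proof (intro exI[of _ V] exI[of _ N'] conjI ballI)
    show "q \<in> N'" using N'(2) VN(4) q by blast
    fix q' assume "q' \<in> N' \<inter> Q'"
    then have "j q' \<in> N \<inter> Q" using N'(2) assms(3) by blast
    then show "(h \<circ> j) q' \<in> V" "agree ((h \<circ> j) q') ((S \<circ> j) q') ((S \<circ> j) q)" using VN(5) by auto
  qed (use VN N' in auto)
qed

lemma lift_subset: "lift Q h S \<Longrightarrow> Q' \<subseteq> Q \<Longrightarrow> lift Q' h S"
  using lift_compose[of Q h S Q' "\<lambda>x. x"] by (simp add: o_def image_subset_iff subset_iff)

lemma lift_cong: "\<lbrakk>lift Q h S; \<And>q. q \<in> Q \<Longrightarrow> h q = h' q\<rbrakk> \<Longrightarrow> lift Q h' S"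
  unfolding lift_def by simp

lemma lift_section: "lift Q h S \<Longrightarrow> q \<in> Q \<Longrightarrow> \<exists>V. F V (S q) \<and> h q \<in> V"
  by (erule liftE) auto

lemma lift_const:
  assumes "F V s" "h ` Q \<subseteq> V"
  shows "lift Q h (\<lambda>q. s)"
  unfolding lift_def
proof
  fix q assume "q \<in> Q"
  then show "\<exists>V N. F V s \<and> h q \<in> V \<and> open N \<and> q \<in> N \<and> (\<forall>q'\<in>N \<inter> Q. h q' \<in> V \<and> agree (h q') s s)"
    using assms by (intro exI[of _ V] exI[of _ UNIV]) auto
qed

text \<open>Near any \<open>q\<close> each lift is represented by a section over a common good set,
  where agreement of two sections at one point implies agreement everywhere. So agreement of the
  lifts is locally constant on the connected set \<open>Q\<close>.\<close>

lemma lift_unique: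
  assumes h: "continuous_on Q h" "h ` Q \<subseteq> M" and Q: "connected Q" "q0 \<in> Q" "q1 \<in> Q"
    and S: "lift Q h S" "lift Q h S'" and "agree (h q0) (S q0) (S' q0)"
  shows "agree (h q1) (S q1) (S' q1)"
proof (rule connected_induction_simple[OF Q(1,2,3), where P = "\<lambda>q. agree (h q) (S q) (S' q)"])
  fix q assume q: "q \<in> Q"
  then have hq: "h q \<in> M" using h(2) by blast
  obtain W where W: "open W" "h q \<in> W"
    "\<And>y V t. \<lbrakk>y \<in> W; F V t; y \<in> V\<rbrakk> \<Longrightarrow> \<exists>s. F W s \<and> agree y s t"
    "\<And>y s s' z. \<lbrakk>y \<in> W; F W s; F W s'; agree y s s'; z \<in> W\<rbrakk> \<Longrightarrow> s z = s' z"
    by (rule goodE[OF hq]) (rule that)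
  have loc: "\<exists>s T. F W s \<and> openin (top_of_set Q) T \<and> q \<in> T \<and> (\<forall>q'\<in>T. h q' \<in> W \<and> agree (h q') (S q') s)"
    if "lift Q h S" for S
  proof -
    obtain V N where VN: "F V (S q)" "h q \<in> V" "open N" "q \<in> N" "\<forall>q'\<in>N \<inter> Q. h q' \<in> V \<and> agree (h q') (S q') (S q)"
      by (rule liftE[OF \<open>lift Q h S\<close> q])
    obtain s where s: "F W s" "agree (h q) s (S q)" using W(3)[OF W(2) VN(1,2)] by blast
    obtain O' where O: "open O'" "h q \<in> O'" "\<And>x. x \<in> O' \<Longrightarrow> agree x s (S q)"
      using agree_neighbourhood[OF s(2)] by blast
    obtain N' where N': "open N'" "N' \<inter> Q = h -` (O' \<inter> W) \<inter> Q"
      using h(1)[unfolded continuous_on_open_invariant, rule_format, OF open_Int[OF O(1) W(1)]] by blast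
    show ?thesis
    proof (intro exI conjI ballI)
      show "F W s" by fact
      show "openin (top_of_set Q) (Q \<inter> (N \<inter> N'))" using VN(3) N'(1) by (simp add: openin_open_Int open_Int)
      show "q \<in> Q \<inter> (N \<inter> N')" using q VN(4) N'(2) O(2) W(2) by blast
      fix q' assume "q' \<in> Q \<inter> (N \<inter> N')"
      then have q': "q' \<in> N \<inter> Q" "h q' \<in> O'" "h q' \<in> W" using N'(2) by blast+
      then show "h q' \<in> W" "agree (h q') (S q') s"
        using VN(5) O(3) agree_trans agree_sym by blast+
    qed
  qed
  obtain s T where s: "F W s" "openin (top_of_set Q) T" "q \<in> T" "\<And>q'. q' \<in> T \<Longrightarrow> h q' \<in> W \<and> agree (h q') (S q') s"
    using loc[OF S(1)] by blast
  obtain s' T' where s': "F W s'" "openin (top_of_set Q) T'" "q \<in> T'" "\<And>q'. q' \<in> T' \<Longrightarrow> h q' \<in> W \<and> agree (h q') (S' q') s'"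
    using loc[OF S(2)] by blast
  show "\<exists>T. openin (top_of_set Q) T \<and> q \<in> T \<and>
     (\<forall>x\<in>T. \<forall>y\<in>T. agree (h x) (S x) (S' x) \<longrightarrow> agree (h y) (S y) (S' y))"
  proof (intro exI[of _ "T \<inter> T'"] conjI ballI impI)
    fix x y assume x: "x \<in> T \<inter> T'" and y: "y \<in> T \<inter> T'" and a: "agree (h x) (S x) (S' x)"
    have "agree (h x) s s'" using s(4)[of x] s'(4)[of x] x a agree_trans agree_sym by blast
    then have "\<forall>z\<in>W. s z = s' z" using W(4) s(1,4) s'(1) x by blast
    then have "agree (h y) s s'" using W(1) s(4)[of y] y unfolding agree_def by blast
    then show "agree (h y) (S y) (S' y)" using s(4)[of y] s'(4)[of y] y agree_trans agree_sym by blast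
  qed (use s s' in auto)
qed fact

text \<open>At a point of both sets the two representing sections have the same germ, so near it
  either one represents both lifts. At any other point, closedness of the second set yields a
  neighbourhood that avoids it.\<close>

lemma lift_glue:
  assumes h: "continuous_on (A \<union> B) h" and cl: "closed A" "closed B"
    and S: "lift A h S" "lift B h S'" and ag: "\<And>q. q \<in> A \<inter> B \<Longrightarrow> agree (h q) (S q) (S' q)"
  shows "lift (A \<union> B) h (\<lambda>q. if q \<in> A then S q else S' q)" (is "lift ?Q h ?S")
  unfolding lift_def
proof
  fix q assume q: "q \<in> ?Q"
  show "\<exists>V N. F V (?S q) \<and> h q \<in> V \<and> open N \<and> q \<in> N \<and> (\<forall>q'\<in>N \<inter> ?Q. h q' \<in> V \<and> agree (h q') (?S q') (?S q))"
  proof (cases "q \<in> A")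
    case A: True
    then obtain V N where VN: "F V (S q)" "h q \<in> V" "open N" "q \<in> N" "\<forall>q'\<in>N \<inter> A. h q' \<in> V \<and> agree (h q') (S q') (S q)"
      by (rule liftE[OF S(1)])
    show ?thesis
    proof (cases "q \<in> B")
      case False
      then show ?thesis using A VN cl(2) by (intro exI[of _ V] exI[of _ "N \<inter> - B"]) auto
    next
      case B: True
      then obtain V' N' where VN': "F V' (S' q)" "h q \<in> V'" "open N'" "q \<in> N'" "\<forall>q'\<in>N' \<inter> B. h q' \<in> V' \<and> agree (h q') (S' q') (S' q)"
        by (rule liftE[OF S(2)])
      obtain O' where O: "open O'" "h q \<in> O'" "\<And>x. x \<in> O' \<Longrightarrow> agree x (S q) (S' q)"
        by (rule agree_neighbourhood[OF ag]) (use A B in auto)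
      obtain N2 where N2: "open N2" "N2 \<inter> ?Q = h -` (O' \<inter> V) \<inter> ?Q"
        using h[unfolded continuous_on_open_invariant, rule_format, OF open_Int[OF O(1) F_open[OF VN(1)]]] by blast
      have "h q' \<in> V \<and> agree (h q') (?S q') (?S q)" if q': "q' \<in> (N \<inter> N' \<inter> N2) \<inter> ?Q" for q'
      proof (cases "q' \<in> A")
        case True then show ?thesis using VN(5) A q' by auto
      next
        case False
        then have "h q' \<in> O' \<inter> V" "q' \<in> N' \<inter> B" using q' N2(2) by blast+
        then have "agree (h q') (S' q') (S' q)" "agree (h q') (S q) (S' q)" using VN'(5) O(3) by blast+
        then have "agree (h q') (S' q') (S q)" using agree_trans agree_sym by blast
        then show ?thesis using \<open>h q' \<in> O' \<inter> V\<close> A False by simp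
      qed
      moreover have "q \<in> N \<inter> N' \<inter> N2" using N2(2) O(2) VN(2,4) VN'(4) q by blast
      ultimately show ?thesis
        using A VN VN'(3) N2(1) by (intro exI[of _ V] exI[of _ "N \<inter> N' \<inter> N2"]) (auto simp: open_Int)
    qed
  next
    case A: False
    then have "q \<in> B" using q by blast
    then obtain V N where VN: "F V (S' q)" "h q \<in> V" "open N" "q \<in> N" "\<forall>q'\<in>N \<inter> B. h q' \<in> V \<and> agree (h q') (S' q') (S' q)"
      by (rule liftE[OF S(2)])
    then show ?thesis using A cl(1) by (intro exI[of _ V] exI[of _ "N \<inter> - A"]) auto
  qed
qed

text \<open>The starting point is an arbitrary point of \<open>Q\<close>, not a base point, so that
  sets can be glued in either order.\<close>

definition liftable :: "('q::topological_space \<Rightarrow> 'm) \<Rightarrow> 'q set \<Rightarrow> bool"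
  where "liftable h Q \<longleftrightarrow> (\<forall>q0\<in>Q. \<forall>V t. F V t \<and> h q0 \<in> V \<longrightarrow> (\<exists>S. lift Q h S \<and> agree (h q0) (S q0) t))"

lemma liftableD: "\<lbrakk>liftable h Q; q0 \<in> Q; F V t; h q0 \<in> V\<rbrakk> \<Longrightarrow> \<exists>S. lift Q h S \<and> agree (h q0) (S q0) t"
  unfolding liftable_def by blast

text \<open>A lift over one set is continued over the other from a point of the intersection;
  connectedness of the intersection makes the two lifts agree on all of it.\<close>

lemma liftable_Un:
  assumes h: "continuous_on (A \<union> B) h" "h ` (A \<union> B) \<subseteq> M" and cl: "closed A" "closed B"
    and AB: "connected (A \<inter> B)" "A \<inter> B \<noteq> {}" and l: "liftable h A" "liftable h B"
  shows "liftable h (A \<union> B)"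
proof -
  have *: "\<exists>S. lift (A \<union> B) h S \<and> agree (h q0) (S q0) t"
    if h: "continuous_on (A \<union> B) h" "h ` (A \<union> B) \<subseteq> M" and cl: "closed A" "closed B"
    and AB: "connected (A \<inter> B)" "A \<inter> B \<noteq> {}" and l: "liftable h A" "liftable h B"
    and q0: "q0 \<in> A" and t: "F V t" "h q0 \<in> V" for A B :: "'a set" and q0 V t
  proof -
    obtain S where S: "lift A h S" "agree (h q0) (S q0) t" using l(1) q0 t unfolding liftable_def by blast
    obtain q1 where q1: "q1 \<in> A \<inter> B" using AB by blast
    obtain V1 where V1: "F V1 (S q1)" "h q1 \<in> V1" using lift_section[OF S(1)] q1 by blast
    obtain S' where S': "lift B h S'" "agree (h q1) (S' q1) (S q1)"
      using l(2) q1 V1 unfolding liftable_def by blast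
    have ag: "agree (h q) (S q) (S' q)" if "q \<in> A \<inter> B" for q
      by (rule lift_unique[OF _ _ AB(1) q1 that lift_subset[OF S(1)] lift_subset[OF S'(1)] agree_sym[OF S'(2)]])
         (use h in \<open>auto intro: continuous_on_subset\<close>)
    show ?thesis
      using lift_glue[OF h(1) cl S(1) S'(1) ag] S(2) q0 by (intro exI[of _ "\<lambda>q. if q \<in> A then S q else S' q"]) simp
  qed
  show ?thesis
    unfolding liftable_def
  proof (intro ballI allI impI)
    fix q0 V t assume "q0 \<in> A \<union> B" "F V t \<and> h q0 \<in> V"
    then show "\<exists>S. lift (A \<union> B) h S \<and> agree (h q0) (S q0) t"
      using *[OF h cl AB l] *[of B A q0 V t] h cl AB l by (auto simp: Un_commute Int_commute)
  qed
qed

text \<open>Bisection in both coordinates plays the role of a Lebesgue number: small rectangles are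
  mapped into a good set and lift by a constant choice of section, they are joined to thin strips,
  and the strips to the square.\<close>

lemma liftable_square:
  fixes h :: "real \<times> real \<Rightarrow> 'm"
  assumes h: "continuous_on ({0..1} \<times> {0..1}) h" "h ` ({0..1} \<times> {0..1}) \<subseteq> M"
  shows "liftable h ({0..1} \<times> {0..1})"
proof -
  define R where "R a b c d = ({0..1} \<times> {0..1}) \<inter> ({a..b} \<times> {c..d})" for a b c d :: real
  have Rc: "closed (R a b c d)" "connected (R a b c d)" for a b c d
  proof -
    have "R a b c d = {max 0 a..min 1 b} \<times> {max 0 c..min 1 d}" by (auto simp: R_def)
    then show "closed (R a b c d)" "connected (R a b c d)"
      by (auto intro!: closed_Times connected_Times)
  qed
  have Rh: "continuous_on (R a b c d) h" "h ` R a b c d \<subseteq> M" for a b c d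
    using h by (auto simp: R_def intro: continuous_on_subset)
  \<comment> \<open>Degenerate rectangles are covered here: if the two pieces are disjoint,
    connectedness of their union makes one of them empty.\<close>
  have join: "liftable h (A \<union> B)" if AB: "A = R a b c d" "B = R a' b' c' d'" "A \<inter> B = R a'' b'' c'' d''"
      "A \<union> B = R a3 b3 c3 d3" "liftable h A" "liftable h B" for A B a b c d a' b' c' d' a'' b'' c'' d'' a3 b3 c3 d3
  proof (cases "A \<inter> B = {}")
    case False then show ?thesis using liftable_Un[of A B h] AB Rc Rh by metis
  next
    case True
    then have "A = {} \<or> B = {}"
      using connected_closedD[OF Rc(2)[of a3 b3 c3 d3], of A B] AB Rc by blast
    then show ?thesis using AB(5,6) by auto
  qed
  have "\<forall>a b c d. 0 \<le> (0::real) \<longrightarrow> True" by simp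
  have strip: "\<exists>\<delta>>0. \<forall>c d. c \<le> y \<and> y \<le> d \<and> d - c < \<delta> \<longrightarrow> liftable h (R 0 1 c d)" if y: "0 \<le> y" "y \<le> 1" for y
  proof (rule Bolzano[of 0 1 "\<lambda>a b. \<exists>\<delta>>0. \<forall>c d. c \<le> y \<and> y \<le> d \<and> d - c < \<delta> \<longrightarrow> liftable h (R a b c d)"])
    fix a b c :: real
    assume "\<exists>\<delta>>0. \<forall>c d. c \<le> y \<and> y \<le> d \<and> d - c < \<delta> \<longrightarrow> liftable h (R a b c d)"
      "\<exists>\<delta>>0. \<forall>c' d. c' \<le> y \<and> y \<le> d \<and> d - c' < \<delta> \<longrightarrow> liftable h (R b c c' d)" and abc: "a \<le> b" "b \<le> c"
    then obtain \<delta> \<delta>' where d: "\<delta> > 0" "\<And>c d. \<lbrakk>c \<le> y; y \<le> d; d - c < \<delta>\<rbrakk> \<Longrightarrow> liftable h (R a b c d)"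
      "\<delta>' > 0" "\<And>c' d. \<lbrakk>c' \<le> y; y \<le> d; d - c' < \<delta>'\<rbrakk> \<Longrightarrow> liftable h (R b c c' d)" by blast
    have "liftable h (R a c c' d)" if "c' \<le> y" "y \<le> d" "d - c' < min \<delta> \<delta>'" for c' d
    proof -
      have eq: "R a b c' d \<union> R b c c' d = R a c c' d" "R a b c' d \<inter> R b c c' d = R b b c' d"
        using abc by (auto simp: R_def)
      show ?thesis
        using join[OF refl refl eq(2) eq(1) d(2) d(4)] that eq(1) by simp
    qed
    then show "\<exists>\<delta>>0. \<forall>c' d. c' \<le> y \<and> y \<le> d \<and> d - c' < \<delta> \<longrightarrow> liftable h (R a c c' d)"
      using d(1,3) by (intro exI[of _ "min \<delta> \<delta>'"]) auto
  next
    fix x :: real assume x: "0 \<le> x" "x \<le> 1"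
    have xy: "(x, y) \<in> {0..1} \<times> {0..1}" using x y by simp
    then have hxy: "h (x, y) \<in> M" using h(2) by blast
    obtain W where W: "open W" "h (x, y) \<in> W" "W \<subseteq> M"
      "\<And>y V t. \<lbrakk>y \<in> W; F V t; y \<in> V\<rbrakk> \<Longrightarrow> \<exists>s. F W s \<and> agree y s t"
      by (rule goodE[OF hxy]) (rule that)
    obtain N where N: "open N" "N \<inter> ({0..1} \<times> {0..1}) = h -` W \<inter> ({0..1} \<times> {0..1})"
      using h(1)[unfolded continuous_on_open_invariant, rule_format, OF W(1)] by blast
    then have "(x, y) \<in> N" using xy W(2) by blast
    then obtain e where e: "e > 0" "ball (x, y) e \<subseteq> N" using N(1) open_contains_ball by blast
    have "liftable h (R a b c d)" if "a \<le> x" "x \<le> b" "b - a < e / 2" "c \<le> y" "y \<le> d" "d - c < e / 2" for a b c d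
    proof -
      have sub: "h ` R a b c d \<subseteq> W"
      proof
        fix m assume "m \<in> h ` R a b c d"
        then obtain u v where uv: "m = h (u, v)" "(u, v) \<in> {0..1} \<times> {0..1}" "u \<in> {a..b}" "v \<in> {c..d}"
          by (auto simp: R_def)
        have "dist (x, y) (u, v) \<le> dist x u + dist y v"
          unfolding dist_Pair_Pair by (rule sqrt_sum_squares_le_sum) auto
        also have "\<dots> < e" using uv that by (auto simp: dist_real_def)
        finally have "(u, v) \<in> N" using e(2) by auto
        then show "m \<in> W" using N(2) uv by blast
      qed
      show ?thesis
        unfolding liftable_def
      proof (intro ballI allI impI)
        fix q0 V t assume q0: "q0 \<in> R a b c d" "F V t \<and> h q0 \<in> V"
        then obtain s where "F W s" "agree (h q0) s t" using W(4)[of "h q0" V t] sub by blast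
        then show "\<exists>S. lift (R a b c d) h S \<and> agree (h q0) (S q0) t"
          using lift_const[OF _ sub] by (intro exI[of _ "\<lambda>_. s"]) blast
      qed
    qed
    then show "\<exists>d>0. \<forall>a b. a \<le> x \<and> x \<le> b \<and> b - a < d \<longrightarrow>
        (\<exists>\<delta>>0. \<forall>c d. c \<le> y \<and> y \<le> d \<and> d - c < \<delta> \<longrightarrow> liftable h (R a b c d))"
      using e(1) half_gt_zero by blast
  qed simp
  have "liftable h (R 0 1 0 1)"
  proof (rule Bolzano[of 0 1 "\<lambda>c d. liftable h (R 0 1 c d)"])
    fix a b c :: real
    assume l: "liftable h (R 0 1 a b)" "liftable h (R 0 1 b c)" "a \<le> b" "b \<le> c"
    have eq: "R 0 1 a b \<union> R 0 1 b c = R 0 1 a c" "R 0 1 a b \<inter> R 0 1 b c = R 0 1 b b"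
      using l(3,4) by (auto simp: R_def)
    show "liftable h (R 0 1 a c)" using join[OF refl refl eq(2) eq(1) l(1,2)] eq(1) by simp
  qed (use strip in auto)
  then show ?thesis by (simp add: R_def)
qed

text \<open>The path is regarded as a map of the square that ignores the first coordinate, and the
  lift is restricted to one edge.\<close>

lemma path_lift_exists:
  assumes p: "path p" "path_image p \<subseteq> M" and t: "F V t" "pathstart p \<in> V"
  obtains S where "lift {0..1} p S" "agree (pathstart p) (S 0) t"
proof -
  have "continuous_on ({0..1} \<times> {0..1}) (p \<circ> snd)" for A :: "real set"
    using p(1) unfolding path_def by (intro continuous_on_compose continuous_intros) (auto intro: continuous_on_subset)
  then have "liftable (p \<circ> snd) ({0..1 :: real} \<times> {0..1})"
    using p(2) by (intro liftable_square) (auto simp: path_image_def)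
  then obtain S where S: "lift ({0..1 :: real} \<times> {0..1}) (p \<circ> snd) S" "agree (p 0) (S (0, 0)) t"
    using liftableD[of "p \<circ> snd" "{0..1 :: real} \<times> {0..1}" "(0, 0)" V t] t by (auto simp: pathstart_def)
  have "lift {0..1} ((p \<circ> snd) \<circ> Pair (0 :: real)) (S \<circ> Pair 0)"
    by (rule lift_compose[OF S(1)]) (auto intro!: continuous_intros)
  then show ?thesis using that S(2) by (simp add: o_def pathstart_def)
qed

text \<open>Lift a homotopy from the loop to a constant loop. Over the constant edge the germs at
  both ends agree. The two edges traced by the base point carry the same path, so uniqueness of
  lifts brings this agreement back to the ends of the given loop.\<close>

lemma loop_lift:
  assumes M: "simply_connected M" and p: "path p" "path_image p \<subseteq> M" "pathfinish p = pathstart p"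
    and S: "lift {0..1} p S"
  shows "agree (pathstart p) (S 1) (S 0)"
proof -
  let ?x = "pathstart p"
  have x: "?x \<in> M" using p(2) pathstart_in_path_image by blast
  have "homotopic_loops M p (\<lambda>t. ?x)"
    by (rule M[unfolded simply_connected_def, rule_format])
       (use p x in \<open>auto simp: path_def pathstart_def pathfinish_def path_image_def\<close>)
  then obtain h where h: "continuous_on ({0..1} \<times> {0..1}) h" "h \<in> ({0..1} \<times> {0..1}) \<rightarrow> M"
    "\<And>s. s \<in> {0..1} \<Longrightarrow> h (0 :: real, s) = p s" "\<And>s. s \<in> {0..1} \<Longrightarrow> h (1, s) = ?x"
    "\<And>t. t \<in> {0..1} \<Longrightarrow> h (t, 1 :: real) = h (t, 0)"
    unfolding homotopic_loops pathstart_def pathfinish_def o_def by blast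
  have hM: "h ` ({0..1} \<times> {0..1}) \<subseteq> M" using h(2) by blast
  obtain V where V: "F V (S 0)" "p 0 \<in> V" using lift_section[OF S, of 0] by auto
  obtain G where G: "lift ({0..1} \<times> {0..1}) h G" "agree (p 0) (G (0, 0)) (S 0)"
    using liftableD[OF liftable_square[OF h(1) hM], of "(0, 0)", OF _ V(1)] V(2) h(3)[of 0] by auto
  have edge: "lift {0..1} (\<lambda>s. h (j s)) (\<lambda>s. G (j s))" if "continuous_on {0..1} j" "j ` {0..1} \<subseteq> {0..1} \<times> {0..1}"
    for j :: "real \<Rightarrow> _" using lift_compose[OF G(1) that] by (simp add: o_def)
  have cedge: "continuous_on {0..1} (\<lambda>s. h (j s))" if "continuous_on {0..1} j" "j ` {0..1} \<subseteq> {0..1} \<times> {0..1}"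
    for j :: "real \<Rightarrow> _" by (rule continuous_on_compose2[OF h(1) that])
  have j: "continuous_on {0..1} (\<lambda>s. (c, s))" "continuous_on {0..1} (\<lambda>s. (s, c))" for c :: real
    by (intro continuous_intros)+
  have eL: "lift {0..1} (\<lambda>s. h (c, s)) (\<lambda>s. G (c, s))" if "c \<in> {0..1}" for c
    by (rule edge[OF j(1)]) (use that in auto)
  have eT: "lift {0..1} (\<lambda>s. h (s, c)) (\<lambda>s. G (s, c))" if "c \<in> {0..1}" for c
    by (rule edge[OF j(2)]) (use that in auto)
  have p1: "p 0 = ?x" "p 1 = ?x" using p(3) by (simp_all add: pathstart_def pathfinish_def)
  have e0: "agree (p 1) (G (0, 1)) (S 1)"
  proof (rule lift_unique[of "{0..1}" p 0 1 "\<lambda>s. G (0, s)" S])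
    show "lift {0..1} p (\<lambda>s. G (0, s))" by (rule lift_cong[OF eL h(3)]) auto
  qed (use p S G(2) in \<open>auto simp: path_def path_image_def\<close>)
  have "agree ?x (G (1, 1)) (G (1, 0))"
  proof -
    obtain V where V: "F V (G (1, 0))" "h (1, 0) \<in> V" using lift_section[OF G(1), of "(1, 0)"] by auto
    have "agree ((\<lambda>s. ?x) 1) ((\<lambda>s. G (1, s)) 1) ((\<lambda>s. G (1, 0)) (1 :: real))"
    proof (rule lift_unique[of "{0..1}" "\<lambda>s. ?x" 0 1 "\<lambda>s. G (1, s)" "\<lambda>s. G (1, 0)"])
      show "lift {0..1} (\<lambda>s. ?x) (\<lambda>s. G (1, s))"
        by (rule lift_cong[OF eL h(4)]) auto
      show "lift {0..1 :: real} (\<lambda>s. ?x) (\<lambda>s. G (1, 0))"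
        by (rule lift_const[OF V(1)]) (use V(2) h(4)[of 0] in auto)
    qed (use x in auto)
    then show ?thesis by simp
  qed
  then have a1: "agree (h (1, 0)) (G (1, 1)) (G (1, 0))" using h(4)[of 0] by simp
  have "agree (h (0, 0)) (G (0, 1)) (G (0, 0))"
  proof (rule lift_unique[of "{0..1}" "\<lambda>t. h (t, 0)" 1 0 "\<lambda>t. G (t, 1)" "\<lambda>t. G (t, 0)"])
    show "continuous_on {0..1} (\<lambda>t. h (t, 0))" by (rule cedge[OF j(2)]) auto
    show "lift {0..1} (\<lambda>t. h (t, 0)) (\<lambda>t. G (t, 1))"
      by (rule lift_cong[OF eT h(5)]) auto
    show "lift {0..1} (\<lambda>t. h (t, 0)) (\<lambda>t. G (t, 0))" by (rule eT) auto
  qed (use hM a1 in auto)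
  then have "agree ?x (G (0, 1)) (G (0, 0))" using h(3)[of 0] p1 by simp
  then show ?thesis using e0 G(2) p1 agree_trans agree_sym by metis
qed

text \<open>The loop formed by \<open>p\<close> and the reverse of \<open>q\<close> has no
  monodromy. The germ of its lift at the middle is the end of the lift along \<open>p\<close> and,
  read backwards, the end of the lift along \<open>q\<close>.\<close>

lemma path_lift_end_unique:
  assumes M: "simply_connected M" and p: "path p" "path_image p \<subseteq> M" and q: "path q" "path_image q \<subseteq> M"
    and pq: "pathstart q = pathstart p" "pathfinish q = pathfinish p"
    and S: "lift {0..1} p S" "lift {0..1} q S'" and ag: "agree (pathstart p) (S 0) (S' 0)"
  shows "agree (pathfinish p) (S 1) (S' 1)"
proof -
  let ?l = "p +++ reversepath q"
  have l: "path ?l" "path_image ?l \<subseteq> M" "pathfinish ?l = pathstart ?l" "pathstart ?l = pathstart p"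
    using p q pq by (auto simp: path_image_join)
  obtain V where V: "F V (S 0)" "p 0 \<in> V" using lift_section[OF S(1), of 0] by auto
  obtain G where G: "lift {0..1} ?l G" "agree (pathstart p) (G 0) (S 0)"
    using path_lift_exists[OF l(1,2) V(1)] V(2) l(4) by (metis pathstart_def)
  have G1: "agree (pathstart p) (G 1) (G 0)" using loop_lift[OF M l(1-3) G(1)] l(4) by simp
  have A: "agree (pathfinish p) (G (1 / 2)) (S 1)"
  proof -
    have "lift {0..1} (?l \<circ> (\<lambda>s. s / 2)) (G \<circ> (\<lambda>s. s / 2))"
      by (rule lift_compose[OF G(1)]) (auto intro!: continuous_intros)
    then have "lift {0..1} p (\<lambda>s. G (s / 2))"
      unfolding o_def by (rule lift_cong) (auto simp: joinpaths_def)
    then show ?thesis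
      using lift_unique[of "{0..1}" p 0 1 "\<lambda>s. G (s / 2)" S] p S(1) G(2)
      by (auto simp: path_def path_image_def pathstart_def pathfinish_def)
  qed
  have B: "agree (pathfinish p) (G (1 / 2)) (S' 1)"
  proof -
    have "lift {0..1} (?l \<circ> (\<lambda>s. 1 - s / 2)) (G \<circ> (\<lambda>s. 1 - s / 2))"
      by (rule lift_compose[OF G(1)]) (auto intro!: continuous_intros)
    then have "lift {0..1} q (\<lambda>s. G (1 - s / 2))"
      unfolding o_def
    proof (rule lift_cong)
      fix s :: real assume "s \<in> {0..1}"
      then show "?l (1 - s / 2) = q s"
        using pq(2) by (cases "s = 1") (auto simp: joinpaths_def reversepath_def pathfinish_def algebra_simps)
    qed
    moreover have "agree (pathstart p) (G 1) (S' 0)" using G1 G(2) ag agree_trans by blast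
    ultimately show ?thesis
      using lift_unique[of "{0..1}" q 0 1 "\<lambda>s. G (1 - s / 2)" S'] q S(2) pq
      by (auto simp: path_def path_image_def pathstart_def pathfinish_def)
  qed
  show ?thesis using A B agree_trans agree_sym by blast
qed

text \<open>Monodromy argument: the value at \<open>x\<close> is taken from the lift along a chosen
  path from \<open>x0\<close>, and independence of the path shows that near each point these values
  are those of a single section.\<close>

theorem global_section_exists:
  assumes M: "simply_connected M" "open M" and x0: "x0 \<in> M" and t: "F V t" "x0 \<in> V"
  obtains s where "F M s" "agree x0 s t"
proof -
  \<comment> \<open>\<open>simply_connected\<close> says that any two loops are freely homotopic;
    for constant loops such a homotopy contains a path between the two points.\<close>
  have pc: "\<exists>p. path p \<and> path_image p \<subseteq> M \<and> pathstart p = x0 \<and> pathfinish p = x" if x: "x \<in> M" for x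
  proof -
    have "homotopic_loops M (\<lambda>t. x0) (\<lambda>t. x)"
      by (rule M(1)[unfolded simply_connected_def, rule_format])
         (use x x0 in \<open>auto simp: path_def pathstart_def pathfinish_def path_image_def\<close>)
    then obtain h where h: "continuous_on ({0..1} \<times> {0..1}) h" "h \<in> ({0..1} \<times> {0..1}) \<rightarrow> M"
      "\<And>s. s \<in> {0..1} \<Longrightarrow> h (0 :: real, s :: real) = x0" "\<And>s. s \<in> {0..1} \<Longrightarrow> h (1, s) = x"
      unfolding homotopic_loops by blast
    have "path (\<lambda>t. h (t, 0))"
      unfolding path_def by (rule continuous_on_compose2[OF h(1)]) (auto intro!: continuous_intros)
    then show ?thesis
      using h(2,3,4) by (intro exI[of _ "\<lambda>t. h (t, 0)"]) (auto simp: path_image_def pathstart_def pathfinish_def)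
  qed
  have "\<exists>p S. path p \<and> path_image p \<subseteq> M \<and> pathstart p = x0 \<and> pathfinish p = x \<and> lift {0..1} p S \<and> agree x0 (S 0) t"
    if x: "x \<in> M" for x
  proof -
    obtain p where p: "path p" "path_image p \<subseteq> M" "pathstart p = x0" "pathfinish p = x" using pc[OF x] by blast
    obtain S where "lift {0..1} p S" "agree (pathstart p) (S 0) t"
      by (rule path_lift_exists[OF p(1,2) t(1)]) (use p(3) t(2) in auto)
    then show ?thesis using p by metis
  qed
  then obtain p S where p: "\<And>x. x \<in> M \<Longrightarrow> path (p x) \<and> path_image (p x) \<subseteq> M \<and> pathstart (p x) = x0 \<and> pathfinish (p x) = x"
    and S: "\<And>x. x \<in> M \<Longrightarrow> lift {0..1} (p x) (S x) \<and> agree x0 (S x 0) t"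
    by metis
  define s where "s x = S x 1 x" for x
  have loc: "\<exists>W u. F W u \<and> x \<in> W \<and> W \<subseteq> M \<and> agree x u (S x 1) \<and> (\<forall>y\<in>W. s y = u y)" if x: "x \<in> M" for x
  proof -
    obtain W where W: "open W" "x \<in> W" "W \<subseteq> M" "path_connected W"
      "\<And>y V t. \<lbrakk>y \<in> W; F V t; y \<in> V\<rbrakk> \<Longrightarrow> \<exists>s. F W s \<and> agree y s t"
      by (rule goodE[OF x]) (rule that)
    have fin: "p x 1 = x" using p[OF x] by (simp add: pathfinish_def)
    obtain V1 where V1: "F V1 (S x 1)" "x \<in> V1" using lift_section[of "{0..1}" "p x" "S x" 1] S[OF x] fin by auto
    obtain u where u: "F W u" "agree x u (S x 1)" using W(5)[OF W(2) V1] by blast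
    have "s y = u y" if y: "y \<in> W" for y
    proof -
      obtain g where g: "path g" "path_image g \<subseteq> W" "pathstart g = x" "pathfinish g = y"
        using W(2,4) y unfolding path_connected_def by metis
      \<comment> \<open>A second path to \<open>y\<close>: the chosen one to \<open>x\<close>,
        followed by one inside the good set \<open>W\<close>, along which the lift is constantly
        \<open>u\<close>.\<close>
      let ?q = "p x +++ g"
      have q: "path ?q" "path_image ?q \<subseteq> M" "pathstart ?q = x0" "pathfinish ?q = y"
        using p[OF x] g W(3) by (auto simp: path_image_join)
      obtain G where G: "lift {0..1} ?q G" "agree (pathstart ?q) (G 0) t"
        by (rule path_lift_exists[OF q(1,2) t(1)]) (use q(3) t(2) in auto)
      have "agree x (G (1 / 2)) (S x 1)"
      proof -
        have "lift {0..1} (?q \<circ> (\<lambda>s. s / 2)) (G \<circ> (\<lambda>s. s / 2))"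
          by (rule lift_compose[OF G(1)]) (auto intro!: continuous_intros)
        then have "lift {0..1} (p x) (\<lambda>s. G (s / 2))"
          unfolding o_def by (rule lift_cong) (auto simp: joinpaths_def)
        moreover have "agree x0 (G 0) (S x 0)" using G(2) S[OF x] q(3) agree_trans agree_sym by metis
        ultimately show ?thesis
          using lift_unique[of "{0..1}" "p x" 0 1 "\<lambda>s. G (s / 2)" "S x"] p[OF x] S[OF x] fin
          by (auto simp: path_def path_image_def pathstart_def)
      qed
      then have xu: "agree x (G (1 / 2)) u" using u(2) agree_trans agree_sym by blast
      have "agree y (G 1) u"
      proof -
        have "lift {0..1} (?q \<circ> (\<lambda>s. (1 + s) / 2)) (G \<circ> (\<lambda>s. (1 + s) / 2))"
          by (rule lift_compose[OF G(1)]) (auto intro!: continuous_intros)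
        then have "lift {0..1} g (\<lambda>s. G ((1 + s) / 2))"
          unfolding o_def
        proof (rule lift_cong)
          fix s :: real assume "s \<in> {0..1}"
          then show "?q ((1 + s) / 2) = g s"
            using fin g(3) by (cases "s = 0") (auto simp: joinpaths_def pathstart_def add_divide_distrib)
        qed
        moreover have "lift {0..1} g (\<lambda>s. u)" by (rule lift_const[OF u(1)]) (use g(2) in \<open>simp add: path_image_def\<close>)
        ultimately have "agree (g 1) (G ((1 + 1) / 2)) u"
          using lift_unique[of "{0..1}" g 0 1 "\<lambda>s. G ((1 + s) / 2)" "\<lambda>s. u"] g xu W(3)
          by (auto simp: path_def path_image_def pathstart_def)
        then show ?thesis using g(4) by (simp add: pathfinish_def)
      qed
      moreover have yM: "y \<in> M" using y W(3) by blast
      moreover have "agree y (G 1) (S y 1)"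
        using path_lift_end_unique[OF M(1) q(1,2), of "p y" G "S y"] p[OF yM] q(3,4) G S[OF yM] agree_trans agree_sym
        by metis
      ultimately have "agree y (S y 1) u" using agree_trans agree_sym by blast
      then show ?thesis unfolding s_def by (rule agree_eq)
    qed
    then show ?thesis using u W by blast
  qed
  have "F M s"
  proof (rule F_local[OF M(2)])
    fix x assume "x \<in> M"
    then obtain W u where W: "F W u" "x \<in> W" "\<forall>y\<in>W. s y = u y" using loc by blast
    then have "agree x s u" unfolding agree_def using F_open by blast
    then show "\<exists>V t. F V t \<and> x \<in> V \<and> agree x s t" using W by blast
  qed
  moreover have "agree x0 s t"
  proof -
    obtain W u where W: "F W u" "x0 \<in> W" "agree x0 u (S x0 1)" "\<forall>y\<in>W. s y = u y" using loc[OF x0] by blast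
    have "agree x0 s u" unfolding agree_def using W F_open by blast
    moreover have "agree x0 (S x0 1) (S x0 0)"
      using loop_lift[OF M(1), of "p x0" "S x0"] p[OF x0] S[OF x0] by simp
    ultimately show ?thesis using W(3) S[OF x0] agree_trans by blast
  qed
  ultimately show ?thesis using that by blast
qed

end

section \<open>Charts and tangent vectors\<close>

lemma bilinear_family_curve_derivative:
  fixes B :: "'a::euclidean_space \<Rightarrow> 'e::euclidean_space \<Rightarrow> 'f::euclidean_space \<Rightarrow> real"
  assumes U: "open U" "z t \<in> U" and sm: "\<And>e f. smooth_on U (\<lambda>z. B z e f)"
    and bil: "\<And>z. z \<in> U \<Longrightarrow> bilinear (B z)" and zU: "\<And>s. s \<in> S \<Longrightarrow> z s \<in> U" "t \<in> S"
    and z: "(z has_vector_derivative v) (at t within S)"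
    and p: "(p has_vector_derivative p') (at t within S)" and q: "(q has_vector_derivative q') (at t within S)"
  shows "((\<lambda>t. B (z t) (p t) (q t)) has_real_derivative
      (frechet_derivative (\<lambda>z. B z (p t) (q t)) (at (z t)) v + B (z t) p' (q t) + B (z t) (p t) q')) (at t within S)"
proof -
  have l1: "linear (\<lambda>e. B x e f)" and l2: "linear (B x e)" if "x \<in> U" for x e f
    using bil[OF that] by (auto simp: bilinear_def)
  let ?D = "\<lambda>f. frechet_derivative (\<lambda>z. B z (p t) f) (at (z t)) v"
  have Dlin: "linear ?D" by (rule frechet_derivative_family_linear[OF U sm l2])
  have d: "((\<lambda>t. B (z t) (p t) f) has_vector_derivative (?D f + B (z t) p' f)) (at t within S)" for f
    by (rule linear_family_curve_derivative[OF U sm l1 zU z p])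
  have "((\<lambda>t. q t \<bullet> b) has_real_derivative (q' \<bullet> b)) (at t within S)" for b
    using bounded_linear.has_vector_derivative[OF bounded_linear_inner_left q]
    by (simp add: has_real_derivative_iff_has_vector_derivative)
  then have "((\<lambda>t. \<Sum>b\<in>Basis. (q t \<bullet> b) *\<^sub>R B (z t) (p t) b) has_vector_derivative
      (\<Sum>b\<in>Basis. (q t \<bullet> b) *\<^sub>R (?D b + B (z t) p' b) + (q' \<bullet> b) *\<^sub>R B (z t) (p t) b)) (at t within S)"
    by (intro has_vector_derivative_sum has_vector_derivative_scaleR d)
  also have "(\<Sum>b\<in>Basis. (q t \<bullet> b) *\<^sub>R (?D b + B (z t) p' b) + (q' \<bullet> b) *\<^sub>R B (z t) (p t) b)
      = ?D (q t) + B (z t) p' (q t) + B (z t) (p t) q'"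
    unfolding linear_Basis_expansion[OF Dlin, of "q t"] linear_Basis_expansion[OF l2[OF U(2)], of p' "q t"]
      linear_Basis_expansion[OF l2[OF U(2)], of "p t" q'] by (simp add: sum.distrib distrib_left)
  finally show ?thesis
    unfolding has_real_derivative_iff_has_vector_derivative
    by (rule has_vector_derivative_transform[OF zU(2), rotated])
       (use linear_Basis_expansion[OF l2[OF zU(1)]] in metis)
qed

section \<open>Transition maps and tangent vectors of a complex manifold\<close>

locale complex_mfd =
  fixes A :: "('m::{t2_space, second_countable_topology}, complex^'n) chart set"
  assumes mfd: "complex_manifold A"
begin

lemma open_chart: "c \<in> A \<Longrightarrow> open (fst c)" and open_chart_image: "c \<in> A \<Longrightarrow> open (chart_image c)"
  using mfd by (auto simp: complex_manifold_def)

lemma chart_homeomorphism: "c \<in> A \<Longrightarrow> homeomorphism (fst c) (chart_image c) (snd c) (chart_inv c)"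
  using mfd by (auto simp: complex_manifold_def)

lemma chart_inv_chart: "\<lbrakk>c \<in> A; p \<in> fst c\<rbrakk> \<Longrightarrow> chart_inv c (snd c p) = p"
  and chart_chart_inv: "\<lbrakk>c \<in> A; z \<in> chart_image c\<rbrakk> \<Longrightarrow> snd c (chart_inv c z) = z"
  and chart_inv_in: "\<lbrakk>c \<in> A; z \<in> chart_image c\<rbrakk> \<Longrightarrow> chart_inv c z \<in> fst c"
  and continuous_chart: "c \<in> A \<Longrightarrow> continuous_on (fst c) (snd c)"
  and continuous_chart_inv: "c \<in> A \<Longrightarrow> continuous_on (chart_image c) (chart_inv c)"
  using chart_homeomorphism[of c] by (auto simp: homeomorphism_def)

lemma chart_in_image: "p \<in> fst c \<Longrightarrow> snd c p \<in> chart_image c"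
  by (simp add: chart_image_def)

lemma open_carrier: "open (carrier A)"
  unfolding carrier_def using open_chart by blast

lemma carrier_charts_at: "p \<in> carrier A \<longleftrightarrow> charts_at A p \<noteq> {}"
  unfolding carrier_def charts_at_def by blast

lemma open_chart_vimage: "\<lbrakk>c \<in> A; open N\<rbrakk> \<Longrightarrow> open (fst c \<inter> snd c -` N)"
  using continuous_open_preimage[OF continuous_chart open_chart] by blast

lemma open_chart_inv_vimage: "\<lbrakk>c \<in> A; open W\<rbrakk> \<Longrightarrow> open (chart_image c \<inter> chart_inv c -` W)"
  using continuous_open_preimage[OF continuous_chart_inv open_chart_image] by blast

definition overlap :: "('m, complex^'n) chart \<Rightarrow> ('m, complex^'n) chart \<Rightarrow> (complex^'n) set"
  where "overlap c d = snd c ` (fst c \<inter> fst d)"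

definition trans :: "('m, complex^'n) chart \<Rightarrow> ('m, complex^'n) chart \<Rightarrow> complex^'n \<Rightarrow> complex^'n"
  where "trans c d = snd d \<circ> chart_inv c"

lemma overlap_iff: "c \<in> A \<Longrightarrow> z \<in> overlap c d \<longleftrightarrow> z \<in> chart_image c \<and> chart_inv c z \<in> fst d"
proof
  assume c: "c \<in> A" and "z \<in> overlap c d"
  then obtain p where "p \<in> fst c" "p \<in> fst d" "z = snd c p" by (auto simp: overlap_def)
  then show "z \<in> chart_image c \<and> chart_inv c z \<in> fst d" by (simp add: chart_inv_chart c chart_in_image)
next
  assume c: "c \<in> A" and z: "z \<in> chart_image c \<and> chart_inv c z \<in> fst d"
  then have "snd c (chart_inv c z) \<in> overlap c d" unfolding overlap_def by (intro imageI IntI chart_inv_in) auto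
  then show "z \<in> overlap c d" using chart_chart_inv c z by simp
qed

lemma open_overlap: "\<lbrakk>c \<in> A; d \<in> A\<rbrakk> \<Longrightarrow> open (overlap c d)"
proof -
  assume cd: "c \<in> A" "d \<in> A"
  have "overlap c d = chart_image c \<inter> chart_inv c -` fst d" using overlap_iff[OF cd(1)] by blast
  then show ?thesis using open_chart_inv_vimage[OF cd(1) open_chart[OF cd(2)]] by simp
qed

lemma in_overlap: "\<lbrakk>p \<in> fst c; p \<in> fst d\<rbrakk> \<Longrightarrow> snd c p \<in> overlap c d"
  by (simp add: overlap_def)

lemma trans_chart: "\<lbrakk>c \<in> A; p \<in> fst c\<rbrakk> \<Longrightarrow> trans c d (snd c p) = snd d p"
  by (simp add: trans_def chart_inv_chart)

lemma trans_inverse: "\<lbrakk>c \<in> A; d \<in> A; z \<in> overlap c d\<rbrakk> \<Longrightarrow> trans d c (trans c d z) = z"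
  by (auto simp: overlap_def trans_chart)

lemma trans_in_overlap: "\<lbrakk>c \<in> A; d \<in> A; z \<in> overlap c d\<rbrakk> \<Longrightarrow> trans c d z \<in> overlap d c"
  by (auto simp: overlap_def trans_chart)

lemma trans_smooth: "\<lbrakk>c \<in> A; d \<in> A\<rbrakk> \<Longrightarrow> smooth_on (overlap c d) (trans c d)"
  using mfd unfolding complex_manifold_def overlap_def[symmetric] trans_def
  by (intro holomorphic_map_on_smooth open_overlap) auto

abbreviation dtrans where "dtrans c d z \<equiv> frechet_derivative (trans c d) (at z)"

lemma dtrans: "\<lbrakk>c \<in> A; d \<in> A; z \<in> overlap c d\<rbrakk> \<Longrightarrow> (trans c d has_derivative dtrans c d z) (at z)"
  by (rule smooth_on_has_derivative[OF trans_smooth])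

lemma dtrans_linear: "\<lbrakk>c \<in> A; d \<in> A; z \<in> overlap c d\<rbrakk> \<Longrightarrow> linear (dtrans c d z)"
  by (rule has_derivative_linear[OF dtrans])

lemma dtrans_smult: "\<lbrakk>c \<in> A; d \<in> A; z \<in> overlap c d\<rbrakk> \<Longrightarrow> dtrans c d z (a *s v) = a *s dtrans c d z v"
proof -
  assume cd: "c \<in> A" "d \<in> A" "z \<in> overlap c d"
  have "holomorphic_map_on (overlap c d) (trans c d)"
    using mfd cd unfolding complex_manifold_def overlap_def trans_def by auto
  then obtain D where "(trans c d has_derivative D) (at z)" "\<forall>a v. D (a *s v) = a *s D v"
    using cd(3) unfolding holomorphic_map_on_def by blast
  then show ?thesis by (simp add: frechet_derivative_eqI)
qed

lemma coord_change_deriv_eq: "coord_change_deriv c d p = dtrans c d (snd c p)"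
  by (simp add: coord_change_deriv_def trans_def)

lemma dtrans_same: "\<lbrakk>c \<in> A; z \<in> chart_image c\<rbrakk> \<Longrightarrow> dtrans c c z = (\<lambda>v. v)"
proof -
  assume c: "c \<in> A" "z \<in> chart_image c"
  have "frechet_derivative (trans c c) (at z) = frechet_derivative (\<lambda>z. z) (at z)"
    by (rule frechet_derivative_cong[OF open_chart_image[OF c(1)] c(2)]) (simp add: trans_def chart_chart_inv c(1))
  then show ?thesis by (simp add: frechet_derivative_ident)
qed

lemma dtrans_cocycle:
  assumes cde: "c \<in> A" "d \<in> A" "e \<in> A" and p: "p \<in> fst c" "p \<in> fst d" "p \<in> fst e"
  shows "dtrans d e (snd d p) (dtrans c d (snd c p) v) = dtrans c e (snd c p) v"
proof -
  have "(trans d e has_derivative dtrans d e (snd d p)) (at (trans c d (snd c p)))"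
    using dtrans[OF cde(2,3) in_overlap] p by (simp add: trans_chart cde)
  then have 1: "((\<lambda>z. trans d e (trans c d z)) has_derivative (\<lambda>v. dtrans d e (snd d p) (dtrans c d (snd c p) v))) (at (snd c p))"
    by (rule has_derivative_compose[OF dtrans[OF cde(1,2) in_overlap[OF p(1,2)]]])
  have "open (overlap c d \<inter> overlap c e)" "snd c p \<in> overlap c d \<inter> overlap c e"
    using open_Int[OF open_overlap[OF cde(1,2)] open_overlap[OF cde(1,3)]] in_overlap p by blast+
  from has_derivative_transform_within_open[OF 1 this]
  have "(trans c e has_derivative (\<lambda>v. dtrans d e (snd d p) (dtrans c d (snd c p) v))) (at (snd c p))"
    using cde by (auto simp: overlap_iff trans_def chart_inv_chart)
  then show ?thesis by (simp add: frechet_derivative_eqI)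
qed

lemma dtrans_inverse:
  assumes "c \<in> A" "d \<in> A" "p \<in> fst c" "p \<in> fst d"
  shows "dtrans d c (snd d p) (dtrans c d (snd c p) v) = v"
  using dtrans_cocycle[OF assms(1,2,1,3,4,3)] dtrans_same[OF assms(1) chart_in_image[OF assms(3)]] by simp

lemma charts_at_iff: "c \<in> charts_at A p \<longleftrightarrow> c \<in> A \<and> p \<in> fst c"
  by (auto simp: charts_at_def)

lemma tangent_of_coords_apply:
  "d \<in> charts_at A p \<Longrightarrow> tangent_of_coords A c p w d = dtrans c d (snd c p) w"
  by (simp add: tangent_of_coords_def coord_change_deriv_eq)

lemma tangent_of_coords_in: "c \<in> charts_at A p \<Longrightarrow> tangent_of_coords A c p w \<in> tangent_space A p"
  unfolding tangent_space_def
  by (auto simp: tangent_of_coords_def coord_change_deriv_eq charts_at_iff dtrans_cocycle)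

lemma tangent_of_coords_self: "c \<in> charts_at A p \<Longrightarrow> tangent_of_coords A c p w c = w"
  by (simp add: tangent_of_coords_apply charts_at_iff dtrans_same chart_in_image)

lemma tangent_eq: "\<lbrakk>v \<in> tangent_space A p; c \<in> charts_at A p\<rbrakk> \<Longrightarrow> v = tangent_of_coords A c p (v c)"
proof (rule ext)
  fix d assume v: "v \<in> tangent_space A p" "c \<in> charts_at A p"
  then have "(d \<notin> charts_at A p \<longrightarrow> v d = 0) \<and> (d \<in> charts_at A p \<longrightarrow> v d = coord_change_deriv c d p (v c))"
    unfolding tangent_space_def by blast
  then show "v d = tangent_of_coords A c p (v c) d" by (simp add: tangent_of_coords_def)
qed

lemma tangent_ext: "\<lbrakk>v \<in> tangent_space A p; w \<in> tangent_space A p; c \<in> charts_at A p; v c = w c\<rbrakk> \<Longrightarrow> v = w"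
  using tangent_eq[of v p c] tangent_eq[of w p c] by simp

lemma tangent_of_coords_linear:
  assumes "c \<in> charts_at A p"
  shows "tangent_of_coords A c p (v + w) = tangent_of_coords A c p v + tangent_of_coords A c p w"
    and "tangent_of_coords A c p (a *s w) = (\<lambda>d. a *s tangent_of_coords A c p w d)"
    and "tangent_of_coords A c p (r *\<^sub>R w) = (\<lambda>d. r *\<^sub>R tangent_of_coords A c p w d)"
  using assms dtrans_linear[OF _ _ in_overlap] dtrans_smult[OF _ _ in_overlap]
  by (auto simp: tangent_of_coords_def coord_change_deriv_eq charts_at_iff fun_eq_iff linear_add linear_cmul)

lemma tangent_of_coords_change:
  assumes "c \<in> charts_at A p" "d \<in> charts_at A p"
  shows "tangent_of_coords A c p w = tangent_of_coords A d p (dtrans c d (snd c p) w)"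
  by (rule tangent_ext[OF tangent_of_coords_in tangent_of_coords_in assms(2)])
     (use assms in \<open>auto simp: tangent_of_coords_self tangent_of_coords_apply\<close>)

lemma tangent_space_cases:
  assumes "v \<in> tangent_space A p"
  obtains "charts_at A p = {}" "v = 0" | c where "c \<in> charts_at A p" "v = tangent_of_coords A c p (v c)"
proof (cases "charts_at A p = {}")
  case True
  then have "v c = 0" for c using assms unfolding tangent_space_def by blast
  then show ?thesis using that(1) True by (simp add: fun_eq_iff)
next
  case False
  then show ?thesis using that(2) tangent_eq[OF assms] by blast
qed

lemma tangent_space_zero: "0 \<in> tangent_space A p"
proof (cases "charts_at A p = {}")
  case False
  then obtain c where "c \<in> charts_at A p" by blast
  then show ?thesis
    using tangent_of_coords_in[of c p 0] tangent_of_coords_linear(3)[of c p 0 0] by (simp add: zero_fun_def)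
qed (simp add: tangent_space_def)

lemma tangent_space_add:
  assumes "v \<in> tangent_space A p" "w \<in> tangent_space A p"
  shows "v + w \<in> tangent_space A p"
  using assms(1)
proof (cases rule: tangent_space_cases)
  case (2 c)
  then show ?thesis
    using tangent_eq[OF assms(2)] tangent_of_coords_linear(1)[of c p "v c" "w c"] tangent_of_coords_in by metis
qed (use assms in simp)

lemma tangent_space_smult:
  assumes "v \<in> tangent_space A p"
  shows "(\<lambda>c. a *s v c) \<in> tangent_space A p"
  using assms
proof (cases rule: tangent_space_cases)
  case 1
  then show ?thesis using tangent_space_zero by (simp add: zero_fun_def)
next
  case (2 c)
  then show ?thesis using tangent_of_coords_linear(2)[of c p a "v c"] tangent_of_coords_in by metis
qed

lemma Jmap_in: "v \<in> tangent_space A p \<Longrightarrow> Jmap v \<in> tangent_space A p"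
  unfolding Jmap_def by (rule tangent_space_smult)

lemma coord_form_eq:
  "\<lbrakk>c \<in> A; p \<in> fst c\<rbrakk> \<Longrightarrow> coord_form A \<Omega> c (snd c p) v w
     = \<Omega> p (tangent_of_coords A c p v) (tangent_of_coords A c p w)"
  by (simp add: coord_form_def chart_inv_chart)

lemma coord_form_change:
  assumes "c \<in> A" "d \<in> A" "z \<in> overlap c d"
  shows "coord_form A \<Omega> c z v w = coord_form A \<Omega> d (trans c d z) (dtrans c d z v) (dtrans c d z w)"
proof -
  obtain p where p: "p \<in> fst c" "p \<in> fst d" "z = snd c p" using assms(3) by (auto simp: overlap_def)
  then show ?thesis
    using assms tangent_of_coords_change[of c p d] by (simp add: coord_form_eq trans_chart charts_at_iff)
qed

end

section \<open>The Kaehler form and the Killing equation in charts\<close>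

locale kaehler_mfd = complex_mfd A for A :: "('m::{t2_space, second_countable_topology}, complex^'n) chart set" +
  fixes \<Omega> :: "'m \<Rightarrow> ('m, complex^'n) tvec \<Rightarrow> ('m, complex^'n) tvec \<Rightarrow> real"
  assumes kaehler: "kaehler_form A \<Omega>"
begin

abbreviation cf where "cf c \<equiv> coord_form A \<Omega> c"

lemma cf_smooth: "c \<in> A \<Longrightarrow> smooth_on (chart_image c) (\<lambda>z. cf c z v w)"
  using kaehler by (simp add: kaehler_form_def)

lemma Omega_rules:
  assumes "p \<in> carrier A" "u \<in> tangent_space A p" "v \<in> tangent_space A p" "w \<in> tangent_space A p"
  shows "\<Omega> p (u + v) w = \<Omega> p u w + \<Omega> p v w" "\<Omega> p (\<lambda>c. r *\<^sub>R v c) w = r * \<Omega> p v w"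
    "\<Omega> p w v = - \<Omega> p v w" "\<Omega> p (Jmap v) (Jmap w) = \<Omega> p v w" "v \<noteq> 0 \<Longrightarrow> \<Omega> p v (Jmap v) > 0"
proof -
  note k = kaehler[unfolded kaehler_form_def kaehler_metric_def]
  show "\<Omega> p (u + v) w = \<Omega> p u w + \<Omega> p v w"
    by (rule k[THEN conjunct1, THEN bspec, THEN bspec, THEN bspec, THEN bspec, OF assms])
  have "(\<forall>r. \<Omega> p (\<lambda>c. r *\<^sub>R v c) w = r * \<Omega> p v w) \<and> \<Omega> p w v = - \<Omega> p v w \<and>
       \<Omega> p (Jmap v) (Jmap w) = \<Omega> p v w \<and> (v \<noteq> 0 \<longrightarrow> \<Omega> p v (Jmap v) > 0)"
    by (rule k[THEN conjunct2, THEN conjunct1, THEN bspec, THEN bspec, THEN bspec, OF assms(1,3,4)])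
  then show "\<Omega> p (\<lambda>c. r *\<^sub>R v c) w = r * \<Omega> p v w" "\<Omega> p w v = - \<Omega> p v w"
    "\<Omega> p (Jmap v) (Jmap w) = \<Omega> p v w" "v \<noteq> 0 \<Longrightarrow> \<Omega> p v (Jmap v) > 0"
    by blast+
qed

lemma cf_rules:
  assumes c: "c \<in> A" "z \<in> chart_image c"
  shows "cf c z (u + v) w = cf c z u w + cf c z v w" "cf c z (r *\<^sub>R v) w = r * cf c z v w"
    "cf c z w v = - cf c z v w" "cf c z (\<i> *s v) (\<i> *s w) = cf c z v w"
    "v \<noteq> 0 \<Longrightarrow> cf c z v (\<i> *s v) > 0"
proof -
  let ?p = "chart_inv c z" and ?t = "tangent_of_coords A c (chart_inv c z)"
  have p: "c \<in> charts_at A ?p" "?p \<in> carrier A"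
    unfolding charts_at_iff carrier_def using c chart_inv_in[OF c] by blast+
  note t = tangent_of_coords_in[OF p(1)] and l = tangent_of_coords_linear[OF p(1)]
  have J: "?t (\<i> *s v) = Jmap (?t v)" for v by (simp add: l Jmap_def)
  show "cf c z (u + v) w = cf c z u w + cf c z v w" "cf c z (r *\<^sub>R v) w = r * cf c z v w"
    "cf c z w v = - cf c z v w" "cf c z (\<i> *s v) (\<i> *s w) = cf c z v w"
    unfolding coord_form_def J by (simp_all only: l(1,3) Omega_rules(1,2,4)[OF p(2) t t t] Omega_rules(3)[OF p(2) t t t, of w v])
  assume "v \<noteq> 0"
  then have "?t v \<noteq> 0" using tangent_of_coords_self[OF p(1), of v] by auto
  then show "cf c z v (\<i> *s v) > 0" unfolding coord_form_def J by (rule Omega_rules(5)[OF p(2) t t t])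
qed

lemma cf_bilinear: "\<lbrakk>c \<in> A; z \<in> chart_image c\<rbrakk> \<Longrightarrow> bilinear (cf c z)"
proof -
  assume c: "c \<in> A" "z \<in> chart_image c"
  note r = cf_rules[OF c]
  have l: "linear (\<lambda>v. cf c z v w)" for w by (rule linearI) (simp_all add: r(1,2))
  have e: "cf c z v = (\<lambda>w. - cf c z w v)" for v by (rule ext) (rule r(3))
  have "linear (cf c z v)" for v unfolding e[of v] by (rule linear_compose_neg[OF l])
  then show ?thesis using l by (simp add: bilinear_def)
qed

text \<open>The transformation law \<open>coord_form_change\<close> is differentiated along \<xi>.
  The second derivatives of the coordinate change that arise are, by their symmetry, exactly those
  in the derivative of the transformed field.\<close>

lemma killing_change_chart:
  assumes cd: "c \<in> A" "d \<in> A" and k: "killing_on (cf c) N \<xi>" and N: "N \<subseteq> overlap c d"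
  shows "killing_on (cf d) (overlap d c \<inter> trans d c -` N) (\<lambda>y. dtrans c d (trans d c y) (\<xi> (trans d c y)))"
proof -
  let ?N = "overlap d c \<inter> trans d c -` N"
  have oN: "open N" and xN: "smooth_on N \<xi>" and xc: "\<And>z a v. z \<in> N \<Longrightarrow> frechet_derivative \<xi> (at z) (a *s v) = a *s frechet_derivative \<xi> (at z) v"
    and xk: "\<And>z v w. z \<in> N \<Longrightarrow> frechet_derivative (\<lambda>z. cf c z v w) (at z) (\<xi> z)
       + cf c z (frechet_derivative \<xi> (at z) v) w + cf c z v (frechet_derivative \<xi> (at z) w) = 0"
    using k by (auto simp: killing_on_def)
  define \<eta> where "\<eta> z = dtrans c d z (\<xi> z)" for z
  have tN: "smooth_on N (trans c d)" by (rule smooth_on_subset[OF trans_smooth[OF cd] N])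
  have eN: "smooth_on N \<eta>" unfolding \<eta>_def by (rule smooth_on_frechet_apply[OF oN tN xN])
  have oN': "open ?N"
    using continuous_open_preimage[OF smooth_on_continuous_on[OF trans_smooth[OF cd(2,1)]] open_overlap[OF cd(2,1)] oN]
    by simp
  have sm: "smooth_on ?N (\<lambda>y. \<eta> (trans d c y))"
    by (rule smooth_on_compose[OF oN' oN _ eN smooth_on_subset[OF trans_smooth[OF cd(2,1)]]]) auto
  define D2 where "D2 z e v = frechet_derivative (\<lambda>z. dtrans c d z e) (at z) v" for z e v
  have D2sym: "D2 z e v = D2 z v e" if "z \<in> N" for z e v
    unfolding D2_def by (rule smooth_on_symmetric_second_derivative[OF tN oN that])
  \<comment> \<open>Complex-linearity of \<open>D2\<close> in its first slot comes from that of the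
    first derivatives; symmetry carries it over to the second slot.\<close>
  have D2smult: "D2 z e (a *s v) = a *s D2 z e v" if z: "z \<in> N" for z e a v
  proof -
    have "((\<lambda>z. dtrans c d z (a *s v)) has_derivative (\<lambda>e. a *s D2 z v e)) (at z)"
      unfolding D2_def
      by (rule has_derivative_transform_within_open[OF bounded_linear.has_derivative[OF bounded_linear_smult_right
            smooth_on_has_derivative[OF smooth_on_frechet_derivative[OF tN] z]] oN z])
         (use dtrans_smult[OF cd] N in auto)
    then have "D2 z (a *s v) e = a *s D2 z v e" unfolding D2_def[of z "a *s v"] by (simp add: frechet_derivative_eqI)
    then show ?thesis using D2sym[OF z] by metis
  qed
  have lin: "linear (dtrans c d z)" if "z \<in> N" for z using dtrans_linear[OF cd] that N by blast
  have D\<eta>: "frechet_derivative \<eta> (at z) v = D2 z (\<xi> z) v + dtrans c d z (frechet_derivative \<xi> (at z) v)" if z: "z \<in> N" for z v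
  proof -
    have "((\<lambda>t. z + t *\<^sub>R v) has_vector_derivative v) (at (0::real))" by (auto intro!: derivative_eq_intros)
    moreover have "open ((\<lambda>t::real. z + t *\<^sub>R v) -` N)" by (rule open_vimage[OF oN]) (intro continuous_intros)
    moreover have "0 \<in> (\<lambda>t::real. z + t *\<^sub>R v) -` N" using z by simp
    moreover have "((\<lambda>t. \<xi> (z + t *\<^sub>R v)) has_vector_derivative frechet_derivative \<xi> (at z) v) (at 0)"
      by (rule has_vector_derivative_line[OF smooth_on_has_derivative[OF xN z]])
    ultimately have "((\<lambda>t. dtrans c d (z + t *\<^sub>R v) (\<xi> (z + t *\<^sub>R v))) has_vector_derivative
       (frechet_derivative (\<lambda>z'. dtrans c d z' (\<xi> (z + 0 *\<^sub>R v))) (at (z + 0 *\<^sub>R v)) v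
         + dtrans c d (z + 0 *\<^sub>R v) (frechet_derivative \<xi> (at z) v))) (at 0 within (\<lambda>t::real. z + t *\<^sub>R v) -` N)"
      by (intro linear_family_curve_derivative[OF oN _ smooth_on_frechet_derivative[OF tN] lin])
         (auto intro: has_vector_derivative_at_within)
    then have "((\<lambda>t. \<eta> (z + t *\<^sub>R v)) has_vector_derivative
       (D2 z (\<xi> z) v + dtrans c d z (frechet_derivative \<xi> (at z) v))) (at 0)"
      using at_within_open[OF \<open>0 \<in> _ -` N\<close> \<open>open (_ -` N)\<close>] by (simp add: \<eta>_def D2_def)
    then show ?thesis
      using has_vector_derivative_line[OF smooth_on_has_derivative[OF eN z], of v] vector_derivative_unique_at by blast
  qed
  have zN: "trans d c y \<in> N" "y \<in> overlap d c" if "y \<in> ?N" for y using that by auto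
  have D\<xi>': "frechet_derivative (\<lambda>y. \<eta> (trans d c y)) (at y) v = frechet_derivative \<eta> (at (trans d c y)) (dtrans d c y v)"
    if y: "y \<in> ?N" for y v
    using has_derivative_compose[OF dtrans[OF cd(2,1) zN(2)[OF y]] smooth_on_has_derivative[OF eN zN(1)[OF y]]]
    by (simp add: frechet_derivative_eqI)
  show ?thesis
    unfolding killing_on_def \<eta>_def[symmetric]
  proof (intro conjI oN' sm ballI allI)
    fix y a v assume y: "y \<in> ?N"
    show "frechet_derivative (\<lambda>y. \<eta> (trans d c y)) (at y) (a *s v) = a *s frechet_derivative (\<lambda>y. \<eta> (trans d c y)) (at y) v"
      unfolding D\<xi>'[OF y] D\<eta>[OF zN(1)[OF y]] dtrans_smult[OF cd(2,1) zN(2)[OF y]] D2smult[OF zN(1)[OF y]] xc[OF zN(1)[OF y]]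
      using dtrans_smult[OF cd, of "trans d c y"] zN[OF y] N by (simp add: vector_add_ldistrib subset_iff)
  next
    fix y v' w' assume y: "y \<in> ?N"
    let ?z = "trans d c y"
    have z: "?z \<in> N" and zo: "?z \<in> overlap c d" using zN[OF y] N by auto
    have yz: "trans c d ?z = y" using trans_inverse[OF cd(2,1) zN(2)[OF y]] .
    obtain p where p: "p \<in> fst c" "p \<in> fst d" "y = snd d p" using zN(2)[OF y] by (auto simp: overlap_def)
    have zp: "?z = snd c p" using p by (simp add: trans_chart cd)
    define v w u where "v = dtrans d c y v'" and "w = dtrans d c y w'" and "u = \<xi> ?z"
    have vw: "v' = dtrans c d ?z v" "w' = dtrans c d ?z w"
      unfolding v_def w_def zp using dtrans_inverse[OF cd(2,1) p(2,1), folded p(3)] by simp_all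
    have yd: "y \<in> chart_image d" using p by (simp add: chart_in_image)
    let ?S = "(\<lambda>t::real. ?z + t *\<^sub>R u) -` N"
    have S: "open ?S" "0 \<in> ?S"
      using z by (auto intro!: open_vimage[OF oN] continuous_intros)
    have at0: "at 0 within ?S = at 0" by (rule at_within_open[OF S(2,1)])
    have "((\<lambda>t. cf d (trans c d (?z + t *\<^sub>R u)) (dtrans c d (?z + t *\<^sub>R u) v) (dtrans c d (?z + t *\<^sub>R u) w)) has_real_derivative
      (frechet_derivative (\<lambda>y. cf d y (dtrans c d (?z + 0 *\<^sub>R u) v) (dtrans c d (?z + 0 *\<^sub>R u) w)) (at (trans c d (?z + 0 *\<^sub>R u))) (dtrans c d ?z u)
        + cf d (trans c d (?z + 0 *\<^sub>R u)) (D2 ?z v u) (dtrans c d (?z + 0 *\<^sub>R u) w)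
        + cf d (trans c d (?z + 0 *\<^sub>R u)) (dtrans c d (?z + 0 *\<^sub>R u) v) (D2 ?z w u))) (at 0 within ?S)"
    proof (rule bilinear_family_curve_derivative[OF open_chart_image[OF cd(2)] _ cf_smooth[OF cd(2)] cf_bilinear[OF cd(2)]])
      show "trans c d (?z + 0 *\<^sub>R u) \<in> chart_image d" using yz yd by simp
      show "trans c d (?z + s *\<^sub>R u) \<in> chart_image d" if "s \<in> ?S" for s
        using trans_in_overlap[OF cd, of "?z + s *\<^sub>R u"] N that overlap_iff[OF cd(2)] by auto
      show "((\<lambda>t. trans c d (?z + t *\<^sub>R u)) has_vector_derivative dtrans c d ?z u) (at 0 within ?S)"
        unfolding at0 by (rule has_vector_derivative_line[OF dtrans[OF cd zo]])
      show "((\<lambda>t. dtrans c d (?z + t *\<^sub>R u) v) has_vector_derivative D2 ?z v u) (at 0 within ?S)"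
        "((\<lambda>t. dtrans c d (?z + t *\<^sub>R u) w) has_vector_derivative D2 ?z w u) (at 0 within ?S)"
        unfolding at0 D2_def
        by (rule has_vector_derivative_line[OF smooth_on_has_derivative[OF smooth_on_frechet_derivative[OF tN] z]])+
    qed (use S in auto)
    then have "((\<lambda>t. cf d (trans c d (?z + t *\<^sub>R u)) (dtrans c d (?z + t *\<^sub>R u) v) (dtrans c d (?z + t *\<^sub>R u) w)) has_real_derivative
      (frechet_derivative (\<lambda>y. cf d y v' w') (at y) (dtrans c d ?z u)
        + cf d y (D2 ?z v u) w' + cf d y v' (D2 ?z w u))) (at 0)"
      unfolding at0 by (simp add: yz vw)
    then have "((\<lambda>t. cf c (?z + t *\<^sub>R u) v w) has_vector_derivative
      (frechet_derivative (\<lambda>y. cf d y v' w') (at y) (dtrans c d ?z u)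
        + cf d y (D2 ?z v u) w' + cf d y v' (D2 ?z w u))) (at 0)"
      unfolding has_real_derivative_iff_has_vector_derivative
      by (rule has_vector_derivative_transform_within_open[OF _ S]) (use coord_form_change[OF cd] N in auto)
    moreover have "((\<lambda>t. cf c (?z + t *\<^sub>R u) v w) has_vector_derivative frechet_derivative (\<lambda>z. cf c z v w) (at ?z) u) (at 0)"
      by (rule has_vector_derivative_line[OF smooth_on_has_derivative[OF cf_smooth[OF cd(1)]]])
         (use zo overlap_iff[OF cd(1)] in blast)
    ultimately have e: "frechet_derivative (\<lambda>z. cf c z v w) (at ?z) u
      = frechet_derivative (\<lambda>y. cf d y v' w') (at y) (dtrans c d ?z u) + cf d y (D2 ?z v u) w' + cf d y v' (D2 ?z w u)"
      using vector_derivative_unique_at by blast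
    have f: "cf c ?z a b = cf d y (dtrans c d ?z a) (dtrans c d ?z b)" for a b
      using coord_form_change[OF cd zo] yz by simp
    have g: "frechet_derivative (\<lambda>y. \<eta> (trans d c y)) (at y) v' = D2 ?z v u + dtrans c d ?z (frechet_derivative \<xi> (at ?z) v)"
      "frechet_derivative (\<lambda>y. \<eta> (trans d c y)) (at y) w' = D2 ?z w u + dtrans c d ?z (frechet_derivative \<xi> (at ?z) w)"
      unfolding D\<xi>'[OF y] D\<eta>[OF z] v_def[symmetric] w_def[symmetric] u_def[symmetric] D2sym[OF z, of u] by simp_all
    have add: "cf d y (a + b) x = cf d y a x + cf d y b x" "cf d y x (a + b) = cf d y x a + cf d y x b" for a b x
      using linear_add[of "\<lambda>a. cf d y a x" a b] linear_add[of "cf d y x" a b] cf_bilinear[OF cd(2) yd]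
      by (auto simp: bilinear_def)
    show "frechet_derivative (\<lambda>y. cf d y v' w') (at y) (\<eta> (trans d c y))
      + cf d y (frechet_derivative (\<lambda>y. \<eta> (trans d c y)) (at y) v') w'
      + cf d y v' (frechet_derivative (\<lambda>y. \<eta> (trans d c y)) (at y) w') = 0"
      using xk[OF z, of v w] unfolding g add f u_def[symmetric] e vw[symmetric]
      by (simp add: \<eta>_def flip: u_def)
  qed
qed

end

section \<open>The sheaf of Killing fields on the manifold\<close>

lemma killing_on_locally:
  assumes "open N" "\<And>z. z \<in> N \<Longrightarrow> \<exists>N'. z \<in> N' \<and> killing_on B N' \<xi>"
  shows "killing_on B N \<xi>"
proof -
  have "smooth_on N \<xi>"
    by (rule smooth_on_locally) (use assms in \<open>metis killing_on_def\<close>)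
  then show ?thesis using assms unfolding killing_on_def by meson
qed

context kaehler_mfd
begin

definition chart_part :: "('m, complex^'n) chart \<Rightarrow> 'm set \<Rightarrow> (complex^'n) set"
  where "chart_part c W = chart_image c \<inter> chart_inv c -` W"

text \<open>Nothing is demanded outside \<open>W\<close>, as for sections of the sheaf above. The
  equation is imposed in all charts at once; \<open>killing_field_of_chart\<close> derives this from
  a single chart.\<close>

definition killing_field :: "'m set \<Rightarrow> ('m \<Rightarrow> ('m, complex^'n) tvec) \<Rightarrow> bool"
  where "killing_field W X \<longleftrightarrow> open W \<and> W \<subseteq> carrier A \<and> (\<forall>x\<in>W. X x \<in> tangent_space A x) \<and>
    (\<forall>c\<in>A. killing_on (cf c) (chart_part c W) (\<lambda>z. X (chart_inv c z) c))"

lemma open_chart_part: "\<lbrakk>c \<in> A; open W\<rbrakk> \<Longrightarrow> open (chart_part c W)"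
  unfolding chart_part_def by (rule open_chart_inv_vimage)

lemma chart_part_in: "\<lbrakk>c \<in> A; x \<in> fst c; x \<in> W\<rbrakk> \<Longrightarrow> snd c x \<in> chart_part c W"
  by (simp add: chart_part_def chart_in_image chart_inv_chart)

lemma killing_field_local:
  assumes W: "open W" and l: "\<And>x. x \<in> W \<Longrightarrow> \<exists>V t. killing_field V t \<and> x \<in> V \<and> (\<exists>N. open N \<and> x \<in> N \<and> (\<forall>z\<in>N. s z = t z))"
  shows "killing_field W s"
  unfolding killing_field_def
proof (intro conjI ballI W)
  show "W \<subseteq> carrier A" using l unfolding killing_field_def by blast
  show "s x \<in> tangent_space A x" if "x \<in> W" for x using l[OF that] unfolding killing_field_def by metis
next
  fix c assume c: "c \<in> A"
  show "killing_on (cf c) (chart_part c W) (\<lambda>z. s (chart_inv c z) c)"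
  proof (rule killing_on_locally[OF open_chart_part[OF c W]])
    fix z assume z: "z \<in> chart_part c W"
    then have "chart_inv c z \<in> W" by (simp add: chart_part_def)
    from l[OF this] obtain V t N where t: "killing_field V t" "chart_inv c z \<in> V" "open N" "chart_inv c z \<in> N" "\<forall>z\<in>N. s z = t z"
      by (elim exE conjE)
    let ?N = "chart_part c (V \<inter> N)"
    have V: "open V" using t(1) by (simp add: killing_field_def)
    have k: "killing_on (cf c) (chart_part c V) (\<lambda>z. t (chart_inv c z) c)" using t(1) c by (simp add: killing_field_def)
    have "killing_on (cf c) ?N (\<lambda>z. t (chart_inv c z) c)"
      by (rule killing_on_subset[OF k open_chart_part[OF c open_Int[OF V t(3)]]]) (auto simp: chart_part_def)
    then have "killing_on (cf c) ?N (\<lambda>z. s (chart_inv c z) c)"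
      by (rule killing_on_cong) (use t(5) in \<open>simp add: chart_part_def\<close>)
    moreover have "z \<in> ?N" using z t(2,4) by (simp add: chart_part_def)
    ultimately show "\<exists>N'. z \<in> N' \<and> killing_on (cf c) N' (\<lambda>z. s (chart_inv c z) c)" by blast
  qed
qed

lemma chart_inv_image: "\<lbrakk>c \<in> A; N \<subseteq> chart_image c\<rbrakk> \<Longrightarrow> chart_inv c ` N = fst c \<inter> snd c -` N"
proof (intro equalityI subsetI)
  fix x assume c: "c \<in> A" and N: "N \<subseteq> chart_image c"
  show "x \<in> fst c \<inter> snd c -` N" if "x \<in> chart_inv c ` N"
  proof -
    from that obtain z where "z \<in> N" "x = chart_inv c z" by blast
    then show ?thesis using chart_chart_inv[OF c] chart_inv_in[OF c] N by (metis IntI subsetD vimageI)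
  qed
  show "x \<in> chart_inv c ` N" if "x \<in> fst c \<inter> snd c -` N"
    using that chart_inv_chart[OF c, of x] by (metis IntD1 IntD2 imageI vimageD)
qed

lemma killing_field_of_chart:
  assumes c: "c \<in> A" and N: "N \<subseteq> chart_image c" and k: "killing_on (cf c) N \<xi>"
  shows "killing_field (chart_inv c ` N) (\<lambda>x. tangent_of_coords A c x (\<xi> (snd c x)))"
  unfolding killing_field_def
proof (intro conjI ballI)
  have oN: "open N" using k by (simp add: killing_on_def)
  show oW: "open (chart_inv c ` N)" unfolding chart_inv_image[OF c N] by (rule open_chart_vimage[OF c oN])
  show "chart_inv c ` N \<subseteq> carrier A" unfolding chart_inv_image[OF c N] carrier_def using c by blast
  show "tangent_of_coords A c x (\<xi> (snd c x)) \<in> tangent_space A x" if "x \<in> chart_inv c ` N" for x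
    by (rule tangent_of_coords_in) (use that c in \<open>simp add: chart_inv_image N charts_at_iff\<close>)
  fix d assume d: "d \<in> A"
  let ?N = "overlap d c \<inter> trans d c -` (N \<inter> overlap c d)"
  have "killing_on (cf c) (N \<inter> overlap c d) \<xi>"
    by (rule killing_on_subset[OF k open_Int[OF oN open_overlap[OF c d]]]) simp
  from killing_change_chart[OF c d this]
  have k': "killing_on (cf d) ?N (\<lambda>y. dtrans c d (trans d c y) (\<xi> (trans d c y)))" by simp
  have eq: "chart_part d (chart_inv c ` N) = ?N"
  proof (intro equalityI subsetI)
    fix y assume "y \<in> chart_part d (chart_inv c ` N)"
    then have y: "y \<in> chart_image d" "chart_inv d y \<in> fst c" "snd c (chart_inv d y) \<in> N"
      by (auto simp: chart_part_def chart_inv_image[OF c N])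
    then have yo: "y \<in> overlap d c" by (simp add: overlap_iff d)
    then have "trans d c y \<in> N" using y by (simp add: trans_def)
    then show "y \<in> ?N" using yo trans_in_overlap[OF d c yo] by simp
  next
    fix y assume y: "y \<in> ?N"
    then show "y \<in> chart_part d (chart_inv c ` N)"
      using overlap_iff[OF d, of y c] by (auto simp: chart_part_def chart_inv_image[OF c N] trans_def)
  qed
  show "killing_on (cf d) (chart_part d (chart_inv c ` N))
      (\<lambda>z. tangent_of_coords A c (chart_inv d z) (\<xi> (snd c (chart_inv d z))) d)"
    unfolding eq
  proof (rule killing_on_cong[OF k'])
    fix y assume "y \<in> ?N"
    then have "y \<in> chart_image d" by (simp add: overlap_iff[OF d])
    then have "d \<in> charts_at A (chart_inv d y)" using chart_inv_in[OF d] d by (simp add: charts_at_iff)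
    then show "dtrans c d (trans d c y) (\<xi> (trans d c y)) = tangent_of_coords A c (chart_inv d y) (\<xi> (snd c (chart_inv d y))) d"
      by (simp add: tangent_of_coords_apply trans_def)
  qed
qed

end

text \<open>All that the global argument takes from the Bochner-Kaehler structure equations is frame
  data on each chart; \<open>frame_data_exists\<close> derives them from the definition.\<close>

locale bochner_mfd = kaehler_mfd A \<Omega> for A :: "('m::{t2_space, second_countable_topology}, complex^'n) chart set"
    and \<Omega> :: "'m \<Rightarrow> ('m, complex^'n) tvec \<Rightarrow> ('m, complex^'n) tvec \<Rightarrow> real" +
  assumes frame: "c \<in> A \<Longrightarrow> \<exists>E F ph H T V. frame_data (chart_image c) E F ph H T V (cf c)"
begin

lemma killing_field_agree:
  assumes c: "c \<in> A" and s: "\<And>x. x \<in> W \<Longrightarrow> s x \<in> tangent_space A x" "\<And>x. x \<in> W \<Longrightarrow> t x \<in> tangent_space A x"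
    and W: "open W" "y \<in> W" "y \<in> fst c" and N: "open N" "snd c y \<in> N"
    and e: "\<And>x. \<lbrakk>x \<in> W; x \<in> fst c; snd c x \<in> N\<rbrakk> \<Longrightarrow> s x c = t x c"
  shows "\<exists>N. open N \<and> y \<in> N \<and> (\<forall>z\<in>N. s z = t z)"
proof (intro exI conjI ballI)
  show "open (W \<inter> (fst c \<inter> snd c -` N))" by (intro open_Int W open_chart_vimage[OF c N(1)])
  show "y \<in> W \<inter> (fst c \<inter> snd c -` N)" using W N by simp
  show "s z = t z" if "z \<in> W \<inter> (fst c \<inter> snd c -` N)" for z
    by (rule tangent_ext[of _ z _ c]) (use that s e c in \<open>auto simp: charts_at_iff\<close>)
qed

text \<open>The good sets correspond in a chart to the balls of
  \<open>killing_locally_constant\<close>, and they are path-connected because balls are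
  convex.\<close>

sublocale killing: locally_constant_sheaf "carrier A" killing_field
    "\<lambda>y s t. \<exists>N. open N \<and> y \<in> N \<and> (\<forall>z\<in>N. s z = t z)"
proof unfold_locales
  show "open W" if "killing_field W s" for W s using that by (simp add: killing_field_def)
  show "killing_field W s" if "open W" "\<And>x. x \<in> W \<Longrightarrow> \<exists>V t. killing_field V t \<and> x \<in> V \<and> (\<exists>N. open N \<and> x \<in> N \<and> (\<forall>z\<in>N. s z = t z))" for W s
    using that by (rule killing_field_local)
next
  fix x assume "x \<in> carrier A"
  then obtain c where c: "c \<in> A" "x \<in> fst c" by (auto simp: carrier_def)
  obtain E F ph H T V where "frame_data (chart_image c) E F ph H T V (cf c)" using frame[OF c(1)] by (elim exE)
  then interpret frame_data "chart_image c" E F ph H T V "cf c" .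
  obtain r where r: "r > 0" "ball (snd c x) r \<subseteq> chart_image c" and
    ex: "\<And>y N \<xi>. \<lbrakk>y \<in> ball (snd c x) r; killing_on (cf c) N \<xi>; y \<in> N\<rbrakk> \<Longrightarrow>
       \<exists>\<xi>'. killing_on (cf c) (ball (snd c x) r) \<xi>' \<and> (\<exists>N'. open N' \<and> y \<in> N' \<and> (\<forall>z\<in>N'. \<xi>' z = \<xi> z))" and
    un: "\<And>y N' \<xi> \<xi>' z. \<lbrakk>killing_on (cf c) (ball (snd c x) r) \<xi>; killing_on (cf c) (ball (snd c x) r) \<xi>'; y \<in> ball (snd c x) r; open N'; y \<in> N';
       \<And>z. z \<in> N' \<Longrightarrow> \<xi> z = \<xi>' z; z \<in> ball (snd c x) r\<rbrakk> \<Longrightarrow> \<xi> z = \<xi>' z"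
  proof (rule killing_locally_constant[OF chart_in_image[OF c(2)]], goal_cases)
    case (1 r)
    show ?case by (rule 1(1)[of r, OF 1(2,3,4)], assumption+) (rule 1(5), assumption+)
  qed
  define b where "b = ball (snd c x) r"
  note r = r[folded b_def] and ex = ex[folded b_def] and un = un[folded b_def]
  define W where "W = chart_inv c ` b"
  have W': "W = fst c \<inter> snd c -` b" unfolding W_def by (rule chart_inv_image[OF c(1) r(2)])
  have oW: "open W" unfolding W' by (rule open_chart_vimage[OF c(1)]) (simp add: b_def)
  have xW: "x \<in> W" unfolding W' using c r(1) by (simp add: b_def)
  have WM: "W \<subseteq> carrier A" unfolding W' carrier_def using c by blast
  have pc: "path_connected W" unfolding W_def
    by (rule path_connected_continuous_image[OF continuous_on_subset[OF continuous_chart_inv[OF c(1)] r(2)]])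
       (simp add: b_def convex_imp_path_connected)
  have part: "chart_part c W = b"
    unfolding chart_part_def W' using r(2) chart_chart_inv[OF c(1)] chart_inv_in[OF c(1)] by (auto simp del: split_paired_All)
  have e: "\<exists>s. killing_field W s \<and> (\<exists>N. open N \<and> y \<in> N \<and> (\<forall>z\<in>N. s z = t z))" if y: "y \<in> W" and t: "killing_field V t" "y \<in> V" for y V t
  proof -
    have yb: "snd c y \<in> b" "y \<in> fst c" using y unfolding W' by auto
    have k: "killing_on (cf c) (chart_part c V) (\<lambda>z. t (chart_inv c z) c)" using t(1) c(1) by (simp add: killing_field_def)
    from ex[OF yb(1) k chart_part_in[OF c(1) yb(2) t(2)]] obtain \<xi>' N' where
      x': "killing_on (cf c) b \<xi>'" "open N'" "snd c y \<in> N'" "\<forall>z\<in>N'. \<xi>' z = t (chart_inv c z) c"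
      by (elim exE conjE)
    let ?s = "\<lambda>x. tangent_of_coords A c x (\<xi>' (snd c x))"
    have ks: "killing_field W ?s" unfolding W_def by (rule killing_field_of_chart[OF c(1) r(2) x'(1)])
    have "\<exists>N. open N \<and> y \<in> N \<and> (\<forall>z\<in>N. ?s z = t z)"
    proof (rule killing_field_agree[OF c(1), where W="V \<inter> W"])
      show "?s x \<in> tangent_space A x" "t x \<in> tangent_space A x" if "x \<in> V \<inter> W" for x
        using ks t(1) that by (auto simp: killing_field_def)
      show "open (V \<inter> W)" using oW t(1) by (auto simp: killing_field_def)
      show "?s x c = t x c" if "x \<in> V \<inter> W" "x \<in> fst c" "snd c x \<in> N'" for x
        using that x'(4) c(1) by (simp add: tangent_of_coords_self charts_at_iff chart_inv_chart)
    qed (use y t yb x' in auto)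
    then show ?thesis using ks by blast
  qed
  have u: "s z = s' z" if y: "y \<in> W" and s: "killing_field W s" "killing_field W s'"
    and a: "\<exists>N. open N \<and> y \<in> N \<and> (\<forall>z\<in>N. s z = s' z)" and z: "z \<in> W" for y s s' z
  proof (rule tangent_ext[of _ z _ c])
    show "s z \<in> tangent_space A z" "s' z \<in> tangent_space A z" using s z by (auto simp: killing_field_def)
    show "c \<in> charts_at A z" using z c by (simp add: W' charts_at_iff)
    from a obtain N where N: "open N" "y \<in> N" "\<forall>z\<in>N. s z = s' z" by (elim exE conjE)
    have k: "killing_on (cf c) b (\<lambda>z. s (chart_inv c z) c)" "killing_on (cf c) b (\<lambda>z. s' (chart_inv c z) c)"
      using s c(1) part unfolding killing_field_def by metis+
    have "(\<lambda>z. s (chart_inv c z) c) (snd c z) = (\<lambda>z. s' (chart_inv c z) c) (snd c z)"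
    proof (rule un[OF k, of "snd c y" "chart_part c N"])
      show "snd c y \<in> chart_part c N" by (rule chart_part_in) (use y N c in \<open>auto simp: W'\<close>)
      show "s (chart_inv c z) c = s' (chart_inv c z) c" if "z \<in> chart_part c N" for z
        using that N(3) by (simp add: chart_part_def)
    qed (use y z N c in \<open>auto simp: W' open_chart_part\<close>)
    then show "s z c = s' z c" using z c(1) by (simp add: W' chart_inv_chart)
  qed
  show "\<exists>W. open W \<and> x \<in> W \<and> W \<subseteq> carrier A \<and> path_connected W \<and>
       (\<forall>y V t. y \<in> W \<and> killing_field V t \<and> y \<in> V \<longrightarrow> (\<exists>s. killing_field W s \<and> (\<exists>N. open N \<and> y \<in> N \<and> (\<forall>z\<in>N. s z = t z)))) \<and>
       (\<forall>y s s'. y \<in> W \<and> killing_field W s \<and> killing_field W s' \<and> (\<exists>N. open N \<and> y \<in> N \<and> (\<forall>z\<in>N. s z = s' z)) \<longrightarrow> (\<forall>z\<in>W. s z = s' z))"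
  proof (intro exI[of _ W] conjI allI impI ballI oW xW WM pc)
    show "\<exists>s. killing_field W s \<and> (\<exists>N. open N \<and> y \<in> N \<and> (\<forall>z\<in>N. s z = t z))"
      if "y \<in> W \<and> killing_field V t \<and> y \<in> V" for y V t
      using that by (elim conjE) (rule e)
    show "s z = s' z" if "y \<in> W \<and> killing_field W s \<and> killing_field W s' \<and> (\<exists>N. open N \<and> y \<in> N \<and> (\<forall>z\<in>N. s z = s' z))" "z \<in> W" for y s s' z
      using that by (elim conjE) (rule u)
  qed
qed (rule reflexive)

text \<open>An independent family of germs at one point is extended to the whole manifold; a linear
  relation between the extensions restricts to one between the germs.\<close>

lemma global_killing_fields:
  assumes M: "simply_connected (carrier A)" and ne: "carrier A \<noteq> {}"
  obtains X :: "'n \<Rightarrow> 'm \<Rightarrow> ('m, complex^'n) tvec"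
  where "\<And>m. killing_field (carrier A) (X m)"
    "\<And>a. (\<And>p c. p \<in> carrier A \<Longrightarrow> (\<Sum>m\<in>UNIV. a m *\<^sub>R X m p c) = 0) \<Longrightarrow> \<forall>m. a m = 0"
proof -
  obtain x where xM: "x \<in> carrier A" using ne by blast
  then obtain c where c: "c \<in> A" "x \<in> fst c" by (auto simp: carrier_def)
  obtain E F ph H T V where "frame_data (chart_image c) E F ph H T V (cf c)" using frame[OF c(1)] by (elim exE)
  then interpret frame_data "chart_image c" E F ph H T V "cf c" .
  obtain r and \<xi> :: "'n \<Rightarrow> complex^'n \<Rightarrow> complex^'n" where r: "r > 0" "ball (snd c x) r \<subseteq> chart_image c"
    and k: "\<And>m. killing_on (cf c) (ball (snd c x) r) (\<xi> m)"
    and ind: "\<And>a N. \<lbrakk>open N; snd c x \<in> N; \<And>z. z \<in> N \<Longrightarrow> (\<Sum>m\<in>UNIV. a m *\<^sub>R \<xi> m z) = 0\<rbrakk> \<Longrightarrow> (\<forall>m. a m = 0)"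
  proof (rule killing_family[OF chart_in_image[OF c(2)]], goal_cases)
    case (1 r \<xi>)
    show ?case by (rule 1(1)[of r \<xi>, OF 1(2,3,4)]) (rule 1(5), assumption+)
  qed
  let ?W = "chart_inv c ` ball (snd c x) r"
  let ?s = "\<lambda>m x. tangent_of_coords A c x (\<xi> m (snd c x))"
  have W: "?W = fst c \<inter> snd c -` ball (snd c x) r" by (rule chart_inv_image[OF c(1) r(2)])
  have "\<exists>X. killing_field (carrier A) X \<and> (\<exists>N. open N \<and> x \<in> N \<and> (\<forall>z\<in>N. X z = ?s m z))" for m
    by (rule killing.global_section_exists[OF M open_carrier xM killing_field_of_chart[OF c(1) r(2) k, of m]])
       (use c r W in auto)
  then obtain X where X: "\<And>m. killing_field (carrier A) (X m)" "\<And>m. \<exists>N. open N \<and> x \<in> N \<and> (\<forall>z\<in>N. X m z = ?s m z)"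
    by metis
  then obtain N where N: "\<And>m. open (N m)" "\<And>m. x \<in> N m" "\<And>m z. z \<in> N m \<Longrightarrow> X m z = ?s m z"
    by metis
  show ?thesis
  proof (rule that[OF X(1)])
    fix a assume a: "\<And>p c. p \<in> carrier A \<Longrightarrow> (\<Sum>m\<in>UNIV. a m *\<^sub>R X m p c) = 0"
    let ?N = "chart_part c (\<Inter>m. N m)"
    show "\<forall>m. a m = 0"
    proof (rule ind)
      show "open ?N" by (intro open_chart_part c open_INT) (use N in auto)
      show "snd c x \<in> ?N" by (rule chart_part_in[OF c]) (use N in auto)
      fix z assume "z \<in> ?N"
      then have z: "z \<in> chart_image c" "\<And>m. chart_inv c z \<in> N m" by (auto simp: chart_part_def)
      have p: "c \<in> charts_at A (chart_inv c z)" using z c(1) chart_inv_in[OF c(1)] by (simp add: charts_at_iff)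
      have "X m (chart_inv c z) c = \<xi> m z" for m
        using N(3)[OF z(2)] tangent_of_coords_self[OF p] chart_chart_inv[OF c(1) z(1)] by simp
      moreover have "chart_inv c z \<in> carrier A" using p carrier_charts_at by blast
      ultimately show "(\<Sum>m\<in>UNIV. a m *\<^sub>R \<xi> m z) = 0" using a[of "chart_inv c z" c] by simp
    qed
  qed
qed

end

section \<open>Unitary frames\<close>

lemma bounded_bilinear_smult: "bounded_bilinear (\<lambda>a (v :: complex^'n). a *s v)"
  unfolding bilinear_conv_bounded_bilinear[symmetric] bilinear_def
  by (auto intro: bounded_linear.linear bounded_linear_smult_left bounded_linear_smult_right)

lemma smooth_on_bilinear_family_apply:
  fixes B :: "'a::real_normed_vector \<Rightarrow> 'd::euclidean_space \<Rightarrow> 'e::euclidean_space \<Rightarrow> 'f::real_normed_vector"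
  assumes S: "open S" and B: "\<And>d e. smooth_on S (\<lambda>z. B z d e)" "\<And>z. z \<in> S \<Longrightarrow> bilinear (B z)"
    and p: "smooth_on S p" "smooth_on S q"
  shows "smooth_on S (\<lambda>z. B z (p z) (q z))"
proof (rule smooth_on_linear_family_apply[OF S _ _ p(2)])
  show "smooth_on S (\<lambda>z. B z (p z) e)" for e
    by (rule smooth_on_linear_family_apply[where A="\<lambda>z d. B z d e", OF S B(1) _ p(1)])
       (use B(2) in \<open>auto simp: bilinear_def\<close>)
  show "linear (B z (p z))" if "z \<in> S" for z using B(2)[OF that] by (auto simp: bilinear_def)
qed

locale kaehler_family =
  fixes U :: "(complex^'n) set" and B :: "complex^'n \<Rightarrow> complex^'n \<Rightarrow> complex^'n \<Rightarrow> real"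
  assumes open_U: "open U" and B_smooth: "smooth_on U (\<lambda>z. B z v w)" and B_bilinear: "z \<in> U \<Longrightarrow> bilinear (B z)"
    and B_skew: "z \<in> U \<Longrightarrow> B z w v = - B z v w" and B_J: "z \<in> U \<Longrightarrow> B z (\<i> *s v) (\<i> *s w) = B z v w"
    and B_pos: "z \<in> U \<Longrightarrow> v \<noteq> 0 \<Longrightarrow> B z v (\<i> *s v) > 0"
begin

text \<open>The Hermitian metric, conjugate-linear in the first argument: its real part is the
  Kaehler metric and its imaginary part the form \<open>B\<close>.\<close>

definition h :: "complex^'n \<Rightarrow> complex^'n \<Rightarrow> complex^'n \<Rightarrow> complex"
  where "h z v w = Complex (B z v (\<i> *s w)) (B z v w)"

lemma B_rules:
  assumes "z \<in> U"
  shows "B z (u + v) w = B z u w + B z v w" "B z w (u + v) = B z w u + B z w v"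
    "B z (r *\<^sub>R v) w = r * B z v w" "B z w (r *\<^sub>R v) = r * B z w v" "B z w (- v) = - B z w v" "B z w (u - v) = B z w u - B z w v"
  using B_bilinear[OF assms] bilinear_ladd bilinear_radd bilinear_lmul bilinear_rmul bilinear_rneg bilinear_rsub
  by (metis real_scaleR_def)+

lemma h_cnj: "z \<in> U \<Longrightarrow> cnj (h z v w) = h z w v"
proof -
  assume z: "z \<in> U"
  have "B z w (\<i> *s v) = - B z (\<i> *s v) w" using B_skew[OF z] .
  also have "\<dots> = - B z (\<i> *s (\<i> *s v)) (\<i> *s w)" by (simp only: B_J[OF z])
  also have "\<dots> = B z v (\<i> *s w)" using B_rules(3)[OF z, of "-1"] by simp
  finally show ?thesis using B_skew[OF z, of w v] by (simp add: h_def complex_eq_iff)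
qed

lemma h_add_right: "z \<in> U \<Longrightarrow> h z v (w + w') = h z v w + h z v w'"
  and h_add_left: "z \<in> U \<Longrightarrow> h z (v + v') w = h z v w + h z v' w"
  by (simp_all add: h_def complex_eq_iff B_rules vector_add_ldistrib)

lemma h_smult_right: "z \<in> U \<Longrightarrow> h z v (a *s w) = a * h z v w"
proof -
  assume z: "z \<in> U"
  have "a *s w = Re a *\<^sub>R w + Im a *\<^sub>R (\<i> *s w)" "\<i> *s (a *s w) = Re a *\<^sub>R (\<i> *s w) + Im a *\<^sub>R (- w)"
    by (auto simp: vec_eq_iff complex_eq_iff algebra_simps)
  then show ?thesis by (simp add: h_def complex_eq_iff B_rules[OF z])
qed

lemma h_smult_left: "z \<in> U \<Longrightarrow> h z (a *s v) w = cnj a * h z v w"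
  using h_cnj[of z w "a *s v"] h_cnj[of z w v] h_smult_right[of z w a v] by (metis complex_cnj_mult)

lemma h_self: "z \<in> U \<Longrightarrow> h z v v = complex_of_real (Re (h z v v))" "z \<in> U \<Longrightarrow> v \<noteq> 0 \<Longrightarrow> Re (h z v v) > 0"
  using h_cnj[of z v v] B_pos[of z v] by (auto simp: complex_eq_iff h_def)

lemma h_bilinear: "z \<in> U \<Longrightarrow> bilinear (h z)"
  unfolding bilinear_def
  by (auto intro!: linearI simp: h_add_left h_add_right scaleR_conv_of_real[where 'a = complex] h_smult_left h_smult_right
      simp flip: smult_conv_scaleR)

lemma h_sum_right: "z \<in> U \<Longrightarrow> h z v (\<Sum>k\<in>K. f k) = (\<Sum>k\<in>K. h z v (f k))"
  and h_sum_left: "z \<in> U \<Longrightarrow> h z (\<Sum>k\<in>K. f k) v = (\<Sum>k\<in>K. h z (f k) v)"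
  using h_bilinear[of z] linear_sum[of "h z v" f K] linear_sum[of "\<lambda>u. h z u v" f K] by (auto simp: bilinear_def)

lemma h_smooth: "\<lbrakk>smooth_on U p; smooth_on U q\<rbrakk> \<Longrightarrow> smooth_on U (\<lambda>z. h z (p z) (q z))"
proof (rule smooth_on_bilinear_family_apply[OF open_U _ h_bilinear])
  have "h z d e = B z d (\<i> *s e) *\<^sub>R 1 + B z d e *\<^sub>R \<i>" for z d e by (simp add: h_def complex_eq_iff)
  then show "smooth_on U (\<lambda>z. h z d e)" for d e
    by (simp only:) (intro smooth_on_add smooth_on_scaleR open_U B_smooth smooth_on_const)
qed

text \<open>Gram-Schmidt for the standard basis, with smooth dependence on \<open>z\<close>. The
  vanishing of components outside \<open>S\<close> makes the next standard vector independent of the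
  earlier fields at every \<open>z\<close>: after orthogonalisation its component at the new index
  is still 1.\<close>

lemma orthonormal_fields_exist:
  "\<exists>e :: 'n \<Rightarrow> complex^'n \<Rightarrow> complex^'n. (\<forall>j\<in>S. smooth_on U (e j)) \<and>
     (\<forall>z\<in>U. (\<forall>j\<in>S. \<forall>k\<in>S. h z (e j z) (e k z) = (if j = k then 1 else 0)) \<and> (\<forall>j\<in>S. \<forall>k. k \<notin> S \<longrightarrow> e j z $ k = 0))"
  using finite[of S]
proof (induction S rule: finite_induct)
  case (insert m S)
  then obtain e :: "'n \<Rightarrow> complex^'n \<Rightarrow> complex^'n" where e: "\<And>j. j \<in> S \<Longrightarrow> smooth_on U (e j)"
    "\<And>z j k. \<lbrakk>z \<in> U; j \<in> S; k \<in> S\<rbrakk> \<Longrightarrow> h z (e j z) (e k z) = (if j = k then 1 else 0)"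
    "\<And>z j k. \<lbrakk>z \<in> U; j \<in> S; k \<notin> S\<rbrakk> \<Longrightarrow> e j z $ k = 0"
    by blast
  define p where "p z = axis m 1 + (\<Sum>k\<in>S. (- h z (e k z) (axis m 1)) *s e k z)" for z
  define q where "q z = inverse (sqrt (Re (h z (p z) (p z)))) *\<^sub>R p z" for z
  have pm: "p z $ m = 1" if "z \<in> U" for z using e(3)[OF that _ insert(2)] by (simp add: p_def axis_def)
  have p0: "p z \<noteq> 0" if "z \<in> U" for z using pm[OF that] by auto
  note pos = h_self(2)[OF _ p0]
  have orth: "h z (e j z) (p z) = 0" if z: "z \<in> U" and j: "j \<in> S" for z j
  proof -
    have "h z (e j z) (p z) = h z (e j z) (axis m 1) + (\<Sum>k\<in>S. - h z (e k z) (axis m 1) * (if j = k then 1 else 0))"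
      unfolding p_def h_add_right[OF z] h_sum_right[OF z] h_smult_right[OF z] using e(2)[OF z j] by simp
    also have "(\<Sum>k\<in>S. - h z (e k z) (axis m 1) * (if j = k then 1 else 0)) = - h z (e j z) (axis m 1)"
      using insert(1) j by (simp add: if_distrib[of "\<lambda>x. _ * x"] sum.delta' sum.delta cong: if_cong)
    finally show ?thesis by simp
  qed
  have q: "q z = complex_of_real (inverse (sqrt (Re (h z (p z) (p z))))) *s p z" for z
    by (simp add: q_def smult_conv_scaleR del: of_real_inverse)
  have sp: "smooth_on U p"
    unfolding p_def
    by (intro smooth_on_add smooth_on_sum smooth_on_bilinear[OF bounded_bilinear_smult] open_U smooth_on_minus h_smooth
        smooth_on_const e(1)) assumption+
  have "smooth_on U (\<lambda>z. Re (h z (p z) (p z)))"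
    by (rule smooth_on_bounded_linear[OF bounded_linear_Re open_U h_smooth[OF sp sp]])
  from smooth_on_compose[OF open_U open_greaterThan _ smooth_on_sqrt this]
  have "smooth_on U (\<lambda>z. sqrt (Re (h z (p z) (p z))))" using pos by auto
  from smooth_on_compose[OF open_U open_Compl[OF closed_singleton] _ smooth_on_inverse this]
  have "smooth_on U (\<lambda>z. inverse (sqrt (Re (h z (p z) (p z)))))" using pos by force
  then have sq: "smooth_on U q" unfolding q_def by (rule smooth_on_scaleR[OF open_U _ sp])
  have qq: "h z (q z) (q z) = 1" if z: "z \<in> U" for z
  proof -
    have "h z (q z) (q z) = (complex_of_real (inverse (sqrt (Re (h z (p z) (p z))))))\<^sup>2 * h z (p z) (p z)"
      unfolding q h_smult_left[OF z] h_smult_right[OF z] by (simp add: power2_eq_square)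
    also have "\<dots> = complex_of_real ((inverse (sqrt (Re (h z (p z) (p z)))))\<^sup>2 * Re (h z (p z) (p z)))"
      by (subst h_self(1)[OF z]) simp
    also have "\<dots> = 1" using pos[OF z z] by (simp add: power_inverse)
    finally show ?thesis .
  qed
  have eq: "h z (e j z) (q z) = 0" "h z (q z) (e j z) = 0" if z: "z \<in> U" and j: "j \<in> S" for z j
  proof -
    show 1: "h z (e j z) (q z) = 0" unfolding q h_smult_right[OF z] orth[OF z j] by simp
    show "h z (q z) (e j z) = 0" using h_cnj[OF z, of "e j z" "q z"] 1 by simp
  qed
  have qk: "q z $ k = 0" if "z \<in> U" "k \<notin> insert m S" for z k
    using that e(3)[OF that(1)] by (simp add: q_def p_def axis_def)
  show ?case
  proof (intro exI[of _ "e(m := q)"] conjI ballI allI impI)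
    show "smooth_on U ((e(m := q)) j)" if "j \<in> insert m S" for j using that e(1) sq by auto
    show "h z ((e(m := q)) j z) ((e(m := q)) k z) = (if j = k then 1 else 0)"
      if "z \<in> U" "j \<in> insert m S" "k \<in> insert m S" for z j k
      using that e(2) eq qq insert(2) by auto
    show "(e(m := q)) j z $ k = 0" if "z \<in> U" "j \<in> insert m S" "k \<notin> insert m S" for z j k
      using that e(3) qk by auto
  qed
qed simp

text \<open>\<open>F\<close> has the orthonormal fields as columns, and \<open>E\<close> computes
  components by pairing with them; hence \<open>E\<close> carries the metric to the standard
  one.\<close>

lemma unitary_frame_exists:
  obtains E F :: "complex^'n \<Rightarrow> complex^'n^'n" where "smooth_on U E" "smooth_on U F"
    "\<And>z. z \<in> U \<Longrightarrow> E z ** F z = mat 1" "\<And>z. z \<in> U \<Longrightarrow> F z ** E z = mat 1"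
    "\<And>z v w. z \<in> U \<Longrightarrow> B z v (\<i> *s w) = (E z *v v) \<bullet> (E z *v w)"
proof -
  obtain e :: "'n \<Rightarrow> complex^'n \<Rightarrow> complex^'n" where e: "\<And>j. smooth_on U (e j)"
    "\<And>z j k. z \<in> U \<Longrightarrow> h z (e j z) (e k z) = (if j = k then 1 else 0)"
  proof -
    from orthonormal_fields_exist[of UNIV] obtain e :: "'n \<Rightarrow> complex^'n \<Rightarrow> complex^'n" where
      "\<forall>j\<in>UNIV. smooth_on U (e j)"
      "\<forall>z\<in>U. (\<forall>j\<in>UNIV. \<forall>k\<in>UNIV. h z (e j z) (e k z) = (if j = k then 1 else 0)) \<and> (\<forall>j\<in>UNIV. \<forall>k. k \<notin> UNIV \<longrightarrow> e j z $ k = 0)"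
      by (elim exE conjE)
    then show ?thesis using that[of e] by blast
  qed
  define F :: "complex^'n \<Rightarrow> complex^'n^'n" where "F z = (\<chi> i j. e j z $ i)" for z
  define E :: "complex^'n \<Rightarrow> complex^'n^'n" where "E z = (\<chi> i j. h z (e i z) (axis j 1))" for z
  have ax: "v = (\<Sum>j\<in>UNIV. v $ j *s axis j 1)" for v :: "complex^'n"
    by (simp add: vec_eq_iff axis_def if_distrib[of "\<lambda>c. _ * c"] cong: if_cong)
  have Ev: "E z *v v = (\<chi> i. h z (e i z) v)" if z: "z \<in> U" for z v
    by (subst (2) ax) (simp add: E_def matrix_vector_mult_def h_sum_right[OF z] h_smult_right[OF z] mult.commute)
  have Fa: "F z *v a = (\<Sum>j\<in>UNIV. a $ j *s e j z)" for z a
    by (simp add: F_def matrix_vector_mult_def vec_eq_iff mult.commute)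
  have EFv: "E z *v (F z *v a) = a" if z: "z \<in> U" for z a
    unfolding Ev[OF z] Fa
    by (simp add: h_sum_right[OF z] h_smult_right[OF z] e(2)[OF z] vec_eq_iff if_distrib[of "\<lambda>c. _ * c"] cong: if_cong)
  have EF: "E z ** F z = mat 1" if z: "z \<in> U" for z
    by (rule matrix_eq_complex) (simp add: matrix_vector_mul_assoc[symmetric] EFv[OF z])
  have FE: "F z ** E z = mat 1" if z: "z \<in> U" for z using EF[OF z] matrix_left_right_inverse by blast
  have hF: "h z (F z *v a) (F z *v b) = herm a b" if z: "z \<in> U" for z a b
    unfolding Fa
    by (simp add: h_sum_right[OF z] h_sum_left[OF z] h_smult_right[OF z] h_smult_left[OF z] e(2)[OF z] herm_def
        if_distrib[of "\<lambda>c. _ * c"] mult.commute cong: if_cong)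
  show ?thesis
  proof (rule that[of E F])
    show "smooth_on U E" unfolding E_def by (intro smooth_on_vec_lambda open_U h_smooth e(1) smooth_on_const)
    show "smooth_on U F" unfolding F_def by (intro smooth_on_vec_lambda open_U smooth_on_vec_nth e(1))
    show "B z v (\<i> *s w) = (E z *v v) \<bullet> (E z *v w)" if z: "z \<in> U" for z v w
    proof -
      have "F z *v (E z *v v) = v" for v by (simp add: matrix_vector_mul_assoc FE[OF z])
      then have "h z v w = herm (E z *v v) (E z *v w)" using hF[OF z, of "E z *v v" "E z *v w"] by simp
      then show ?thesis unfolding inner_eq_Re_herm by (metis h_def complex.sel(1))
    qed
  qed (use EF FE in auto)
qed

end

section \<open>Sections of the coframe bundle\<close>

lemma open_invertible: "open {a :: complex^'n^'n. invertible a}"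
proof -
  have "continuous_on UNIV (det :: complex^'n^'n \<Rightarrow> complex)"
    unfolding det_def by (intro continuous_intros)
  then have "open (det -` (- {0 :: complex}) :: (complex^'n^'n) set)"
    by (intro open_vimage) auto
  then show ?thesis by (simp add: vimage_def invertible_det_nz)
qed

section \<open>Charts of the coframe bundle\<close>

context complex_mfd
begin

definition coframe_of :: "('m, complex^'n) chart \<Rightarrow> 'm \<Rightarrow> complex^'n^'n \<Rightarrow> ('m, complex^'n) tvec \<Rightarrow> complex^'n"
  where "coframe_of d x a = (\<lambda>v. if v \<in> tangent_space A x then a *v (v d) else 0)"

lemma coframe_of_in:
  assumes d: "d \<in> charts_at A x" and a: "a ** b = mat 1" "b ** a = mat 1"
  shows "coframe_of d x a \<in> coframes A x"
  unfolding coframes_def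
proof (intro CollectI conjI ballI allI impI)
  show "coframe_of d x a (v + w) = coframe_of d x a v + coframe_of d x a w"
    if "v \<in> tangent_space A x" "w \<in> tangent_space A x" for v w
    using that tangent_space_add by (simp add: coframe_of_def matrix_vector_right_distrib)
  show "coframe_of d x a (\<lambda>c. r *s v c) = r *s coframe_of d x a v" if "v \<in> tangent_space A x" for r v
    using that tangent_space_smult by (simp add: coframe_of_def vector_scalar_commute)
  show "coframe_of d x a v = 0" if "v \<notin> tangent_space A x" for v using that by (simp add: coframe_of_def)
  show "bij_betw (coframe_of d x a) (tangent_space A x) UNIV"
  proof (rule bij_betw_byWitness[where f' = "\<lambda>w. tangent_of_coords A d x (b *v w)"])
    show "\<forall>v\<in>tangent_space A x. tangent_of_coords A d x (b *v coframe_of d x a v) = v"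
      using tangent_eq[OF _ d] by (simp add: coframe_of_def matrix_vector_mul_assoc a)
    show "\<forall>w\<in>UNIV. coframe_of d x a (tangent_of_coords A d x (b *v w)) = w"
      using d by (simp add: coframe_of_def tangent_of_coords_in tangent_of_coords_self matrix_vector_mul_assoc a)
  qed (use tangent_of_coords_in[OF d] in auto)
qed

lemma coframe_matrix:
  assumes u: "u \<in> coframes A x" and d: "d \<in> charts_at A x"
  shows "u = coframe_of d x (\<chi> i j. u (tangent_of_coords A d x (axis j 1)) $ i)"
proof (rule ext)
  fix v
  show "u v = coframe_of d x (\<chi> i j. u (tangent_of_coords A d x (axis j 1)) $ i) v"
  proof (cases "v \<in> tangent_space A x")
    case True
    let ?f = "\<lambda>w. u (tangent_of_coords A d x w)"
    note t = tangent_of_coords_in[OF d] and tl = tangent_of_coords_linear[OF d]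
    have add: "?f (w + w') = ?f w + ?f w'" for w w' using u t by (simp add: coframes_def tl)
    have sm: "?f (a *s w) = a *s ?f w" for a w using u t by (simp add: coframes_def tl)
    have lin: "linear ?f"
      by (rule linearI) (simp add: add, metis sm smult_conv_scaleR)
    have "u v = ?f (v d)" using tangent_eq[OF True d] by simp
    also have "\<dots> = (\<chi> i j. ?f (axis j 1) $ i) *v (v d)" by (rule linear_components_vec[OF lin sm])
    finally show ?thesis using True by (simp add: coframe_of_def)
  next
    case False
    then show ?thesis using u by (simp add: coframes_def coframe_of_def)
  qed
qed

abbreviation cc where "cc d \<equiv> coframe_chart A d"

lemma cc_coords:
  assumes d: "d \<in> charts_at A x" and e: "e \<in> charts_at A x"
  shows "snd (cc e) (x, coframe_of d x a) = (snd e x, \<chi> i j. (a *v dtrans e d (snd e x) (axis j 1)) $ i)"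
  using d e by (simp add: coframe_chart_def coframe_of_def tangent_of_coords_in tangent_of_coords_apply)

lemma cc_coords_same:
  assumes d: "d \<in> charts_at A x"
  shows "snd (cc d) (x, coframe_of d x a) = (snd d x, a)"
proof -
  have "dtrans d d (snd d x) (axis j 1) = axis j 1" for j
    using d dtrans_same[of d "snd d x"] chart_in_image[of x d] by (simp add: charts_at_iff)
  moreover have "(a *v axis j 1) $ i = a $ i $ j" for i j
    by (simp add: matrix_vector_mult_def axis_def if_distrib[of "\<lambda>c. _ * c"] cong: if_cong)
  ultimately show ?thesis unfolding cc_coords[OF d d] by (simp only: vec_lambda_eta)
qed

lemma fst_cc: "(x, u) \<in> fst (cc d) \<longleftrightarrow> x \<in> fst d \<and> u \<in> coframes A x"
  by (simp add: coframe_chart_def)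

lemma cc_inj: "d \<in> A \<Longrightarrow> inj_on (snd (cc d)) (fst (cc d))"
proof (rule inj_onI)
  fix p q assume d: "d \<in> A" and pq: "p \<in> fst (cc d)" "q \<in> fst (cc d)" "snd (cc d) p = snd (cc d) q"
  obtain x u y w where xy: "p = (x, u)" "q = (y, w)" by fastforce
  have x: "x \<in> fst d" "u \<in> coframes A x" "y \<in> fst d" "w \<in> coframes A y" using pq xy by (auto simp: fst_cc)
  have "snd d x = snd d y" using pq(3) xy by (simp add: coframe_chart_def)
  then have "x = y" using chart_inv_chart[OF d] x by metis
  then have "(\<chi> i j. u (tangent_of_coords A d x (axis j 1)) $ i) = (\<chi> i j. w (tangent_of_coords A d x (axis j 1)) $ i)"
    using pq(3) xy by (simp add: coframe_chart_def)
  then have "u = w" using coframe_matrix[of u x d] coframe_matrix[of w x d] x d \<open>x = y\<close> by (simp add: charts_at_iff)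
  then show "p = q" using xy \<open>x = y\<close> by simp
qed

lemma cc_inv:
  assumes d: "d \<in> A" and y: "y \<in> chart_image d" and a: "invertible a"
  shows "chart_inv (cc d) (y, a) = (chart_inv d y, coframe_of d (chart_inv d y) a)"
    and "(y, a) \<in> chart_image (cc d)"
proof -
  obtain b where b: "a ** b = mat 1" "b ** a = mat 1" using a by (auto simp: invertible_def)
  have x: "d \<in> charts_at A (chart_inv d y)" using d y chart_inv_in by (simp add: charts_at_iff)
  let ?p = "(chart_inv d y, coframe_of d (chart_inv d y) a)"
  have p: "?p \<in> fst (cc d)" using coframe_of_in[OF x b] x by (simp add: fst_cc charts_at_iff)
  have s: "snd (cc d) ?p = (y, a)" using cc_coords_same[OF x, of a] chart_chart_inv[OF d y] by simp
  show "chart_inv (cc d) (y, a) = ?p"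
    by (simp only: chart_inv_def[of "cc d"] inv_into_f_eq[OF cc_inj[OF d] p s])
  show "(y, a) \<in> chart_image (cc d)" unfolding chart_image_def using p s by (metis imageI)
qed

text \<open>The matrix of a coframe changes by multiplication with the Jacobian of the inverse
  coordinate change. Invertibility of \<open>a\<close> ensures that \<open>(y, a)\<close> comes from
  a coframe, so that the inverse of the bundle chart is known there.\<close>

lemma cc_trans_smooth:
  assumes d: "d \<in> A" and e: "e \<in> A"
  shows "open (overlap d e \<times> {a :: complex^'n^'n. invertible a})"
    "smooth_on (overlap d e \<times> {a. invertible a}) (snd (cc e) \<circ> chart_inv (cc d))"
proof -
  let ?G = "overlap d e \<times> {a :: complex^'n^'n. invertible a}"
  show G: "open ?G" by (intro open_Times open_overlap d e open_invertible)
  define K where "K q = (trans d e (fst q), \<chi> i j. (snd q *v dtrans e d (trans d e (fst q)) (axis j 1)) $ i)"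
    for q :: "(complex^'n) \<times> (complex^'n^'n)"
  have sf: "smooth_on ?G fst" and ss: "smooth_on ?G snd"
    using smooth_on_bounded_linear[OF bounded_linear_fst G smooth_on_ident]
      smooth_on_bounded_linear[OF bounded_linear_snd G smooth_on_ident] by auto
  have st: "smooth_on ?G (\<lambda>q. trans d e (fst q))"
    by (rule smooth_on_compose[OF G open_overlap[OF d e] _ trans_smooth[OF d e] sf]) auto
  have "smooth_on ?G (\<lambda>q. dtrans e d (trans d e (fst q)) (axis j 1))" for j
    by (rule smooth_on_compose[OF G open_overlap[OF e d] _ smooth_on_frechet_derivative[OF trans_smooth[OF e d]] st])
       (use trans_in_overlap[OF d e] in auto)
  then have "smooth_on ?G K"
    unfolding K_def by (intro smooth_on_Pair G st smooth_on_vec_lambda smooth_on_vec_nth smooth_on_matrix_vec ss)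
  then show "smooth_on ?G (snd (cc e) \<circ> chart_inv (cc d))"
  proof (rule smooth_on_cong[OF G, rotated])
    fix q assume "q \<in> ?G"
    then obtain y a where q: "q = (y, a)" "y \<in> overlap d e" "invertible a" by auto
    have y: "y \<in> chart_image d" "chart_inv d y \<in> fst e" using q(2) by (auto simp: overlap_iff[OF d])
    have x: "d \<in> charts_at A (chart_inv d y)" "e \<in> charts_at A (chart_inv d y)"
      using y d e chart_inv_in by (auto simp: charts_at_iff)
    show "K q = (snd (cc e) \<circ> chart_inv (cc d)) q"
      unfolding q(1) by (simp add: cc_inv(1)[OF d y(1) q(3)] cc_coords[OF x] K_def trans_def)
  qed
qed

lemma cc_charts_at:
  "u \<in> coframes A x \<Longrightarrow> D \<in> charts_at (coframe_atlas A) (x, u) \<longleftrightarrow> (\<exists>d\<in>charts_at A x. D = cc d)"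
  unfolding charts_at_def coframe_atlas_def mem_Collect_eq image_iff using fst_cc[of x u] by blast

end

section \<open>The section of the coframe bundle defined by a unitary frame\<close>

locale framed_chart = kaehler_mfd A \<Omega> for A :: "('m::{t2_space, second_countable_topology}, complex^'n) chart set"
    and \<Omega> :: "'m \<Rightarrow> ('m, complex^'n) tvec \<Rightarrow> ('m, complex^'n) tvec \<Rightarrow> real" +
  fixes c :: "('m, complex^'n) chart" and E F :: "complex^'n \<Rightarrow> complex^'n^'n"
  assumes c: "c \<in> A" and E_smooth: "smooth_on (chart_image c) E"
    and E_F: "z \<in> chart_image c \<Longrightarrow> E z ** F z = mat 1" and F_E: "z \<in> chart_image c \<Longrightarrow> F z ** E z = mat 1"
    and E_unitary: "z \<in> chart_image c \<Longrightarrow> cf c z v (\<i> *s w) = (E z *v v) \<bullet> (E z *v w)"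
begin

definition frame_section :: "complex^'n \<Rightarrow> ('m, 'n) coframe_point"
  where "frame_section z = (chart_inv c z, coframe_of c (chart_inv c z) (E z))"

text \<open>The image of \<open>v\<close> under the differential of \<open>frame_section\<close>,
  given directly by its components in all charts of the bundle.\<close>

definition frame_lift :: "complex^'n \<Rightarrow> complex^'n \<Rightarrow> ('m, 'n) coframe_tvec"
  where "frame_lift z v = (\<lambda>D. if D \<in> charts_at (coframe_atlas A) (frame_section z)
     then frechet_derivative (\<lambda>y. snd D (frame_section y)) (at z) v else 0)"

lemma c_at: "z \<in> chart_image c \<Longrightarrow> c \<in> charts_at A (chart_inv c z)"
  using c chart_inv_in by (simp add: charts_at_iff)

lemma coframe_of_E: "z \<in> chart_image c \<Longrightarrow> coframe_of c (chart_inv c z) (E z) \<in> coframes A (chart_inv c z)"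
  by (rule coframe_of_in[OF c_at E_F F_E])

lemma frame_section_in: "z \<in> chart_image c \<Longrightarrow> frame_section z \<in> unitary_coframes A \<Omega>"
proof -
  assume z: "z \<in> chart_image c"
  have "(E z *v v c) \<bullet> (E z *v w c) = kaehler_metric \<Omega> (chart_inv c z) v w"
    if "v \<in> tangent_space A (chart_inv c z)" "w \<in> tangent_space A (chart_inv c z)" for v w
    using E_unitary[OF z, of "v c" "w c"] tangent_eq[OF that(1) c_at[OF z]] tangent_eq[OF Jmap_in[OF that(2)] c_at[OF z]]
    by (simp add: kaehler_metric_def coord_form_def Jmap_def)
  then show ?thesis
    using coframe_of_E[OF z] c_at[OF z] carrier_charts_at[of "chart_inv c z"]
    by (auto simp: unitary_coframes_def frame_section_def coframe_of_def)
qed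

lemma frame_section_charts:
  assumes z: "z \<in> chart_image c"
  shows "D \<in> charts_at (coframe_atlas A) (frame_section z) \<longleftrightarrow> (\<exists>d\<in>A. z \<in> overlap c d \<and> D = cc d)"
  unfolding frame_section_def cc_charts_at[OF coframe_of_E[OF z]] Bex_def charts_at_iff overlap_iff[OF c] using z by blast

lemma frame_section_coords:
  assumes "d \<in> A" "z \<in> overlap c d"
  shows "snd (cc d) (frame_section z) = (trans c d z, \<chi> i j. (E z *v dtrans d c (trans c d z) (axis j 1)) $ i)"
proof -
  have z: "z \<in> chart_image c" "chart_inv c z \<in> fst d" using assms by (auto simp: overlap_iff[OF c])
  then have d: "d \<in> charts_at A (chart_inv c z)" using assms by (simp add: charts_at_iff)
  show ?thesis unfolding frame_section_def cc_coords[OF c_at[OF z(1)] d] by (simp add: trans_def)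
qed

lemma frame_section_own: "z \<in> chart_image c \<Longrightarrow> snd (cc c) (frame_section z) = (z, E z)"
  by (simp add: frame_section_def cc_coords_same c_at chart_chart_inv c)

lemma overlap_self: "overlap c c = chart_image c"
  by (simp add: overlap_def chart_image_def)

lemma overlap_sub: "overlap c d \<subseteq> chart_image c"
  by (auto simp: overlap_def chart_image_def)

lemma frame_section_smooth: "d \<in> A \<Longrightarrow> smooth_on (overlap c d) (\<lambda>z. snd (cc d) (frame_section z))"
proof (rule smooth_on_cong[OF open_overlap[OF c]])
  assume d: "d \<in> A"
  have "smooth_on (overlap c d) (\<lambda>z. dtrans d c (trans c d z) (axis j 1))" for j
    by (rule smooth_on_compose[OF open_overlap[OF c d] open_overlap[OF d c] _
          smooth_on_frechet_derivative[OF trans_smooth[OF d c]] trans_smooth[OF c d]])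
       (use trans_in_overlap[OF c d] in auto)
  then show "smooth_on (overlap c d) (\<lambda>z. (trans c d z, \<chi> i j. (E z *v dtrans d c (trans c d z) (axis j 1)) $ i))"
    by (intro smooth_on_Pair open_overlap c d trans_smooth smooth_on_vec_lambda smooth_on_vec_nth smooth_on_matrix_vec
        smooth_on_subset[OF E_smooth overlap_sub])
qed (use frame_section_coords in auto)

lemma frame_lift_chart: "\<lbrakk>d \<in> A; z \<in> overlap c d\<rbrakk> \<Longrightarrow>
    frame_lift z v (cc d) = frechet_derivative (\<lambda>y. snd (cc d) (frame_section y)) (at z) v"
proof -
  assume d: "d \<in> A" "z \<in> overlap c d"
  then have "z \<in> chart_image c" using overlap_sub by blast
  then have "cc d \<in> charts_at (coframe_atlas A) (frame_section z)" using frame_section_charts d by blast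
  then show ?thesis by (simp add: frame_lift_def)
qed

lemma frame_lift_own:
  assumes z: "z \<in> chart_image c"
  shows "frame_lift z v (cc c) = (v, frechet_derivative E (at z) v)"
proof -
  have "frechet_derivative (\<lambda>y. snd (cc c) (frame_section y)) (at z) = frechet_derivative (\<lambda>y. (y, E y)) (at z)"
    by (rule frechet_derivative_cong[OF open_chart_image[OF c] z frame_section_own])
  also have "\<dots> = (\<lambda>v. (v, frechet_derivative E (at z) v))"
    by (rule frechet_derivative_eqI[OF has_derivative_Pair[OF has_derivative_ident smooth_on_has_derivative[OF E_smooth z]]])
  finally show ?thesis using frame_lift_chart[OF c, of z] z by (simp add: overlap_self)
qed

text \<open>Keeps the section inside the open set on which \<open>cc_trans_smooth\<close> applies,
  as the chain rule for a change of bundle charts demands.\<close>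

lemma frame_section_coords_in:
  assumes d: "d \<in> A" and e: "e \<in> A" and zo: "z \<in> overlap c d \<inter> overlap c e"
  shows "snd (cc d) (frame_section z) \<in> overlap d e \<times> {a. invertible a}"
proof -
  have zd: "z \<in> overlap c d" using zo by simp
  have zx: "z \<in> chart_image c" "chart_inv c z \<in> fst d" "chart_inv c z \<in> fst e" using zo by (auto simp: overlap_iff[OF c])
  let ?D = "dtrans d c (trans c d z)"
  have t: "trans c d z \<in> overlap d c" using trans_in_overlap[OF c d zd] .
  have 1: "E z ** (\<chi> i j. ?D (axis j 1) $ i) = (\<chi> i j. (E z *v ?D (axis j 1)) $ i)"
    by (simp add: matrix_matrix_mult_def matrix_vector_mult_def vec_eq_iff)
  have Dv: "?D v = (\<chi> i j. ?D (axis j 1) $ i) *v v" for v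
    by (rule linear_components_vec[OF dtrans_linear[OF d c t] dtrans_smult[OF d c t]])
  have D'v: "dtrans c d z v = (\<chi> i j. dtrans c d z (axis j 1) $ i) *v v" for v
    by (rule linear_components_vec[OF dtrans_linear[OF c d zd] dtrans_smult[OF c d zd]])
  have "?D (dtrans c d z v) = v" for v
    using dtrans_inverse[OF c d chart_inv_in[OF c zx(1)] zx(2)] chart_chart_inv[OF c zx(1)] by (simp add: trans_def)
  then have "(\<chi> i j. ?D (axis j 1) $ i) ** (\<chi> i j. dtrans c d z (axis j 1) $ i) = mat 1"
    by (intro matrix_eq_complex) (simp add: matrix_vector_mul_assoc[symmetric] flip: Dv D'v)
  then have "invertible (\<chi> i j. ?D (axis j 1) $ i)" unfolding invertible_right_inverse by blast
  moreover have "invertible (E z)" using E_F[OF zx(1)] unfolding invertible_right_inverse by blast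
  ultimately have "invertible (\<chi> i j. (E z *v ?D (axis j 1)) $ i)" using invertible_mult 1 by metis
  moreover have "trans c d z \<in> overlap d e" unfolding trans_def using zx by (simp add: in_overlap)
  ultimately show ?thesis unfolding frame_section_coords[OF d zd] by simp
qed

lemma frame_lift_tangent:
  assumes z: "z \<in> chart_image c"
  shows "frame_lift z v \<in> tangent_space (coframe_atlas A) (frame_section z)"
  unfolding tangent_space_def
proof (intro CollectI conjI allI impI ballI)
  show "frame_lift z v D = 0" if "D \<notin> charts_at (coframe_atlas A) (frame_section z)" for D
    using that by (simp add: frame_lift_def)
  fix D D' assume "D \<in> charts_at (coframe_atlas A) (frame_section z)" "D' \<in> charts_at (coframe_atlas A) (frame_section z)"
  then obtain d e where d: "d \<in> A" "z \<in> overlap c d" "D = cc d" and e: "e \<in> A" "z \<in> overlap c e" "D' = cc e"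
    unfolding frame_section_charts[OF z] by blast
  let ?s = "\<lambda>d y. snd (cc d) (frame_section y)" and ?K = "snd (cc e) \<circ> chart_inv (cc d)"
  let ?N = "overlap c d \<inter> overlap c e"
  have N: "open ?N" "z \<in> ?N" using open_Int[OF open_overlap[OF c d(1)] open_overlap[OF c e(1)]] d e by auto
  have in_cc: "frame_section y \<in> fst (cc d)" if "y \<in> overlap c d" for y
    using that overlap_iff[OF c, of y d] coframe_of_E by (simp add: frame_section_def fst_cc)
  have K: "?K (?s d y) = ?s e y" if "y \<in> ?N" for y
    unfolding o_def chart_inv_def using inv_into_f_f[OF cc_inj[OF d(1)] in_cc] that by simp
  have "((\<lambda>y. ?K (?s d y)) has_derivative (\<lambda>v. frechet_derivative ?K (at (?s d z)) (frechet_derivative (?s d) (at z) v))) (at z)"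
    by (rule has_derivative_compose[OF smooth_on_has_derivative[OF frame_section_smooth[OF d(1)] d(2)]
          smooth_on_has_derivative[OF cc_trans_smooth(2)[OF d(1) e(1)] frame_section_coords_in[OF d(1) e(1) N(2)]]])
  then have "(?s e has_derivative (\<lambda>v. frechet_derivative ?K (at (?s d z)) (frechet_derivative (?s d) (at z) v))) (at z)"
    by (rule has_derivative_transform_within_open[OF _ N K])
  then show "frame_lift z v D' = coord_change_deriv D D' (frame_section z) (frame_lift z v D)"
    unfolding d(3) e(3) coord_change_deriv_def frame_lift_chart[OF d(1,2)] frame_lift_chart[OF e(1,2)]
    by (simp add: frechet_derivative_eqI)
qed

text \<open>The required curve in the bundle is the image under \<open>frame_section\<close> of the
  straight line through \<open>z\<close> with velocity \<open>v\<close>.\<close>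

lemma frame_lift_in:
  assumes z: "z \<in> chart_image c"
  shows "frame_lift z v \<in> submanifold_tangent (coframe_atlas A) (unitary_coframes A \<Omega>) (frame_section z)"
  unfolding submanifold_tangent_def
proof (intro CollectI conjI frame_lift_tangent[OF z] ballI)
  fix D assume "D \<in> charts_at (coframe_atlas A) (frame_section z)"
  then obtain d where d: "d \<in> A" "z \<in> overlap c d" "D = cc d" unfolding frame_section_charts[OF z] by blast
  obtain r where r: "r > 0" "ball z r \<subseteq> overlap c d" using open_overlap[OF c d(1)] d(2) open_contains_ball by blast
  \<comment> \<open>Short enough for the line to stay in the overlap of \<open>c\<close> and
    \<open>d\<close>; the added 1 covers \<open>v = 0\<close>.\<close>
  define \<epsilon> where "\<epsilon> = r / (norm v + 1)"
  have \<epsilon>: "\<epsilon> > 0" unfolding \<epsilon>_def using r by (simp add: add_nonneg_pos)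
  let ?I = "{-\<epsilon><..<\<epsilon>}"
  have zt: "z + t *\<^sub>R v \<in> overlap c d" if "t \<in> ?I" for t
  proof -
    have "\<bar>t\<bar> * norm v \<le> \<bar>t\<bar> * (norm v + 1)" by (simp add: mult_left_mono)
    also have "\<dots> < \<epsilon> * (norm v + 1)" using that by (intro mult_strict_right_mono) (auto simp: add_nonneg_pos)
    also have "\<dots> = r" unfolding \<epsilon>_def by (simp add: add_nonneg_eq_0_iff)
    finally show ?thesis using r(2) by (auto simp: dist_norm)
  qed
  have sm: "smooth_on ?I (snd D \<circ> (\<lambda>t. frame_section (z + t *\<^sub>R v)))"
    unfolding d(3) o_def
    by (rule smooth_on_compose[OF _ open_overlap[OF c d(1)] _ frame_section_smooth[OF d(1)], of ?I "\<lambda>t. z + t *\<^sub>R v"])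
       (use zt in \<open>auto intro!: smooth_on_add smooth_on_bounded_linear[OF bounded_linear_scaleR_left]\<close>)
  have P: "frame_section y \<in> unitary_coframes A \<Omega> \<inter> fst (cc d)" if "y \<in> overlap c d" for y
    using that overlap_iff[OF c, of y d] coframe_of_E frame_section_in by (simp add: frame_section_def fst_cc)
  show "\<exists>\<gamma>. \<exists>\<epsilon>>0. \<gamma> 0 = frame_section z \<and> \<gamma> ` {-\<epsilon><..<\<epsilon>} \<subseteq> unitary_coframes A \<Omega> \<inter> fst D \<and>
      smooth_on {-\<epsilon><..<\<epsilon>} (snd D \<circ> \<gamma>) \<and> (snd D \<circ> \<gamma> has_vector_derivative frame_lift z v D) (at 0)"
  proof (intro exI[of _ "\<lambda>t. frame_section (z + t *\<^sub>R v)"] exI[of _ \<epsilon>] conjI \<epsilon> sm)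
    show "(\<lambda>t. frame_section (z + t *\<^sub>R v)) ` ?I \<subseteq> unitary_coframes A \<Omega> \<inter> fst D" unfolding d(3) using P zt by auto
    show "(snd D \<circ> (\<lambda>t. frame_section (z + t *\<^sub>R v)) has_vector_derivative frame_lift z v D) (at 0)"
      unfolding d(3) o_def frame_lift_chart[OF d(1,2)]
      by (rule has_vector_derivative_line[OF smooth_on_has_derivative[OF frame_section_smooth[OF d(1)] d(2)]])
  qed simp
qed

lemma tautological_frame_lift:
  assumes z: "z \<in> chart_image c"
  shows "tautological_form A (frame_section z) (frame_lift z v) = E z *v v"
proof -
  let ?p = "frame_section z" and ?x = "chart_inv c z"
  \<comment> \<open>\<open>differential\<close> is computed in an unspecified chart of the bundle,
    so the calculation passes through the chart over some \<open>e\<close> and returns by the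
    cocycle rule.\<close>
  let ?D = "SOME D. D \<in> charts_at (coframe_atlas A) ?p"
  have "cc c \<in> charts_at (coframe_atlas A) ?p" unfolding frame_section_charts[OF z] using c z overlap_self by auto
  then have "?D \<in> charts_at (coframe_atlas A) ?p" by (rule someI)
  then obtain e where e: "e \<in> A" "z \<in> overlap c e" "?D = cc e" unfolding frame_section_charts[OF z] by blast
  have "differential (coframe_atlas A) A fst ?p (frame_lift z v) = tangent_of_coords A c ?x v"
  proof (rule ext)
    fix d
    show "differential (coframe_atlas A) A fst ?p (frame_lift z v) d = tangent_of_coords A c ?x v d"
    proof (cases "d \<in> charts_at A ?x")
      case True
      then have d: "d \<in> A" "z \<in> overlap c d" using z by (auto simp: charts_at_iff overlap_iff[OF c])
      have N: "open (overlap c d \<inter> overlap c e)" "z \<in> overlap c d \<inter> overlap c e" using open_Int[OF open_overlap[OF c d(1)] open_overlap[OF c e(1)]] d e by auto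
      let ?s = "\<lambda>y. snd (cc e) (frame_section y)"
      let ?G = "overlap e d \<times> {a :: complex^'n^'n. invertible a}" and ?f = "snd d \<circ> fst \<circ> chart_inv (cc e)"
      note G = frame_section_coords_in[OF e(1) d(1), of z]
      have sz: "?s z \<in> ?G" using G N(2) by blast
      have xe: "snd e ?x \<in> overlap e d" using e d z by (intro in_overlap) (auto simp: overlap_iff[OF c])
      have te: "trans c e z = snd e ?x" by (simp add: trans_def)
      have "((\<lambda>q. trans e d (fst q)) has_derivative (\<lambda>w. dtrans e d (snd e ?x) (fst w))) (at (?s z))"
        by (rule has_derivative_compose[OF has_derivative_fst[OF has_derivative_ident]])
           (use dtrans[OF e(1) d(1) xe] in \<open>simp add: frame_section_coords[OF e(1,2)] te\<close>)
      then have "(?f has_derivative (\<lambda>w. dtrans e d (snd e ?x) (fst w))) (at (?s z))"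
        by (rule has_derivative_transform_within_open[OF _ cc_trans_smooth(1)[OF e(1) d(1)] sz])
           (auto simp: cc_inv(1)[OF e(1)] overlap_iff[OF e(1)] trans_def)
      then have f: "frechet_derivative ?f (at (?s z)) = (\<lambda>w. dtrans e d (snd e ?x) (fst w))"
        by (rule frechet_derivative_eqI)
      have "((\<lambda>y. fst (?s y)) has_derivative (\<lambda>v. fst (frechet_derivative ?s (at z) v))) (at z)"
        by (rule has_derivative_fst[OF smooth_on_has_derivative[OF frame_section_smooth[OF e(1)] e(2)]])
      then have "(trans c e has_derivative (\<lambda>v. fst (frechet_derivative ?s (at z) v))) (at z)"
        by (rule has_derivative_transform_within_open[OF _ open_overlap[OF c e(1)] e(2)])
           (simp add: frame_section_coords[OF e(1)])
      then have g: "fst (frechet_derivative ?s (at z) v) = dtrans c e z v" by (simp add: frechet_derivative_eqI)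
      have "differential (coframe_atlas A) A fst ?p (frame_lift z v) d
          = frechet_derivative ?f (at (?s z)) (frame_lift z v (cc e))"
        using True by (simp add: differential_def frame_section_def Let_def e(3)[unfolded frame_section_def])
      also have "\<dots> = dtrans e d (snd e ?x) (dtrans c e z v)"
        by (simp add: f frame_lift_chart[OF e(1,2)] g)
      also have "\<dots> = dtrans c d z v"
        using dtrans_cocycle[OF c e(1) d(1) chart_inv_in[OF c z]] e(2) d(2) chart_chart_inv[OF c z]
        by (simp add: overlap_iff[OF c])
      finally show ?thesis using True chart_chart_inv[OF c z] by (simp add: tangent_of_coords_apply)
    qed (simp add: differential_def tangent_of_coords_def frame_section_def)
  qed
  then show ?thesis
    using c_at[OF z] by (simp add: tautological_form_def frame_section_def coframe_of_def tangent_of_coords_in tangent_of_coords_self)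
qed

end

text \<open>Exterior differentiation commutes with pull-back: the terms containing second
  derivatives of \<open>s\<close> are symmetric in \<open>v\<close> and \<open>w\<close> and
  cancel.\<close>

lemma pullback_family:
  fixes s :: "'a::euclidean_space \<Rightarrow> 'e::euclidean_space" and a :: "'e \<Rightarrow> 'e \<Rightarrow> 'f::euclidean_space"
  assumes N: "open N" "\<And>q. q \<in> N \<Longrightarrow> linear (a q)" "\<And>e. smooth_on N (\<lambda>q. a q e)"
    and W: "open W" "smooth_on W s" "s ` W \<subseteq> N"
  defines "G \<equiv> \<lambda>w y. a (s y) (frechet_derivative s (at y) w)"
  shows "smooth_on W (G w)"
    and "z \<in> W \<Longrightarrow> frechet_derivative (G w) (at z) v - frechet_derivative (G v) (at z) w
      = frechet_derivative (\<lambda>q. a q (frechet_derivative s (at z) w)) (at (s z)) (frechet_derivative s (at z) v)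
      - frechet_derivative (\<lambda>q. a q (frechet_derivative s (at z) v)) (at (s z)) (frechet_derivative s (at z) w)"
proof -
  have as: "smooth_on W (\<lambda>y. a (s y) e)" for e by (rule smooth_on_compose[OF W(1) N(1) W(3) N(3) W(2)])
  have sN: "s y \<in> N" if "y \<in> W" for y using that W(3) by blast
  show G: "smooth_on W (G w)" for w
    unfolding G_def by (rule smooth_on_linear_family_apply[OF W(1) as N(2)[OF sN] smooth_on_frechet_derivative[OF W(2)]])
  assume z: "z \<in> W"
  have "frechet_derivative (G w) (at z) v
      = frechet_derivative (\<lambda>q. a q (frechet_derivative s (at z) w)) (at (s z)) (frechet_derivative s (at z) v)
      + a (s z) (frechet_derivative (\<lambda>y. frechet_derivative s (at y) w) (at z) v)" for v w
  proof -
    let ?S = "(\<lambda>t::real. z + t *\<^sub>R v) -` W"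
    have S: "open ?S" "0 \<in> ?S" using z by (auto intro!: open_vimage[OF W(1)] continuous_intros)
    have at0: "at 0 within ?S = at 0" by (rule at_within_open[OF S(2,1)])
    have "((\<lambda>t. a (s (z + t *\<^sub>R v)) (frechet_derivative s (at (z + t *\<^sub>R v)) w)) has_vector_derivative
       (frechet_derivative (\<lambda>q. a q (frechet_derivative s (at (z + 0 *\<^sub>R v)) w)) (at (s (z + 0 *\<^sub>R v))) (frechet_derivative s (at z) v)
         + a (s (z + 0 *\<^sub>R v)) (frechet_derivative (\<lambda>y. frechet_derivative s (at y) w) (at z) v))) (at 0 within ?S)"
    proof (rule linear_family_curve_derivative[OF N(1) _ N(3) N(2)])
      show "((\<lambda>t. s (z + t *\<^sub>R v)) has_vector_derivative frechet_derivative s (at z) v) (at 0 within ?S)"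
        unfolding at0 by (rule has_vector_derivative_line[OF smooth_on_has_derivative[OF W(2) z]])
      show "((\<lambda>t. frechet_derivative s (at (z + t *\<^sub>R v)) w) has_vector_derivative
          frechet_derivative (\<lambda>y. frechet_derivative s (at y) w) (at z) v) (at 0 within ?S)"
        unfolding at0 by (rule has_vector_derivative_line[OF smooth_on_has_derivative[OF smooth_on_frechet_derivative[OF W(2)] z]])
    qed (use S z sN in auto)
    then have "((\<lambda>t. G w (z + t *\<^sub>R v)) has_vector_derivative
       (frechet_derivative (\<lambda>q. a q (frechet_derivative s (at z) w)) (at (s z)) (frechet_derivative s (at z) v)
         + a (s z) (frechet_derivative (\<lambda>y. frechet_derivative s (at y) w) (at z) v))) (at 0)"
      unfolding at0 G_def by simp
    then show ?thesis
      using has_vector_derivative_line[OF smooth_on_has_derivative[OF G z], of w v] vector_derivative_unique_at by blast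
  qed
  then show "frechet_derivative (G w) (at z) v - frechet_derivative (G v) (at z) w
      = frechet_derivative (\<lambda>q. a q (frechet_derivative s (at z) w)) (at (s z)) (frechet_derivative s (at z) v)
      - frechet_derivative (\<lambda>q. a q (frechet_derivative s (at z) v)) (at (s z)) (frechet_derivative s (at z) w)"
    using smooth_on_symmetric_second_derivative[OF W(2,1) z, of w v] by simp
qed

section \<open>Pull-back of the structure equations to a chart\<close>

context framed_chart
begin

abbreviation "U \<equiv> chart_image c"

lemma cc_at: "z \<in> U \<Longrightarrow> cc c \<in> charts_at (coframe_atlas A) (frame_section z)"
  using frame_section_charts c overlap_self by blast

lemma graph_smooth: "smooth_on U (\<lambda>y. (y, E y))"
  by (intro smooth_on_Pair open_chart_image c smooth_on_ident E_smooth)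

lemma graph_derivative: "z \<in> U \<Longrightarrow> frechet_derivative (\<lambda>y. (y, E y)) (at z) v = frame_lift z v (cc c)"
  using frechet_derivative_eqI[OF has_derivative_Pair[OF has_derivative_ident smooth_on_has_derivative[OF E_smooth]], of z]
  by (simp add: frame_lift_own)

lemma graph_vimage: "open N \<Longrightarrow> open (U \<inter> (\<lambda>y. (y, E y)) -` N)"
  by (rule continuous_open_preimage[OF smooth_on_continuous_on[OF graph_smooth] open_chart_image[OF c]])

lemma frame_section_in_cc: "z \<in> U \<Longrightarrow> frame_section z \<in> unitary_coframes A \<Omega> \<inter> fst (cc c)"
  using frame_section_in cc_at by (simp add: charts_at_def)

text \<open>In the bundle chart over \<open>c\<close> the frame section is the graph of
  \<open>E\<close>. Composing the local ambient extensions with this graph gives smooth functions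
  near each point of the chart, and the chain rule gives their derivatives.\<close>

lemma pullback_function:
  fixes f :: "('m, 'n) coframe_point \<Rightarrow> 'v::euclidean_space"
  assumes d: "has_differential_on (coframe_atlas A) (unitary_coframes A \<Omega>) f \<alpha>"
  shows "smooth_on U (\<lambda>y. f (frame_section y))"
    and "z \<in> U \<Longrightarrow> ((\<lambda>y. f (frame_section y)) has_derivative (\<lambda>v. \<alpha> (frame_section z) (frame_lift z v))) (at z)"
proof -
  let ?s = "\<lambda>y. (y, E y)"
  have ext: "\<exists>N G. z \<in> U \<inter> ?s -` N \<and> open N \<and> smooth_on N G \<and> (\<forall>y\<in>U \<inter> ?s -` N. G (?s y) = f (frame_section y)) \<and>
      (\<forall>v. \<alpha> (frame_section z) (frame_lift z v) = frechet_derivative G (at (?s z)) (frame_lift z v (cc c)))" if z: "z \<in> U" for z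
  proof -
    from d frame_section_in[OF z] cc_at[OF z] obtain N G where
      N: "snd (cc c) (frame_section z) \<in> N" "function_extension (unitary_coframes A \<Omega>) (cc c) f N G" and
      G: "\<And>v. v \<in> submanifold_tangent (coframe_atlas A) (unitary_coframes A \<Omega>) (frame_section z) \<Longrightarrow>
          \<alpha> (frame_section z) v = frechet_derivative G (at (snd (cc c) (frame_section z))) (v (cc c))"
      unfolding has_differential_on_def by meson
    have "G (?s y) = f (frame_section y)" if "y \<in> U \<inter> ?s -` N" for y
      using N(2) frame_section_in_cc[of y] frame_section_own[of y] that unfolding function_extension_def by force
    then show ?thesis
      using N z G[OF frame_lift_in[OF z]] frame_section_own[OF z] unfolding function_extension_def
      by (intro exI[of _ N] exI[of _ G]) auto
  qed
  show "smooth_on U (\<lambda>y. f (frame_section y))"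
  proof (rule smooth_on_locally)
    fix z assume "z \<in> U"
    from ext[OF this] obtain N G where N: "z \<in> U \<inter> ?s -` N" "open N" "smooth_on N G" "\<forall>y\<in>U \<inter> ?s -` N. G (?s y) = f (frame_section y)"
      by blast
    have "smooth_on (U \<inter> ?s -` N) (\<lambda>y. G (?s y))"
      by (rule smooth_on_compose[OF graph_vimage[OF N(2)] N(2) _ N(3) smooth_on_subset[OF graph_smooth]]) auto
    then have "smooth_on (U \<inter> ?s -` N) (\<lambda>y. f (frame_section y))"
      by (rule smooth_on_cong[OF graph_vimage[OF N(2)], rotated]) (use N(4) in blast)
    then show "\<exists>N. open N \<and> z \<in> N \<and> smooth_on N (\<lambda>y. f (frame_section y))" using N(1) graph_vimage[OF N(2)] by blast
  qed
  assume z: "z \<in> U"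
  from ext[OF this] obtain N G where N: "z \<in> U \<inter> ?s -` N" "open N" "smooth_on N G" "\<forall>y\<in>U \<inter> ?s -` N. G (?s y) = f (frame_section y)"
      "\<forall>v. \<alpha> (frame_section z) (frame_lift z v) = frechet_derivative G (at (?s z)) (frame_lift z v (cc c))"
    by (elim exE conjE)
  have "((\<lambda>y. G (?s y)) has_derivative (\<lambda>v. frechet_derivative G (at (?s z)) (frechet_derivative ?s (at z) v))) (at z)"
    by (rule has_derivative_compose[OF smooth_on_has_derivative[OF graph_smooth z] smooth_on_has_derivative[OF N(3)]])
       (use N(1) in auto)
  then have "((\<lambda>y. f (frame_section y)) has_derivative (\<lambda>v. frechet_derivative G (at (?s z)) (frechet_derivative ?s (at z) v))) (at z)"
    by (rule has_derivative_transform_within_open[OF _ graph_vimage[OF N(2)] N(1)]) (use N(4) in blast)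
  then show "((\<lambda>y. f (frame_section y)) has_derivative (\<lambda>v. \<alpha> (frame_section z) (frame_lift z v))) (at z)"
    by (simp add: N(5) graph_derivative[OF z])
qed

text \<open>As for functions, with \<open>pullback_family\<close> supplying the exterior derivative;
  linearity in \<open>v\<close> is inherited from the ambient extensions.\<close>

lemma pullback_form:
  fixes \<alpha> :: "('m, 'n) coframe_point \<Rightarrow> ('m, 'n) coframe_tvec \<Rightarrow> 'v::euclidean_space"
  assumes d: "has_exterior_derivative_on (coframe_atlas A) (unitary_coframes A \<Omega>) \<alpha> \<beta>"
  defines "a \<equiv> \<lambda>z v. \<alpha> (frame_section z) (frame_lift z v)"
  shows "smooth_on U (\<lambda>z. a z v)" and "z \<in> U \<Longrightarrow> linear (a z)"
    and "z \<in> U \<Longrightarrow> frechet_derivative (\<lambda>z. a z w) (at z) v - frechet_derivative (\<lambda>z. a z v) (at z) w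
       = \<beta> (frame_section z) (frame_lift z v) (frame_lift z w)"
proof -
  let ?s = "\<lambda>y. (y, E y)"
  have ext: "\<exists>N g. z \<in> U \<inter> ?s -` N \<and> open N \<and> (\<forall>q\<in>N. linear (g q)) \<and> (\<forall>e. smooth_on N (\<lambda>q. g q e)) \<and>
      (\<forall>y\<in>U \<inter> ?s -` N. \<forall>v. a y v = g (?s y) (frechet_derivative ?s (at y) v)) \<and>
      (\<forall>v w. \<beta> (frame_section z) (frame_lift z v) (frame_lift z w)
        = frechet_derivative (\<lambda>q. g q (frechet_derivative ?s (at z) w)) (at (?s z)) (frechet_derivative ?s (at z) v)
        - frechet_derivative (\<lambda>q. g q (frechet_derivative ?s (at z) v)) (at (?s z)) (frechet_derivative ?s (at z) w))"
    if z: "z \<in> U" for z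
  proof -
    from d frame_section_in[OF z] cc_at[OF z] obtain N g where
      N: "snd (cc c) (frame_section z) \<in> N" "form_extension (coframe_atlas A) (unitary_coframes A \<Omega>) (cc c) \<alpha> N g" and
      G: "\<And>v w. \<lbrakk>v \<in> submanifold_tangent (coframe_atlas A) (unitary_coframes A \<Omega>) (frame_section z);
            w \<in> submanifold_tangent (coframe_atlas A) (unitary_coframes A \<Omega>) (frame_section z)\<rbrakk> \<Longrightarrow>
          \<beta> (frame_section z) v w = frechet_derivative (\<lambda>q. g q (w (cc c))) (at (snd (cc c) (frame_section z))) (v (cc c))
            - frechet_derivative (\<lambda>q. g q (v (cc c))) (at (snd (cc c) (frame_section z))) (w (cc c))"
      unfolding has_exterior_derivative_on_def by meson
    have "a y v = g (?s y) (frechet_derivative ?s (at y) v)" if y: "y \<in> U \<inter> ?s -` N" for y v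
    proof -
      have yU: "y \<in> U" using y by blast
      have "\<forall>v\<in>submanifold_tangent (coframe_atlas A) (unitary_coframes A \<Omega>) (frame_section y).
          \<alpha> (frame_section y) v = g (snd (cc c) (frame_section y)) (v (cc c))"
        using N(2) frame_section_in_cc[OF yU] frame_section_own[OF yU] y unfolding form_extension_def by auto
      then show ?thesis
        using frame_lift_in[OF yU] by (simp add: a_def graph_derivative[OF yU] frame_section_own[OF yU])
    qed
    then show ?thesis
      using N z G[OF frame_lift_in[OF z] frame_lift_in[OF z]] frame_section_own[OF z] unfolding form_extension_def
      by (intro exI[of _ N] exI[of _ g]) (auto simp: graph_derivative[OF z])
  qed
  have loc: "\<exists>W. open W \<and> z \<in> W \<and> (\<forall>v. smooth_on W (\<lambda>z. a z v)) \<and> linear (a z) \<and>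
      (\<forall>v w. frechet_derivative (\<lambda>z. a z w) (at z) v - frechet_derivative (\<lambda>z. a z v) (at z) w
         = \<beta> (frame_section z) (frame_lift z v) (frame_lift z w))" if z: "z \<in> U" for z
  proof -
    from ext[OF z] obtain N g where N: "z \<in> U \<inter> ?s -` N" "open N" and lin: "\<forall>q\<in>N. linear (g q)" and sm: "\<forall>e. smooth_on N (\<lambda>q. g q e)"
      and eq: "\<forall>y\<in>U \<inter> ?s -` N. \<forall>v. a y v = g (?s y) (frechet_derivative ?s (at y) v)"
      and b: "\<forall>v w. \<beta> (frame_section z) (frame_lift z v) (frame_lift z w)
        = frechet_derivative (\<lambda>q. g q (frechet_derivative ?s (at z) w)) (at (?s z)) (frechet_derivative ?s (at z) v)
        - frechet_derivative (\<lambda>q. g q (frechet_derivative ?s (at z) v)) (at (?s z)) (frechet_derivative ?s (at z) w)"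
      by (elim exE conjE)
    let ?W = "U \<inter> ?s -` N"
    have W: "open ?W" by (rule graph_vimage[OF N(2)])
    have sW: "smooth_on ?W ?s" by (rule smooth_on_subset[OF graph_smooth]) simp
    have im: "?s ` ?W \<subseteq> N" by auto
    note p = pullback_family[OF N(2) lin[rule_format] sm[rule_format] W sW im]
    have eq': "g (?s y) (frechet_derivative ?s (at y) v) = a y v" if "y \<in> ?W" for y v using eq that by simp
    have f: "frechet_derivative (\<lambda>y. g (?s y) (frechet_derivative ?s (at y) v)) (at z) = frechet_derivative (\<lambda>z. a z v) (at z)" for v
      by (rule frechet_derivative_cong[OF W N(1) eq'])
    show ?thesis
    proof (intro exI[of _ ?W] conjI W N(1) allI)
      show "smooth_on ?W (\<lambda>z. a z v)" for v by (rule smooth_on_cong[OF W eq' p(1)])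
      have "a z = (\<lambda>v. g (?s z) (frechet_derivative ?s (at z) v))" using eq N(1) by blast
      then show "linear (a z)"
        using linear_compose[OF smooth_on_linear_frechet[OF sW N(1)], of "g (?s z)"] lin N(1) by (auto simp: o_def)
      show "frechet_derivative (\<lambda>z. a z w) (at z) v - frechet_derivative (\<lambda>z. a z v) (at z) w
         = \<beta> (frame_section z) (frame_lift z v) (frame_lift z w)" for v w
        using p(2)[rotated, OF N(1), of w v] b unfolding f by simp
    qed
  qed
  show "smooth_on U (\<lambda>z. a z v)" by (rule smooth_on_locally) (use loc in blast)
  show "linear (a z)" if "z \<in> U" using loc[OF that] by blast
  show "frechet_derivative (\<lambda>z. a z w) (at z) v - frechet_derivative (\<lambda>z. a z v) (at z) w
       = \<beta> (frame_section z) (frame_lift z v) (frame_lift z w)" if "z \<in> U"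
    using loc[OF that] by blast
qed

end

context kaehler_mfd
begin

lemma cf_kaehler_family: "c \<in> A \<Longrightarrow> kaehler_family (chart_image c) (cf c)"
  by unfold_locales
    (rule open_chart_image cf_smooth cf_bilinear cf_rules(3) cf_rules(4) cf_rules(5), assumption+)+

text \<open>By \<open>tautological_frame_lift\<close> the tautological form pulls back to
  \<open>E dz\<close>, so its structure equation becomes the torsion equation for \<open>E\<close>;
  the equations for \<phi>, \<open>H\<close>, \<open>T\<close> and \<open>V\<close> keep their
  shape.\<close>

lemma frame_data_exists:
  assumes bk: "bochner_kaehler A \<Omega>" and c: "c \<in> A"
  shows "\<exists>E F ph H T V. frame_data (chart_image c) E F ph H T V (cf c)"
proof -
  let ?P = "unitary_coframes A \<Omega>" and ?B = "coframe_atlas A" and ?w = "tautological_form A"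
  interpret kaehler_family "chart_image c" "cf c" by (rule cf_kaehler_family[OF c])
  obtain E F :: "complex^'n \<Rightarrow> complex^'n^'n" where E: "smooth_on (chart_image c) E" and F: "smooth_on (chart_image c) F"
    and EF: "\<And>z. z \<in> chart_image c \<Longrightarrow> E z ** F z = mat 1" and FE: "\<And>z. z \<in> chart_image c \<Longrightarrow> F z ** E z = mat 1"
    and un: "\<And>z v w. z \<in> chart_image c \<Longrightarrow> cf c z v (\<i> *s w) = (E z *v v) \<bullet> (E z *v w)"
    by (rule unitary_frame_exists) (rule that)
  interpret framed_chart A \<Omega> c E F by unfold_locales (use c E EF FE un in auto)
  obtain \<phi> and H :: "('m, 'n) coframe_point \<Rightarrow> complex^'n^'n" and T :: "('m, 'n) coframe_point \<Rightarrow> complex^'n"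
    and V :: "('m, 'n) coframe_point \<Rightarrow> real" where
    conn: "is_connection_form A \<Omega> \<phi>" and hH: "\<forall>p\<in>?P. conj_transpose (H p) = H p"
    and d\<phi>: "has_exterior_derivative_on ?B ?P \<phi> (\<lambda>p v w. - (\<phi> p v ** \<phi> p w - \<phi> p w ** \<phi> p v) + rho (H p) (?w p v) (?w p w))"
    and dH: "has_differential_on ?B ?P H (\<lambda>p v. kapH (H p) (T p) (?w p v) (\<phi> p v))"
    and dT: "has_differential_on ?B ?P T (\<lambda>p v. kapT (H p) (T p) (V p) (?w p v) (\<phi> p v))"
    and dV: "has_differential_on ?B ?P (\<lambda>p. complex_of_real (V p)) (\<lambda>p v. kapV (H p) (T p) (?w p v))"
    using bk unfolding bochner_kaehler_def Let_def rho_def kapH_def kapT_def kapV_def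
    by (elim conjE exE) (simp only: add_diff_eq add.assoc diff_conv_add_uminus)
  have d\<omega>: "has_exterior_derivative_on ?B ?P ?w (\<lambda>p v w. - (\<phi> p v *v ?w p w - \<phi> p w *v ?w p v))"
    and skew: "\<And>p v. \<lbrakk>p \<in> ?P; v \<in> submanifold_tangent ?B ?P p\<rbrakk> \<Longrightarrow> conj_transpose (\<phi> p v) = - \<phi> p v"
    using conn unfolding is_connection_form_def Let_def by blast+
  note tl = tautological_frame_lift
  have dE: "frechet_derivative (\<lambda>z. ?w (frame_section z) (frame_lift z w)) (at z) v = frechet_derivative E (at z) v *v w"
    if z: "z \<in> U" for z v w
  proof -
    have "frechet_derivative (\<lambda>z. ?w (frame_section z) (frame_lift z w)) (at z) = frechet_derivative (\<lambda>z. E z *v w) (at z)"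
      by (rule frechet_derivative_cong[OF open_U z tl])
    also have "\<dots> = (\<lambda>v. frechet_derivative E (at z) v *v w)"
      by (rule frechet_derivative_eqI[OF bounded_linear.has_derivative[OF bounded_bilinear.bounded_linear_left[OF bounded_bilinear_matrix_vec]
          smooth_on_has_derivative[OF E z]]])
    finally show ?thesis by simp
  qed
  have "frame_data U E F (\<lambda>z v. \<phi> (frame_section z) (frame_lift z v)) (\<lambda>z. H (frame_section z)) (\<lambda>z. T (frame_section z))
      (\<lambda>z. V (frame_section z)) (cf c)"
  proof (rule frame_data.intro)
    fix z assume z: "z \<in> U"
    show "frechet_derivative E (at z) v *v w - frechet_derivative E (at z) w *v v
        = - (\<phi> (frame_section z) (frame_lift z v) *v (E z *v w) - \<phi> (frame_section z) (frame_lift z w) *v (E z *v v))" for v w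
      using pullback_form(3)[OF d\<omega> z, of w v] unfolding dE[OF z] tl[OF z] .
    show "frechet_derivative (\<lambda>z. \<phi> (frame_section z) (frame_lift z w)) (at z) v - frechet_derivative (\<lambda>z. \<phi> (frame_section z) (frame_lift z v)) (at z) w
        = - (\<phi> (frame_section z) (frame_lift z v) ** \<phi> (frame_section z) (frame_lift z w) - \<phi> (frame_section z) (frame_lift z w) ** \<phi> (frame_section z) (frame_lift z v))
          + rho (H (frame_section z)) (E z *v v) (E z *v w)" for v w
      using pullback_form(3)[OF d\<phi> z, of w v] unfolding tl[OF z] .
    show "conj_transpose (\<phi> (frame_section z) (frame_lift z v)) = - \<phi> (frame_section z) (frame_lift z v)" for v
      by (rule skew[OF frame_section_in[OF z] frame_lift_in[OF z]])
    show "linear (\<lambda>v. \<phi> (frame_section z) (frame_lift z v))" by (rule pullback_form(2)[OF d\<phi> z])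
    show "conj_transpose (H (frame_section z)) = H (frame_section z)" using hH frame_section_in[OF z] by blast
    show "((\<lambda>z. H (frame_section z)) has_derivative (\<lambda>v. kapH (H (frame_section z)) (T (frame_section z)) (E z *v v) (\<phi> (frame_section z) (frame_lift z v)))) (at z)"
      using pullback_function(2)[OF dH z] unfolding tl[OF z] .
    show "((\<lambda>z. T (frame_section z)) has_derivative (\<lambda>v. kapT (H (frame_section z)) (T (frame_section z)) (V (frame_section z)) (E z *v v) (\<phi> (frame_section z) (frame_lift z v)))) (at z)"
      using pullback_function(2)[OF dT z] unfolding tl[OF z] .
    show "((\<lambda>z. complex_of_real (V (frame_section z))) has_derivative (\<lambda>v. kapV (H (frame_section z)) (T (frame_section z)) (E z *v v))) (at z)"
      using pullback_function(2)[OF dV z] unfolding tl[OF z] .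
  qed (use open_U E F EF FE un pullback_form(1)[OF d\<phi>] pullback_function(1)[OF dH] in auto)
  then show ?thesis by blast
qed

lemma bochner_mfd_axioms: "bochner_kaehler A \<Omega> \<Longrightarrow> bochner_mfd A \<Omega>"
  by unfold_locales (rule frame_data_exists)

end

section \<open>The variational equation of a flow\<close>

text \<open>The deviation of \<open>y\<close> from the approximation \<open>z + u\<close> satisfies
  the linearised equation up to a quadratic error, because two solutions stay within twice their
  initial distance. Both estimates come from \<open>ode_norm_bound\<close>, hence the constants
  1/2.\<close>

lemma ode_linearization:
  fixes f :: "'e::euclidean_space \<Rightarrow> 'e"
  assumes Taylor: "\<And>x y. \<lbrakk>x \<in> K; y \<in> K\<rbrakk> \<Longrightarrow> norm (f y - f x - D x (y - x)) \<le> C * (norm (y - x))\<^sup>2" and C: "C \<ge> 0"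
    and Lip: "\<And>x y. \<lbrakk>x \<in> K; y \<in> K\<rbrakk> \<Longrightarrow> norm (f y - f x) \<le> norm (y - x) / 2"
    and D: "\<And>x. x \<in> K \<Longrightarrow> linear (D x)" "\<And>x w. x \<in> K \<Longrightarrow> norm (D x w) \<le> norm w / 2"
    and y: "\<And>t. t \<in> {0..1} \<Longrightarrow> y t \<in> K" "\<And>t. t \<in> {0..1} \<Longrightarrow> (y has_vector_derivative f (y t)) (at t within {0..1})"
    and z: "\<And>t. t \<in> {0..1} \<Longrightarrow> z t \<in> K" "\<And>t. t \<in> {0..1} \<Longrightarrow> (z has_vector_derivative f (z t)) (at t within {0..1})"
    and u: "\<And>t. t \<in> {0..1} \<Longrightarrow> (u has_vector_derivative D (z t) (u t)) (at t within {0..1})"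
    and t: "t \<in> {0..1}"
  shows "norm (y t - z t - u t) \<le> 2 * (norm (y 0 - z 0 - u 0) + 4 * C * (norm (y 0 - z 0))\<^sup>2)"
proof -
  have e1: "norm (y t - z t) \<le> 2 * norm (y 0 - z 0)" if "t \<in> {0..1}" for t
    using ode_norm_bound[of "\<lambda>t. y t - z t" "\<lambda>t. f (y t) - f (z t)" 0 t] y z Lip that
    by (auto intro!: has_vector_derivative_diff)
  show ?thesis
  proof (rule ode_norm_bound[of "\<lambda>t. y t - z t - u t" "\<lambda>t. f (y t) - f (z t) - D (z t) (u t)", OF _ _ t])
    fix s :: real assume s: "s \<in> {0..1}"
    show "((\<lambda>t. y t - z t - u t) has_vector_derivative f (y s) - f (z s) - D (z s) (u s)) (at s within {0..1})"
      by (intro has_vector_derivative_diff y z u s)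
    have "f (y s) - f (z s) - D (z s) (u s) = D (z s) (y s - z s - u s) + (f (y s) - f (z s) - D (z s) (y s - z s))"
      by (simp add: linear_diff[OF D(1)[OF z(1)[OF s]]])
    also have "norm \<dots> \<le> norm (y s - z s - u s) / 2 + C * (norm (y s - z s))\<^sup>2"
      by (intro norm_triangle_mono D Taylor y z s)
    also have "C * (norm (y s - z s))\<^sup>2 \<le> C * (2 * norm (y 0 - z 0))\<^sup>2"
      by (intro mult_left_mono power_mono e1 s C norm_ge_zero)
    finally show "norm (f (y s) - f (z s) - D (z s) (u s)) \<le> norm (y s - z s - u s) / 2 + 4 * C * (norm (y 0 - z 0))\<^sup>2"
      by (simp add: power_mult_distrib mult_ac)
  qed
qed

text \<open>Carries differentiability from the initial values \<psi> to the values \<open>g\<close>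
  at a later time: the bound has the form delivered by \<open>ode_linearization\<close>, and it is
  o(s) when \<psi> is differentiable.\<close>

lemma has_vector_derivative_dominated:
  fixes \<psi> :: "real \<Rightarrow> 'b::real_inner" and g :: "real \<Rightarrow> 'a::real_normed_vector"
  assumes \<psi>: "(\<psi> has_vector_derivative u0) (at 0)"
    and ev: "\<forall>\<^sub>F s in at 0. norm (g s - g 0 - s *\<^sub>R u) \<le> 2 * (norm (\<psi> s - \<psi> 0 - s *\<^sub>R u0) + C * (norm (\<psi> s - \<psi> 0))\<^sup>2)"
  shows "(g has_vector_derivative u) (at 0)"
proof -
  have l: "((\<lambda>s. norm (\<psi> s - \<psi> 0 - s *\<^sub>R u0) / \<bar>s\<bar>) \<longlongrightarrow> 0) (at 0)"
    using \<psi> unfolding has_vector_derivative_def has_derivative_at by simp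
  have "((\<lambda>s. (\<psi> s - \<psi> 0) \<bullet> (\<psi> s - \<psi> 0)) has_derivative (\<lambda>h. 0)) (at 0)"
  proof -
    have "((\<lambda>s. \<psi> s - \<psi> 0) has_derivative (\<lambda>h. h *\<^sub>R u0)) (at 0)"
      using has_derivative_diff[OF \<psi>[unfolded has_vector_derivative_def] has_derivative_const] by simp
    from has_derivative_inner[OF this this] show ?thesis by simp
  qed
  then have q: "((\<lambda>s. (norm (\<psi> s - \<psi> 0))\<^sup>2 / \<bar>s\<bar>) \<longlongrightarrow> 0) (at 0)"
    unfolding has_derivative_at by (simp add: power2_norm_eq_inner)
  have "((\<lambda>s. 2 * (norm (\<psi> s - \<psi> 0 - s *\<^sub>R u0) / \<bar>s\<bar> + C * ((norm (\<psi> s - \<psi> 0))\<^sup>2 / \<bar>s\<bar>))) \<longlongrightarrow> 2 * (0 + C * 0)) (at 0)"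
    by (intro tendsto_intros l q)
  then have "((\<lambda>s. 2 * (norm (\<psi> s - \<psi> 0 - s *\<^sub>R u0) / \<bar>s\<bar> + C * ((norm (\<psi> s - \<psi> 0))\<^sup>2 / \<bar>s\<bar>))) \<longlongrightarrow> 0) (at 0)"
    by simp
  then have "((\<lambda>s. norm (g s - g 0 - s *\<^sub>R u) / \<bar>s\<bar>) \<longlongrightarrow> 0) (at 0)"
  proof (rule Lim_null_comparison[rotated])
    show "\<forall>\<^sub>F s in at 0. norm (norm (g s - g 0 - s *\<^sub>R u) / \<bar>s\<bar>)
        \<le> 2 * (norm (\<psi> s - \<psi> 0 - s *\<^sub>R u0) / \<bar>s\<bar> + C * ((norm (\<psi> s - \<psi> 0))\<^sup>2 / \<bar>s\<bar>))"
      using ev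
    proof eventually_elim
      case (elim s)
      then have "norm (g s - g 0 - s *\<^sub>R u) / \<bar>s\<bar> \<le> 2 * (norm (\<psi> s - \<psi> 0 - s *\<^sub>R u0) + C * (norm (\<psi> s - \<psi> 0))\<^sup>2) / \<bar>s\<bar>"
        by (simp add: divide_right_mono)
      then show ?case by (simp add: add_divide_distrib)
    qed
  qed
  then show ?thesis unfolding has_vector_derivative_def has_derivative_at by (simp add: bounded_linear_scaleR_left)
qed

context kaehler_mfd
begin

text \<open>Consider a first exit time. Before it, the coordinates have moved by at most r/4 from a
  point within r/2 of the centre, so the curve lies over the closed ball of radius 3r/4. The part of
  the manifold over that ball is compact, hence closed in the Hausdorff space, so the exit point
  lies in it too and is no exit point.\<close>

lemma curve_confined:
  assumes d: "d \<in> A" and r: "r > 0" "cball y0 r \<subseteq> chart_image d"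
    and \<gamma>: "continuous_on {0..1} \<gamma>" "\<gamma> 0 \<in> fst d" "dist y0 (snd d (\<gamma> 0)) < r / 2"
    and f: "\<And>y. y \<in> cball y0 r \<Longrightarrow> norm (f y) \<le> r / 4"
    and der: "\<And>s. \<lbrakk>s \<in> {0..1}; \<gamma> s \<in> fst d\<rbrakk> \<Longrightarrow>
       ((\<lambda>s. snd d (\<gamma> s)) has_vector_derivative f (snd d (\<gamma> s))) (at s within {0..1})"
    and s: "s \<in> {0..1::real}"
  shows "\<gamma> s \<in> fst d \<and> snd d (\<gamma> s) \<in> cball y0 r"
proof -
  define G where "G = fst d \<inter> snd d -` ball y0 r"
  have "open G" unfolding G_def by (rule open_chart_vimage[OF d open_ball])
  define Bad where "Bad = {0..1} \<inter> \<gamma> -` (- G)"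
  have "closed Bad" unfolding Bad_def
    by (rule continuous_closed_preimage[OF \<gamma>(1)]) (use \<open>open G\<close> in auto)
  then have comp: "compact Bad" unfolding Bad_def by (metis bounded_Int bounded_closed_interval compact_eq_bounded_closed)
  have "Bad = {}"
  proof (rule ccontr)
    assume "Bad \<noteq> {}"
    then obtain b where b: "b \<in> Bad" "\<And>s. s \<in> Bad \<Longrightarrow> b \<le> s"
      using compact_attains_inf[OF comp] by blast
    have b01: "b \<in> {0..1}" "\<gamma> b \<notin> G" using b(1) by (auto simp: Bad_def)
    have "\<gamma> 0 \<in> G" using \<gamma>(2,3) r(1) by (simp add: G_def)
    then have "b > 0" using b01 by (cases "b = 0") auto
    have good: "\<gamma> s \<in> G" if "0 \<le> s" "s < b" for s using b(2)[of s] that b01 by (auto simp: Bad_def)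
    define Kc where "Kc = chart_inv d ` cball y0 (3 * r / 4)"
    have sub: "cball y0 (3 * r / 4) \<subseteq> chart_image d" using r by auto
    have "compact Kc" unfolding Kc_def
      by (rule compact_continuous_image[OF continuous_on_subset[OF continuous_chart_inv[OF d] sub] compact_cball])
    then have Kc: "closed Kc" by (rule compact_imp_closed)
    have "Kc \<subseteq> G" unfolding Kc_def chart_inv_image[OF d sub] G_def using r(1) by auto
    have inK: "\<gamma> s \<in> Kc" if s: "0 \<le> s" "s < b" for s
    proof -
      have "norm (snd d (\<gamma> 0) - snd d (\<gamma> s)) \<le> r / 4 * norm (0 - s)"
      proof (rule vector_derivative_norm_bound[of "{0..s}"])
        fix t assume t: "t \<in> {0..s}"
        then have gt: "\<gamma> t \<in> fst d" "snd d (\<gamma> t) \<in> cball y0 r" using good[of t] s by (auto simp: G_def)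
        show "((\<lambda>s. snd d (\<gamma> s)) has_vector_derivative f (snd d (\<gamma> t))) (at t within {0..s})"
          by (rule has_vector_derivative_within_subset[OF der]) (use t s b01 gt in auto)
        show "norm (f (snd d (\<gamma> t))) \<le> r / 4" by (rule f[OF gt(2)])
      qed (use s in auto)
      also have "\<dots> \<le> r / 4 * 1" using s b01 r(1) by (intro mult_left_mono) auto
      finally have "dist (snd d (\<gamma> 0)) (snd d (\<gamma> s)) \<le> r / 4" by (simp add: dist_norm)
      then have "dist y0 (snd d (\<gamma> s)) \<le> 3 * r / 4" using \<gamma>(3) dist_triangle[of y0 "snd d (\<gamma> s)" "snd d (\<gamma> 0)"] by linarith
      then show ?thesis unfolding Kc_def chart_inv_image[OF d sub] using good[OF s] by (simp add: G_def)
    qed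
    have "closed ({0..b} \<inter> \<gamma> -` Kc)"
      by (rule continuous_closed_preimage[OF continuous_on_subset[OF \<gamma>(1)] _ Kc]) (use b01 in auto)
    moreover have "{0..<b} \<subseteq> {0..b} \<inter> \<gamma> -` Kc" using inK by auto
    ultimately have "closure {0..<b} \<subseteq> {0..b} \<inter> \<gamma> -` Kc" by (rule closure_minimal[rotated])
    then have "{0..b} \<subseteq> \<gamma> -` Kc" using \<open>b > 0\<close> by simp
    moreover have "b \<in> {0..b}" using \<open>b > 0\<close> by simp
    ultimately have "\<gamma> b \<in> Kc" by blast
    then show False using \<open>Kc \<subseteq> G\<close> b01 by blast
  qed
  then have "\<gamma> s \<in> G" using s unfolding Bad_def by blast
  then show ?thesis by (auto simp: G_def)
qed

end

locale flow_mfd = kaehler_mfd A \<Omega> for A :: "('m::{t2_space, second_countable_topology}, complex^'n) chart set"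
    and \<Omega> :: "'m \<Rightarrow> ('m, complex^'n) tvec \<Rightarrow> ('m, complex^'n) tvec \<Rightarrow> real" +
  fixes X :: "'m \<Rightarrow> ('m, complex^'n) tvec" and W :: "'m set" and \<epsilon> :: real and \<Phi> :: "real \<Rightarrow> 'm \<Rightarrow> 'm"
  assumes flow: "local_flow A X W \<epsilon> \<Phi>"
    and X_smooth: "d \<in> A \<Longrightarrow> smooth_on (chart_image d) (\<lambda>z. X (chart_inv d z) d)"
begin

definition Xc where "Xc d z = X (chart_inv d z) d"

definition jacobi :: "('m, complex^'n) chart \<Rightarrow> 'm \<Rightarrow> complex^'n \<Rightarrow> real \<Rightarrow> ('m, complex^'n) chart \<Rightarrow> complex^'n"
  where "jacobi c x v t d = frechet_derivative (snd d \<circ> \<Phi> t \<circ> chart_inv c) (at (snd c x)) v"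

lemma flow_rules:
  shows "open W" "W \<subseteq> carrier A" "\<epsilon> > 0" "x \<in> W \<Longrightarrow> \<Phi> 0 x = x"
    "x \<in> W \<Longrightarrow> continuous_on {-\<epsilon><..<\<epsilon>} (\<lambda>t. \<Phi> t x)"
    "\<lbrakk>x \<in> W; t \<in> {-\<epsilon><..<\<epsilon>}; c \<in> charts_at A (\<Phi> t x)\<rbrakk> \<Longrightarrow>
       ((\<lambda>s. snd c (\<Phi> s x)) has_vector_derivative X (\<Phi> t x) c) (at t)"
    "t \<in> {-\<epsilon><..<\<epsilon>} \<Longrightarrow> smooth_map A A W (\<Phi> t)"
  using flow unfolding local_flow_def by blast+

lemma jacobi_derivative:
  assumes "t \<in> {-\<epsilon><..<\<epsilon>}" "x \<in> W" "c \<in> charts_at A x" "d \<in> charts_at A (\<Phi> t x)"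
  shows "(snd d \<circ> \<Phi> t \<circ> chart_inv c has_derivative (\<lambda>v. jacobi c x v t d)) (at (snd c x))"
    and "\<exists>N. open N \<and> snd c x \<in> N \<and> (\<forall>z\<in>N. z \<in> chart_image c \<and> chart_inv c z \<in> W \<and> \<Phi> t (chart_inv c z) \<in> fst d)"
proof -
  have c: "c \<in> A" using assms(3) by (simp add: charts_at_iff)
  from flow_rules(7)[OF assms(1)] assms(2-4) obtain N where N: "open N" "snd c x \<in> N" "N \<subseteq> chart_image c"
    "\<Phi> t ` chart_inv c ` N \<subseteq> fst d" "smooth_on N (snd d \<circ> \<Phi> t \<circ> chart_inv c)"
    unfolding smooth_map_def by meson
  show "(snd d \<circ> \<Phi> t \<circ> chart_inv c has_derivative (\<lambda>v. jacobi c x v t d)) (at (snd c x))"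
    unfolding jacobi_def using smooth_on_has_derivative[OF N(5,2)] .
  have "open (N \<inter> chart_part c W)" by (intro open_Int N open_chart_part c flow_rules(1))
  moreover have "snd c x \<in> N \<inter> chart_part c W" using N(2) chart_part_in[OF c _ assms(2)] assms(3) by (simp add: charts_at_iff)
  moreover have "\<forall>z\<in>N \<inter> chart_part c W. z \<in> chart_image c \<and> chart_inv c z \<in> W \<and> \<Phi> t (chart_inv c z) \<in> fst d"
    using N(3,4) by (auto simp: chart_part_def)
  ultimately show "\<exists>N. open N \<and> snd c x \<in> N \<and> (\<forall>z\<in>N. z \<in> chart_image c \<and> chart_inv c z \<in> W \<and> \<Phi> t (chart_inv c z) \<in> fst d)"
    by blast
qed

text \<open>A one-sided derivative in rescaled time, for \<eta> of either sign. Since the flow is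
  known to be smooth in the point only for each fixed time, the Jacobi vector is identified with the
  solution \<open>u\<close> of the linearised equation by comparing orbits of nearby points over the
  unit interval.\<close>

lemma jacobi_step:
  assumes t0: "t0 \<in> {-\<epsilon><..<\<epsilon>}" and x: "x \<in> W" and cx: "c \<in> charts_at A x" and dx: "d \<in> charts_at A (\<Phi> t0 x)"
  obtains \<delta> where "\<delta> > 0" "\<And>\<eta>. \<bar>\<eta>\<bar> = \<delta> \<Longrightarrow> ((\<lambda>\<tau>. jacobi c x v (t0 + \<eta> * \<tau>) d) has_vector_derivative
      \<eta> *\<^sub>R frechet_derivative (Xc d) (at (snd d (\<Phi> t0 x))) (jacobi c x v t0 d)) (at 0 within {0..1})"
proof -
  define y0 where "y0 = snd d (\<Phi> t0 x)"
  define z0 where "z0 = snd c x"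
  let ?f = "Xc d" and ?D = "\<lambda>z. frechet_derivative (Xc d) (at z)"
  have d: "d \<in> A" "\<Phi> t0 x \<in> fst d" and c: "c \<in> A" "x \<in> fst c" using dx cx by (auto simp: charts_at_iff)
  have cz: "chart_inv c z0 = x" unfolding z0_def by (rule chart_inv_chart[OF c])
  have sf: "smooth_on (chart_image d) ?f" using X_smooth[OF d(1)] by (simp add: Xc_def[abs_def])
  have y0: "y0 \<in> chart_image d" unfolding y0_def by (rule chart_in_image[OF d(2)])
  obtain r where r: "r > 0" "cball y0 r \<subseteq> chart_image d" using open_chart_image[OF d(1)] y0 open_contains_cball by blast
  let ?K = "cball y0 r"
  have "bounded (?f ` ?K)"
    by (intro compact_imp_bounded compact_continuous_image continuous_on_subset[OF smooth_on_continuous_on[OF sf] r(2)] compact_cball)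
  then obtain M where M: "\<And>y. y \<in> ?K \<Longrightarrow> norm (?f y) \<le> M" unfolding bounded_iff by blast
  have M0: "M \<ge> 0" using M[of y0] r(1) norm_ge_zero order_trans by (metis centre_in_cball less_imp_le)
  have Dlin: "linear (?D z)" if "z \<in> ?K" for z using smooth_on_linear_frechet[OF sf] r(2) that by blast
  have Dcont: "continuous_on ?K (\<lambda>z. ?D z e)" for e
    by (rule continuous_on_subset[OF smooth_on_continuous_on[OF smooth_on_frechet_derivative[OF sf]] r(2)])
  obtain L where L: "L \<ge> 0" "\<And>z e. z \<in> ?K \<Longrightarrow> norm (?D z e) \<le> L * norm e"
    using linear_family_bound[OF compact_cball Dlin Dcont] by blast
  obtain C where C: "C \<ge> 0" "\<And>x y. \<lbrakk>x \<in> ?K; y \<in> ?K\<rbrakk> \<Longrightarrow> norm (?f y - ?f x - ?D x (y - x)) \<le> C * (norm (y - x))\<^sup>2"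
    using smooth_on_Taylor_cball[OF sf r(2)] by blast
  have fL: "norm (?f y - ?f x) \<le> L * norm (y - x)" if "x \<in> ?K" "y \<in> ?K" for x y
  proof (rule differentiable_bound[where f = ?f and f' = ?D and S = ?K and B = L and x = y and y = x])
    show "(?f has_derivative ?D w) (at w within ?K)" if "w \<in> ?K" for w
      by (rule has_derivative_at_withinI[OF smooth_on_has_derivative[OF sf subsetD[OF r(2) that]]])
    show "onorm (?D w) \<le> L" if "w \<in> ?K" for w by (rule onorm_bound[OF L(1) L(2)[OF that]])
  qed (use that in simp_all)
  \<comment> \<open>The three bounds keep the orbits in the ball during unit rescaled time, give the
    rescaled field Lipschitz constant 1/2, and keep \<open>t0 + \<eta> * \<tau>\<close> in the time
    interval of the flow.\<close>
  define \<delta> where "\<delta> = min (r / (4 * (M + 1))) (min (1 / (2 * (L + 1))) ((\<epsilon> - \<bar>t0\<bar>) / 2))"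
  have \<delta>0: "\<delta> > 0" using r(1) M0 L(1) t0 by (auto simp: \<delta>_def)
  have "\<delta> * M \<le> r / (4 * (M + 1)) * (M + 1)" using M0 r(1) \<delta>0 by (intro mult_mono) (auto simp: \<delta>_def)
  also have "\<dots> = r / 4" using M0 by (simp add: divide_simps) (simp add: algebra_simps)?
  finally have \<delta>M: "\<delta> * M \<le> r / 4" .
  have "\<delta> * L \<le> 1 / (2 * (L + 1)) * (L + 1)" using L(1) \<delta>0 by (intro mult_mono) (auto simp: \<delta>_def)
  also have "\<dots> = 1 / 2" using L(1) by (simp add: divide_simps)
  finally have \<delta>L: "\<delta> * L \<le> 1 / 2" .
  have \<delta>t: "\<bar>t0\<bar> + \<delta> < \<epsilon>" 
  proof -
    have "\<delta> \<le> (\<epsilon> - \<bar>t0\<bar>) / 2" unfolding \<delta>_def by (rule order_trans[OF min.cobounded2 min.cobounded2])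
    moreover have "\<bar>t0\<bar> < \<epsilon>" using t0 by auto
    ultimately show ?thesis by argo
  qed
  show ?thesis
  proof (rule that[OF \<delta>0])
    fix \<eta> :: real assume \<eta>: "\<bar>\<eta>\<bar> = \<delta>"
    have tI: "t0 + \<eta> * \<tau> \<in> {-\<epsilon><..<\<epsilon>}" if "\<tau> \<in> {0..1}" for \<tau>
    proof -
      have "\<bar>\<eta> * \<tau>\<bar> \<le> \<delta> * 1" unfolding abs_mult \<eta> using that \<delta>0 by (intro mult_left_mono) auto
      then show ?thesis using \<delta>t by auto
    qed
    let ?g = "\<lambda>y. \<eta> *\<^sub>R ?f y" and ?E = "\<lambda>y w. \<eta> *\<^sub>R ?D y w"
    have g4: "norm (?g y) \<le> r / 4" if "y \<in> ?K" for y
      using order_trans[OF mult_left_mono[OF M[OF that] less_imp_le[OF \<delta>0]] \<delta>M] by (simp add: \<eta>)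
    have E2: "norm (?E y w) \<le> 1 / 2 * norm w" if "y \<in> ?K" for y w
    proof -
      have "norm (?E y w) \<le> \<delta> * (L * norm w)" using mult_left_mono[OF L(2)[OF that], of \<delta>] \<delta>0 by (simp add: \<eta>)
      also have "\<dots> \<le> 1 / 2 * norm w" using mult_right_mono[OF \<delta>L, of "norm w"] by (simp add: mult_ac)
      finally show ?thesis .
    qed
    have Lip: "norm (?g y - ?g x) \<le> norm (y - x) / 2" if "x \<in> ?K" "y \<in> ?K" for x y
    proof -
      have "norm (?g y - ?g x) = \<delta> * norm (?f y - ?f x)" using \<eta> by (simp flip: scaleR_right_diff_distrib)
      also have "\<dots> \<le> \<delta> * (L * norm (y - x))" using fL[OF that] \<delta>0 by (intro mult_left_mono) auto
      also have "\<dots> \<le> 1 / 2 * norm (y - x)" using mult_right_mono[OF \<delta>L, of "norm (y - x)"] by (simp add: mult_ac)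
      finally show ?thesis by simp
    qed
    have Tay: "norm (?g y - ?g x - ?E x (y - x)) \<le> (\<delta> * C) * (norm (y - x))\<^sup>2" if "x \<in> ?K" "y \<in> ?K" for x y
    proof -
      have "norm (?g y - ?g x - ?E x (y - x)) = \<delta> * norm (?f y - ?f x - ?D x (y - x))"
        using \<eta> by (simp flip: scaleR_right_diff_distrib)
      also have "\<dots> \<le> \<delta> * (C * (norm (y - x))\<^sup>2)" using C(2)[OF that] \<delta>0 by (intro mult_left_mono) auto
      finally show ?thesis by (simp add: mult_ac)
    qed
    have Elin: "linear (?E y)" if "y \<in> ?K" for y using linear_compose_scale_right[OF Dlin[OF that]] .
    define \<gamma> where "\<gamma> p \<tau> = \<Phi> (t0 + \<eta> * \<tau>) p" for p \<tau>
    have \<gamma>c: "continuous_on {0..1} (\<gamma> p)" if p: "p \<in> W" for p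
      unfolding \<gamma>_def by (rule continuous_on_compose2[OF flow_rules(5)[OF p], of "{0..1}" "\<lambda>\<tau>. t0 + \<eta> * \<tau>"])
        (use tI in \<open>auto intro!: continuous_intros simp del: greaterThanLessThan_iff\<close>)
    have \<gamma>d: "((\<lambda>s. snd d (\<gamma> p s)) has_vector_derivative ?g (snd d (\<gamma> p s))) (at s within {0..1})"
      if p: "p \<in> W" and s: "s \<in> {0..1}" "\<gamma> p s \<in> fst d" for p s
    proof -
      have "((\<lambda>s. snd d (\<Phi> s p)) has_vector_derivative X (\<gamma> p s) d) (at (t0 + \<eta> * s))"
        unfolding \<gamma>_def by (rule flow_rules(6)[OF p tI[OF s(1)]]) (use s d in \<open>simp add: charts_at_iff \<gamma>_def\<close>)
      then have "((\<lambda>s. snd d (\<Phi> s p)) has_vector_derivative X (\<gamma> p s) d) (at (t0 + \<eta> * s) within range (\<lambda>s. t0 + \<eta> * s))"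
        by (rule has_vector_derivative_at_within)
      moreover have "((\<lambda>s. t0 + \<eta> * s) has_vector_derivative \<eta>) (at s)"
        by (auto intro!: derivative_eq_intros simp: has_real_derivative_iff_has_vector_derivative[symmetric])
      ultimately have "((\<lambda>s. snd d (\<Phi> s p)) \<circ> (\<lambda>s. t0 + \<eta> * s) has_vector_derivative \<eta> *\<^sub>R X (\<gamma> p s) d) (at s)"
        by (rule vector_diff_chain_within[rotated])
      then show ?thesis
        using chart_inv_chart[OF d(1) s(2)] by (auto simp: \<gamma>_def o_def Xc_def intro: has_vector_derivative_at_within)
    qed
    have conf: "\<gamma> p \<tau> \<in> fst d \<and> snd d (\<gamma> p \<tau>) \<in> ?K"
      if p: "p \<in> W" "\<gamma> p 0 \<in> fst d" "dist y0 (snd d (\<gamma> p 0)) < r / 2" and \<tau>: "\<tau> \<in> {0..1}" for p \<tau>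
      by (rule curve_confined[OF d(1) r \<gamma>c[OF p(1)] p(2,3) g4 \<gamma>d[OF p(1)] \<tau>])
    have x0: "\<gamma> x 0 \<in> fst d" "dist y0 (snd d (\<gamma> x 0)) < r / 2" using d(2) r(1) by (auto simp: \<gamma>_def y0_def)
    note cx' = conf[OF x x0]
    have bc: "continuous_on {0..1} (\<lambda>\<tau>. snd d (\<gamma> x \<tau>))"
      by (rule continuous_on_vector_derivative[OF \<gamma>d[OF x]]) (use cx' in auto)
    have Ec: "continuous_on {0..1} (\<lambda>\<tau>. ?E (snd d (\<gamma> x \<tau>)) e)" for e
      by (intro continuous_on_scaleR continuous_on_const continuous_on_compose2[OF Dcont bc]) (use cx' in auto)
    obtain u where u: "u 0 = jacobi c x v t0 d" "\<And>\<tau>. \<tau> \<in> {0..1} \<Longrightarrow>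
        (u has_vector_derivative ?E (snd d (\<gamma> x \<tau>)) (u \<tau>)) (at \<tau> within {0..1})"
      by (rule linear_ode_exists[of "\<lambda>\<tau>. ?E (snd d (\<gamma> x \<tau>))" "1/2" "jacobi c x v t0 d"])
         (use cx' Elin E2 Ec in auto)
    define p where "p s = chart_inv c (z0 + s *\<^sub>R v)" for s :: real
    have p0: "p 0 = x" by (simp add: p_def cz)
    have dirder: "((\<lambda>s. snd d (\<Phi> t (p s))) has_vector_derivative jacobi c x v t d) (at 0)"
      if "t \<in> {-\<epsilon><..<\<epsilon>}" "\<Phi> t x \<in> fst d" for t
      using has_vector_derivative_line[OF jacobi_derivative(1)[OF that(1) x cx, of d], of v] that d(1)
      by (simp add: charts_at_iff p_def z0_def)
    have \<psi>: "((\<lambda>s. snd d (\<Phi> t0 (p s))) has_vector_derivative jacobi c x v t0 d) (at 0)" by (rule dirder[OF t0 d(2)])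
    have ev: "\<forall>\<^sub>F s in at 0. p s \<in> W \<and> \<gamma> (p s) 0 \<in> fst d \<and> dist y0 (snd d (\<gamma> (p s) 0)) < r / 2"
    proof -
      obtain N where N: "open N" "z0 \<in> N" "\<And>z. z \<in> N \<Longrightarrow> chart_inv c z \<in> W \<and> \<Phi> t0 (chart_inv c z) \<in> fst d"
        using jacobi_derivative(2)[OF t0 x cx dx] unfolding z0_def by blast
      have "((\<lambda>s. z0 + s *\<^sub>R v) \<longlongrightarrow> z0 + 0 *\<^sub>R v) (at 0)" by (intro tendsto_intros)
      then have "\<forall>\<^sub>F s in at 0. z0 + s *\<^sub>R v \<in> N" using N(1,2) topological_tendstoD by fastforce
      moreover have "isCont (\<lambda>s. snd d (\<Phi> t0 (p s))) 0" using has_vector_derivative_continuous[OF \<psi>] .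
      then have "((\<lambda>s. snd d (\<Phi> t0 (p s))) \<longlongrightarrow> y0) (at 0)" by (simp add: isCont_def p0 y0_def)
      then have "\<forall>\<^sub>F s in at 0. dist (snd d (\<Phi> t0 (p s))) y0 < r / 2" using r(1) by (intro tendstoD) auto
      ultimately show ?thesis
        by eventually_elim (use N(3) in \<open>auto simp: p_def \<gamma>_def dist_commute\<close>)
    qed
    \<comment> \<open>At rescaled time \<tau> the curve of orbit points, parametrised by
      \<open>s\<close>, has derivative \<open>u \<tau>\<close> by the linearisation estimate and the
      Jacobi vector by the chain rule.\<close>
    have key: "jacobi c x v (t0 + \<eta> * \<tau>) d = u \<tau>" if \<tau>: "\<tau> \<in> {0..1}" for \<tau>
    proof -
      let ?g = "\<lambda>s. snd d (\<gamma> (p s) \<tau>)" and ?\<psi> = "\<lambda>s. snd d (\<Phi> t0 (p s))"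
      have "\<forall>\<^sub>F s in at 0. norm (?g s - ?g 0 - s *\<^sub>R u \<tau>)
          \<le> 2 * (norm (?\<psi> s - ?\<psi> 0 - s *\<^sub>R u 0) + (4 * (\<delta> * C)) * (norm (?\<psi> s - ?\<psi> 0))\<^sup>2)"
        using ev
      proof eventually_elim
        case (elim s)
        then have ps: "p s \<in> W" "\<gamma> (p s) 0 \<in> fst d" "dist y0 (snd d (\<gamma> (p s) 0)) < r / 2" by auto
        note cs = conf[OF ps]
        have "norm (snd d (\<gamma> (p s) \<tau>) - snd d (\<gamma> x \<tau>) - s *\<^sub>R u \<tau>)
          \<le> 2 * (norm (snd d (\<gamma> (p s) 0) - snd d (\<gamma> x 0) - s *\<^sub>R u 0) + 4 * (\<delta> * C) * (norm (snd d (\<gamma> (p s) 0) - snd d (\<gamma> x 0)))\<^sup>2)"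
        proof (rule ode_linearization[where f = "\<lambda>y. \<eta> *\<^sub>R Xc d y" and D = ?E and K = ?K, OF Tay _ Lip Elin])
          show "0 \<le> \<delta> * C" using \<delta>0 C(1) by simp
          show "norm (?E y w) \<le> norm w / 2" if "y \<in> ?K" for y w using E2[OF that] by simp
          show "((\<lambda>t. s *\<^sub>R u t) has_vector_derivative ?E (snd d (\<gamma> x t)) (s *\<^sub>R u t)) (at t within {0..1})" if "t \<in> {0..1}" for t
          proof -
            have "((\<lambda>t. s *\<^sub>R u t) has_vector_derivative s *\<^sub>R ?E (snd d (\<gamma> x t)) (u t)) (at t within {0..1})"
              by (rule bounded_linear.has_vector_derivative[OF bounded_linear_scaleR_right u(2)[OF that]])
            then show ?thesis using linear_cmul[OF Elin, of "snd d (\<gamma> x t)"] cx'[OF that] by simp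
          qed
        qed (use cs cx' \<gamma>d[OF ps(1)] \<gamma>d[OF x] \<tau> in auto)
        then show ?case by (simp add: p0 \<gamma>_def)
      qed
      then have "(?g has_vector_derivative u \<tau>) (at 0)"
        by (rule has_vector_derivative_dominated[OF \<psi>[folded u(1)]])
      moreover have "(?g has_vector_derivative jacobi c x v (t0 + \<eta> * \<tau>) d) (at 0)"
        unfolding \<gamma>_def by (rule dirder[OF tI[OF \<tau>]]) (use cx'[OF \<tau>] in \<open>simp add: \<gamma>_def\<close>)
      ultimately show ?thesis using vector_derivative_unique_at by blast
    qed
    have "(u has_vector_derivative ?E y0 (jacobi c x v t0 d)) (at 0 within {0..1})"
      using u(2)[of 0] by (simp add: u(1) \<gamma>_def y0_def)
    then show "((\<lambda>\<tau>. jacobi c x v (t0 + \<eta> * \<tau>) d) has_vector_derivative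
      \<eta> *\<^sub>R frechet_derivative (Xc d) (at (snd d (\<Phi> t0 x))) (jacobi c x v t0 d)) (at 0 within {0..1})"
      unfolding y0_def by (rule has_vector_derivative_transform[rotated 2]) (use key in auto)
  qed
qed

end

context flow_mfd
begin

text \<open>The forward and backward one-sided derivatives, for \<eta> = \<delta> and \<eta> = -
  \<delta>, have the same value and are joined.\<close>

lemma jacobi_ode:
  assumes t0: "t0 \<in> {-\<epsilon><..<\<epsilon>}" and x: "x \<in> W" and cx: "c \<in> charts_at A x" and dx: "d \<in> charts_at A (\<Phi> t0 x)"
  shows "((\<lambda>t. jacobi c x v t d) has_vector_derivative
      frechet_derivative (Xc d) (at (snd d (\<Phi> t0 x))) (jacobi c x v t0 d)) (at t0)"
proof -
  let ?D = "frechet_derivative (Xc d) (at (snd d (\<Phi> t0 x))) (jacobi c x v t0 d)"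
  obtain \<delta> where \<delta>: "\<delta> > 0" "\<And>\<eta>. \<bar>\<eta>\<bar> = \<delta> \<Longrightarrow> ((\<lambda>\<tau>. jacobi c x v (t0 + \<eta> * \<tau>) d) has_vector_derivative \<eta> *\<^sub>R ?D) (at 0 within {0..1})"
    using jacobi_step[OF assms] by blast
  have half: "((\<lambda>t. jacobi c x v t d) has_vector_derivative ?D) (at t0 within S)"
    if \<eta>: "\<bar>\<eta>\<bar> = \<delta>" and S: "\<And>t. t \<in> S \<Longrightarrow> (t - t0) / \<eta> \<in> {0..1}" for \<eta> S
  proof -
    have \<eta>0: "\<eta> \<noteq> 0" using \<eta> \<delta>(1) by (metis abs_zero less_irrefl)
    have 1: "((\<lambda>t. (t - t0) / \<eta>) has_vector_derivative 1 / \<eta>) (at t0 within S)"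
      unfolding has_real_derivative_iff_has_vector_derivative[symmetric] using \<eta>0 by (auto intro!: derivative_eq_intros)
    have 2: "((\<lambda>\<tau>. jacobi c x v (t0 + \<eta> * \<tau>) d) has_vector_derivative \<eta> *\<^sub>R ?D) (at ((t0 - t0) / \<eta>) within (\<lambda>t. (t - t0) / \<eta>) ` S)"
      by (rule has_vector_derivative_within_subset[of _ _ _ "{0..1}"]) (use \<delta>(2)[OF \<eta>] S in auto)
    from vector_diff_chain_within[OF 1 2] show ?thesis using \<eta>0 by (simp add: o_def)
  qed
  have "((\<lambda>t. jacobi c x v t d) has_vector_derivative ?D) (at t0 within {t0..t0 + \<delta>})"
    using half[of \<delta> "{t0..t0 + \<delta>}"] \<delta>(1) by (simp add: divide_simps)
  moreover have "((\<lambda>t. jacobi c x v t d) has_vector_derivative ?D) (at t0 within {t0 - \<delta>..t0})"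
    using half[of "- \<delta>" "{t0 - \<delta>..t0}"] \<delta>(1) by (simp add: divide_simps)
  ultimately have "((\<lambda>t. jacobi c x v t d) has_vector_derivative ?D) (at t0 within ({t0..t0 + \<delta>} \<union> {t0 - \<delta>..t0}))"
    unfolding has_vector_derivative_def has_derivative_within
    by (simp only: at_within_union) (blast intro: filterlim_sup)
  moreover have "at t0 within ({t0..t0 + \<delta>} \<union> {t0 - \<delta>..t0}) = at t0"
  proof (rule at_within_interior)
    have "{t0 - \<delta><..<t0 + \<delta>} \<subseteq> {t0..t0 + \<delta>} \<union> {t0 - \<delta>..t0}" by auto
    then show "t0 \<in> interior ({t0..t0 + \<delta>} \<union> {t0 - \<delta>..t0})" using \<delta>(1) by (intro interiorI[of "{t0 - \<delta><..<t0 + \<delta>}"]) auto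
  qed
  ultimately show ?thesis by simp
qed

lemma orbit_nbhd:
  assumes "t \<in> {-\<epsilon><..<\<epsilon>}" "x \<in> W" "d \<in> charts_at A (\<Phi> t x)"
  obtains S where "open S" "t \<in> S" "S \<subseteq> {-\<epsilon><..<\<epsilon>}" "\<And>s. s \<in> S \<Longrightarrow> d \<in> charts_at A (\<Phi> s x)"
proof (rule that)
  show "open ({-\<epsilon><..<\<epsilon>} \<inter> (\<lambda>s. \<Phi> s x) -` fst d)"
    by (rule continuous_open_preimage[OF flow_rules(5)[OF assms(2)]]) (use assms(3) open_chart in \<open>auto simp: charts_at_def\<close>)
qed (use assms in \<open>auto simp: charts_at_def\<close>)

text \<open>Solutions of the variational equation along the orbit of \<open>x\<close>. They are
  closed under differences and, for a Killing field, under \<open>Jmap\<close>; holomorphy of the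
  flow is deduced from this.\<close>

definition jacobi_field :: "'m \<Rightarrow> (real \<Rightarrow> ('m, complex^'n) tvec) \<Rightarrow> bool"
  where "jacobi_field x Z \<longleftrightarrow> (\<forall>t\<in>{-\<epsilon><..<\<epsilon>}. Z t \<in> tangent_space A (\<Phi> t x) \<and>
    (\<forall>d\<in>charts_at A (\<Phi> t x). ((\<lambda>s. Z s d) has_vector_derivative
       frechet_derivative (Xc d) (at (snd d (\<Phi> t x))) (Z t d)) (at t)))"

lemma jacobi_field_differential:
  assumes x: "x \<in> W"
  shows "jacobi_field x (\<lambda>t. differential A A (\<Phi> t) x v)"
proof -
  define c where "c = (SOME c. c \<in> charts_at A x)"
  have c: "c \<in> charts_at A x"
  proof -
    have "\<exists>c. c \<in> charts_at A x" using subsetD[OF flow_rules(2) x] unfolding carrier_charts_at by blast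
    then show ?thesis unfolding c_def by (rule someI_ex)
  qed
  have df: "differential A A (\<Phi> t) x v d = (if d \<in> charts_at A (\<Phi> t x) then jacobi c x (v c) t d else 0)" for t d
    by (simp add: differential_def jacobi_def c_def Let_def)
  show ?thesis
    unfolding jacobi_field_def
  proof (intro ballI conjI)
    fix t assume t: "t \<in> {-\<epsilon><..<\<epsilon>}"
    show "differential A A (\<Phi> t) x v \<in> tangent_space A (\<Phi> t x)"
      unfolding tangent_space_def
    proof (intro CollectI conjI allI impI ballI)
      fix d e assume d: "d \<in> charts_at A (\<Phi> t x)" and e: "e \<in> charts_at A (\<Phi> t x)"
      have de: "d \<in> A" "e \<in> A" "\<Phi> t x \<in> fst d" "\<Phi> t x \<in> fst e" using d e by (auto simp: charts_at_iff)
      have cA: "c \<in> A" "x \<in> fst c" using c by (auto simp: charts_at_iff)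
      let ?f = "\<lambda>d. snd d \<circ> \<Phi> t \<circ> chart_inv c"
      obtain N where N: "open N" "snd c x \<in> N" "\<forall>z\<in>N. z \<in> chart_image c \<and> chart_inv c z \<in> W \<and> \<Phi> t (chart_inv c z) \<in> fst d"
        using jacobi_derivative(2)[OF t x c d] by blast
      have fd: "?f d (snd c x) = snd d (\<Phi> t x)" using chart_inv_chart[OF cA] by simp
      have "(trans d e has_derivative dtrans d e (snd d (\<Phi> t x))) (at (?f d (snd c x)))"
        unfolding fd using dtrans[OF de(1,2) in_overlap[OF de(3,4)]] .
      from has_derivative_compose[OF jacobi_derivative(1)[OF t x c d] this]
      have "((\<lambda>z. trans d e (?f d z)) has_derivative (\<lambda>v. dtrans d e (snd d (\<Phi> t x)) (jacobi c x v t d))) (at (snd c x))" .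
      then have "(?f e has_derivative (\<lambda>v. dtrans d e (snd d (\<Phi> t x)) (jacobi c x v t d))) (at (snd c x))"
        by (rule has_derivative_transform_within_open[OF _ N(1,2)]) (use N(3) trans_chart[OF de(1)] in simp)
      then have "jacobi c x v t e = dtrans d e (snd d (\<Phi> t x)) (jacobi c x v t d)" for v
        unfolding jacobi_def[of c x v t e] by (simp add: frechet_derivative_eqI)
      then show "differential A A (\<Phi> t) x v e = coord_change_deriv d e (\<Phi> t x) (differential A A (\<Phi> t) x v d)"
        using d e by (simp add: df coord_change_deriv_eq)
    qed (simp add: df)
    fix d assume d: "d \<in> charts_at A (\<Phi> t x)"
    obtain S where S: "open S" "t \<in> S" "S \<subseteq> {-\<epsilon><..<\<epsilon>}" "\<And>s. s \<in> S \<Longrightarrow> d \<in> charts_at A (\<Phi> s x)"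
      using orbit_nbhd[OF t x d] by blast
    show "((\<lambda>s. differential A A (\<Phi> s) x v d) has_vector_derivative
       frechet_derivative (Xc d) (at (snd d (\<Phi> t x))) (differential A A (\<Phi> t) x v d)) (at t)"
      using has_vector_derivative_transform_within_open[OF jacobi_ode[OF t x c d, of "v c"] S(1,2)] S(4) d by (simp add: df)
  qed
qed

lemma differential_initial:
  assumes x: "x \<in> W" and v: "v \<in> tangent_space A x"
  shows "differential A A (\<Phi> 0) x v = v"
proof (rule ext)
  fix d
  define c where "c = (SOME c. c \<in> charts_at A x)"
  have c: "c \<in> charts_at A x"
  proof -
    have "\<exists>c. c \<in> charts_at A x" using subsetD[OF flow_rules(2) x] unfolding carrier_charts_at by blast
    then show ?thesis unfolding c_def by (rule someI_ex)
  qed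
  have cA: "c \<in> A" "x \<in> fst c" using c by (auto simp: charts_at_iff)
  have "frechet_derivative (snd d \<circ> \<Phi> 0 \<circ> chart_inv c) (at (snd c x)) = dtrans c d (snd c x)"
    by (rule frechet_derivative_cong[OF open_chart_part[OF cA(1) flow_rules(1)] chart_part_in[OF cA x]])
       (simp add: trans_def chart_part_def flow_rules(4))
  then show "differential A A (\<Phi> 0) x v d = v d"
    using tangent_eq[OF v c] flow_rules(4)[OF x]
    by (simp add: differential_def flip: c_def) (metis coord_change_deriv_eq tangent_of_coords_def)
qed

text \<open>The derivative of the pairing along the orbit is the Killing expression evaluated on the
  two Jacobi fields, so the pairing is constant.\<close>

lemma flow_preserves:
  assumes k: "killing_field (carrier A) X" and x: "x \<in> W" and t: "t \<in> {-\<epsilon><..<\<epsilon>}"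
    and Z: "jacobi_field x Z" "jacobi_field x Z'"
  shows "\<Omega> (\<Phi> t x) (Z t) (Z' t) = \<Omega> x (Z 0) (Z' 0)"
proof -
  let ?q = "\<lambda>s. \<Omega> (\<Phi> s x) (Z s) (Z' s)"
  have "(?q has_real_derivative 0) (at s within {-\<epsilon><..<\<epsilon>})" if s: "s \<in> {-\<epsilon><..<\<epsilon>}" for s
  proof -
    have "\<Phi> s x \<in> carrier A" using flow_rules(7)[OF s] x unfolding smooth_map_def by blast
    then obtain d where d: "d \<in> charts_at A (\<Phi> s x)" using carrier_charts_at by blast
    have dA: "d \<in> A" "\<Phi> s x \<in> fst d" using d by (auto simp: charts_at_iff)
    obtain S where S: "open S" "s \<in> S" "S \<subseteq> {-\<epsilon><..<\<epsilon>}" "\<And>s. s \<in> S \<Longrightarrow> d \<in> charts_at A (\<Phi> s x)"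
      using orbit_nbhd[OF s x d] by blast
    let ?\<phi> = "\<lambda>s. snd d (\<Phi> s x)" and ?D = "frechet_derivative (Xc d) (at (snd d (\<Phi> s x)))"
    have im: "?\<phi> s' \<in> chart_image d" if "s' \<in> S" for s' using S(4)[OF that] by (simp add: charts_at_iff chart_in_image)
    have "((\<lambda>s. cf d (?\<phi> s) (Z s d) (Z' s d)) has_real_derivative
        (frechet_derivative (\<lambda>z. cf d z (Z s d) (Z' s d)) (at (?\<phi> s)) (X (\<Phi> s x) d)
          + cf d (?\<phi> s) (?D (Z s d)) (Z' s d) + cf d (?\<phi> s) (Z s d) (?D (Z' s d)))) (at s within S)"
    proof (rule bilinear_family_curve_derivative[OF open_chart_image[OF dA(1)] _ cf_smooth[OF dA(1)] cf_bilinear[OF dA(1)]])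
      show "(?\<phi> has_vector_derivative X (\<Phi> s x) d) (at s within S)"
        by (rule has_vector_derivative_at_within[OF flow_rules(6)[OF x s d]])
      show "((\<lambda>s. Z s d) has_vector_derivative ?D (Z s d)) (at s within S)"
        "((\<lambda>s. Z' s d) has_vector_derivative ?D (Z' s d)) (at s within S)"
        by (rule has_vector_derivative_at_within; use Z s d in \<open>unfold jacobi_field_def; blast\<close>)+
    qed (use S(2) im in auto)
    moreover have "frechet_derivative (\<lambda>z. cf d z (Z s d) (Z' s d)) (at (?\<phi> s)) (X (\<Phi> s x) d)
          + cf d (?\<phi> s) (?D (Z s d)) (Z' s d) + cf d (?\<phi> s) (Z s d) (?D (Z' s d)) = 0"
    proof -
      have "killing_on (cf d) (chart_part d (carrier A)) (Xc d)"
        using k dA(1) unfolding killing_field_def Xc_def[abs_def] by blast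
      moreover have "?\<phi> s \<in> chart_part d (carrier A)" by (rule chart_part_in[OF dA]) (use dA in \<open>auto simp: carrier_def\<close>)
      moreover have "Xc d (?\<phi> s) = X (\<Phi> s x) d" by (simp add: Xc_def chart_inv_chart dA)
      ultimately show ?thesis unfolding killing_on_def by metis
    qed
    ultimately have "((\<lambda>s. cf d (?\<phi> s) (Z s d) (Z' s d)) has_real_derivative 0) (at s)"
      using at_within_open[OF S(2,1)] by simp
    then have "(?q has_real_derivative 0) (at s)"
    proof (rule has_field_derivative_transform_within_open[OF _ S(1,2)])
      fix s' assume s': "s' \<in> S"
      have "Z s' \<in> tangent_space A (\<Phi> s' x)" "Z' s' \<in> tangent_space A (\<Phi> s' x)" using Z s' S(3) by (auto simp: jacobi_field_def)
      then show "cf d (?\<phi> s') (Z s' d) (Z' s' d) = ?q s'"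
        using tangent_eq[OF _ S(4)[OF s']] coord_form_eq[of d "\<Phi> s' x" \<Omega>] S(4)[OF s'] by (simp add: charts_at_iff)
    qed
    then show ?thesis by (rule has_field_derivative_at_within)
  qed
  then have "\<exists>C. \<forall>s\<in>{-\<epsilon><..<\<epsilon>}. ?q s = C"
    by (intro has_field_derivative_zero_constant) auto
  then have "?q t = ?q 0" using t flow_rules(3) by auto
  then show ?thesis using flow_rules(4)[OF x] by simp
qed

lemma jacobi_field_J:
  assumes k: "killing_field (carrier A) X" and x: "x \<in> W" and Z: "jacobi_field x Z"
  shows "jacobi_field x (\<lambda>t. Jmap (Z t))"
  unfolding jacobi_field_def
proof (intro ballI conjI)
  fix t assume t: "t \<in> {-\<epsilon><..<\<epsilon>}"
  show "Jmap (Z t) \<in> tangent_space A (\<Phi> t x)" using Z t by (intro Jmap_in) (simp add: jacobi_field_def)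
  fix d assume d: "d \<in> charts_at A (\<Phi> t x)"
  then have dA: "d \<in> A" "\<Phi> t x \<in> fst d" by (auto simp: charts_at_iff)
  have "killing_on (cf d) (chart_part d (carrier A)) (Xc d)"
    using k dA(1) unfolding killing_field_def Xc_def[abs_def] by blast
  moreover have "snd d (\<Phi> t x) \<in> chart_part d (carrier A)" by (rule chart_part_in[OF dA]) (use dA in \<open>auto simp: carrier_def\<close>)
  ultimately have "frechet_derivative (Xc d) (at (snd d (\<Phi> t x))) (\<i> *s Z t d) = \<i> *s frechet_derivative (Xc d) (at (snd d (\<Phi> t x))) (Z t d)"
    unfolding killing_on_def by blast
  moreover have zd: "((\<lambda>s. Z s d) has_vector_derivative frechet_derivative (Xc d) (at (snd d (\<Phi> t x))) (Z t d)) (at t)"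
    using Z t d unfolding jacobi_field_def by blast
  ultimately show "((\<lambda>s. Jmap (Z s) d) has_vector_derivative frechet_derivative (Xc d) (at (snd d (\<Phi> t x))) (Jmap (Z t) d)) (at t)"
    using bounded_linear.has_vector_derivative[OF bounded_linear_smult_right zd, of \<i>] by (simp add: Jmap_def)
qed

lemma jacobi_field_diff:
  assumes x: "x \<in> W" and Z: "jacobi_field x Z" "jacobi_field x Z'"
  shows "jacobi_field x (\<lambda>t. Z t - Z' t)"
  unfolding jacobi_field_def
proof (intro ballI conjI)
  fix t assume t: "t \<in> {-\<epsilon><..<\<epsilon>}"
  have "Z t + (\<lambda>c. (- 1) *s Z' t c) \<in> tangent_space A (\<Phi> t x)"
    using Z t by (intro tangent_space_add tangent_space_smult) (auto simp: jacobi_field_def)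
  then show "Z t - Z' t \<in> tangent_space A (\<Phi> t x)" by (simp add: fun_diff_def plus_fun_def)
  fix d assume d: "d \<in> charts_at A (\<Phi> t x)"
  then have dA: "d \<in> A" "\<Phi> t x \<in> fst d" by (auto simp: charts_at_iff)
  have "linear (frechet_derivative (Xc d) (at (snd d (\<Phi> t x))))"
    using smooth_on_linear_frechet[OF X_smooth[OF dA(1)] chart_in_image[OF dA(2)]] by (simp add: Xc_def[abs_def])
  then show "((\<lambda>s. (Z s - Z' s) d) has_vector_derivative frechet_derivative (Xc d) (at (snd d (\<Phi> t x))) ((Z t - Z' t) d)) (at t)"
    using Z t d by (simp add: jacobi_field_def linear_diff has_vector_derivative_diff)
qed

text \<open>For compatibility with \<open>Jmap\<close>, the difference of the two sides is a Jacobi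
  field that vanishes at time 0. Its squared length is the pairing with its own image under
  \<open>Jmap\<close>; this is constant along the orbit, hence 0, and positivity makes the field
  vanish.\<close>

lemma flow_symmetry:
  assumes k: "killing_field (carrier A) X" and x: "x \<in> W" and t: "t \<in> {-\<epsilon><..<\<epsilon>}"
    and v: "v \<in> tangent_space A x" and w: "w \<in> tangent_space A x"
  shows "differential A A (\<Phi> t) x (Jmap v) = Jmap (differential A A (\<Phi> t) x v)"
    and "\<Omega> (\<Phi> t x) (differential A A (\<Phi> t) x v) (differential A A (\<Phi> t) x w) = \<Omega> x v w"
proof -
  let ?d = "\<lambda>v t. differential A A (\<Phi> t) x v"
  note jf = jacobi_field_differential[OF x]
  show "\<Omega> (\<Phi> t x) (?d v t) (?d w t) = \<Omega> x v w"
    using flow_preserves[OF k x t jf jf, of v w] differential_initial[OF x] v w by simp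
  let ?Q = "\<lambda>t. ?d (Jmap v) t - Jmap (?d v t)"
  have Q: "jacobi_field x ?Q" by (intro jacobi_field_diff jacobi_field_J x k jf)
  have Q0: "?Q 0 = 0" using differential_initial[OF x] v Jmap_in[OF v] by simp
  have p: "\<Phi> t x \<in> carrier A" using flow_rules(7)[OF t] x unfolding smooth_map_def by blast
  have Qt: "?Q t \<in> tangent_space A (\<Phi> t x)" using Q t unfolding jacobi_field_def by blast
  have x': "x \<in> carrier A" using x flow_rules(2) by blast
  have "\<Omega> x 0 (Jmap 0) = 0"
    using Omega_rules(2)[OF x' tangent_space_zero tangent_space_zero Jmap_in[OF tangent_space_zero], of 0] by (simp add: zero_fun_def)
  then have "\<Omega> (\<Phi> t x) (?Q t) (Jmap (?Q t)) = 0"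
    using flow_preserves[OF k x t Q jacobi_field_J[OF k x Q]] Q0 by simp
  then have "?Q t = 0" using Omega_rules(5)[OF p Qt Qt Qt] by force
  then show "?d (Jmap v) t = Jmap (?d v t)" by simp
qed

end

section \<open>From global Killing fields to independent symmetry fields\<close>

context kaehler_mfd
begin

lemma killing_field_symmetry:
  assumes k: "killing_field (carrier A) X" and z: "\<And>x. x \<notin> carrier A \<Longrightarrow> X x = 0"
  shows "X \<in> symmetry_fields A \<Omega>"
proof -
  have sm: "smooth_on (chart_image c) (\<lambda>z. X (chart_inv c z) c)" if c: "c \<in> A" for c
  proof -
    have "chart_part c (carrier A) = chart_image c"
      unfolding chart_part_def carrier_def using c chart_inv_in[OF c] by blast
    then show ?thesis using k c unfolding killing_field_def killing_on_def by metis
  qed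
  have "X x \<in> tangent_space A x" for x
    using k z tangent_space_zero unfolding killing_field_def by (cases "x \<in> carrier A") auto
  then have "smooth_vector_field A X" using sm by (simp add: smooth_vector_field_def)
  moreover have "differential A A (\<Phi> t) x (Jmap v) = Jmap (differential A A (\<Phi> t) x v) \<and>
       (\<forall>w\<in>tangent_space A x. \<Omega> (\<Phi> t x) (differential A A (\<Phi> t) x v) (differential A A (\<Phi> t) x w) = \<Omega> x v w)"
    if fl: "local_flow A X W \<epsilon> \<Phi>" and t: "t \<in> {-\<epsilon><..<\<epsilon>}" and x: "x \<in> W" and v: "v \<in> tangent_space A x" for W \<epsilon> \<Phi> t x v
  proof -
    interpret flow_mfd A \<Omega> X W \<epsilon> \<Phi> by unfold_locales (use fl sm in auto)
    show ?thesis using flow_symmetry[OF k x t v] v by blast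
  qed
  ultimately show ?thesis unfolding symmetry_fields_def by blast
qed

end

lemma sum_fields_apply: "(\<Sum>i\<in>I. f i) p c = (\<Sum>i\<in>I. (f i p c :: 'a::comm_monoid_add))"
  by (induction I rule: infinite_finite_induct) auto

lemma (in bochner_mfd) symmetry_fields_independent:
  assumes "simply_connected (carrier A)" "carrier A \<noteq> {}"
  shows "\<exists>S \<subseteq> symmetry_fields A \<Omega>. card S = CARD('n) \<and> vector_fields.independent S"
proof -
  obtain X :: "'n \<Rightarrow> 'm \<Rightarrow> ('m, complex^'n) tvec" where k: "\<And>m. killing_field (carrier A) (X m)"
    and ind: "\<And>a. (\<And>p c. p \<in> carrier A \<Longrightarrow> (\<Sum>m\<in>UNIV. a m *\<^sub>R X m p c) = 0) \<Longrightarrow> \<forall>m. a m = 0"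
  proof (rule global_killing_fields[OF assms], goal_cases)
    case (1 X)
    show ?case by (rule 1(1)[of X, OF 1(2)]) (rule 1(3), assumption)
  qed
  \<comment> \<open>Outside the carrier a sheaf section is arbitrary, whereas a symmetry field has
    to lie in the tangent space there, which is \<open>{0}\<close>.\<close>
  define Y where "Y m x = (if x \<in> carrier A then X m x else 0)" for m x
  have "killing_field (carrier A) (Y m)" for m
  proof (rule killing_field_local[OF open_carrier])
    show "\<exists>V t. killing_field V t \<and> x \<in> V \<and> (\<exists>N. open N \<and> x \<in> N \<and> (\<forall>z\<in>N. Y m z = t z))" if "x \<in> carrier A" for x
      by (intro exI[of _ "carrier A"] exI[of _ "X m"] conjI k that open_carrier) (simp add: Y_def)
  qed
  then have sym: "Y m \<in> symmetry_fields A \<Omega>" for m by (rule killing_field_symmetry) (simp add: Y_def)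
  have ind': "\<forall>m. a m = 0" if "(\<Sum>m\<in>UNIV. field_scale (a m) (Y m)) = 0" for a
  proof (rule ind)
    fix p c assume p: "p \<in> carrier A"
    have "(\<Sum>m\<in>UNIV. field_scale (a m) (Y m)) p c = 0" using that by simp
    then show "(\<Sum>m\<in>UNIV. a m *\<^sub>R X m p c) = 0" using p by (simp add: sum_fields_apply field_scale_def Y_def)
  qed
  \<comment> \<open>Equal fields with different indices would satisfy the relation with coefficients
    1 and -1. Injectivity gives the set of fields its n elements.\<close>
  have inj: "inj Y"
  proof (rule injI, rule ccontr)
    fix i j assume ij: "Y i = Y j" "i \<noteq> j"
    let ?a = "\<lambda>m. if m = i then 1 else if m = j then - 1 else 0 :: real"
    have "(\<Sum>m\<in>UNIV. field_scale (?a m) (Y m)) = (\<Sum>m\<in>{i, j}. field_scale (?a m) (Y m))"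
      by (rule sum.mono_neutral_right) (auto simp: field_scale_def fun_eq_iff)
    also have "\<dots> = 0" using ij by (simp add: field_scale_def fun_eq_iff)
    finally show False using ind'[of ?a] by (auto dest: spec[of _ i])
  qed
  have "vector_fields.independent (range Y)"
  proof (subst vector_fields.dependent_finite, simp, rule notI, elim exE conjE bexE)
    fix u v assume v: "v \<in> range Y" "u v \<noteq> 0" and s: "(\<Sum>v\<in>range Y. field_scale (u v) v) = 0"
    have "(\<Sum>m\<in>UNIV. field_scale (u (Y m)) (Y m)) = 0" using s by (simp add: sum.reindex[OF inj])
    then show False using ind'[of "\<lambda>m. u (Y m)"] v by auto
  qed
  then show ?thesis using sym inj by (intro exI[of _ "range Y"]) (auto simp: card_image)
qed

theorem theorem2:
  fixes A :: "('m::{t2_space, second_countable_topology}, complex^'n) chart set"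
    and \<Omega> :: "'m \<Rightarrow> ('m, complex^'n) tvec \<Rightarrow> ('m, complex^'n) tvec \<Rightarrow> real"
  assumes "complex_manifold A"
    and "carrier A \<noteq> {}"
    and "simply_connected (carrier A)"
    and "bochner_kaehler A \<Omega>"
  shows "\<exists>X \<subseteq> symmetry_fields A \<Omega>. card X = CARD('n) \<and> vector_fields.independent X"
proof -
  interpret kaehler_mfd A \<Omega>
    by unfold_locales (use assms in \<open>auto simp: bochner_kaehler_def\<close>)
  interpret bochner_mfd A \<Omega> by (rule bochner_mfd_axioms[OF assms(4)])
  show ?thesis by (rule symmetry_fields_independent[OF assms(3,2)])
qed

end
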